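(* Let $\delta>0$, $S>0$, $U_0\in H^2_*(\Omega)$, $V_0\in L^2(\Omega)$, $\Lambda_1<P\le\Lambda_2$, and let $U$ be the weak solution on $[0,\infty)$ of the plate problem with data $(\delta,S,P,U_0,V_0)$ and $F\equiv0$. Set $\lambda_+=\sqrt{\frac{P-\Lambda_1}{S}}$. If $\mathcal{E}(U;0)<0$, then $U(t)\to\overline U$ in $H^2_*(\Omega)$ and $U'(t)\to0$ in $L^2(\Omega)$ as $t\to\infty$, where $$\overline U=\begin{cases}\lambda_+w_1&\text{if }(U_0,w_1)_2>0,\\-\lambda_+w_1&\text{if }(U_0,w_1)_2<0.\end{cases}$$
   Context: Let $0<\sigma<\frac12$, $l>0$ and $\Omega=(0,\pi)\times(-l,l)$. Let $H^2_*(\Omega)=\{U\in H^2(\Omega): U=0 \text{ on } \{0,\pi\}\times[-l,l]\}$, equipped with the inner product $(U,V)_2=\int_\Omega\big(\Delta U\Delta V-(1-\sigma)(U_{xx}V_{yy}+U_{yy}V_{xx}-2U_{xy}V_{xy})\big)$ and norm $\|\cdot\|_2$. Let $(\cdot,\cdot)_0,\|\cdot\|_0$ be the inner product and norm of $L^2(\Omega)$, $\mathcal{H}$ the dual space of $H^2_*(\Omega)$ and $\langle\cdot,\cdot\rangle$ the duality $\mathcal{H}\times H^2_*(\Omega)$ (with $L^2(\Omega)\subset\mathcal H$ via $\langle f,V\rangle=(f,V)_0$). Primes denote time derivatives. Put $\phi(U)=-P+S\int_\Omega U_x^2$. The plate problem is $U_{tt}+\delta U_t+\Delta^2U-\phi(U)U_{xx}=F$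 in $\Omega\times(0,\infty)$, with $U=U_{xx}=0$ on $\{0,\pi\}\times[-l,l]$, $U_{yy}+\sigma U_{xx}=U_{yyy}+(2-\sigma)U_{xxy}=0$ on $[0,\pi]\times\{-l,l\}$, $U(\cdot,0)=U_0$, $U_t(\cdot,0)=V_0$. A weak solution on $[0,T]$ is a function $U\in\mathcal{C}^0([0,T],H^2_*(\Omega))\cap\mathcal{C}^1([0,T],L^2(\Omega))\cap\mathcal{C}^2([0,T],\mathcal{H})$ with $U(0)=U_0$, $U'(0)=V_0$ and $\langle U'',V\rangle+\delta(U',V)_0+(U,V)_2+\phi(U)(U_x,V_x)_0=(F,V)_0$ for all $t\in[0,T]$, $V\in H^2_*(\Omega)$; a weak solution on $[0,\infty)$ is one on every $[0,T]$ (it exists and is unique). The mechanical energy is $\mathcal{E}(U;t)=\frac12\|U'(t)\|_0^2+\frac12\|U(t)\|_2^2-\frac P2\|U_x(t)\|_0^2+\frac S4\|U_x(t)\|_0^4$, so $\mathcal E(U;0)$ is this expression evaluated at $(U_0,V_0)$. $\Lambda_1<\Lambda_2$ are the first and second eigenvalues $\Lambda$ of the buckling problem $\Delta^2w+\Lambda w_{xx}=0$ in $\Omega$ with the same boundary conditions, i.e. $(w,z)_2=\Lambda(w_x,z_x)_0$ for all $z\in H^2_*(\Omega)$. The function $w_1$ is an eigenfunction associated with the least eigenvalue $\Lambda_1$; it has the form $w_1(x,y)=\varphi_{1,1}(y)\sin x$ and is normalized by $\|w_1\|_0=1$ (so that $\|(w_1)_x\|_0=1$ and $\|w_1\|_2^2=\Lambda_1$).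 *)

theory Defs
  imports "HOL-Analysis.Analysis"
begin

section \<open>Weak derivatives and Sobolev spaces on planar domains\<close>

text \<open>
  Elements of $L^2$, $H^2$ etc. are represented by functions on the plane; only their values
  almost everywhere on the domain matter, so the norms below are seminorms on representatives.
\<close>

definition pdx :: "(real \<times> real \<Rightarrow> real) \<Rightarrow> real \<times> real \<Rightarrow> real" where
  "pdx f = (\<lambda>(x, y). deriv (\<lambda>s. f (s, y)) x)"

definition pdy :: "(real \<times> real \<Rightarrow> real) \<Rightarrow> real \<times> real \<Rightarrow> real" where
  "pdy f = (\<lambda>(x, y). deriv (\<lambda>s. f (x, s)) y)"

definition pderivs :: "nat \<Rightarrow> nat \<Rightarrow> (real \<times> real \<Rightarrow> real) \<Rightarrow> real \<times> real \<Rightarrow> real" where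
  "pderivs i j f = (pdx ^^ i) ((pdy ^^ j) f)"

text \<open>
  The functions of class $C_c^\infty(\Omega)$. Since all the derivatives are required to be
  Frechet differentiable, they are continuous and the order of differentiation is irrelevant.
\<close>

definition test_functions :: "(real \<times> real) set \<Rightarrow> (real \<times> real \<Rightarrow> real) set" where
  "test_functions \<Omega> =
     {f. (\<forall>i j. pderivs i j f differentiable_on UNIV) \<and>
         compact (closure {p. f p \<noteq> 0}) \<and> closure {p. f p \<noteq> 0} \<subseteq> \<Omega>}"

definition L2_space :: "(real \<times> real) set \<Rightarrow> (real \<times> real \<Rightarrow> real) set" where
  "L2_space \<Omega> =
     {f. f \<in> borel_measurable (lebesgue_on \<Omega>) \<and> integrable (lebesgue_on \<Omega>) (\<lambda>p. (f p)\<^sup>2)}"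

definition has_weak_deriv ::
  "(real \<times> real) set \<Rightarrow> nat \<Rightarrow> nat \<Rightarrow> (real \<times> real \<Rightarrow> real) \<Rightarrow> (real \<times> real \<Rightarrow> real) \<Rightarrow> bool" where
  "has_weak_deriv \<Omega> i j f g \<longleftrightarrow>
     (\<forall>\<psi>\<in>test_functions \<Omega>.
        (\<integral>p. f p * pderivs i j \<psi> p \<partial>lebesgue_on \<Omega>) =
        (-1) ^ (i + j) * (\<integral>p. g p * \<psi> p \<partial>lebesgue_on \<Omega>))"

definition H2_space :: "(real \<times> real) set \<Rightarrow> (real \<times> real \<Rightarrow> real) set" where
  "H2_space \<Omega> =
     {f \<in> L2_space \<Omega>. \<forall>i j. i + j \<le> 2 \<longrightarrow> (\<exists>g\<in>L2_space \<Omega>. has_weak_deriv \<Omega> i j f g)}"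

text \<open>A representative of the weak derivative, which is unique up to null sets.\<close>

definition weak_deriv ::
  "(real \<times> real) set \<Rightarrow> nat \<Rightarrow> nat \<Rightarrow> (real \<times> real \<Rightarrow> real) \<Rightarrow> real \<times> real \<Rightarrow> real" where
  "weak_deriv \<Omega> i j f = (SOME g. g \<in> L2_space \<Omega> \<and> has_weak_deriv \<Omega> i j f g)"


section \<open>The function spaces of the plate\<close>

definition plate :: "real \<Rightarrow> (real \<times> real) set" where
  "plate l = {0<..<pi} \<times> {-l<..<l}"

abbreviation wdx :: "real \<Rightarrow> (real \<times> real \<Rightarrow> real) \<Rightarrow> real \<times> real \<Rightarrow> real" where
  "wdx l \<equiv> weak_deriv (plate l) 1 0"

abbreviation wdxx :: "real \<Rightarrow> (real \<times> real \<Rightarrow> real) \<Rightarrow> real \<times> real \<Rightarrow> real" where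
  "wdxx l \<equiv> weak_deriv (plate l) 2 0"

abbreviation wdxy :: "real \<Rightarrow> (real \<times> real \<Rightarrow> real) \<Rightarrow> real \<times> real \<Rightarrow> real" where
  "wdxy l \<equiv> weak_deriv (plate l) 1 1"

abbreviation wdyy :: "real \<Rightarrow> (real \<times> real \<Rightarrow> real) \<Rightarrow> real \<times> real \<Rightarrow> real" where
  "wdyy l \<equiv> weak_deriv (plate l) 0 2"

definition laplacian :: "real \<Rightarrow> (real \<times> real \<Rightarrow> real) \<Rightarrow> real \<times> real \<Rightarrow> real" where
  "laplacian l U = (\<lambda>p. wdxx l U p + wdyy l U p)"

text \<open>
  In dimension two every element of $H^2$ has a representative that is continuous up to the
  boundary; the condition on the two short edges refers to its pointwise values.
\<close>

definition H2star :: "real \<Rightarrow> (real \<times> real \<Rightarrow> real) set" where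
  "H2star l =
     {U \<in> H2_space (plate l).
        \<exists>g. continuous_on ({0..pi} \<times> {-l..l}) g \<and>
            (AE p in lebesgue_on (plate l). U p = g p) \<and>
            (\<forall>p \<in> {0, pi} \<times> {-l..l}. g p = 0)}"

definition inner0 :: "real \<Rightarrow> (real \<times> real \<Rightarrow> real) \<Rightarrow> (real \<times> real \<Rightarrow> real) \<Rightarrow> real" where
  "inner0 l U V = (\<integral>p. U p * V p \<partial>lebesgue_on (plate l))"

definition norm0 :: "real \<Rightarrow> (real \<times> real \<Rightarrow> real) \<Rightarrow> real" where
  "norm0 l U = sqrt (inner0 l U U)"

definition inner2 ::
  "real \<Rightarrow> real \<Rightarrow> (real \<times> real \<Rightarrow> real) \<Rightarrow> (real \<times> real \<Rightarrow> real) \<Rightarrow> real" where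
  "inner2 \<sigma> l U V =
     (\<integral>p. laplacian l U p * laplacian l V p
           - (1 - \<sigma>) * (wdxx l U p * wdyy l V p + wdyy l U p * wdxx l V p
                        - 2 * wdxy l U p * wdxy l V p) \<partial>lebesgue_on (plate l))"

definition norm2 :: "real \<Rightarrow> real \<Rightarrow> (real \<times> real \<Rightarrow> real) \<Rightarrow> real" where
  "norm2 \<sigma> l U = sqrt (inner2 \<sigma> l U U)"

text \<open>
  The dual space of \<open>H2star l\<close>. The defining conditions force a functional to take equal values
  on functions that coincide almost everywhere on the plate; its values outside \<open>H2star l\<close>
  are irrelevant.
\<close>

definition H2star_dual :: "real \<Rightarrow> real \<Rightarrow> ((real \<times> real \<Rightarrow> real) \<Rightarrow> real) set" where
  "H2star_dual \<sigma> l =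
     {f. (\<forall>U\<in>H2star l. \<forall>V\<in>H2star l. f (\<lambda>p. U p + V p) = f U + f V) \<and>
         (\<forall>c. \<forall>V\<in>H2star l. f (\<lambda>p. c * V p) = c * f V) \<and>
         (\<exists>C. \<forall>V\<in>H2star l. \<bar>f V\<bar> \<le> C * norm2 \<sigma> l V)}"

definition dual_norm :: "real \<Rightarrow> real \<Rightarrow> ((real \<times> real \<Rightarrow> real) \<Rightarrow> real) \<Rightarrow> real" where
  "dual_norm \<sigma> l f = (SUP V \<in> {V \<in> H2star l. norm2 \<sigma> l V \<le> 1}. \<bar>f V\<bar>)"


section \<open>Regularity in time\<close>

text \<open>
  Here \<open>X\<close> is a space of real functions (either functions on the plate or functionals) and
  \<open>N\<close> its (semi)norm.
\<close>

definition C0_in ::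
  "('a \<Rightarrow> real) set \<Rightarrow> (('a \<Rightarrow> real) \<Rightarrow> real) \<Rightarrow> real \<Rightarrow> (real \<Rightarrow> 'a \<Rightarrow> real) \<Rightarrow> bool" where
  "C0_in X N T u \<longleftrightarrow>
     (\<forall>t\<in>{0..T}. u t \<in> X \<and> ((\<lambda>s. N (\<lambda>p. u s p - u t p)) \<longlongrightarrow> 0) (at t within {0..T}))"

definition C1_in ::
  "('a \<Rightarrow> real) set \<Rightarrow> (('a \<Rightarrow> real) \<Rightarrow> real) \<Rightarrow> real
     \<Rightarrow> (real \<Rightarrow> 'a \<Rightarrow> real) \<Rightarrow> (real \<Rightarrow> 'a \<Rightarrow> real) \<Rightarrow> bool" where
  "C1_in X N T u u' \<longleftrightarrow>
     C0_in X N T u \<and> C0_in X N T u' \<and>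
     (\<forall>t\<in>{0..T}.
        ((\<lambda>s. N (\<lambda>p. (u s p - u t p) / (s - t) - u' t p)) \<longlongrightarrow> 0) (at t within {0..T}))"


section \<open>The evolution problem\<close>

definition nonlocal_coeff :: "real \<Rightarrow> real \<Rightarrow> real \<Rightarrow> (real \<times> real \<Rightarrow> real) \<Rightarrow> real" where
  "nonlocal_coeff l P S U = - P + S * (\<integral>p. (wdx l U p)\<^sup>2 \<partial>lebesgue_on (plate l))"

text \<open>
  \<open>U'\<close> is the time derivative of \<open>U\<close>. Functions in $L^2$ act on \<open>H2star l\<close> by \<open>inner0 l\<close>.
\<close>

definition weak_solution_on ::
  "real \<Rightarrow> real \<Rightarrow> real \<Rightarrow> real \<Rightarrow> real \<Rightarrow> (real \<Rightarrow> real \<times> real \<Rightarrow> real)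
     \<Rightarrow> (real \<times> real \<Rightarrow> real) \<Rightarrow> (real \<times> real \<Rightarrow> real) \<Rightarrow> real
     \<Rightarrow> (real \<Rightarrow> real \<times> real \<Rightarrow> real) \<Rightarrow> (real \<Rightarrow> real \<times> real \<Rightarrow> real) \<Rightarrow> bool" where
  "weak_solution_on \<sigma> l \<delta> P S F U\<^sub>0 V\<^sub>0 T U U' \<longleftrightarrow>
     C0_in (H2star l) (norm2 \<sigma> l) T U \<and>
     C1_in (L2_space (plate l)) (norm0 l) T U U' \<and>
     (AE p in lebesgue_on (plate l). U 0 p = U\<^sub>0 p) \<and>
     (AE p in lebesgue_on (plate l). U' 0 p = V\<^sub>0 p) \<and>
     (\<exists>U''.
        C1_in (H2star_dual \<sigma> l) (dual_norm \<sigma> l) T (\<lambda>t. inner0 l (U t)) (\<lambda>t. inner0 l (U' t)) \<and>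
        C1_in (H2star_dual \<sigma> l) (dual_norm \<sigma> l) T (\<lambda>t. inner0 l (U' t)) U'' \<and>
        (\<forall>t\<in>{0..T}. \<forall>V\<in>H2star l.
           U'' t V + \<delta> * inner0 l (U' t) V + inner2 \<sigma> l (U t) V
             + nonlocal_coeff l P S (U t) * inner0 l (wdx l (U t)) (wdx l V)
           = inner0 l (F t) V))"

definition weak_solution ::
  "real \<Rightarrow> real \<Rightarrow> real \<Rightarrow> real \<Rightarrow> real \<Rightarrow> (real \<Rightarrow> real \<times> real \<Rightarrow> real)
     \<Rightarrow> (real \<times> real \<Rightarrow> real) \<Rightarrow> (real \<times> real \<Rightarrow> real)
     \<Rightarrow> (real \<Rightarrow> real \<times> real \<Rightarrow> real) \<Rightarrow> (real \<Rightarrow> real \<times> real \<Rightarrow> real) \<Rightarrow> bool" where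
  "weak_solution \<sigma> l \<delta> P S F U\<^sub>0 V\<^sub>0 U U' \<longleftrightarrow>
     (\<forall>T>0. weak_solution_on \<sigma> l \<delta> P S F U\<^sub>0 V\<^sub>0 T U U')"

definition mech_energy ::
  "real \<Rightarrow> real \<Rightarrow> real \<Rightarrow> real
     \<Rightarrow> (real \<Rightarrow> real \<times> real \<Rightarrow> real) \<Rightarrow> (real \<Rightarrow> real \<times> real \<Rightarrow> real) \<Rightarrow> real \<Rightarrow> real" where
  "mech_energy \<sigma> l P S U U' t =
     1/2 * (norm0 l (U' t))\<^sup>2 + 1/2 * (norm2 \<sigma> l (U t))\<^sup>2
     - P/2 * (norm0 l (wdx l (U t)))\<^sup>2 + S/4 * (norm0 l (wdx l (U t))) ^ 4"


section \<open>The buckling eigenvalue problem\<close>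

definition buckling_eigenpair ::
  "real \<Rightarrow> real \<Rightarrow> real \<Rightarrow> (real \<times> real \<Rightarrow> real) \<Rightarrow> bool" where
  "buckling_eigenpair \<sigma> l \<Lambda> w \<longleftrightarrow>
     w \<in> H2star l \<and> \<not> (AE p in lebesgue_on (plate l). w p = 0) \<and>
     (\<forall>z\<in>H2star l. inner2 \<sigma> l w z = \<Lambda> * inner0 l (wdx l w) (wdx l z))"

text \<open>
  \<open>\<Lambda>\<close> is the \<open>k\<close>-th eigenvalue, counted from 1 and according to multiplicity: the least number
  below or at which there are \<open>k\<close> mutually orthogonal eigenfunctions.
\<close>

definition has_eigenfunctions_upto :: "real \<Rightarrow> real \<Rightarrow> nat \<Rightarrow> real \<Rightarrow> bool" where
  "has_eigenfunctions_upto \<sigma> l k \<Lambda> \<longleftrightarrow>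
     (\<exists>\<mu> w. (\<forall>i<k. buckling_eigenpair \<sigma> l (\<mu> i) (w i) \<and> \<mu> i \<le> \<Lambda>) \<and>
            (\<forall>i<k. \<forall>j<k. i \<noteq> j \<longrightarrow> inner2 \<sigma> l (w i) (w j) = 0))"

definition is_kth_buckling_eigenvalue :: "real \<Rightarrow> real \<Rightarrow> nat \<Rightarrow> real \<Rightarrow> bool" where
  "is_kth_buckling_eigenvalue \<sigma> l k \<Lambda> \<longleftrightarrow>
     has_eigenfunctions_upto \<sigma> l k \<Lambda> \<and> (\<forall>\<Lambda>'. has_eigenfunctions_upto \<sigma> l k \<Lambda>' \<longrightarrow> \<Lambda> \<le> \<Lambda>')"

end

theory Submission
  imports Defs "HOL-Library.Function_Algebras" "HOL-Computational_Algebra.Polynomial"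
begin

text \<open>
  The mechanical energy $E$ of a weak solution satisfies $E' = -\delta \|U'\|_0^2$. Write $\beta = \|U_x\|_0^2$
  and $c = (U_x,(w_1)_x)_0$. Since $P = \Lambda_1 + S \lambda_+^2$, completing the square gives
  \[ E + \frac{S \lambda_+^4}{4} = \frac{1}{2}\|U'\|_0^2 + \frac{S}{4}(\beta - \lambda_+^2)^2
     + \frac{1}{2}\big(\|U\|_2^2 - \Lambda_1 \beta\big), \]
  a sum of nonnegative terms that vanishes exactly at the two equilibria $\pm\lambda_+ w_1$. It has to be
  shown that this sum tends to 0 and that the sign of $c$ decides which equilibrium is approached.

  The sign: on the complement of $w_1$ the Rayleigh quotient $\|u\|_2^2 / \|u_x\|_0^2$ is at least $\Lambda_2$,
  and $P \le \Lambda_2$; hence $E \ge -\frac{1}{2}(P - \Lambda_1) c^2$. As $E$ decreases from a negative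
  value, $c^2$ stays above a positive constant (\<open>c_lower\<close>), so $c$ keeps the sign of
  $\Lambda_1 c(0) = (U_0,w_1)_2$.

  The decay: the multiplier $V = U - (\lambda_+^2 / c) w_1$ is built so that the stationary part of the
  equation, tested with $V$, is exactly $R = (\|U\|_2^2 - \Lambda_1 \beta) + S (\beta - \lambda_+^2)^2$. Thus
  $(U',V)_0' \le C \|U'\|_0^2 - R/2$, and $\|V\|_0^2 \le C R$ by the spectral gap and the lower bound for $c^2$.
  For small $\epsilon$ the functional $E + S \lambda_+^4/4 + \epsilon (U',V)_0$ is comparable to
  $E + S \lambda_+^4/4$ and decays exponentially. The theorem \<open>convergence\<close> carries this out for an
  abstract equation.

  Three ingredients need analysis. First, the energy identity (\<open>energy_balance\<close>): $U'$ is no admissible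
  test function, so the equation is tested with symmetric difference quotients of $U$, for which the leading
  terms telescope. Second, the spectral gap (\<open>spectral_gap\<close>): $\Lambda_2$ is defined by counting
  eigenfunctions, and the variational inequality follows by minimising the Rayleigh quotient
  (\<open>eigenfunction_below\<close>). This needs the completeness of $H^2_*(\Omega)$ (\<open>H2star_complete\<close>) and the
  compactness of $\|u_x\|_0$ relative to $\|u\|_2$, which the Poincare inequality on the cells of a fine grid
  provides (\<open>finitely_many_means\<close>). Third, facts on weak derivatives: a function with a weak
  $x$-derivative is absolutely continuous on almost every row (\<open>absolutely_continuous_on_lines\<close>), and this
  reduces the boundary condition, integration by parts, the sup bound and the Poincare inequalities to
  statements in one variable. The product form of $w_1$ enters through $(w_1)_{xx} = -w_1$, which turns
  $\|w_1\|_0 = 1$ into $\|(w_1)_x\|_0 = 1$.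
\<close>

section \<open>Semidefinite inner products\<close>

text \<open>
  Square integrable functions stand for their classes modulo null sets, so the symmetric
  bilinear forms that occur are only semidefinite.
\<close>
locale semi_inner =
  fixes X :: "'v::real_vector set" and ip :: "'v \<Rightarrow> 'v \<Rightarrow> real"
  assumes subspace_X: "subspace X"
    and add_left: "\<lbrakk>u \<in> X; v \<in> X; w \<in> X\<rbrakk> \<Longrightarrow> ip (u + v) w = ip u w + ip v w"
    and scale_left: "\<lbrakk>u \<in> X; w \<in> X\<rbrakk> \<Longrightarrow> ip (c *\<^sub>R u) w = c * ip u w"
    and sym: "\<lbrakk>u \<in> X; v \<in> X\<rbrakk> \<Longrightarrow> ip u v = ip v u"
    and nonneg: "u \<in> X \<Longrightarrow> 0 \<le> ip u u"
begin

definition N :: "'v \<Rightarrow> real" where "N u = sqrt (ip u u)"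

lemma mem [simp]:
  "\<lbrakk>u \<in> X; v \<in> X\<rbrakk> \<Longrightarrow> u + v \<in> X" "u \<in> X \<Longrightarrow> c *\<^sub>R u \<in> X"
  "\<lbrakk>u \<in> X; v \<in> X\<rbrakk> \<Longrightarrow> u - v \<in> X" "0 \<in> X" "u \<in> X \<Longrightarrow> u /\<^sub>R c \<in> X"
  using subspace_X by (auto simp: subspace_add subspace_scale subspace_diff subspace_0)

lemma diff_left: "\<lbrakk>u \<in> X; v \<in> X; w \<in> X\<rbrakk> \<Longrightarrow> ip (u - v) w = ip u w - ip v w"
  using add_left[of "u - v" v w] by simp

lemma add_right: "\<lbrakk>u \<in> X; v \<in> X; w \<in> X\<rbrakk> \<Longrightarrow> ip w (u + v) = ip w u + ip w v"
  by (metis add_left mem(1) sym)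

lemma diff_right: "\<lbrakk>u \<in> X; v \<in> X; w \<in> X\<rbrakk> \<Longrightarrow> ip w (u - v) = ip w u - ip w v"
  by (metis diff_left mem(3) sym)

lemma scale_right: "\<lbrakk>u \<in> X; w \<in> X\<rbrakk> \<Longrightarrow> ip w (c *\<^sub>R u) = c * ip w u"
  by (metis mem(2) scale_left sym)

lemmas bilin = add_left diff_left scale_left add_right diff_right scale_right

lemma N_nonneg [simp]: "u \<in> X \<Longrightarrow> 0 \<le> N u"
  by (simp add: N_def nonneg)

lemma N_sq: "u \<in> X \<Longrightarrow> (N u)\<^sup>2 = ip u u"
  by (simp add: N_def nonneg)

lemma N_zero [simp]: "N 0 = 0"
  using scale_left[of 0 0 0] by (simp add: N_def)

lemma cauchy_schwarz_sq:
  assumes "u \<in> X" "v \<in> X" shows "(ip u v)\<^sup>2 \<le> ip u u * ip v v"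
proof -
  have q: "0 \<le> ip u u + 2 * t * ip u v + t\<^sup>2 * ip v v" for t
    using nonneg[of "u + t *\<^sub>R v"] assms
    by (simp add: bilin sym[of v u] algebra_simps power2_eq_square)
  show ?thesis
  proof (cases "ip v v = 0")
    case True
    have "ip u v = 0"
    proof (rule ccontr)
      assume "ip u v \<noteq> 0"
      with q[of "- (ip u u + 1) / (2 * ip u v)"] True nonneg[OF assms(1)] show False
        by (simp add: field_simps)
    qed
    with True show ?thesis by simp
  next
    case False
    with nonneg[OF assms(2)] have "ip v v > 0" by simp
    with q[of "- ip u v / ip v v"] show ?thesis
      by (simp add: field_simps power2_eq_square)
  qed
qed

lemma cauchy_schwarz:
  assumes "u \<in> X" "v \<in> X" shows "\<bar>ip u v\<bar> \<le> N u * N v"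
  using real_sqrt_le_mono[OF cauchy_schwarz_sq[OF assms]] by (simp add: N_def real_sqrt_mult)

lemma N_triangle:
  assumes "u \<in> X" "v \<in> X" shows "N (u + v) \<le> N u + N v"
proof (rule power2_le_imp_le)
  show "(N (u + v))\<^sup>2 \<le> (N u + N v)\<^sup>2"
    using assms cauchy_schwarz[OF assms]
    by (simp add: N_sq power2_sum bilin sym[of v u])
qed (use assms in simp)

lemma N_minus_commute:
  assumes "u \<in> X" "v \<in> X" shows "N (u - v) = N (v - u)"
  using assms by (simp add: N_def bilin)

lemma N_diff_triangle:
  assumes "u \<in> X" "v \<in> X" "w \<in> X" shows "N (u - w) \<le> N (u - v) + N (v - w)"
  using N_triangle[of "u - v" "v - w"] assms by simp

lemma N_scale: "u \<in> X \<Longrightarrow> N (c *\<^sub>R u) = \<bar>c\<bar> * N u"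
  by (simp add: N_def bilin real_sqrt_mult mult.assoc[symmetric])

lemma tendsto_N:
  assumes "((\<lambda>s. N (f s - l)) \<longlongrightarrow> 0) F" "\<forall>\<^sub>F s in F. f s \<in> X" "l \<in> X"
  shows "((\<lambda>s. N (f s)) \<longlongrightarrow> N l) F"
proof (rule LIM_zero_cancel, rule tendsto_0_le[OF assms(1), of _ 1])
  show "\<forall>\<^sub>F s in F. norm (N (f s) - N l) \<le> norm (N (f s - l)) * 1"
    using assms(2)
  proof eventually_elim
    case (elim s)
    have "N (f s) \<le> N (f s - l) + N l" "N l \<le> N (l - f s) + N (f s)"
      using N_triangle[of "f s - l" l] N_triangle[of "l - f s" "f s"] elim assms(3) by auto
    with N_minus_commute[of l "f s"] elim assms(3) show ?case by (auto simp: abs_if)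
  qed
qed

lemma tendsto_ip:
  assumes f: "((\<lambda>s. N (f s - l)) \<longlongrightarrow> 0) F" "\<forall>\<^sub>F s in F. f s \<in> X" "l \<in> X"
    and g: "((\<lambda>s. N (g s - k)) \<longlongrightarrow> 0) F" "\<forall>\<^sub>F s in F. g s \<in> X" "k \<in> X"
  shows "((\<lambda>s. ip (f s) (g s)) \<longlongrightarrow> ip l k) F"
proof -
  have b: "((\<lambda>s. N (f s - l) * N (g s) + N l * N (g s - k)) \<longlongrightarrow> 0 * N k + N l * 0) F"
    by (intro tendsto_intros f g tendsto_N)
  have "((\<lambda>s. ip (f s) (g s) - ip l k) \<longlongrightarrow> 0) F"
  proof (rule Lim_null_comparison)
    show "((\<lambda>s. N (f s - l) * N (g s) + N l * N (g s - k)) \<longlongrightarrow> 0) F" using b by simp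
    show "\<forall>\<^sub>F s in F. norm (ip (f s) (g s) - ip l k) \<le> N (f s - l) * N (g s) + N l * N (g s - k)"
      using f(2) g(2)
    proof eventually_elim
      case (elim s)
      have "ip (f s) (g s) - ip l k = ip (f s - l) (g s) + ip l (g s - k)"
        using elim f(3) g(3) by (simp add: bilin)
      then show ?case
        using cauchy_schwarz[of "f s - l" "g s"] cauchy_schwarz[of l "g s - k"] elim f(3) g(3) by auto
    qed
  qed
  then show ?thesis by (simp add: LIM_zero_iff)
qed

lemma tendsto_ip_const:
  assumes "((\<lambda>s. N (f s - l)) \<longlongrightarrow> 0) F" "\<forall>\<^sub>F s in F. f s \<in> X" "l \<in> X" "v \<in> X"
  shows "((\<lambda>s. ip (f s) v) \<longlongrightarrow> ip l v) F"
  by (rule tendsto_ip[OF assms(1-3)]) (use assms in auto)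

end

section \<open>The energy identity of a damped evolution equation\<close>

text \<open>
  The plate equation in abstract form: \<open>L\<close> is the space of square integrable
  functions, \<open>H\<close> the energy space, \<open>i0\<close>, \<open>a\<close> and
  \<open>b\<close> are $(u,v)_0$, $(u,v)_2$ and $(u_x,v_x)_0$, and \<open>D\<close> is $u
  \mapsto u_{xx}$, which represents \<open>b\<close> in terms of \<open>i0\<close>. The curve
  \<open>U\<close> is continuous into \<open>H\<close> but differentiable only into
  \<open>L\<close>, and the equation holds when tested with a fixed element of \<open>H\<close>.
\<close>
locale damped_evolution =
  L: semi_inner L i0 + A: semi_inner H a + B: semi_inner H b
  for L H :: "'v::real_vector set" and i0 a b +
  fixes D :: "'v \<Rightarrow> 'v" and U U' :: "real \<Rightarrow> 'v" and \<delta> P S \<Lambda>\<^sub>1 \<Lambda>\<^sub>2 K :: real and w :: 'v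
  assumes H_sub: "H \<subseteq> L"
    and D_in: "u \<in> H \<Longrightarrow> D u \<in> L"
    and ibp: "\<lbrakk>u \<in> H; v \<in> H\<rbrakk> \<Longrightarrow> b u v = - i0 (D u) v"
    and D_bound: "\<lbrakk>u \<in> H; v \<in> H\<rbrakk> \<Longrightarrow> i0 (D u - D v) (D u - D v) \<le> K * a (u - v) (u - v)"
    and i0_le_b: "u \<in> H \<Longrightarrow> i0 u u \<le> K * b u u"
    and w_in: "w \<in> H" and w_unit: "b w w = 1"
    and w_eigen: "u \<in> H \<Longrightarrow> a w u = \<Lambda>\<^sub>1 * b w u"
    and gap: "u \<in> H \<Longrightarrow> (\<Lambda>\<^sub>2 - \<Lambda>\<^sub>1) * (b u u - (b u w)\<^sup>2) \<le> a u u - \<Lambda>\<^sub>1 * b u u"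
    and params: "0 < \<delta>" "0 < S" "0 < \<Lambda>\<^sub>1" "\<Lambda>\<^sub>1 < P" "P \<le> \<Lambda>\<^sub>2" "0 < K"
    and U_in: "0 \<le> t \<Longrightarrow> U t \<in> H" and U'_in: "0 \<le> t \<Longrightarrow> U' t \<in> L"
    and contU: "0 \<le> t \<Longrightarrow> ((\<lambda>s. A.N (U s - U t)) \<longlongrightarrow> 0) (at t within {0..})"
    and contU': "0 \<le> t \<Longrightarrow> ((\<lambda>s. L.N (U' s - U' t)) \<longlongrightarrow> 0) (at t within {0..})"
    and derU: "0 \<le> t \<Longrightarrow> ((\<lambda>s. L.N ((U s - U t) /\<^sub>R (s - t) - U' t)) \<longlongrightarrow> 0) (at t within {0..})"
    and weak: "\<lbrakk>0 \<le> t; v \<in> H\<rbrakk> \<Longrightarrow>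
      ((\<lambda>s. i0 (U' s) v) has_real_derivative
        - (\<delta> * i0 (U' t) v + a (U t) v + (S * b (U t) (U t) - P) * b (U t) v)) (at t within {0..})"
begin

lemma H_L [simp]: "u \<in> H \<Longrightarrow> u \<in> L" using H_sub by auto
declare D_in [simp] w_in [simp] U_in [simp] U'_in [simp]

lemma gap_pos: "\<Lambda>\<^sub>1 < \<Lambda>\<^sub>2" using params by simp

lemma b_w_le: "u \<in> H \<Longrightarrow> (b u w)\<^sup>2 \<le> b u u"
  using B.cauchy_schwarz_sq[of u w] by (simp add: w_unit)

lemma b_le_a: "u \<in> H \<Longrightarrow> \<Lambda>\<^sub>1 * b u u \<le> a u u"
  using gap[of u] b_w_le[of u] gap_pos mult_nonneg_nonneg[of "\<Lambda>\<^sub>2 - \<Lambda>\<^sub>1" "b u u - (b u w)\<^sup>2"]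
  by linarith

lemma at_within_half_line: "0 < t \<Longrightarrow> at t within {0..} = at (t::real)"
  by (rule at_within_interior) simp

lemma eventually_pos_at: "0 < t \<Longrightarrow> \<forall>\<^sub>F s in at t. 0 \<le> (s::real)"
  using eventually_at_in_open'[of "{0<..}" t] by (auto elim: eventually_mono)

lemma eventually_nonneg_within: "\<forall>\<^sub>F s in at t within {0..}. 0 \<le> (s::real)"
  by (auto simp: eventually_at_filter)

lemma contDU: "0 \<le> t \<Longrightarrow> ((\<lambda>s. L.N (D (U s) - D (U t))) \<longlongrightarrow> 0) (at t within {0..})"
proof (rule Lim_null_comparison)
  assume t: "0 \<le> t"
  show "((\<lambda>s. sqrt K * A.N (U s - U t)) \<longlongrightarrow> 0) (at t within {0..})"
    using tendsto_mult[OF tendsto_const[of "sqrt K"] contU[OF t]] by simp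
  show "\<forall>\<^sub>F s in at t within {0..}. norm (L.N (D (U s) - D (U t))) \<le> sqrt K * A.N (U s - U t)"
    using eventually_nonneg_within[of t]
  proof eventually_elim
    case (elim s)
    then show ?case using D_bound[of "U s" "U t"] t
      by (simp add: L.N_def A.N_def real_sqrt_mult[symmetric] L.nonneg)
  qed
qed

lemma has_derivative_i0_U:
  assumes t: "0 \<le> t" and v: "v \<in> L"
  shows "((\<lambda>s. i0 v (U s)) has_real_derivative i0 v (U' t)) (at t within {0..})"
  unfolding has_field_derivative_iff
proof (rule Lim_transform_eventually)
  show "((\<lambda>s. i0 v ((U s - U t) /\<^sub>R (s - t))) \<longlongrightarrow> i0 v (U' t)) (at t within {0..})"
    by (rule L.tendsto_ip[OF _ _ _ derU])
      (use t v eventually_nonneg_within[of t] in \<open>auto elim!: eventually_mono\<close>)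
  show "\<forall>\<^sub>F s in at t within {0..}. i0 v ((U s - U t) /\<^sub>R (s - t)) = (i0 v (U s) - i0 v (U t)) / (s - t)"
    using eventually_nonneg_within[of t]
    by eventually_elim (use t v in \<open>simp add: L.bilin divide_inverse mult.commute\<close>)
qed

definition c :: "real \<Rightarrow> real" where "c t = b (U t) w"
definition \<beta> :: "real \<Rightarrow> real" where "\<beta> t = b (U t) (U t)"

lemma has_derivative_c:
  assumes t: "0 \<le> t"
  shows "(c has_real_derivative - i0 (D w) (U' t)) (at t within {0..})"
proof (rule has_field_derivative_transform_within[where d = 1])
  show "((\<lambda>s. - i0 (D w) (U s)) has_real_derivative - i0 (D w) (U' t)) (at t within {0..})"
    by (intro DERIV_minus has_derivative_i0_U t) simp
qed (use t in \<open>auto simp: c_def ibp[symmetric] B.sym[of w]\<close>)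

text \<open>
  The velocity lies in \<open>L\<close>, where \<open>b\<close> has no meaning. Writing \<open>b
  u v\<close> as \<open>- i0 (D u) v\<close> moves both derivatives to \<open>D (U s)\<close>,
  which is continuous in time, and leaves the difference quotient of \<open>U\<close>, which
  converges in \<open>L\<close>.
\<close>
lemma has_derivative_\<beta>:
  assumes t: "0 \<le> t"
  shows "(\<beta> has_real_derivative - 2 * i0 (D (U t)) (U' t)) (at t within {0..})"
  unfolding has_field_derivative_iff
proof (rule Lim_transform_eventually)
  let ?q = "\<lambda>s. (U s - U t) /\<^sub>R (s - t)"
  have "((\<lambda>s. - i0 (D (U s)) (?q s) - i0 (D (U t)) (?q s))
      \<longlongrightarrow> - i0 (D (U t)) (U' t) - i0 (D (U t)) (U' t)) (at t within {0..})"
    by (intro tendsto_diff tendsto_minus L.tendsto_ip contDU derU)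
      (use t eventually_nonneg_within[of t] in \<open>auto elim!: eventually_mono\<close>)
  then show "((\<lambda>s. - i0 (D (U s)) (?q s) - i0 (D (U t)) (?q s))
      \<longlongrightarrow> - 2 * i0 (D (U t)) (U' t)) (at t within {0..})" by simp
  show "\<forall>\<^sub>F s in at t within {0..}. - i0 (D (U s)) (?q s) - i0 (D (U t)) (?q s) = (\<beta> s - \<beta> t) / (s - t)"
    using eventually_nonneg_within[of t]
  proof eventually_elim
    case (elim s)
    have "- i0 (D (U s)) (?q s) - i0 (D (U t)) (?q s) = b (U s) (?q s) + b (U t) (?q s)"
      using elim t by (simp add: ibp)
    also have "\<dots> = (\<beta> s - \<beta> t) / (s - t)"
      using elim t by (simp add: B.bilin \<beta>_def divide_inverse B.sym[of "U t" "U s"] algebra_simps)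
    finally show ?case .
  qed
qed

text \<open>
  The equation may be tested with a moving element \<open>W s\<close> whose velocity
  \<open>W'\<close> exists only in \<open>L\<close>: the increment of \<open>U'\<close> is
  always paired with the frozen element \<open>W t\<close> of \<open>H\<close>, the increment of
  \<open>W\<close> with \<open>U' s\<close>.
\<close>
lemma product_rule:
  assumes t: "0 < t"
    and W: "\<forall>\<^sub>F s in at t. W s \<in> L" "W t \<in> H" "W' \<in> L"
    and dW: "((\<lambda>s. L.N ((W s - W t) /\<^sub>R (s - t) - W')) \<longlongrightarrow> 0) (at t)"
  shows "((\<lambda>s. i0 (U' s) (W s)) has_real_derivative
      - (\<delta> * i0 (U' t) (W t) + a (U t) (W t) + (S * \<beta> t - P) * b (U t) (W t)) + i0 (U' t) W') (at t)"
  unfolding has_field_derivative_iff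
proof (rule Lim_transform_eventually)
  have t0: "0 \<le> t" using t by simp
  let ?q = "\<lambda>s. (W s - W t) /\<^sub>R (s - t)"
  note weak' = weak[OF t0 W(2), unfolded at_within_half_line[OF t] has_field_derivative_iff]
  have ev: "\<forall>\<^sub>F s in at t. U' s \<in> L"
    using eventually_pos_at[OF t] by (auto elim: eventually_mono)
  show "((\<lambda>s. (i0 (U' s) (W t) - i0 (U' t) (W t)) / (s - t) + i0 (U' s) (?q s))
      \<longlongrightarrow> - (\<delta> * i0 (U' t) (W t) + a (U t) (W t) + (S * \<beta> t - P) * b (U t) (W t)) + i0 (U' t) W') (at t)"
    unfolding \<beta>_def
    by (intro tendsto_add weak' L.tendsto_ip dW contU'[OF t0, unfolded at_within_half_line[OF t]] ev)
      (use W t in \<open>auto elim!: eventually_mono\<close>)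
  show "\<forall>\<^sub>F s in at t. (i0 (U' s) (W t) - i0 (U' t) (W t)) / (s - t) + i0 (U' s) (?q s)
      = (i0 (U' s) (W s) - i0 (U' t) (W t)) / (s - t)"
    using ev W(1)
    by eventually_elim (use t W in \<open>simp add: L.bilin divide_inverse algebra_simps\<close>)
qed

text \<open>
  The test function behind the energy identity. The velocity itself is not admissible, as it
  need not belong to \<open>H\<close>; its symmetric approximation \<open>W h t /\<^sub>R (2 *
  h)\<close> does.
\<close>
definition W :: "real \<Rightarrow> real \<Rightarrow> 'v" where "W h t = U (t + h) - U (t - h)"

lemma tendsto_shift:
  fixes f :: "real \<Rightarrow> real"
  assumes "(f \<longlongrightarrow> l) (at (t + h))"
  shows "((\<lambda>s. f (s + h)) \<longlongrightarrow> l) (at t)"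
  using LIM_offset[OF assms, of h] by simp

lemma derU_shift:
  assumes "0 < t + h"
  shows "((\<lambda>s. L.N ((U (s + h) - U (t + h)) /\<^sub>R (s - t) - U' (t + h))) \<longlongrightarrow> 0) (at t)"
  using tendsto_shift[OF derU[of "t + h", unfolded at_within_half_line[OF assms]]] assms by simp

lemma eventually_shift_pos: "0 < t + h \<Longrightarrow> \<forall>\<^sub>F s in at t. 0 \<le> s + (h::real)"
  using eventually_at_in_open'[of "{-h<..}" t] by (auto elim: eventually_mono)

lemma derW:
  assumes h: "0 < h" "h < t"
  shows "((\<lambda>s. L.N ((W h s - W h t) /\<^sub>R (s - t) - (U' (t + h) - U' (t - h)))) \<longlongrightarrow> 0) (at t)"
proof (rule Lim_null_comparison)
  let ?f = "\<lambda>h s. (U (s + h) - U (t + h)) /\<^sub>R (s - t) - U' (t + h)"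
  show "((\<lambda>s. L.N (?f h s) + L.N (?f (-h) s)) \<longlongrightarrow> 0) (at t)"
    using tendsto_add[OF derU_shift[of t h] derU_shift[of t "-h"]] h by simp
  have 1: "\<forall>\<^sub>F s in at t. 0 \<le> s + h" "\<forall>\<^sub>F s in at t. 0 \<le> s + (- h)"
    using h by (intro eventually_shift_pos; simp)+
  show "\<forall>\<^sub>F s in at t. norm (L.N ((W h s - W h t) /\<^sub>R (s - t) - (U' (t + h) - U' (t - h))))
      \<le> L.N (?f h s) + L.N (?f (-h) s)"
    using 1
  proof eventually_elim
    case (elim s)
    have m: "?f h s \<in> L" "?f (-h) s \<in> L" using elim h by auto
    have "(W h s - W h t) /\<^sub>R (s - t) - (U' (t + h) - U' (t - h)) = ?f h s + (-1) *\<^sub>R ?f (-h) s"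
      by (simp add: W_def algebra_simps)
    then have "L.N ((W h s - W h t) /\<^sub>R (s - t) - (U' (t + h) - U' (t - h)))
        \<le> L.N (?f h s) + L.N ((-1) *\<^sub>R ?f (-h) s)"
      using L.N_triangle[of "?f h s" "(-1) *\<^sub>R ?f (-h) s"] m L.mem(2) by metis
    moreover have "L.N ((-1) *\<^sub>R ?f (-h) s) = L.N (?f (-h) s)" using L.N_scale[OF m(2), of "-1"] by simp
    moreover have "0 \<le> L.N ((W h s - W h t) /\<^sub>R (s - t) - (U' (t + h) - U' (t - h)))"
      using elim h by (intro L.N_nonneg) (auto simp: W_def)
    ultimately show ?case by simp
  qed
qed

text \<open>
  \<open>L\<close> carries only a seminorm and no topology of its own; the uniform continuity of
  \<open>U'\<close> on compact time intervals is read off from this real function of two times.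
\<close>
lemma continuous_N_U':
  "continuous_on ({0..} \<times> {0..}) (\<lambda>z. L.N (U' (fst z) - U' (snd z)))"
  unfolding continuous_on_def
proof
  fix z :: "real \<times> real" assume z: "z \<in> {0..} \<times> {0..}"
  obtain x y where xy: "z = (x, y)" "0 \<le> x" "0 \<le> y" using z by (cases z) auto
  let ?F = "at z within {0..} \<times> {0..}"
  have ev: "\<forall>\<^sub>F p in ?F. 0 \<le> fst p \<and> 0 \<le> snd p"
    unfolding eventually_at_filter by (intro always_eventually) auto
  have 0: "((\<lambda>s. L.N (U' s - U' x)) \<longlongrightarrow> 0) (inf (nhds x) (principal {0..}))" if "0 \<le> x" for x
    unfolding tendsto_def
  proof (intro allI impI)
    fix O' :: "real set" assume O': "open O'" "0 \<in> O'"
    have "\<forall>\<^sub>F s in nhds x. s \<noteq> x \<longrightarrow> s \<in> {0..} \<longrightarrow> L.N (U' s - U' x) \<in> O'"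
      using topological_tendstoD[OF contU'[OF that] O'] by (simp add: eventually_at_filter)
    then show "\<forall>\<^sub>F s in inf (nhds x) (principal {0..}). L.N (U' s - U' x) \<in> O'"
      unfolding eventually_inf_principal
    proof eventually_elim
      case (elim s)
      then show ?case using O' by (cases "s = x") auto
    qed
  qed
  have lim: "filterlim fst (inf (nhds x) (principal {0..})) ?F" "filterlim snd (inf (nhds y) (principal {0..})) ?F"
    using tendsto_fst[OF tendsto_ident_at, of z "{0..} \<times> {0..}"] tendsto_snd[OF tendsto_ident_at, of z "{0..} \<times> {0..}"] xy ev
    by (auto simp: filterlim_inf filterlim_principal elim: eventually_mono)
  have l: "((\<lambda>p. L.N (U' (fst p) - U' x) + L.N (U' (snd p) - U' y)) \<longlongrightarrow> 0) ?F"
    using tendsto_add[OF filterlim_compose[OF 0 lim(1)] filterlim_compose[OF 0 lim(2)]] xy by simp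
  have "((\<lambda>p. L.N (U' (fst p) - U' (snd p)) - L.N (U' x - U' y)) \<longlongrightarrow> 0) ?F"
  proof (rule Lim_null_comparison[OF _ l])
    show "\<forall>\<^sub>F p in ?F. norm (L.N (U' (fst p) - U' (snd p)) - L.N (U' x - U' y))
        \<le> L.N (U' (fst p) - U' x) + L.N (U' (snd p) - U' y)"
      using ev
    proof eventually_elim
      case (elim p)
      define f g where "f = U' (fst p)" and "g = U' (snd p)"
      have m: "f \<in> L" "g \<in> L" "U' x \<in> L" "U' y \<in> L" using elim xy by (auto simp: f_def g_def)
      have "L.N (f - g) \<le> L.N (f - U' x) + L.N (U' x - U' y) + L.N (U' y - g)"
        using L.N_diff_triangle[of f "U' x" g] L.N_diff_triangle[of "U' x" "U' y" g] m by simp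
      moreover have "L.N (U' x - U' y) \<le> L.N (U' x - f) + L.N (f - g) + L.N (g - U' y)"
        using L.N_diff_triangle[of "U' x" f "U' y"] L.N_diff_triangle[of f g "U' y"] m by simp
      ultimately show ?case unfolding f_def[symmetric] g_def[symmetric]
        using m by (simp add: L.N_minus_commute[of "U' x" f] L.N_minus_commute[of "U' y" g] abs_le_iff)
    qed
  qed
  then show "((\<lambda>z. L.N (U' (fst z) - U' (snd z))) \<longlongrightarrow> L.N (U' (fst z) - U' (snd z))) ?F"
    by (simp add: xy LIM_zero_iff)
qed

text \<open>
  Let \<open>v\<close> be the error times \<open>2 * h\<close>. The mean value theorem for the
  real function \<open>i0 v (U \<tau>) - \<tau> * i0 v (U' t)\<close> bounds the square of the
  norm of \<open>v\<close> by \<open>2 * h\<close> times that norm times the oscillation of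
  \<open>U'\<close>; this replaces a vector-valued fundamental theorem of calculus.
\<close>
lemma uniform_difference_quotient:
  assumes s: "0 < s" and e: "0 < e"
  shows "\<exists>h0>0. h0 < s \<and> (\<forall>h t. 0 < h \<and> h < h0 \<and> s \<le> t \<and> t \<le> r \<longrightarrow>
           L.N (W h t /\<^sub>R (2 * h) - U' t) \<le> e)"
proof -
  let ?Q = "{0..r + 1} \<times> {0..r + 1}"
  have "uniformly_continuous_on ?Q (\<lambda>z. L.N (U' (fst z) - U' (snd z)))"
    by (intro compact_uniformly_continuous continuous_on_subset[OF continuous_N_U'] compact_Times) auto
  then obtain d where d: "0 < d" "\<And>x y. \<lbrakk>x \<in> ?Q; y \<in> ?Q; dist y x < d\<rbrakk> \<Longrightarrow>
      dist (L.N (U' (fst y) - U' (snd y))) (L.N (U' (fst x) - U' (snd x))) < e"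
    unfolding uniformly_continuous_on_def using e by metis
  (* h0 < s keeps t - h positive, h0 < 1 keeps t + h in the compact interval *)
  define h0 where "h0 = min d (min s 1) / 2"
  have h0: "0 < h0" "h0 < s" "h0 < 1" "h0 < d" using s d by (auto simp: h0_def)
  have "L.N (W h t /\<^sub>R (2 * h) - U' t) \<le> e" if h: "0 < h" "h < h0" "s \<le> t" "t \<le> r" for h t
  proof -
    have osc: "L.N (U' \<tau> - U' t) \<le> e" if "t - h \<le> \<tau>" "\<tau> \<le> t + h" for \<tau>
    proof -
      have "\<bar>\<tau> - t\<bar> < d" using h h0 that by linarith
      moreover have "(t, t) \<in> ?Q" "(\<tau>, t) \<in> ?Q" using h h0 that s by auto
      ultimately have "\<bar>L.N (U' \<tau> - U' t) - L.N (U' t - U' t)\<bar> < e"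
        using d(2)[of "(t, t)" "(\<tau>, t)"] by (simp add: dist_Pair_Pair dist_real_def)
      then show ?thesis by simp
    qed
    define v where "v = W h t - (2 * h) *\<^sub>R U' t"
    have tp: "0 \<le> t" "0 \<le> t - h" "0 \<le> t + h" using h h0 s by auto
    have vL: "v \<in> L" using tp by (simp add: v_def W_def)
    define \<psi> where "\<psi> = (\<lambda>\<tau>. i0 v (U \<tau>) - \<tau> * i0 v (U' t))"
    have d\<psi>: "(\<psi> has_real_derivative i0 v (U' \<tau>) - i0 v (U' t)) (at \<tau>)" if "t - h \<le> \<tau>" for \<tau>
    proof -
      have "0 < \<tau>" using that h h0 by simp
      with has_derivative_i0_U[of \<tau> v] vL show ?thesis
        unfolding \<psi>_def by (auto intro!: derivative_eq_intros simp: at_within_half_line)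
    qed
    have "t - h < t + h" using h by simp
    from MVT2[OF this d\<psi>] obtain z where z: "t - h < z" "z < t + h"
      and mvt: "\<psi> (t + h) - \<psi> (t - h) = (t + h - (t - h)) * (i0 v (U' z) - i0 v (U' t))"
      by blast
    have "L.N v ^ 2 = i0 v (W h t) - 2 * h * i0 v (U' t)"
    proof -
      have "i0 v v = i0 v (W h t - (2 * h) *\<^sub>R U' t)" by (subst (2) v_def) (rule refl)
      then show ?thesis
        using L.diff_right[of "W h t" "(2 * h) *\<^sub>R U' t" v] L.scale_right[of "U' t" v "2 * h"] vL tp
        by (simp add: L.N_sq W_def)
    qed
    also have "i0 v (W h t) = i0 v (U (t + h)) - i0 v (U (t - h))"
      using vL tp by (simp add: W_def L.diff_right)
    also have "\<dots> - 2 * h * i0 v (U' t) = \<psi> (t + h) - \<psi> (t - h)"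
      by (simp add: \<psi>_def algebra_simps)
    also have "\<dots> = 2 * h * i0 v (U' z - U' t)" using mvt z tp vL by (simp add: L.bilin)
    also have "\<dots> \<le> 2 * h * (L.N v * e)"
    proof (intro mult_left_mono)
      have "i0 v (U' z - U' t) \<le> L.N v * L.N (U' z - U' t)"
        using L.cauchy_schwarz[of v "U' z - U' t"] vL z tp by simp
      also have "\<dots> \<le> L.N v * e" using osc[of z] z vL by (intro mult_left_mono) auto
      finally show "i0 v (U' z - U' t) \<le> L.N v * e" .
    qed (use h in simp)
    finally have "L.N v * L.N v \<le> L.N v * (2 * h * e)" by (simp add: power2_eq_square algebra_simps)
    then have "L.N v \<le> 2 * h * e"
    proof (cases "L.N v = 0")
      case False
      with L.N_nonneg[OF vL] have "0 < L.N v" by simp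
      with \<open>L.N v * L.N v \<le> L.N v * (2 * h * e)\<close> show ?thesis
        by (simp only: mult_le_cancel_left_pos)
    qed (use h e in simp)
    then have "L.N v / (2 * h) \<le> e" using h pos_divide_le_eq[of "2 * h" "L.N v" e] by (simp only: ac_simps)
    moreover have "L.N (v /\<^sub>R (2 * h)) = L.N v / (2 * h)"
      unfolding L.N_scale[OF vL] divide_inverse_commute using h by simp
    moreover have "v /\<^sub>R (2 * h) = W h t /\<^sub>R (2 * h) - U' t"
      unfolding v_def scaleR_diff_right using h by simp
    ultimately show ?thesis by metis
  qed
  then show ?thesis using h0 by blast
qed

text \<open>
  Kinetic energy plus bending energy.
\<close>
definition G :: "real \<Rightarrow> real" where "G t = (i0 (U' t) (U' t) + a (U t) (U t)) / 2"

text \<open>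
  The power of the damping and of the axial force, which is the derivative of \<open>G\<close>.
\<close>
definition power_in :: "real \<Rightarrow> real" where
  "power_in t = - (\<delta> * i0 (U' t) (U' t)) + (S * \<beta> t - P) * i0 (D (U t)) (U' t)"

lemma contU_nhds: "0 < t \<Longrightarrow> ((\<lambda>s. A.N (U s - U t)) \<longlongrightarrow> 0) (nhds t)"
  using contU[of t] by (simp add: at_within_half_line tendsto_nhds_iff)

lemma contU'_nhds: "0 < t \<Longrightarrow> ((\<lambda>s. L.N (U' s - U' t)) \<longlongrightarrow> 0) (nhds t)"
  using contU'[of t] by (simp add: at_within_half_line tendsto_nhds_iff)

lemma contDU_nhds: "0 < t \<Longrightarrow> ((\<lambda>s. L.N (D (U s) - D (U t))) \<longlongrightarrow> 0) (nhds t)"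
  using contDU[of t] by (simp add: at_within_half_line tendsto_nhds_iff)

lemma eventually_pos_tendsto: "(f \<longlongrightarrow> t) F \<Longrightarrow> 0 < t \<Longrightarrow> \<forall>\<^sub>F h in F. 0 \<le> (f h :: real)"
  using order_tendstoD(1)[of f t F 0] by (auto elim: eventually_mono)

lemma eventually_U_in:
  assumes "(f \<longlongrightarrow> t) F" "0 < t"
  shows "\<forall>\<^sub>F h in F. U (f h) \<in> H" "\<forall>\<^sub>F h in F. U' (f h) \<in> L"
  using eventually_pos_tendsto[OF assms] by (auto elim!: eventually_mono)

lemma tendsto_a_U:
  assumes "0 < t" "(f \<longlongrightarrow> t) F" "(g \<longlongrightarrow> t) F"
  shows "((\<lambda>h. a (U (f h)) (U (g h))) \<longlongrightarrow> a (U t) (U t)) F"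
  by (intro A.tendsto_ip filterlim_compose[OF contU_nhds[OF assms(1)]] assms(2,3)
      eventually_U_in[OF assms(2,1)] eventually_U_in[OF assms(3,1)])
    (use assms in auto)

lemma tendsto_i0_U':
  assumes "0 < t" "(f \<longlongrightarrow> t) F" "(g \<longlongrightarrow> t) F"
  shows "((\<lambda>h. i0 (U' (f h)) (U' (g h))) \<longlongrightarrow> i0 (U' t) (U' t)) F"
  by (intro L.tendsto_ip filterlim_compose[OF contU'_nhds[OF assms(1)]] assms(2,3)
      eventually_U_in[OF assms(2,1)] eventually_U_in[OF assms(3,1)])
    (use assms in auto)

lemma isCont_\<beta>: "0 < t \<Longrightarrow> isCont \<beta> t"
  using has_derivative_\<beta>[of t] by (auto simp: at_within_half_line intro: DERIV_isCont)

lemma isCont_power_in: "0 < t \<Longrightarrow> isCont power_in t"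
  unfolding power_in_def continuous_within
  apply (intro tendsto_intros tendsto_i0_U' isCont_\<beta>[unfolded continuous_within])
  subgoal by assumption
  subgoal by assumption
  subgoal
    apply (rule L.tendsto_ip)
    using contDU_nhds[of t] contU'_nhds[of t] eventually_pos_at[of t]
    by (auto simp: tendsto_nhds_iff elim!: eventually_mono)
  done

lemma antiderivative_on_half_line:
  fixes f :: "real \<Rightarrow> real"
  assumes "\<And>t. 0 < t \<Longrightarrow> isCont f t" "0 < p"
  obtains F where "\<And>t. \<lbrakk>p < t; t < q\<rbrakk> \<Longrightarrow> (F has_real_derivative f t) (at t)"
proof -
  have "continuous_on {p..q} f" using assms by (intro continuous_at_imp_continuous_on) auto
  then obtain F where F: "\<And>x. x \<in> {p..q} \<Longrightarrow> (F has_vector_derivative f x) (at x within {p..q})"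
    using antiderivative_continuous by blast
  have "(F has_real_derivative f t) (at t)" if "p < t" "t < q" for t
    using F[of t] that by (simp add: has_real_derivative_iff_has_vector_derivative at_within_Icc_at)
  then show ?thesis using that by blast
qed

text \<open>
  This turns increments of primitives of \<open>a (U t) (U (t + h))\<close> and of \<open>i0 (U'
  t) (U' (t + h))\<close> over a step \<open>h\<close> into the two halves of the energy.
\<close>
lemma increment_tendsto:
  fixes k :: "real \<Rightarrow> real \<Rightarrow> real"
  assumes k: "\<And>f g :: real \<Rightarrow> real. \<lbrakk>(f \<longlongrightarrow> t) (at_right 0); (g \<longlongrightarrow> t) (at_right 0)\<rbrakk> \<Longrightarrow>
      ((\<lambda>h. k (f h) (g h)) \<longlongrightarrow> l) (at_right 0)"
    and h0: "0 < h0"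
    and F: "\<And>h s. \<lbrakk>0 < h; h < h0; t - h \<le> s; s \<le> t\<rbrakk> \<Longrightarrow> (F h has_real_derivative k s (s + h)) (at s)"
  shows "((\<lambda>h. (F h t - F h (t - h)) / (2 * h)) \<longlongrightarrow> l / 2) (at_right 0)"
proof -
  have "\<exists>z. t - h < z \<and> z < t \<and> F h t - F h (t - h) = h * k z (z + h)" if "0 < h" "h < h0" for h
  proof -
    have "t - h < t" using that by simp
    from MVT2[OF this F[OF that]] obtain z where z: "t - h < z" "z < t"
        "F h t - F h (t - h) = (t - (t - h)) * k z (z + h)" by blast
    then show ?thesis by (intro exI[of _ z]) simp
  qed
  then obtain z where z: "\<And>h. \<lbrakk>0 < h; h < h0\<rbrakk> \<Longrightarrow> t - h < z h \<and> z h < t \<and> F h t - F h (t - h) = h * k (z h) (z h + h)"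
    by metis
  have ev: "\<forall>\<^sub>F h in at_right 0. 0 < h \<and> h < h0"
    using h0 by (auto simp: eventually_at_right)
  have zl: "(z \<longlongrightarrow> t) (at_right 0)"
  proof (rule tendsto_sandwich)
    show "((\<lambda>h. t - h) \<longlongrightarrow> t) (at_right 0)" "((\<lambda>h. t) \<longlongrightarrow> t) (at_right 0)"
      by (auto intro!: tendsto_eq_intros)
  qed (use ev z in \<open>auto elim!: eventually_mono intro: less_imp_le\<close>)
  have "((\<lambda>h. z h + h) \<longlongrightarrow> t) (at_right 0)" using tendsto_add[OF zl tendsto_ident_at] by simp
  from k[OF zl this] have "((\<lambda>h. k (z h) (z h + h) / 2) \<longlongrightarrow> l / 2) (at_right 0)" by (intro tendsto_intros) auto
  then show ?thesis
  proof (rule Lim_transform_eventually)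
    show "\<forall>\<^sub>F h in at_right 0. k (z h) (z h + h) / 2 = (F h t - F h (t - h)) / (2 * h)"
      using ev by eventually_elim (simp add: z)
  qed
qed

text \<open>
  Testing at time \<open>t\<close> with \<open>W h t\<close> produces \<open>a (U t) (U (t + h))
  - a (U (t - h)) (U t)\<close> and the same expression for \<open>i0\<close> and
  \<open>U'\<close>. By symmetry each is a difference \<open>k t - k (t - h)\<close> of a single
  continuous function, hence the derivative of an increment of a primitive of \<open>k\<close>.
  The regularised energy \<open>Q h\<close> built from these increments is therefore
  differentiable although \<open>U'\<close> is not; as \<open>h\<close> tends to 0 it tends to
  \<open>G\<close>, and its derivative tends to \<open>power_in\<close> uniformly on compact
  time intervals.
\<close>
lemma energy_balance:
  assumes s: "0 < s" and sr: "s < r"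
  assumes F: "\<And>t. \<lbrakk>s \<le> t; t \<le> r\<rbrakk> \<Longrightarrow> (F has_real_derivative power_in t) (at t)"
  shows "G r - F r = G s - F s"
proof -
  let ?p = "s / 2" let ?q = "r + 1"
  have kc: "isCont (\<lambda>\<tau>. a (U \<tau>) (U (\<tau> + h))) t" and nc: "isCont (\<lambda>\<tau>. i0 (U' \<tau>) (U' (\<tau> + h))) t"
    if "0 < t" "0 < h" for t h
  proof -
    have l: "((\<lambda>\<tau>. \<tau> + h) \<longlongrightarrow> t + h) (at t)" by (intro tendsto_intros)
    have l0: "((\<lambda>\<tau>. \<tau>) \<longlongrightarrow> t) (at t)" by (intro tendsto_intros)
    have th: "0 < t + h" using that by simp
    show "isCont (\<lambda>\<tau>. a (U \<tau>) (U (\<tau> + h))) t" unfolding continuous_within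
      by (intro A.tendsto_ip filterlim_compose[OF contU_nhds[OF th] l] filterlim_compose[OF contU_nhds[OF that(1)] l0])
        (use that eventually_pos_at[of t] in \<open>auto elim!: eventually_mono\<close>)
    show "isCont (\<lambda>\<tau>. i0 (U' \<tau>) (U' (\<tau> + h))) t" unfolding continuous_within
      by (intro L.tendsto_ip filterlim_compose[OF contU'_nhds[OF th] l] filterlim_compose[OF contU'_nhds[OF that(1)] l0])
        (use that eventually_pos_at[of t] in \<open>auto elim!: eventually_mono\<close>)
  qed
  have "\<exists>A. \<forall>t. ?p < t \<and> t < ?q \<longrightarrow> (A has_real_derivative a (U t) (U (t + h))) (at t)" if "0 < h" for h
    by (rule antiderivative_on_half_line[OF kc[OF _ that], where p = ?p and q = ?q]) (use s in auto)
  then obtain KA where KA: "\<And>h t. \<lbrakk>0 < h; ?p < t; t < ?q\<rbrakk> \<Longrightarrow> (KA h has_real_derivative a (U t) (U (t + h))) (at t)"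
    by metis
  have "\<exists>A. \<forall>t. ?p < t \<and> t < ?q \<longrightarrow> (A has_real_derivative i0 (U' t) (U' (t + h))) (at t)" if "0 < h" for h
    by (rule antiderivative_on_half_line[OF nc[OF _ that], where p = ?p and q = ?q]) (use s in auto)
  then obtain KN where KN: "\<And>h t. \<lbrakk>0 < h; ?p < t; t < ?q\<rbrakk> \<Longrightarrow> (KN h has_real_derivative i0 (U' t) (U' (t + h))) (at t)"
    by metis
  (* KA h and KN h are primitives of the functions whose increments telescope *)
  define Q where "Q h t = i0 (U' t) (W h t) / (2 * h) - (KN h t - KN h (t - h)) / (2 * h)
      + (KA h t - KA h (t - h)) / (2 * h)" for h t
  (* the derivative of Q h: the terms with a and with the second time derivative have cancelled *)
  define fh where "fh h t = - (\<delta> * i0 (U' t) (W h t /\<^sub>R (2 * h))) + (S * \<beta> t - P) * i0 (D (U t)) (W h t /\<^sub>R (2 * h))" for h t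
  have dQ: "(Q h has_real_derivative fh h t) (at t)" if h: "0 < h" "h < s / 2" and t: "s \<le> t" "t \<le> r" for h t
  proof -
    have t0: "0 < t" "0 \<le> t" "0 \<le> t - h" "0 \<le> t + h" "?p < t" "t < ?q" "?p < t - h" "t - h < ?q" "h < t" using s h t by auto
    have WH: "W h t \<in> H" using t0 by (simp add: W_def)
    have evW: "\<forall>\<^sub>F s in at t. W h s \<in> L"
    proof -
      have "\<forall>\<^sub>F s in at t. 0 \<le> s + h" "\<forall>\<^sub>F s in at t. 0 \<le> s + (- h)"
        by (rule eventually_shift_pos, use t0 h in simp)+
      then show ?thesis by eventually_elim (simp add: W_def)
    qed
    have d1: "((\<lambda>s. i0 (U' s) (W h s)) has_real_derivative
      - (\<delta> * i0 (U' t) (W h t) + a (U t) (W h t) + (S * \<beta> t - P) * b (U t) (W h t))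
        + i0 (U' t) (U' (t + h) - U' (t - h))) (at t)"
      by (rule product_rule[OF t0(1) evW WH _ derW[OF h(1) t0(9)]]) (use t0 in simp)
    have d2: "((\<lambda>t. KN h (t - h)) has_real_derivative i0 (U' (t - h)) (U' t)) (at t)"
      using DERIV_shift[of "KN h" "i0 (U' (t - h)) (U' t)" t "-h"] KN[OF h(1) t0(7,8)] by simp
    have d3: "((\<lambda>t. KA h (t - h)) has_real_derivative a (U (t - h)) (U t)) (at t)"
      using DERIV_shift[of "KA h" "a (U (t - h)) (U t)" t "-h"] KA[OF h(1) t0(7,8)] by simp
    have "(Q h has_real_derivative
       (- (\<delta> * i0 (U' t) (W h t) + a (U t) (W h t) + (S * \<beta> t - P) * b (U t) (W h t))
        + i0 (U' t) (U' (t + h) - U' (t - h))) / (2 * h) - (i0 (U' t) (U' (t + h)) - i0 (U' (t - h)) (U' t)) / (2 * h)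
        + (a (U t) (U (t + h)) - a (U (t - h)) (U t)) / (2 * h)) (at t)"
      unfolding Q_def
      by (intro DERIV_add DERIV_diff DERIV_cdivide d1 d2 d3 KN KA h t0)
    moreover have "(- (\<delta> * i0 (U' t) (W h t) + a (U t) (W h t) + (S * \<beta> t - P) * b (U t) (W h t))
        + i0 (U' t) (U' (t + h) - U' (t - h))) / (2 * h) - (i0 (U' t) (U' (t + h)) - i0 (U' (t - h)) (U' t)) / (2 * h)
        + (a (U t) (U (t + h)) - a (U (t - h)) (U t)) / (2 * h) = fh h t"
    proof -
      have e1: "a (U t) (U (t + h)) - a (U (t - h)) (U t) = a (U t) (W h t)"
        using t0 by (simp add: W_def A.bilin A.sym[of "U t" "U (t - h)"])
      have e2: "i0 (U' t) (U' (t + h)) - i0 (U' (t - h)) (U' t) = i0 (U' t) (U' (t + h) - U' (t - h))"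
        using t0 by (simp add: L.bilin L.sym[of "U' t" "U' (t - h)"])
      have e3: "b (U t) (W h t) = - i0 (D (U t)) (W h t)" using ibp WH t0 by simp
      have e4: "i0 (U' t) (W h t /\<^sub>R (2 * h)) = i0 (U' t) (W h t) / (2 * h)"
        "i0 (D (U t)) (W h t /\<^sub>R (2 * h)) = i0 (D (U t)) (W h t) / (2 * h)"
        unfolding divide_inverse_commute by (rule L.scale_right; use WH t0 in simp)+
      show ?thesis unfolding fh_def e1 e2 e3 e4
        by (simp add: add_divide_distrib[symmetric] diff_divide_distrib[symmetric])
    qed
    ultimately show ?thesis by simp
  qed
  have conv: "((\<lambda>h. Q h t) \<longlongrightarrow> G t) (at_right 0)" if t: "s \<le> t" "t \<le> r" for t
  proof -
    have t0: "0 < t" using s t by simp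
    have 0: "((\<lambda>h. L.N (W h t /\<^sub>R (2 * h) - U' t)) \<longlongrightarrow> 0) (at_right 0)"
    proof (rule tendstoI)
      fix e :: real assume "0 < e"
      then obtain h0 where h0: "h0 > 0" "h0 < t" "\<And>h. \<lbrakk>0 < h; h < h0\<rbrakk> \<Longrightarrow> L.N (W h t /\<^sub>R (2 * h) - U' t) \<le> e / 2"
        using uniform_difference_quotient[OF t0, of "e / 2" t] by auto
      have "dist (L.N (W h t /\<^sub>R (2 * h) - U' t)) 0 < e" if "0 < h" "h < h0" for h
      proof -
        have "0 \<le> L.N (W h t /\<^sub>R (2 * h) - U' t)"
          using that h0 by (intro L.N_nonneg) (auto simp: W_def)
        with h0(3)[OF that] \<open>0 < e\<close> show ?thesis by (simp add: dist_real_def)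
      qed
      then show "\<forall>\<^sub>F h in at_right 0. dist (L.N (W h t /\<^sub>R (2 * h) - U' t)) 0 < e"
        unfolding eventually_at_right[OF zero_less_one] using h0(1) by blast
    qed
    have evW: "\<forall>\<^sub>F h in at_right 0. W h t \<in> L"
      unfolding eventually_at_right[OF zero_less_one] using t0
      by (intro exI[of _ t]) (auto simp: W_def)
    have 1: "((\<lambda>h. i0 (U' t) (W h t /\<^sub>R (2 * h))) \<longlongrightarrow> i0 (U' t) (U' t)) (at_right 0)"
    proof (rule L.tendsto_ip[OF _ _ _ 0])
      show "\<forall>\<^sub>F h in at_right 0. W h t /\<^sub>R (2 * h) \<in> L" using evW by eventually_elim (rule L.mem)
    qed (use t0 in auto)
    have 2: "((\<lambda>h. i0 (U' t) (W h t) / (2 * h)) \<longlongrightarrow> i0 (U' t) (U' t)) (at_right 0)"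
    proof (rule Lim_transform_eventually[OF 1])
      show "\<forall>\<^sub>F h in at_right 0. i0 (U' t) (W h t /\<^sub>R (2 * h)) = i0 (U' t) (W h t) / (2 * h)"
        using evW unfolding divide_inverse_commute by eventually_elim (rule L.scale_right, use t0 in auto)
    qed
    have h0: "0 < s / 2" using s by simp
    have 3: "((\<lambda>h. (KN h t - KN h (t - h)) / (2 * h)) \<longlongrightarrow> i0 (U' t) (U' t) / 2) (at_right 0)"
    proof (rule increment_tendsto[where k = "\<lambda>x y. i0 (U' x) (U' y)", OF _ h0])
      fix h x :: real assume "0 < h" "h < s / 2" "t - h \<le> x" "x \<le> t"
      then show "(KN h has_real_derivative i0 (U' x) (U' (x + h))) (at x)" using t by (intro KN) auto
    qed (rule tendsto_i0_U'[OF t0])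
    have 4: "((\<lambda>h. (KA h t - KA h (t - h)) / (2 * h)) \<longlongrightarrow> a (U t) (U t) / 2) (at_right 0)"
    proof (rule increment_tendsto[where k = "\<lambda>x y. a (U x) (U y)", OF _ h0])
      fix h x :: real assume "0 < h" "h < s / 2" "t - h \<le> x" "x \<le> t"
      then show "(KA h has_real_derivative a (U x) (U (x + h))) (at x)" using t by (intro KA) auto
    qed (rule tendsto_a_U[OF t0])
    show ?thesis unfolding Q_def
      by (rule tendsto_eq_rhs[OF tendsto_add[OF tendsto_diff[OF 2 3] 4]]) (simp add: G_def field_simps)
  qed
  have bound: "\<exists>C>0. \<forall>t. s \<le> t \<and> t \<le> r \<longrightarrow> \<delta> * L.N (U' t) + \<bar>S * \<beta> t - P\<bar> * L.N (D (U t)) \<le> C"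
  proof -
    have "isCont (\<lambda>t. \<delta> * L.N (U' t) + \<bar>S * \<beta> t - P\<bar> * L.N (D (U t))) t" if "0 < t" for t
    proof -
      have "isCont (\<lambda>t. L.N (U' t)) t" "isCont (\<lambda>t. L.N (D (U t))) t"
        unfolding continuous_within
        using contU'_nhds[OF that] contDU_nhds[OF that] that
          eventually_U_in[OF tendsto_ident_at that, of UNIV]
        by (auto intro!: L.tendsto_N simp: tendsto_nhds_iff elim: eventually_mono)
      then show ?thesis by (intro continuous_intros isCont_\<beta> that)
    qed
    then have "continuous_on {s..r} (\<lambda>t. \<delta> * L.N (U' t) + \<bar>S * \<beta> t - P\<bar> * L.N (D (U t)))"
      using s by (intro continuous_at_imp_continuous_on) auto
    from compact_imp_bounded[OF compact_continuous_image[OF this compact_Icc]]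
    obtain C where "C > 0" "\<forall>x\<in>(\<lambda>t. \<delta> * L.N (U' t) + \<bar>S * \<beta> t - P\<bar> * L.N (D (U t))) ` {s..r}. norm x \<le> C"
      unfolding bounded_pos by auto
    then have "\<forall>t. s \<le> t \<and> t \<le> r \<longrightarrow> \<delta> * L.N (U' t) + \<bar>S * \<beta> t - P\<bar> * L.N (D (U t)) \<le> C"
      by (auto simp: abs_le_iff)
    with \<open>C > 0\<close> show ?thesis by blast
  qed
  then obtain C where C: "C > 0" "\<And>t. \<lbrakk>s \<le> t; t \<le> r\<rbrakk> \<Longrightarrow> \<delta> * L.N (U' t) + \<bar>S * \<beta> t - P\<bar> * L.N (D (U t)) \<le> C" by blast
  have small: "\<forall>\<^sub>F h in at_right 0. \<bar>(Q h r - F r) - (Q h s - F s)\<bar> \<le> e" if e: "0 < e" for e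
  proof -
    let ?e = "e / (C * (r - s))"
    have e': "0 < ?e" using e C sr by simp
    obtain h0 where h0: "h0 > 0" "h0 < s" and h0': "\<And>h t. \<lbrakk>0 < h; h < h0; s \<le> t; t \<le> r\<rbrakk> \<Longrightarrow>
        L.N (W h t /\<^sub>R (2 * h) - U' t) \<le> ?e"
      using uniform_difference_quotient[OF s e', of r] by auto
    have main: "\<bar>(Q h r - F r) - (Q h s - F s)\<bar> \<le> e" if h: "0 < h" "h < h0" "h < s / 2" for h
    proof -
      have der: "((\<lambda>t. Q h t - F t) has_real_derivative fh h t - power_in t) (at t)" if "s \<le> t" "t \<le> r" for t
        by (intro DERIV_diff dQ F h that)
      obtain z where z: "s < z" "z < r" "(Q h r - F r) - (Q h s - F s) = (r - s) * (fh h z - power_in z)"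
        using MVT2[OF sr der] by blast
      have zp: "0 < z" "0 \<le> z" "h < z" using z s h by auto
      let ?d = "W h z /\<^sub>R (2 * h) - U' z"
      have m: "W h z \<in> L" "?d \<in> L" using zp h by (auto simp: W_def)
      have "fh h z - power_in z = - (\<delta> * i0 (U' z) ?d) + (S * \<beta> z - P) * i0 (D (U z)) ?d"
      proof -
        have "i0 v ?d = i0 v (W h z /\<^sub>R (2 * h)) - i0 v (U' z)" if "v \<in> L" for v
          by (rule L.diff_right) (use m zp that in auto)
        then have *: "i0 (U' z) ?d = i0 (U' z) (W h z /\<^sub>R (2 * h)) - i0 (U' z) (U' z)"
          "i0 (D (U z)) ?d = i0 (D (U z)) (W h z /\<^sub>R (2 * h)) - i0 (D (U z)) (U' z)"
          using zp by auto
        show ?thesis unfolding fh_def power_in_def * by (simp only: right_diff_distrib)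
      qed
      also have "\<bar>\<dots>\<bar> \<le> \<delta> * (L.N (U' z) * L.N ?d) + \<bar>S * \<beta> z - P\<bar> * (L.N (D (U z)) * L.N ?d)"
        apply (rule order_trans[OF abs_triangle_ineq])
        unfolding abs_minus_cancel abs_mult
        using L.cauchy_schwarz[of "U' z" ?d] L.cauchy_schwarz[of "D (U z)" ?d] m zp params(1)
        by (intro add_mono mult_left_mono) auto
      also have "\<dots> = (\<delta> * L.N (U' z) + \<bar>S * \<beta> z - P\<bar> * L.N (D (U z))) * L.N ?d"
        by (simp add: algebra_simps)
      also have "\<dots> \<le> C * ?e"
        using C(1) C(2)[of z] h0'[of h z] h z m L.N_nonneg[OF m(2)] by (intro mult_mono) auto
      finally have "\<bar>fh h z - power_in z\<bar> \<le> C * ?e" .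
      then have "(r - s) * \<bar>fh h z - power_in z\<bar> \<le> (r - s) * (C * ?e)" using sr by (intro mult_left_mono) auto
      also have "\<dots> = e" using sr C by simp
      finally show ?thesis using z(3) sr by (simp add: abs_mult)
    qed
    show ?thesis unfolding eventually_at_right[OF zero_less_one]
      by (intro exI[of _ "min h0 (s / 2)"]) (use h0 s in \<open>auto intro!: main\<close>)
  qed
  have lim: "((\<lambda>h. \<bar>(Q h r - F r) - (Q h s - F s)\<bar>) \<longlongrightarrow> \<bar>(G r - F r) - (G s - F s)\<bar>) (at_right 0)"
    using sr by (intro tendsto_intros conv) auto
  have "\<bar>(G r - F r) - (G s - F s)\<bar> \<le> e" if "0 < e" for e
    by (rule tendsto_upperbound[OF lim small[OF that]]) simp
  then have "\<bar>(G r - F r) - (G s - F s)\<bar> \<le> 0" by (meson dense_ge)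
  then show ?thesis by simp
qed

lemma has_derivative_G:
  assumes t: "0 < t"
  shows "(G has_real_derivative power_in t) (at t)"
proof -
  obtain F where F: "\<And>s. \<lbrakk>t / 3 < s; s < t + 2\<rbrakk> \<Longrightarrow> (F has_real_derivative power_in s) (at s)"
    using antiderivative_on_half_line[OF isCont_power_in, of "t / 3" "t + 2"] t by auto
  have eq: "G s = F s + (G (t / 2) - F (t / 2))" if "t / 2 < s" "s < t + 1" for s
  proof -
    have "G s - F s = G (t / 2) - F (t / 2)"
      by (rule energy_balance) (use that t in \<open>auto intro!: F\<close>)
    then show ?thesis by simp
  qed
  have "((\<lambda>s. F s + (G (t / 2) - F (t / 2))) has_real_derivative power_in t) (at t)"
    using F[of t] t by (auto intro!: derivative_eq_intros)
  then show ?thesis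
    by (rule has_field_derivative_transform_within_open[where S = "{t / 2<..<t + 1}"]) (use t eq in auto)
qed

end

section \<open>Convergence to the bottom of a potential well\<close>

text \<open>
  The product of \<open>f t\<close> and \<open>exp (\<gamma> * t)\<close> is nonincreasing.
\<close>
lemma exponential_decay:
  fixes f f' :: "real \<Rightarrow> real"
  assumes \<gamma>: "0 < \<gamma>" and f: "\<And>t. 1 \<le> t \<Longrightarrow> 0 \<le> f t"
    and d: "\<And>t. 1 \<le> t \<Longrightarrow> (f has_real_derivative f' t) (at t)"
    and le: "\<And>t. 1 \<le> t \<Longrightarrow> f' t \<le> - \<gamma> * f t"
  shows "(f \<longlongrightarrow> 0) at_top"
proof (rule tendsto_sandwich[where f = "\<lambda>_. 0" and h = "\<lambda>t. (f 1 * exp \<gamma>) * exp (- (\<gamma> * t))"])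
  have b: "f t * exp (\<gamma> * t) \<le> f 1 * exp \<gamma>" if "1 \<le> t" for t
  proof -
    have "(\<lambda>t. f t * exp (\<gamma> * t)) t \<le> (\<lambda>t. f t * exp (\<gamma> * t)) 1"
    proof (rule DERIV_nonpos_imp_nonincreasing[OF that])
      fix x assume x: "1 \<le> x" "x \<le> t"
      have "((\<lambda>t. f t * exp (\<gamma> * t)) has_real_derivative (f' x + \<gamma> * f x) * exp (\<gamma> * x)) (at x)"
        by (auto intro!: derivative_eq_intros d x simp: algebra_simps)
      moreover have "(f' x + \<gamma> * f x) * exp (\<gamma> * x) \<le> 0"
        using le[OF x(1)] by (intro mult_nonpos_nonneg) auto
      ultimately show "\<exists>y. ((\<lambda>t. f t * exp (\<gamma> * t)) has_real_derivative y) (at x) \<and> y \<le> 0" by blast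
    qed
    then show ?thesis by simp
  qed
  show "\<forall>\<^sub>F t in at_top. f t \<le> (f 1 * exp \<gamma>) * exp (- (\<gamma> * t))"
    using eventually_ge_at_top[of 1]
  proof eventually_elim
    case (elim t)
    have "f t * exp (\<gamma> * t) * exp (- (\<gamma> * t)) \<le> (f 1 * exp \<gamma>) * exp (- (\<gamma> * t))"
      using b[OF elim] by (intro mult_right_mono) auto
    then show ?case by (simp add: mult.assoc exp_minus_inverse)
  qed
  have "((\<lambda>t. exp (- (\<gamma> * t))) \<longlongrightarrow> 0) at_top"
    using \<gamma> by (intro filterlim_compose[OF exp_at_bot])
      (simp add: filterlim_uminus_at_top[symmetric] filterlim_tendsto_pos_mult_at_top[OF tendsto_const _ filterlim_ident])
  from tendsto_mult_right_zero[OF this] show "((\<lambda>t. (f 1 * exp \<gamma>) * exp (- (\<gamma> * t))) \<longlongrightarrow> 0) at_top" .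
  show "\<forall>\<^sub>F t in at_top. 0 \<le> f t" using eventually_ge_at_top[of 1] by eventually_elim (rule f)
qed simp

context damped_evolution begin

text \<open>
  The mechanical energy \<open>En\<close> is at least \<open>- S * lam2\<^sup>2 / 4\<close>, its
  value at the two equilibria \<open>\<plusminus> sqrt lam2 *\<^sub>R w\<close>, and
  \<open>e\<close> is the excess over this minimum. The excess splits into contributions of
  \<open>p\<close> (velocity), of \<open>q\<close> (deviation of the axial force from the value
  that balances the first mode) and of \<open>m\<close> (bending energy in excess of the first
  Rayleigh quotient); \<open>R\<close> collects the last two.
\<close>
definition En :: "real \<Rightarrow> real" where "En t = G t - P / 2 * \<beta> t + S / 4 * (\<beta> t)\<^sup>2"
definition lam2 :: real where "lam2 = (P - \<Lambda>\<^sub>1) / S"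
definition m :: "real \<Rightarrow> real" where "m t = a (U t) (U t) - \<Lambda>\<^sub>1 * \<beta> t"
definition q :: "real \<Rightarrow> real" where "q t = S * (\<beta> t - lam2)"
definition p :: "real \<Rightarrow> real" where "p t = i0 (U' t) (U' t)"
definition R :: "real \<Rightarrow> real" where "R t = m t + (q t)\<^sup>2 / S"
definition e :: "real \<Rightarrow> real" where "e t = En t + S * lam2\<^sup>2 / 4"

lemma lam2_pos: "0 < lam2" using params by (simp add: lam2_def)

lemma S_lam2: "S * lam2 = P - \<Lambda>\<^sub>1" using params by (simp add: lam2_def)

lemma q_sq: "(q t)\<^sup>2 / S = S * (\<beta> t)\<^sup>2 - 2 * (P - \<Lambda>\<^sub>1) * \<beta> t + (P - \<Lambda>\<^sub>1) * lam2"
proof -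
  have "(q t)\<^sup>2 / S = S * (\<beta> t - lam2)\<^sup>2"
    using params(2) by (simp add: q_def power_mult_distrib power2_eq_square)
  also have "\<dots> = S * (\<beta> t)\<^sup>2 - 2 * (S * lam2) * \<beta> t + (S * lam2) * lam2"
    by (simp add: power2_eq_square algebra_simps)
  finally show ?thesis by (simp only: S_lam2)
qed

lemma has_derivative_En:
  assumes t: "0 < t"
  shows "(En has_real_derivative - \<delta> * p t) (at t)"
proof -
  have "(En has_real_derivative power_in t - P / 2 * (- 2 * i0 (D (U t)) (U' t))
      + S / 4 * (2 * \<beta> t * (- 2 * i0 (D (U t)) (U' t)))) (at t)"
    unfolding En_def using t
    by (auto intro!: derivative_eq_intros has_derivative_G
        has_derivative_\<beta>[of t, unfolded at_within_half_line[OF t]])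
  then show ?thesis
    by (rule DERIV_cong) (simp add: power_in_def p_def algebra_simps)
qed

lemma p_nonneg: "0 \<le> t \<Longrightarrow> 0 \<le> p t" by (simp add: p_def L.nonneg)

text \<open>
  The energy identity is available at positive times only; the initial time is reached by
  continuity from the right.
\<close>
lemma En_le:
  assumes "0 \<le> t" shows "En t \<le> En 0"
proof (cases "t = 0")
  case False
  with assms have t: "0 < t" by simp
  have mono: "En t \<le> En s" if "0 < s" "s \<le> t" for s
  proof (rule DERIV_nonpos_imp_nonincreasing[OF that(2)])
    fix x assume "s \<le> x" "x \<le> t"
    then show "\<exists>y. (En has_real_derivative y) (at x) \<and> y \<le> 0"
      using has_derivative_En[of x] that p_nonneg[of x] params(1) by auto
  qed
  have ev: "\<forall>\<^sub>F s in at_right 0. 0 < s \<and> s \<le> (t::real)"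
    unfolding eventually_at_right[OF zero_less_one] using t by (intro exI[of _ t]) auto
  have le: "at_right 0 \<le> at (0::real) within {0..}"
    by (rule at_le) auto
  have "(En \<longlongrightarrow> En 0) (at 0 within {0..})"
  proof -
    have 1: "(\<beta> \<longlongrightarrow> \<beta> 0) (at 0 within {0..})"
      using DERIV_continuous[OF has_derivative_\<beta>[of 0]] by (simp add: continuous_within)
    have 2: "((\<lambda>t. i0 (U' t) (U' t)) \<longlongrightarrow> i0 (U' 0) (U' 0)) (at 0 within {0..})"
      by (intro L.tendsto_ip contU') (auto intro: eventually_mono[OF eventually_nonneg_within])
    have 3: "((\<lambda>t. a (U t) (U t)) \<longlongrightarrow> a (U 0) (U 0)) (at 0 within {0..})"
      by (intro A.tendsto_ip contU) (auto intro: eventually_mono[OF eventually_nonneg_within])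
    show ?thesis unfolding En_def G_def by (intro tendsto_intros 1 2 3) auto
  qed
  then have lim: "(En \<longlongrightarrow> En 0) (at_right 0)" by (rule tendsto_mono[OF le])
  show ?thesis
    by (rule tendsto_lowerbound[OF lim]) (use ev mono in \<open>auto elim!: eventually_mono\<close>)
qed simp

text \<open>
  Completing the square in \<open>\<beta> t\<close>, with \<open>S * lam2\<close> equal to
  \<open>P - \<Lambda>\<^sub>1\<close>.
\<close>
lemma e_eq: "0 \<le> t \<Longrightarrow> e t = p t / 2 + (q t)\<^sup>2 / (4 * S) + m t / 2"
proof -
  have "S * lam2\<^sup>2 = (P - \<Lambda>\<^sub>1) * lam2" by (simp add: S_lam2[symmetric] power2_eq_square)
  moreover have "(q t)\<^sup>2 / (4 * S) = ((q t)\<^sup>2 / S) / 4" by simp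
  ultimately show ?thesis
    unfolding e_def En_def G_def p_def m_def q_sq
    by (simp add: algebra_simps add_divide_distrib diff_divide_distrib)
qed

lemma \<beta>_c: "0 \<le> t \<Longrightarrow> 0 \<le> \<beta> t - (c t)\<^sup>2" "0 \<le> t \<Longrightarrow> (\<Lambda>\<^sub>2 - \<Lambda>\<^sub>1) * (\<beta> t - (c t)\<^sup>2) \<le> m t"
  using b_w_le[of "U t"] gap[of "U t"] by (auto simp: \<beta>_def c_def m_def)

lemma m_nonneg: "0 \<le> t \<Longrightarrow> 0 \<le> m t"
  using \<beta>_c[of t] gap_pos mult_nonneg_nonneg[of "\<Lambda>\<^sub>2 - \<Lambda>\<^sub>1" "\<beta> t - (c t)\<^sup>2"] by linarith

text \<open>
  By the gap the part of \<open>\<beta> t\<close> that does not come from the first mode adds at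
  least \<open>(\<Lambda>\<^sub>2 - P) / 2\<close> times itself to the energy, and this is
  nonnegative because \<open>P \<le> \<Lambda>\<^sub>2\<close>. Hence the energy is at least
  \<open>(\<Lambda>\<^sub>1 - P) * (c t)\<^sup>2 / 2\<close>, and it never exceeds its initial
  value.
\<close>
lemma c_lower:
  assumes t: "0 \<le> t"
  shows "- 2 * En 0 / (P - \<Lambda>\<^sub>1) \<le> (c t)\<^sup>2"
proof -
  have "(\<Lambda>\<^sub>1 - P) * (c t)\<^sup>2 / 2 \<le> En t"
  proof -
    have "0 \<le> p t / 2 + S / 4 * (\<beta> t)\<^sup>2 + (m t - (\<Lambda>\<^sub>2 - \<Lambda>\<^sub>1) * (\<beta> t - (c t)\<^sup>2)) / 2
        + (\<Lambda>\<^sub>2 - P) * (\<beta> t - (c t)\<^sup>2) / 2"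
      using p_nonneg[OF t] \<beta>_c[OF t] params by (intro add_nonneg_nonneg) auto
    also have "\<dots> = En t - (\<Lambda>\<^sub>1 - P) * (c t)\<^sup>2 / 2"
      unfolding En_def G_def p_def m_def by (simp add: field_simps)
    finally show ?thesis by simp
  qed
  with En_le[OF t] have "- 2 * En 0 \<le> (P - \<Lambda>\<^sub>1) * (c t)\<^sup>2" by (simp add: algebra_simps)
  then show ?thesis using params by (simp add: field_simps)
qed

end

locale damped_evolution_well = damped_evolution +
  assumes energy_neg: "En 0 < 0"
begin

definition c0 :: real where "c0 = - 2 * En 0 / (P - \<Lambda>\<^sub>1)"

lemma c0_pos: "0 < c0" unfolding c0_def using energy_neg params by (intro divide_pos_pos) auto

lemma c_sq_ge: "0 \<le> t \<Longrightarrow> c0 \<le> (c t)\<^sup>2" using c_lower by (simp add: c0_def)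

lemma c_nonzero: "0 \<le> t \<Longrightarrow> c t \<noteq> 0" using c_sq_ge[of t] c0_pos by auto

text \<open>
  The coefficient of the first mode is continuous in time and bounded away from 0, so the
  solution stays in the well in which it starts.
\<close>
lemma sgn_c: assumes t: "0 \<le> t" shows "sgn (c t) = sgn (c 0)"
proof (rule ccontr)
  assume ne: "sgn (c t) \<noteq> sgn (c 0)"
  have cont: "continuous_on {0..t} c"
  proof (rule DERIV_continuous_on)
    fix x assume "x \<in> {0..t}"
    then show "(c has_real_derivative - i0 (D w) (U' x)) (at x within {0..t})"
      by (intro DERIV_subset[OF has_derivative_c]) auto
  qed
  have "c 0 < 0 \<and> 0 < c t \<or> c t < 0 \<and> 0 < c 0"
    using ne c_nonzero[of 0] c_nonzero[OF t] by (auto simp: sgn_real_def split: if_splits)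
  then have "\<exists>x\<ge>0. x \<le> t \<and> c x = 0"
    using IVT'[of c 0 0 t] IVT2'[of c t 0 0] cont t by fastforce
  then show False using c_nonzero by auto
qed

lemma \<beta>_le: assumes t: "0 \<le> t" shows "\<beta> t \<le> 2 * lam2"
proof -
  have "(q t)\<^sup>2 / (4 * S) \<le> e t"
    using e_eq[OF t] p_nonneg[OF t] m_nonneg[OF t] by simp
  also have "\<dots> \<le> S * lam2\<^sup>2 / 4" using En_le[OF t] energy_neg by (simp add: e_def)
  finally have "(\<beta> t - lam2)\<^sup>2 \<le> lam2\<^sup>2"
    using params(2) by (simp add: q_def field_simps power2_eq_square)
  then have "\<beta> t - lam2 \<le> lam2" using lam2_pos by (simp add: power2_le_iff_abs_le)
  then show ?thesis by simp
qed

text \<open>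
  The multiplier. The factor \<open>lam2 / c t\<close> is the one for which the stationary part
  of the equation, tested with \<open>V t\<close>, equals \<open>R t\<close> exactly; the
  obvious choice \<open>U t - sgn (c t) * sqrt lam2 *\<^sub>R w\<close> leaves a remainder
  without a sign.
\<close>
definition V :: "real \<Rightarrow> 'a" where "V t = U t - (lam2 / c t) *\<^sub>R w"

lemma V_in: "0 \<le> t \<Longrightarrow> V t \<in> H" by (simp add: V_def)

text \<open>
  The constant that \<open>V_bound\<close> produces.
\<close>
definition C2 :: real where
  "C2 = K * (1 / (\<Lambda>\<^sub>2 - \<Lambda>\<^sub>1) + (2 / S + 4 * lam2 / (\<Lambda>\<^sub>2 - \<Lambda>\<^sub>1)) / c0)"

lemma C2_pos: "0 < C2"
  unfolding C2_def using params gap_pos c0_pos lam2_pos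
  by (intro mult_pos_pos add_pos_pos divide_pos_pos) auto

text \<open>
  \<open>b (V t) (V t)\<close> is the sum of \<open>\<beta> t - (c t)\<^sup>2\<close>, which the
  gap bounds by \<open>m t\<close>, and of \<open>((c t)\<^sup>2 - lam2)\<^sup>2 / (c
  t)\<^sup>2\<close>. In the second term the denominator is bounded below, and \<open>(c
  t)\<^sup>2 - lam2\<close> differs from \<open>q t / S\<close> by the first term.
\<close>
lemma V_bound: assumes t: "0 \<le> t" shows "i0 (V t) (V t) \<le> C2 * R t"
proof -
  let ?g = "\<Lambda>\<^sub>2 - \<Lambda>\<^sub>1" let ?d = "\<beta> t - (c t)\<^sup>2"
  note m0 = m_nonneg[OF t] and cn = c_nonzero[OF t]
  have g: "0 < ?g" using gap_pos by simp
  have d: "0 \<le> ?d" "?d \<le> m t / ?g" using \<beta>_c[OF t] g by (auto simp: field_simps)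
  have "b (V t) (V t) = \<beta> t - 2 * (lam2 / c t) * c t + (lam2 / c t)\<^sup>2"
    using t unfolding V_def by (simp add: B.bilin w_unit \<beta>_def c_def B.sym[of w "U t"] power2_eq_square algebra_simps)
  also have "\<dots> = ?d + ((c t)\<^sup>2 - lam2)\<^sup>2 / (c t)\<^sup>2"
    using cn by (simp add: field_simps power2_eq_square)
  also have "((c t)\<^sup>2 - lam2)\<^sup>2 / (c t)\<^sup>2 \<le> ((c t)\<^sup>2 - lam2)\<^sup>2 / c0"
    using c_sq_ge[OF t] c0_pos cn by (intro divide_left_mono mult_pos_pos) auto
  also have "((c t)\<^sup>2 - lam2)\<^sup>2 \<le> 2 * (q t)\<^sup>2 / S\<^sup>2 + 4 * lam2 * m t / ?g"
  proof -
    have "((c t)\<^sup>2 - lam2)\<^sup>2 = (q t / S - ?d)\<^sup>2" using params(2) by (simp add: q_def)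
    also have "\<dots> \<le> 2 * (q t / S)\<^sup>2 + 2 * ?d\<^sup>2"
      using zero_le_power2[of "q t / S + ?d"] by (simp add: power2_eq_square algebra_simps)
    also have "?d\<^sup>2 \<le> (2 * lam2) * (m t / ?g)"
      unfolding power2_eq_square[of ?d] using d \<beta>_le[OF t] lam2_pos zero_le_power2[of "c t"]
      by (intro mult_mono) linarith+
    finally show ?thesis by (simp add: power_divide)
  qed
  finally have "b (V t) (V t) \<le> m t / ?g + (2 * (q t)\<^sup>2 / S\<^sup>2 + 4 * lam2 * m t / ?g) / c0"
    using d c0_pos by (simp add: divide_right_mono)
  also have "\<dots> = (1 / ?g) * m t + (2 / S / c0) * ((q t)\<^sup>2 / S) + (4 * lam2 / ?g / c0) * m t"
    by (simp add: add_divide_distrib power2_eq_square)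
  also have "\<dots> \<le> (1 / ?g) * R t + (2 / S / c0) * R t + (4 * lam2 / ?g / c0) * R t"
    using m0 params(2) c0_pos lam2_pos g
    by (intro add_mono mult_left_mono) (auto simp: R_def)
  also have "\<dots> = (1 / ?g + (2 / S + 4 * lam2 / ?g) / c0) * R t"
    by (simp add: add_divide_distrib algebra_simps)
  finally have "K * b (V t) (V t) \<le> K * ((1 / ?g + (2 / S + 4 * lam2 / ?g) / c0) * R t)"
    using params by (intro mult_left_mono) auto
  with i0_le_b[OF V_in[OF t]] show ?thesis by (simp add: C2_def mult.assoc)
qed

lemma R_nonneg: "0 \<le> t \<Longrightarrow> 0 \<le> R t" using m_nonneg params(2) by (simp add: R_def)

lemma cross_bound:
  assumes t: "0 \<le> t" and k: "0 \<le> k"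
  shows "k * \<bar>i0 (U' t) (V t)\<bar> \<le> (k\<^sup>2 * C2 * p t + R t) / 2"
proof -
  let ?x = "i0 (U' t) (V t)"
  have "?x\<^sup>2 \<le> p t * i0 (V t) (V t)"
    using L.cauchy_schwarz_sq[of "U' t" "V t"] t V_in by (simp add: p_def)
  also have "\<dots> \<le> p t * (C2 * R t)" using V_bound[OF t] p_nonneg[OF t] by (rule mult_left_mono)
  finally have x: "?x\<^sup>2 \<le> (C2 * p t) * R t" by (simp add: algebra_simps)
  have "(k * \<bar>?x\<bar>)\<^sup>2 \<le> ((k\<^sup>2 * C2 * p t + R t) / 2)\<^sup>2"
  proof -
    have "(k * \<bar>?x\<bar>)\<^sup>2 = k\<^sup>2 * ?x\<^sup>2" by (simp add: power_mult_distrib)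
    also have "\<dots> \<le> k\<^sup>2 * ((C2 * p t) * R t)" using x by (intro mult_left_mono) auto
    also have "\<dots> \<le> ((k\<^sup>2 * C2 * p t + R t) / 2)\<^sup>2"
      using zero_le_power2[of "k\<^sup>2 * C2 * p t - R t"] by (simp add: power2_eq_square field_simps)
    finally show ?thesis .
  qed
  then show ?thesis
    by (rule power2_le_imp_le) (use p_nonneg[OF t] R_nonneg[OF t] C2_pos in simp)
qed

text \<open>
  The product \<open>i0 (U' t) (V t)\<close>, expanded so that each summand has a known
  derivative.
\<close>
definition Y :: "real \<Rightarrow> real" where "Y t = i0 (U' t) (U t) - lam2 / c t * i0 (U' t) w"

lemma Y_eq: "0 \<le> t \<Longrightarrow> Y t = i0 (U' t) (V t)"
  by (simp add: Y_def V_def L.bilin)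

text \<open>
  The identity \<open>S * lam2 = P - \<Lambda>\<^sub>1\<close> is what makes the stationary
  terms collapse to \<open>R t\<close>.
\<close>
lemma has_derivative_Y:
  assumes t: "0 < t"
  shows "(Y has_real_derivative p t - lam2 / (c t)\<^sup>2 * i0 (D w) (U' t) * i0 (U' t) w
     - \<delta> * i0 (U' t) (V t) - R t) (at t)"
proof -
  have t0: "0 \<le> t" using t by simp
  have d1: "((\<lambda>s. i0 (U' s) (U s)) has_real_derivative
      - (\<delta> * i0 (U' t) (U t) + a (U t) (U t) + (S * \<beta> t - P) * b (U t) (U t)) + i0 (U' t) (U' t)) (at t)"
  proof (rule product_rule[OF t _ _ _ derU[OF t0, unfolded at_within_half_line[OF t]]])
    show "\<forall>\<^sub>F s in at t. U s \<in> L" using eventually_pos_at[OF t] by eventually_elim simp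
  qed (use t0 in auto)
  have d2: "((\<lambda>s. i0 (U' s) w) has_real_derivative
      - (\<delta> * i0 (U' t) w + a (U t) w + (S * \<beta> t - P) * b (U t) w)) (at t)"
    using weak[OF t0 w_in] by (simp add: at_within_half_line[OF t] \<beta>_def)
  have aw: "a (U t) w = \<Lambda>\<^sub>1 * c t" using w_eigen[of "U t"] t0 by (simp add: A.sym[of "U t"] B.sym[of w] c_def)
  have Vt: "i0 (U' t) (V t) = i0 (U' t) (U t) - lam2 / c t * i0 (U' t) w" using t0 by (simp add: V_def L.bilin)
  have d3: "((\<lambda>s. lam2 / c s) has_real_derivative lam2 / (c t)\<^sup>2 * i0 (D w) (U' t)) (at t)"
    using c_nonzero[OF t0]
    by (auto intro!: derivative_eq_intros has_derivative_c[OF t0, unfolded at_within_half_line[OF t]]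
        simp: power2_eq_square)
  have "lam2 / c t * ((S * \<beta> t - P) * c t + \<Lambda>\<^sub>1 * c t) = (S * lam2) * \<beta> t - (P - \<Lambda>\<^sub>1) * lam2"
    using c_nonzero[OF t0] by (simp add: field_simps)
  then have r: "lam2 / c t * ((S * \<beta> t - P) * c t + \<Lambda>\<^sub>1 * c t) = (P - \<Lambda>\<^sub>1) * \<beta> t - (P - \<Lambda>\<^sub>1) * lam2"
    by (simp only: S_lam2)
  show ?thesis
    unfolding Y_def
    apply (rule DERIV_cong[OF DERIV_diff[OF d1 DERIV_mult[OF d3 d2]]])
    unfolding aw Vt R_def m_def q_sq p_def \<beta>_def[symmetric] c_def[symmetric]
    using r by (simp add: algebra_simps power2_eq_square)
qed

text \<open>
  All terms with velocities in the derivative of \<open>Y\<close> are absorbed in this multiple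
  of \<open>p t\<close>.
\<close>
definition C3 :: real where "C3 = 1 + lam2 / c0 * (L.N (D w) * L.N w) + \<delta>\<^sup>2 * C2 / 2"

lemma C3_pos: "0 < C3"
  unfolding C3_def using lam2_pos c0_pos C2_pos params(1)
  by (intro add_pos_nonneg mult_nonneg_nonneg divide_nonneg_nonneg) auto

lemma Y_derivative_bound:
  assumes t: "0 \<le> t"
  shows "p t - lam2 / (c t)\<^sup>2 * i0 (D w) (U' t) * i0 (U' t) w - \<delta> * i0 (U' t) (V t) - R t
    \<le> C3 * p t - R t / 2"
proof -
  have "\<bar>lam2 / (c t)\<^sup>2 * i0 (D w) (U' t) * i0 (U' t) w\<bar>
      = lam2 / (c t)\<^sup>2 * (\<bar>i0 (D w) (U' t)\<bar> * \<bar>i0 (U' t) w\<bar>)"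
    using lam2_pos by (simp add: abs_mult)
  also have "\<dots> \<le> lam2 / c0 * ((L.N (D w) * L.N (U' t)) * (L.N (U' t) * L.N w))"
    using lam2_pos c0_pos c_sq_ge[OF t] t L.cauchy_schwarz[of "D w" "U' t"] L.cauchy_schwarz[of "U' t" w]
      c_nonzero[OF t]
    by (intro mult_mono divide_left_mono mult_pos_pos) auto
  also have "\<dots> = lam2 / c0 * (L.N (D w) * L.N w) * p t"
    using t by (simp add: p_def L.N_sq[symmetric] power2_eq_square)
  finally have 1: "- (lam2 / (c t)\<^sup>2 * i0 (D w) (U' t) * i0 (U' t) w) \<le> lam2 / c0 * (L.N (D w) * L.N w) * p t"
    by linarith
  have "- (\<delta> * i0 (U' t) (V t)) = \<delta> * (- i0 (U' t) (V t))" by simp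
  also have "\<dots> \<le> \<delta> * \<bar>i0 (U' t) (V t)\<bar>" using params(1) by (intro mult_left_mono) auto
  also have "\<dots> \<le> (\<delta>\<^sup>2 * C2 * p t + R t) / 2" using cross_bound[OF t, of \<delta>] params(1) by simp
  finally have 2: "- (\<delta> * i0 (U' t) (V t)) \<le> \<delta>\<^sup>2 * C2 / 2 * p t + R t / 2" by (simp add: add_divide_distrib)
  have "C3 * p t = p t + lam2 / c0 * (L.N (D w) * L.N w) * p t + \<delta>\<^sup>2 * C2 / 2 * p t"
    unfolding C3_def distrib_right by simp
  with 1 2 show ?thesis by linarith
qed

text \<open>
  The first bound makes \<open>e + \<epsilon> Y\<close> comparable to \<open>e\<close>, the
  second lets the damping absorb \<open>\<epsilon> * C3 * p t\<close>.
\<close>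
definition \<epsilon> :: real where "\<epsilon> = min (1 / (2 * (C2 + 2))) (\<delta> / (2 * C3))"

lemma \<epsilon>: "0 < \<epsilon>" "\<epsilon> * (C2 + 2) \<le> 1 / 2" "\<epsilon> * C3 \<le> \<delta> / 2"
proof -
  show "0 < \<epsilon>" using C2_pos C3_pos params by (simp add: \<epsilon>_def)
  have "\<epsilon> \<le> 1 / (2 * (C2 + 2))" "\<epsilon> \<le> \<delta> / (2 * C3)" by (auto simp: \<epsilon>_def)
  then show "\<epsilon> * (C2 + 2) \<le> 1 / 2" "\<epsilon> * C3 \<le> \<delta> / 2"
    using C2_pos C3_pos by (auto simp: field_simps)
qed

lemma e_bounds: assumes t: "0 \<le> t"
  shows "p t / 2 + R t / 4 \<le> e t" "e t \<le> p t / 2 + R t / 2"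
proof -
  define Q where "Q = (q t)\<^sup>2 / S"
  have qS: "0 \<le> Q" "(q t)\<^sup>2 / (4 * S) = Q / 4" "(q t)\<^sup>2 / S = Q" using params(2) by (auto simp: Q_def)
  have ar: "x / 2 + (y + z) / 4 \<le> x / 2 + z / 4 + y / 2" "x / 2 + z / 4 + y / 2 \<le> x / 2 + (y + z) / 2"
    if "0 \<le> y" "0 \<le> z" for x y z :: real using that by (auto simp: field_simps)
  show "p t / 2 + R t / 4 \<le> e t" "e t \<le> p t / 2 + R t / 2"
    unfolding e_eq[OF t] R_def qS(2,3) by (rule ar[OF m_nonneg[OF t] qS(1)])+
qed

lemma Y_le: assumes t: "0 \<le> t" shows "\<bar>Y t\<bar> \<le> (C2 + 2) * e t"
proof -
  have "\<bar>Y t\<bar> \<le> (C2 * p t + R t) / 2" using cross_bound[OF t, of 1] t by (simp add: Y_eq)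
  also have "\<dots> \<le> (C2 + 2) * (p t / 2 + R t / 4)"
    using C2_pos p_nonneg[OF t] R_nonneg[OF t] mult_nonneg_nonneg[of C2 "R t"] by (simp add: algebra_simps)
  also have "\<dots> \<le> (C2 + 2) * e t" using e_bounds[OF t] C2_pos by (intro mult_left_mono) auto
  finally show ?thesis .
qed

lemma e_nonneg: "0 \<le> t \<Longrightarrow> 0 \<le> e t"
  using e_bounds(1)[of t] p_nonneg[of t] R_nonneg[of t] by simp

lemma Lyapunov_equiv: assumes t: "0 \<le> t" shows "e t / 2 \<le> e t + \<epsilon> * Y t" "e t + \<epsilon> * Y t \<le> 2 * e t"
proof -
  have "\<bar>\<epsilon> * Y t\<bar> \<le> \<epsilon> * ((C2 + 2) * e t)" using Y_le[OF t] \<epsilon>(1) by (simp add: abs_mult)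
  also have "\<dots> \<le> 1 / 2 * e t" using mult_right_mono[OF \<epsilon>(2) e_nonneg[OF t]] by (simp add: mult.assoc)
  finally show "e t / 2 \<le> e t + \<epsilon> * Y t" "e t + \<epsilon> * Y t \<le> 2 * e t" using e_nonneg[OF t] by (auto simp: abs_le_iff)
qed

text \<open>
  The functional \<open>e + \<epsilon> Y\<close> decays exponentially: the damping supplies the
  missing multiple of \<open>p\<close>, the multiplier that of \<open>R\<close>.
\<close>
lemma e_tendsto_0: "(e \<longlongrightarrow> 0) at_top"
proof -
  let ?L = "\<lambda>t. e t + \<epsilon> * Y t"
  let ?L' = "\<lambda>t. - \<delta> * p t + \<epsilon> * (p t - lam2 / (c t)\<^sup>2 * i0 (D w) (U' t) * i0 (U' t) w - \<delta> * i0 (U' t) (V t) - R t)"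
  let ?\<gamma> = "min \<delta> \<epsilon>"
  have "(?L \<longlongrightarrow> 0) at_top"
  proof (rule exponential_decay)
    show "0 < ?\<gamma> / 2" using params \<epsilon> by simp
    fix t :: real assume t1: "1 \<le> t"
    then have t: "0 \<le> t" "0 < t" by auto
    show "0 \<le> ?L t" using Lyapunov_equiv(1)[OF t(1)] e_nonneg[OF t(1)] by simp
    have "(e has_real_derivative - \<delta> * p t) (at t)"
      unfolding e_def using has_derivative_En[OF t(2)] by (auto intro!: derivative_eq_intros)
    then show "(?L has_real_derivative ?L' t) (at t)"
      by (intro DERIV_add DERIV_cmult has_derivative_Y t)
    have "?L' t \<le> - \<delta> * p t + \<epsilon> * (C3 * p t - R t / 2)"
      using Y_derivative_bound[OF t(1)] \<epsilon>(1) by (intro add_left_mono mult_left_mono) auto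
    also have "\<dots> = - (\<delta> - \<epsilon> * C3) * p t - \<epsilon> * (R t / 2)" by (simp add: algebra_simps)
    also have "\<dots> \<le> - (?\<gamma> * (p t / 2)) - ?\<gamma> * (R t / 2)"
    proof -
      have "?\<gamma> * (p t / 2) \<le> (\<delta> - \<epsilon> * C3) * p t"
        using \<epsilon>(3) p_nonneg[OF t(1)] mult_right_mono[of "?\<gamma> / 2" "\<delta> - \<epsilon> * C3" "p t"] by auto
      moreover have "?\<gamma> * (R t / 2) \<le> \<epsilon> * (R t / 2)"
        using R_nonneg[OF t(1)] by (intro mult_right_mono) auto
      moreover have "- (\<delta> - \<epsilon> * C3) * p t = - ((\<delta> - \<epsilon> * C3) * p t)" by (rule minus_mult_left[symmetric])
      ultimately show ?thesis by linarith
    qed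
    also have "\<dots> = - ?\<gamma> * (p t / 2 + R t / 2)" by (simp add: algebra_simps)
    also have "\<dots> \<le> - ?\<gamma> * e t"
      using e_bounds(2)[OF t(1)] params(1) \<epsilon>(1) by (simp add: mult_left_mono)
    also have "\<dots> \<le> - (?\<gamma> / 2) * ?L t"
      using mult_left_mono[OF Lyapunov_equiv(2)[OF t(1)], of "?\<gamma> / 2"] params(1) \<epsilon>(1) by simp
    finally show "?L' t \<le> - (?\<gamma> / 2) * ?L t" .
  qed
  from tendsto_mult_right_zero[OF this, of 2] have l: "((\<lambda>t. 2 * ?L t) \<longlongrightarrow> 0) at_top" .
  show ?thesis
  proof (rule tendsto_sandwich[OF _ _ tendsto_const l])
    show "\<forall>\<^sub>F t in at_top. 0 \<le> e t" using eventually_ge_at_top[of 0] by eventually_elim (rule e_nonneg)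
    show "\<forall>\<^sub>F t in at_top. e t \<le> 2 * ?L t" using eventually_ge_at_top[of 0]
      by eventually_elim (use Lyapunov_equiv(1) in fastforce)
  qed
qed

lemma tendsto_0_if_le_e:
  assumes "\<And>t. 0 \<le> t \<Longrightarrow> 0 \<le> f t" "\<And>t. 0 \<le> t \<Longrightarrow> f t \<le> k * e t"
  shows "((f :: real \<Rightarrow> real) \<longlongrightarrow> 0) at_top"
proof (rule tendsto_sandwich[OF _ _ tendsto_const tendsto_mult_right_zero[OF e_tendsto_0, of k]])
  show "\<forall>\<^sub>F t in at_top. 0 \<le> f t" using eventually_ge_at_top[of 0] by eventually_elim (rule assms)
  show "\<forall>\<^sub>F t in at_top. f t \<le> k * e t" using eventually_ge_at_top[of 0] by eventually_elim (rule assms)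
qed

text \<open>
  With \<open>e\<close> also \<open>p\<close>, \<open>m\<close> and \<open>q\<close> tend to 0.
  The gap then gives \<open>\<beta> - c\<^sup>2 \<rightarrow> 0\<close>, so
  \<open>c\<^sup>2\<close> tends to \<open>lam2\<close> and \<open>c\<close>, whose sign is
  constant, converges. The distance to the equilibrium is a combination of these quantities.
\<close>
theorem convergence:
  shows "((\<lambda>t. A.N (U t - (sgn (c 0) * sqrt lam2) *\<^sub>R w)) \<longlongrightarrow> 0) at_top"
    and "((\<lambda>t. L.N (U' t)) \<longlongrightarrow> 0) at_top"
proof -
  have "(p \<longlongrightarrow> 0) at_top"
    by (rule tendsto_0_if_le_e[of _ 2]) (use p_nonneg R_nonneg e_bounds(1) in fastforce)+
  from tendsto_real_sqrt[OF this] show "((\<lambda>t. L.N (U' t)) \<longlongrightarrow> 0) at_top"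
    by (simp add: L.N_def p_def)
  have Rl: "(R \<longlongrightarrow> 0) at_top"
    by (rule tendsto_0_if_le_e[of _ 4]) (use p_nonneg R_nonneg e_bounds(1) in fastforce)+
  have ml: "(m \<longlongrightarrow> 0) at_top"
    by (rule tendsto_sandwich[OF _ _ tendsto_const Rl])
      (use params(2) m_nonneg in \<open>auto simp: R_def eventually_at_top_linorder\<close>)
  have q2: "((\<lambda>t. (q t)\<^sup>2) \<longlongrightarrow> 0) at_top"
  proof -
    have "((\<lambda>t. S * (R t - m t)) \<longlongrightarrow> S * (0 - 0)) at_top" by (intro tendsto_intros Rl ml)
    then show ?thesis using params(2) by (simp add: R_def)
  qed
  have ql: "(q \<longlongrightarrow> 0) at_top" using tendsto_real_sqrt[OF q2] by (simp add: tendsto_rabs_zero_iff)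
  let ?g = "\<Lambda>\<^sub>2 - \<Lambda>\<^sub>1"
  have dl: "((\<lambda>t. \<beta> t - (c t)\<^sup>2) \<longlongrightarrow> 0) at_top"
  proof (rule tendsto_sandwich[OF _ _ tendsto_const])
    show "((\<lambda>t. m t / ?g) \<longlongrightarrow> 0) at_top" using tendsto_divide_zero[OF ml] .
    show "\<forall>\<^sub>F t in at_top. 0 \<le> \<beta> t - (c t)\<^sup>2" using eventually_ge_at_top[of 0] by eventually_elim (rule \<beta>_c)
    show "\<forall>\<^sub>F t in at_top. \<beta> t - (c t)\<^sup>2 \<le> m t / ?g" using eventually_ge_at_top[of 0]
      by eventually_elim (use \<beta>_c(2) gap_pos in \<open>simp add: pos_le_divide_eq mult.commute\<close>)
  qed
  let ?k = "sgn (c 0) * sqrt lam2"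
  have "((\<lambda>t. q t / S + lam2 - (\<beta> t - (c t)\<^sup>2)) \<longlongrightarrow> 0 / S + lam2 - 0) at_top"
    using params(2) by (intro tendsto_intros ql dl) auto
  then have "((\<lambda>t. (c t)\<^sup>2) \<longlongrightarrow> lam2) at_top" using params(2) by (simp add: q_def)
  from tendsto_real_sqrt[OF this] have "((\<lambda>t. \<bar>c t\<bar>) \<longlongrightarrow> sqrt lam2) at_top" by simp
  from tendsto_mult_left[OF this, of "sgn (c 0)"] have cl0: "((\<lambda>t. sgn (c 0) * \<bar>c t\<bar>) \<longlongrightarrow> ?k) at_top" .
  have cl: "(c \<longlongrightarrow> ?k) at_top"
  proof (rule Lim_transform_eventually[OF cl0])
    show "\<forall>\<^sub>F t in at_top. sgn (c 0) * \<bar>c t\<bar> = c t" using eventually_ge_at_top[of 0]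
      by eventually_elim (simp add: sgn_c[symmetric] sgn_mult_abs)
  qed
  have "((\<lambda>t. m t + \<Lambda>\<^sub>1 * ((\<beta> t - (c t)\<^sup>2) + (c t - ?k)\<^sup>2)) \<longlongrightarrow> 0 + \<Lambda>\<^sub>1 * (0 + (?k - ?k)\<^sup>2)) at_top"
    by (intro tendsto_intros ml dl cl)
  then have l: "((\<lambda>t. m t + \<Lambda>\<^sub>1 * ((\<beta> t - (c t)\<^sup>2) + (c t - ?k)\<^sup>2)) \<longlongrightarrow> 0) at_top" by simp
  have "((\<lambda>t. a (U t - ?k *\<^sub>R w) (U t - ?k *\<^sub>R w)) \<longlongrightarrow> 0) at_top"
  proof (rule Lim_transform_eventually[OF l])
    show "\<forall>\<^sub>F t in at_top. m t + \<Lambda>\<^sub>1 * ((\<beta> t - (c t)\<^sup>2) + (c t - ?k)\<^sup>2) = a (U t - ?k *\<^sub>R w) (U t - ?k *\<^sub>R w)"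
      using eventually_ge_at_top[of 0]
    proof eventually_elim
      case (elim t)
      have aw: "a w (U t) = \<Lambda>\<^sub>1 * c t" "a (U t) w = \<Lambda>\<^sub>1 * c t" "a w w = \<Lambda>\<^sub>1"
        using w_eigen[of "U t"] w_eigen[of w] elim by (auto simp: A.sym[of "U t"] B.sym[of w] c_def w_unit)
      have "a (U t - k *\<^sub>R w) (U t - k *\<^sub>R w) = a (U t) (U t) - 2 * k * (\<Lambda>\<^sub>1 * c t) + k\<^sup>2 * \<Lambda>\<^sub>1" for k
        using elim by (simp add: A.bilin aw power2_eq_square algebra_simps)
      then have "m t + \<Lambda>\<^sub>1 * ((\<beta> t - (c t)\<^sup>2) + (c t - k)\<^sup>2) = a (U t - k *\<^sub>R w) (U t - k *\<^sub>R w)" for k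
        by (simp only:) (simp add: m_def power2_eq_square algebra_simps)
      then show ?case .
    qed
  qed
  from tendsto_real_sqrt[OF this]
  show "((\<lambda>t. A.N (U t - ?k *\<^sub>R w)) \<longlongrightarrow> 0) at_top" by (simp add: A.N_def)
qed

end

section \<open>Eigenfunctions of a pair of quadratic forms\<close>

text \<open>
  Bolzano--Weierstrass, applied to one sequence after the other.
\<close>
lemma finite_family_convergent_subsequence:
  fixes f :: "nat \<Rightarrow> nat \<Rightarrow> real"
  assumes "\<And>i. i < k \<Longrightarrow> bounded (range (f i))"
  shows "\<exists>r. strict_mono (r :: nat \<Rightarrow> nat) \<and> (\<forall>i<k. convergent (\<lambda>n. f i (r n)))"
  using assms
proof (induction k)
  case 0
  show ?case by (rule exI[of _ id]) (simp add: strict_mono_def)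
next
  case (Suc k)
  then obtain r where r: "strict_mono r" "\<And>i. i < k \<Longrightarrow> convergent (\<lambda>n. f i (r n))" by force
  have "bounded (range (\<lambda>n. f k (r n)))"
    using Suc.prems[of k] by (rule bounded_subset) auto
  then obtain l s where s: "strict_mono s" "((\<lambda>n. f k (r n)) \<circ> s) \<longlonglongrightarrow> l"
    using bounded_imp_convergent_subsequence by blast
  have "convergent (\<lambda>n. f i (r (s n)))" if "i < Suc k" for i
  proof (cases "i = k")
    case True
    with s(2) show ?thesis by (auto simp: convergent_def o_def)
  next
    case False
    with that r(2) have "convergent (\<lambda>n. f i (r n))" by simp
    from convergent_subseq_convergent[OF this s(1)] show ?thesis by (simp add: o_def)
  qed
  with r(1) s(1) show ?case
    by (intro exI[of _ "r \<circ> s"]) (auto simp: strict_mono_def)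
qed

text \<open>
  Used to extract the Euler equation of a minimiser.
\<close>
lemma linear_coefficient_zero:
  fixes x y :: real
  assumes "\<And>t. 0 \<le> 2 * t * x + t\<^sup>2 * y"
  shows "x = 0"
proof (rule ccontr)
  assume x: "x \<noteq> 0"
  let ?d = "\<bar>y\<bar> + 1"
  have "0 \<le> 2 * (- x / ?d) * x + (- x / ?d)\<^sup>2 * y" by (rule assms)
  also have "\<dots> = (x\<^sup>2 / ?d) * (y / ?d - 2)"
    by (simp add: power2_eq_square algebra_simps)
  also have "\<dots> < 0"
  proof (rule mult_pos_neg)
    have "y / ?d \<le> 1" by (subst divide_le_eq_1_pos) auto
    then show "y / ?d - 2 < 0" by linarith
  qed (use x in \<open>simp add: divide_pos_pos\<close>)
  finally show False by simp
qed

text \<open>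
  The last assumption expresses that \<open>b\<close> is compact relative to \<open>a\<close>
  without weak convergence or an orthonormal basis: up to a small multiple of \<open>a\<close>,
  the form \<open>b\<close> is controlled by finitely many bounded functionals.
\<close>
locale compact_form = A: semi_inner H a + B: semi_inner H b
  for H :: "'v::real_vector set" and a b +
  fixes C :: real
  assumes b_le_a: "u \<in> H \<Longrightarrow> b u u \<le> C * a u u"
    and complete: "\<lbrakk>\<And>n. y n \<in> H; \<And>e. 0 < e \<Longrightarrow> \<exists>N. \<forall>m\<ge>N. \<forall>n\<ge>N. a (y m - y n) (y m - y n) < e\<rbrakk>
      \<Longrightarrow> \<exists>v\<in>H. (\<lambda>n. a (y n - v) (y n - v)) \<longlonglongrightarrow> 0"
    and almost_finite_rank: "0 < e \<Longrightarrow> \<exists>(k::nat) \<phi>.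
      (\<forall>i<k. (\<forall>u\<in>H. \<forall>v\<in>H. \<phi> i (u - v) = \<phi> i u - \<phi> i v) \<and> (\<exists>M. \<forall>u\<in>H. \<bar>\<phi> i u\<bar> \<le> M * A.N u)) \<and>
      (\<forall>u\<in>H. b u u \<le> e * a u u + (\<Sum>i<k. (\<phi> i u :: real)\<^sup>2))"
begin

text \<open>
  The direct method. Minimise \<open>a\<close> on the \<open>b\<close>-unit sphere of the
  \<open>b\<close>-orthogonal complement of \<open>w\<close>. A minimising sequence along which
  the finitely many functionals converge is Cauchy for \<open>a\<close> by the parallelogram
  identity; its limit is a minimiser. The Euler equation holds on the complement of
  \<open>w\<close> first, and on all of \<open>H\<close> because \<open>w\<close> is itself an
  eigenvector.
\<close>
theorem eigenfunction_below:
  assumes w: "w \<in> H" "b w w = 1" "\<And>u. u \<in> H \<Longrightarrow> a w u = \<Lambda> * b w u"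
    and z0: "z0 \<in> H" "b z0 w = 0" "a z0 z0 < \<mu>0 * b z0 z0"
  shows "\<exists>\<mu> z. \<mu> < \<mu>0 \<and> z \<in> H \<and> b z z = 1 \<and> b z w = 0 \<and> (\<forall>v\<in>H. a z v = \<mu> * b z v)"
proof -
  define Z where "Z = {z \<in> H. b z w = 0 \<and> b z z = 1}"
  define \<mu> where "\<mu> = Inf ((\<lambda>z. a z z) ` Z)"
  have normalize: "z /\<^sub>R B.N z \<in> Z" "a (z /\<^sub>R B.N z) (z /\<^sub>R B.N z) = a z z / b z z"
    if "z \<in> H" "b z w = 0" "0 < b z z" for z
  proof -
    have N: "0 < B.N z" "B.N z * B.N z = b z z" using that by (auto simp: B.N_def)
    show "z /\<^sub>R B.N z \<in> Z" using that w(1) N(1)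
      by (simp add: Z_def B.bilin N(2)[symmetric] field_simps)
    show "a (z /\<^sub>R B.N z) (z /\<^sub>R B.N z) = a z z / b z z" using that N(1)
      by (simp add: A.bilin N(2)[symmetric] field_simps)
  qed
  have bdd: "bdd_below ((\<lambda>z. a z z) ` Z)"
    by (rule bdd_belowI[of _ 0]) (auto simp: Z_def A.nonneg)
  have bz0: "0 < b z0 z0"
    using z0 A.nonneg[OF z0(1)] B.nonneg[OF z0(1)] by (cases "b z0 z0 = 0") auto
  have ne: "Z \<noteq> {}" using normalize(1)[OF z0(1,2) bz0] by auto
  have "\<mu> \<le> a z0 z0 / b z0 z0"
    unfolding \<mu>_def normalize(2)[OF z0(1,2) bz0, symmetric]
    by (rule cINF_lower[OF bdd normalize(1)[OF z0(1,2) bz0]])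
  also have "\<dots> < \<mu>0" using z0(3) bz0 by (simp add: field_simps)
  finally have \<mu>_less: "\<mu> < \<mu>0" .
  have \<mu>_nonneg: "0 \<le> \<mu>" unfolding \<mu>_def by (rule cINF_greatest[OF ne]) (simp add: Z_def A.nonneg)
  have rayleigh: "\<mu> * b u u \<le> a u u" if u: "u \<in> H" "b u w = 0" for u
  proof (cases "b u u = 0")
    case True
    then show ?thesis using A.nonneg[OF u(1)] by simp
  next
    case False
    then have pos: "0 < b u u" using B.nonneg[OF u(1)] by simp
    have "\<mu> \<le> a u u / b u u"
      unfolding \<mu>_def normalize(2)[OF u pos, symmetric] by (rule cINF_lower[OF bdd normalize(1)[OF u pos]])
    then show ?thesis using pos by (simp add: field_simps)
  qed
  have "\<exists>z\<in>Z. a z z < \<mu> + 1 / real (Suc n)" for n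
    using cInf_less_iff[of "(\<lambda>z. a z z) ` Z" "\<mu> + 1 / real (Suc n)"] ne bdd by (auto simp: \<mu>_def)
  then obtain z where z: "\<And>n. z n \<in> Z" "\<And>n. a (z n) (z n) < \<mu> + 1 / real (Suc n)" by metis
  have zH: "z n \<in> H" "b (z n) w = 0" "b (z n) (z n) = 1" for n using z(1)[of n] by (auto simp: Z_def)
  have az: "(\<lambda>n. a (z n) (z n)) \<longlonglongrightarrow> \<mu>"
  proof (rule tendsto_sandwich[OF _ _ tendsto_const])
    show "(\<lambda>n. \<mu> + 1 / real (Suc n)) \<longlonglongrightarrow> \<mu>"
      using tendsto_add[OF tendsto_const[of \<mu>] LIMSEQ_Suc[OF lim_inverse_n']] by simp
    show "\<forall>\<^sub>F n in sequentially. \<mu> \<le> a (z n) (z n)" using rayleigh[OF zH(1,2)] zH(3) by simp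
  qed (use z(2) in \<open>auto intro!: always_eventually less_imp_le\<close>)
  (* small enough for mu * e <= 1 / 2, so that the term e * a of the difference can be absorbed *)
  define e where "e = 1 / (2 * (\<mu> + 1))"
  have e: "0 < e" "\<mu> * e \<le> 1 / 2" using \<mu>_nonneg by (auto simp: e_def field_simps)
  obtain k :: nat and \<phi> where \<phi>: "\<And>i u v. \<lbrakk>i < k; u \<in> H; v \<in> H\<rbrakk> \<Longrightarrow> \<phi> i (u - v) = \<phi> i u - \<phi> i v"
    "\<And>i. i < k \<Longrightarrow> \<exists>M. \<forall>u\<in>H. \<bar>\<phi> i u\<bar> \<le> M * A.N u"
    "\<And>u. u \<in> H \<Longrightarrow> b u u \<le> e * a u u + (\<Sum>i<k. (\<phi> i u)\<^sup>2)"
    using almost_finite_rank[OF e(1)] by blast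
  have "bounded (range (\<lambda>n. \<phi> i (z n)))" if i: "i < k" for i
  proof -
    obtain M where M: "\<And>u. u \<in> H \<Longrightarrow> \<bar>\<phi> i u\<bar> \<le> M * A.N u" using \<phi>(2)[OF i] by blast
    have "\<bar>\<phi> i (z n)\<bar> \<le> \<bar>M\<bar> * sqrt (\<mu> + 1)" for n
    proof -
      have "a (z n) (z n) \<le> \<mu> + 1" using z(2)[of n] by (auto elim!: order.strict_trans2[THEN less_imp_le])
      then have N: "A.N (z n) \<le> sqrt (\<mu> + 1)" by (simp add: A.N_def)
      have "\<bar>\<phi> i (z n)\<bar> \<le> M * A.N (z n)" by (rule M[OF zH(1)])
      also have "\<dots> \<le> \<bar>M\<bar> * sqrt (\<mu> + 1)" using N zH(1)[of n] by (intro mult_mono) auto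
      finally show ?thesis .
    qed
    then show ?thesis unfolding bounded_iff by auto
  qed
  then obtain r where r: "strict_mono r" "\<And>i. i < k \<Longrightarrow> convergent (\<lambda>n. \<phi> i (z (r n)))"
    using finite_family_convergent_subsequence[of k "\<lambda>i n. \<phi> i (z n)"] by blast
  define y where "y n = z (r n)" for n
  have yH: "y n \<in> H" "b (y n) w = 0" "b (y n) (y n) = 1" for n using zH by (auto simp: y_def)
  have ay: "(\<lambda>n. a (y n) (y n)) \<longlonglongrightarrow> \<mu>"
    using LIMSEQ_subseq_LIMSEQ[OF az r(1)] by (simp add: y_def o_def)
  (* parallelogram identity: b of the sum is 4 minus b of the difference, which e * a and the functionals control *)
  have cauchy_bound: "a (y m - y n) (y m - y n)
      \<le> 4 * (a (y m) (y m) - \<mu>) + 4 * (a (y n) (y n) - \<mu>) + 2 * \<mu> * (\<Sum>i<k. (\<phi> i (y m) - \<phi> i (y n))\<^sup>2)" for m n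
  proof -
    let ?d = "y m - y n" let ?s = "y m + y n"
    have dH: "?d \<in> H" "?s \<in> H" using yH by auto
    have "b ?s w = 0" using yH w by (simp add: B.bilin)
    from rayleigh[OF dH(2) this] have 1: "\<mu> * b ?s ?s \<le> a ?s ?s" .
    have 2: "a ?s ?s + a ?d ?d = 2 * a (y m) (y m) + 2 * a (y n) (y n)" using yH by (simp add: A.bilin)
    have "b ?s ?s + b ?d ?d = 4" using yH by (simp add: B.bilin)
    then have 3: "b ?s ?s = 4 - b ?d ?d" by simp
    let ?T = "\<Sum>i<k. (\<phi> i (y m) - \<phi> i (y n))\<^sup>2"
    have "b ?d ?d \<le> e * a ?d ?d + ?T" using \<phi>(3)[OF dH(1)] \<phi>(1) yH by simp
    from mult_left_mono[OF this \<mu>_nonneg] have 4: "\<mu> * b ?d ?d \<le> (\<mu> * e) * a ?d ?d + \<mu> * ?T"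
      by (simp add: algebra_simps)
    have 5: "(\<mu> * e) * a ?d ?d \<le> 1 / 2 * a ?d ?d" using e(2) A.nonneg[OF dH(1)] by (rule mult_right_mono)
    have "\<mu> * b ?s ?s = 4 * \<mu> - \<mu> * b ?d ?d" unfolding 3 by (simp add: algebra_simps)
    then show ?thesis using 1 2 4 5 by (simp add: algebra_simps)
  qed
  have "\<exists>N. \<forall>m\<ge>N. \<forall>n\<ge>N. a (y m - y n) (y m - y n) < \<epsilon>" if \<epsilon>: "0 < \<epsilon>" for \<epsilon>
  proof -
    have "\<forall>\<^sub>F n in sequentially. a (y n) (y n) - \<mu> < \<epsilon> / 16"
      using order_tendstoD(2)[OF tendsto_diff[OF ay tendsto_const[of \<mu>]], of "\<epsilon> / 16"] \<epsilon> by simp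
    then obtain N1 where N1: "\<And>n. N1 \<le> n \<Longrightarrow> a (y n) (y n) - \<mu> < \<epsilon> / 16" by (auto simp: eventually_sequentially)
    define \<eta> where "\<eta> = sqrt (\<epsilon> / (8 * (\<mu> + 1) * (real k + 1)))"
    have \<eta>: "0 < \<eta>" using \<epsilon> \<mu>_nonneg by (simp add: \<eta>_def)
    have "\<exists>N. \<forall>m\<ge>N. \<forall>n\<ge>N. \<bar>\<phi> i (y m) - \<phi> i (y n)\<bar> < \<eta>" if "i < k" for i
    proof -
      have "Cauchy (\<lambda>n. \<phi> i (y n))" using r(2)[OF that] by (simp add: y_def convergent_Cauchy)
      from metric_CauchyD[OF this \<eta>] show ?thesis by (simp add: dist_real_def)
    qed
    then obtain N2 where N2: "\<And>i m n. \<lbrakk>i < k; N2 i \<le> m; N2 i \<le> n\<rbrakk> \<Longrightarrow> \<bar>\<phi> i (y m) - \<phi> i (y n)\<bar> < \<eta>" by metis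
    have "a (y m - y n) (y m - y n) < \<epsilon>" if mn: "max N1 (\<Sum>i<k. N2 i) \<le> m" "max N1 (\<Sum>i<k. N2 i) \<le> n" for m n
    proof -
      have "(\<Sum>i<k. (\<phi> i (y m) - \<phi> i (y n))\<^sup>2) \<le> (\<Sum>i<k. \<eta>\<^sup>2)"
      proof (rule sum_mono)
        fix i assume i: "i \<in> {..<k}"
        have "N2 i \<le> (\<Sum>i<k. N2 i)" using i by (intro member_le_sum) auto
        with N2[of i m n] i mn have "\<bar>\<phi> i (y m) - \<phi> i (y n)\<bar> \<le> \<eta>" by simp
        then show "(\<phi> i (y m) - \<phi> i (y n))\<^sup>2 \<le> \<eta>\<^sup>2" using \<eta> by (simp add: power2_le_iff_abs_le)
      qed
      also have "\<dots> = real k * (\<epsilon> / (8 * (\<mu> + 1) * (real k + 1)))" using \<epsilon> \<mu>_nonneg by (simp add: \<eta>_def)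
      finally have "2 * \<mu> * (\<Sum>i<k. (\<phi> i (y m) - \<phi> i (y n))\<^sup>2) \<le> 2 * \<mu> * (real k * (\<epsilon> / (8 * (\<mu> + 1) * (real k + 1))))"
        using \<mu>_nonneg by (intro mult_left_mono) auto
      also have "\<dots> = (\<epsilon> / 4) * ((\<mu> / (\<mu> + 1)) * (real k / (real k + 1)))"
        using \<mu>_nonneg by (simp add: divide_simps)
      also have "\<dots> \<le> (\<epsilon> / 4) * (1 * 1)"
        using \<epsilon> \<mu>_nonneg by (intro mult_left_mono mult_mono) (auto simp: divide_le_eq_1)
      finally show ?thesis using cauchy_bound[of m n] N1[of m] N1[of n] mn \<epsilon> by simp
    qed
    then show ?thesis by blast
  qed
  from complete[OF yH(1) this] obtain v where v: "v \<in> H" "(\<lambda>n. a (y n - v) (y n - v)) \<longlonglongrightarrow> 0" by blast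
  have NA: "(\<lambda>n. A.N (y n - v)) \<longlonglongrightarrow> 0" using tendsto_real_sqrt[OF v(2)] by (simp add: A.N_def)
  have "(\<lambda>n. b (y n - v) (y n - v)) \<longlonglongrightarrow> 0"
    by (rule tendsto_sandwich[OF _ _ tendsto_const tendsto_mult_right_zero[OF v(2), of C]])
      (use yH v b_le_a B.nonneg in \<open>auto intro!: always_eventually\<close>)
  from tendsto_real_sqrt[OF this] have NB: "(\<lambda>n. B.N (y n - v)) \<longlonglongrightarrow> 0" by (simp add: B.N_def)
  have "(\<lambda>n. a (y n) (y n)) \<longlonglongrightarrow> a v v" by (rule A.tendsto_ip[OF NA _ _ NA]) (use yH v in auto)
  then have av: "a v v = \<mu>" using LIMSEQ_unique ay by blast
  have "(\<lambda>n. b (y n) (y n)) \<longlonglongrightarrow> b v v" by (rule B.tendsto_ip[OF NB _ _ NB]) (use yH v in auto)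
  then have bv: "b v v = 1" using LIMSEQ_unique[of "\<lambda>n. 1::real"] yH(3) by simp
  have "(\<lambda>n. b (y n) w) \<longlonglongrightarrow> b v w" by (rule B.tendsto_ip_const[OF NB]) (use yH v w in auto)
  then have bw: "b v w = 0" using LIMSEQ_unique[of "\<lambda>n. 0::real"] yH(2) by simp
  have euler: "a v u = \<mu> * b v u" if u: "u \<in> H" "b u w = 0" for u
  proof -
    have "0 \<le> 2 * t * (a v u - \<mu> * b v u) + t\<^sup>2 * (a u u - \<mu> * b u u)" for t
    proof -
      have "b (v + t *\<^sub>R u) w = 0" using u v w bw by (simp add: B.bilin)
      from rayleigh[OF _ this] u v have "0 \<le> a (v + t *\<^sub>R u) (v + t *\<^sub>R u) - \<mu> * b (v + t *\<^sub>R u) (v + t *\<^sub>R u)" by simp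
      also have "\<dots> = 2 * t * (a v u - \<mu> * b v u) + t\<^sup>2 * (a u u - \<mu> * b u u)"
        using u v by (simp add: A.bilin B.bilin av bv A.sym[of u v] B.sym[of u v] power2_eq_square algebra_simps)
      finally show ?thesis .
    qed
    from linear_coefficient_zero[OF this] show ?thesis by simp
  qed
  have "a v u = \<mu> * b v u" if u: "u \<in> H" for u
  proof -
    (* v is orthogonal to w for both forms, so only the component orthogonal to w matters *)
    define u' where "u' = u - (b u w) *\<^sub>R w"
    have u': "u' \<in> H" "b u' w = 0" using u w by (auto simp: u'_def B.bilin)
    have avw: "a v w = 0" using w(3)[OF v(1)] bw A.sym[OF v(1) w(1)] B.sym[OF v(1) w(1)] by simp
    have "a v u' = a v u" "b v u' = b v u"
      using u v w avw bw by (auto simp: u'_def A.bilin B.bilin)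
    with euler[OF u'] show ?thesis by simp
  qed
  with \<mu>_less v bv bw show ?thesis by blast
qed

end

section \<open>Bumps on the real line\<close>

text \<open>
  Iterated \<open>deriv\<close> is the form in which \<open>test_functions\<close> refers to
  higher derivatives.
\<close>
fun differentiable_times :: "nat \<Rightarrow> (real \<Rightarrow> real) \<Rightarrow> bool" where
  "differentiable_times 0 f = True"
| "differentiable_times (Suc n) f = ((\<forall>x. f field_differentiable (at x)) \<and> differentiable_times n (deriv f))"

definition smooth :: "(real \<Rightarrow> real) \<Rightarrow> bool" where
  "smooth f \<longleftrightarrow> (\<forall>n. differentiable_times n f)"

lemma smooth_has_derivative: "smooth f \<Longrightarrow> (f has_real_derivative deriv f x) (at x)"
  unfolding smooth_def by (metis DERIV_deriv_iff_field_differentiable differentiable_times.simps(2))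

lemma smooth_deriv: "smooth f \<Longrightarrow> smooth (deriv f)"
  unfolding smooth_def by (metis differentiable_times.simps(2))

text \<open>
  A class of functions that contains a derivative of each of its members consists of smooth
  functions. Products and the flat exponential are treated by naming such a class.
\<close>
lemma smooth_coinduct:
  assumes "P f" and step: "\<And>g. P g \<Longrightarrow> \<exists>g'. P g' \<and> (\<forall>x. (g has_real_derivative g' x) (at x))"
  shows "smooth f"
proof -
  have "differentiable_times n g" if "P g" for n g
    using that
  proof (induction n arbitrary: g)
    case (Suc n)
    then obtain g' where g': "P g'" "\<And>x. (g has_real_derivative g' x) (at x)" using step by blast
    then have "deriv g = g'" by (auto simp: DERIV_imp_deriv)
    with g' Suc.IH[OF g'(1)] show ?case by (auto simp: field_differentiable_def)
  qed simp
  with assms(1) show ?thesis by (auto simp: smooth_def)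
qed

lemma smooth_isCont: "smooth f \<Longrightarrow> isCont f x"
  using DERIV_isCont smooth_has_derivative by blast

lemma smooth_continuous_on: "smooth f \<Longrightarrow> continuous_on A f"
  by (simp add: continuous_at_imp_continuous_on smooth_isCont)

lemma smooth_borel [measurable_dest]: "smooth f \<Longrightarrow> f \<in> borel_measurable borel"
  by (simp add: borel_measurable_continuous_onI smooth_continuous_on)

lemma smooth_const: "smooth (\<lambda>_. k)"
proof (rule smooth_coinduct[where P = "\<lambda>g. \<exists>k. g = (\<lambda>_. k)"])
  fix g :: "real \<Rightarrow> real" assume "\<exists>k. g = (\<lambda>_. k)"
  then show "\<exists>g'. (\<exists>k. g' = (\<lambda>_. k)) \<and> (\<forall>x. (g has_real_derivative g' x) (at x))"
    by (intro exI[of _ "\<lambda>_. 0"]) auto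
qed auto

lemma smooth_add: "smooth f \<Longrightarrow> smooth g \<Longrightarrow> smooth (\<lambda>x. f x + g x)"
proof (rule smooth_coinduct[where P = "\<lambda>h. \<exists>f g. smooth f \<and> smooth g \<and> h = (\<lambda>x. f x + g x)"])
  fix h assume "\<exists>f g. smooth f \<and> smooth g \<and> h = (\<lambda>x. f x + g x)"
  then obtain f g where "smooth f" "smooth g" "h = (\<lambda>x. f x + g x)" by blast
  then show "\<exists>h'. (\<exists>f g. smooth f \<and> smooth g \<and> h' = (\<lambda>x. f x + g x)) \<and> (\<forall>x. (h has_real_derivative h' x) (at x))"
    by (intro exI[of _ "\<lambda>x. deriv f x + deriv g x"])
      (auto intro!: smooth_deriv DERIV_add smooth_has_derivative)
qed auto

text \<open>
  Products of smooth functions are not closed under differentiation; their sums are.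
\<close>
inductive sum_of_products :: "(real \<Rightarrow> real) \<Rightarrow> bool" where
  "smooth f \<Longrightarrow> smooth g \<Longrightarrow> sum_of_products (\<lambda>x. f x * g x)"
| "sum_of_products f \<Longrightarrow> sum_of_products g \<Longrightarrow> sum_of_products (\<lambda>x. f x + g x)"

lemma smooth_mult: "smooth f \<Longrightarrow> smooth g \<Longrightarrow> smooth (\<lambda>x. f x * g x)"
proof (rule smooth_coinduct[where P = sum_of_products])
  fix h assume "sum_of_products h"
  then show "\<exists>h'. sum_of_products h' \<and> (\<forall>x. (h has_real_derivative h' x) (at x))"
  proof induction
    case (1 f g)
    then show ?case
      by (intro exI[of _ "\<lambda>x. deriv f x * g x + f x * deriv g x"])
        (auto intro!: sum_of_products.intros smooth_deriv derivative_eq_intros smooth_has_derivative)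
  next
    case (2 f g)
    then obtain f' g' where "sum_of_products f'" "sum_of_products g'"
      "\<forall>x. (f has_real_derivative f' x) (at x)" "\<forall>x. (g has_real_derivative g' x) (at x)" by blast
    then show ?case
      by (intro exI[of _ "\<lambda>x. f' x + g' x"]) (auto intro!: sum_of_products.intros DERIV_add)
  qed
qed (auto intro: sum_of_products.intros)

lemma smooth_cmult: "smooth f \<Longrightarrow> smooth (\<lambda>x. k * f x)"
  by (intro smooth_mult smooth_const)

lemma smooth_diff: "smooth f \<Longrightarrow> smooth g \<Longrightarrow> smooth (\<lambda>x. f x - g x)"
  using smooth_add[of f "\<lambda>x. (-1) * g x"] smooth_cmult[of g "-1"] by simp

lemma smooth_power: "smooth f \<Longrightarrow> smooth (\<lambda>x. f x ^ n)"
  by (induction n) (simp_all add: smooth_const smooth_mult)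

lemma smooth_affine: "smooth f \<Longrightarrow> smooth (\<lambda>x. f (a * x + b))"
proof (rule smooth_coinduct[where P = "\<lambda>h. \<exists>f k. smooth f \<and> h = (\<lambda>x. k * f (a * x + b))"])
  fix h assume "\<exists>f k. smooth f \<and> h = (\<lambda>x. k * f (a * x + b))"
  then obtain f k where h: "smooth f" "h = (\<lambda>x. k * f (a * x + b))" by blast
  have "(h has_real_derivative (k * a) * deriv f (a * x + b)) (at x)" for x
    unfolding h(2) by (auto intro!: derivative_eq_intros DERIV_chain'[OF _ smooth_has_derivative[OF h(1)]])
  then show "\<exists>h'. (\<exists>f k. smooth f \<and> h' = (\<lambda>x. k * f (a * x + b))) \<and> (\<forall>x. (h has_real_derivative h' x) (at x))"
    using smooth_deriv[OF h(1)] by (intro exI[of _ "\<lambda>x. (k * a) * deriv f (a * x + b)"]) blast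
next
  assume "smooth f"
  then show "\<exists>fa k. smooth fa \<and> (\<lambda>x. f (a * x + b)) = (\<lambda>x. k * fa (a * x + b))"
    by (intro exI[of _ f] exI[of _ 1]) simp
qed

text \<open>
  For all polynomials together these functions are closed under differentiation, which makes
  \<open>exp (- 1 / x)\<close>, extended by 0, smooth.
\<close>
definition flat :: "real poly \<Rightarrow> real \<Rightarrow> real" where
  "flat p x = (if 0 < x then poly p (1 / x) * exp (- (1 / x)) else 0)"

lemma poly_mult_exp_tendsto_0: "((\<lambda>y. poly p y * exp (- y)) \<longlongrightarrow> (0::real)) at_top"
proof -
  have "((\<lambda>y. \<Sum>i\<le>degree p. coeff p i * (y ^ i / exp y)) \<longlongrightarrow> (\<Sum>i\<le>degree p. coeff p i * 0)) at_top"
    by (intro tendsto_intros tendsto_power_div_exp_0)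
  then show ?thesis
    by (simp add: poly_altdef sum_distrib_right exp_minus divide_inverse mult.assoc)
qed

text \<open>
  With \<open>y = 1 / x\<close> the derivative of \<open>poly p y * exp (- y)\<close> is
  \<open>y\<^sup>2 * poly (p - pderiv p) y * exp (- y)\<close>; at 0 the exponential beats every
  power.
\<close>
lemma flat_has_derivative:
  "(flat p has_real_derivative flat (monom 1 2 * (p - pderiv p)) x) (at x)"
proof -
  consider "0 < x" | "x < 0" | "x = 0" by linarith
  then show ?thesis
  proof cases
    case 1
    have "((\<lambda>x. poly p (1 / x) * exp (- (1 / x))) has_real_derivative
        flat (monom 1 2 * (p - pderiv p)) x) (at x)"
      using 1 unfolding flat_def
      by (auto intro!: derivative_eq_intros DERIV_chain'[OF _ poly_DERIV]
          simp: poly_monom power2_eq_square field_simps)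
    then show ?thesis
      by (rule has_field_derivative_transform_within_open[where S = "{0<..}"]) (use 1 in \<open>auto simp: flat_def\<close>)
  next
    case 2
    have "((\<lambda>x. 0) has_real_derivative flat (monom 1 2 * (p - pderiv p)) x) (at x)"
      using 2 by (simp add: flat_def)
    then show ?thesis
      by (rule has_field_derivative_transform_within_open[where S = "{..<0}"]) (use 2 in \<open>auto simp: flat_def\<close>)
  next
    case 3
    have "((\<lambda>h. flat p h / h) \<longlongrightarrow> 0) (at_right 0)"
    proof -
      have "((\<lambda>h. poly (pCons 0 p) (1 / h) * exp (- (1 / h))) \<longlongrightarrow> 0) (at_right (0::real))"
        using filterlim_compose[OF poly_mult_exp_tendsto_0[of "pCons 0 p"] filterlim_inverse_at_top_right]
        by (simp add: inverse_eq_divide)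
      then show ?thesis
        by (rule Lim_transform_eventually) (auto simp: flat_def eventually_at_filter)
    qed
    moreover have "((\<lambda>h. flat p h / h) \<longlongrightarrow> 0) (at_left 0)"
      by (rule tendsto_eventually) (auto simp: flat_def eventually_at_filter)
    ultimately have "((\<lambda>h. flat p h / h) \<longlongrightarrow> 0) (at 0)" by (simp add: filterlim_split_at_real filterlim_split_at)
    then show ?thesis using 3 by (simp add: DERIV_def flat_def)
  qed
qed

lemma smooth_flat: "smooth (flat p)"
  by (rule smooth_coinduct[where P = "\<lambda>g. \<exists>p. g = flat p"]) (use flat_has_derivative in blast)+

text \<open>
  The test functions of the open interval between \<open>p\<close> and \<open>q\<close>.
\<close>
definition bump :: "real \<Rightarrow> real \<Rightarrow> (real \<Rightarrow> real) \<Rightarrow> bool" where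
  "bump p q \<alpha> \<longleftrightarrow> smooth \<alpha> \<and> (\<exists>c d. p < c \<and> d < q \<and> (\<forall>x. x \<notin> {c..d} \<longrightarrow> \<alpha> x = 0))"

lemma bump_smooth: "bump p q \<alpha> \<Longrightarrow> smooth \<alpha>" by (simp add: bump_def)

lemma bump_borel [measurable_dest]: "bump p q \<alpha> \<Longrightarrow> \<alpha> \<in> borel_measurable borel"
  by (simp add: bump_smooth smooth_borel)

lemma bump_outside: "bump p q \<alpha> \<Longrightarrow> x \<notin> {p<..<q} \<Longrightarrow> \<alpha> x = 0"
  unfolding bump_def by force

lemma bump_bounded: assumes "bump p q \<alpha>" shows "\<exists>B. \<forall>x. \<bar>\<alpha> x\<bar> \<le> B"
proof -
  have "bounded (\<alpha> ` {p..q})"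
    using assms by (intro compact_imp_bounded compact_continuous_image smooth_continuous_on bump_smooth) auto
  then obtain B where B: "\<And>x. x \<in> {p..q} \<Longrightarrow> \<bar>\<alpha> x\<bar> \<le> B" unfolding bounded_iff by fastforce
  have "\<bar>\<alpha> x\<bar> \<le> max B 0" for x
    using B[of x] bump_outside[OF assms, of x] by (cases "x \<in> {p<..<q}") auto
  then show ?thesis by blast
qed

lemma bump_add: "bump p q f \<Longrightarrow> bump p q g \<Longrightarrow> bump p q (\<lambda>x. f x + g x)"
proof -
  assume f: "bump p q f" and g: "bump p q g"
  obtain c d c' d' where "p < c" "d < q" "p < c'" "d' < q" "\<And>x. x \<notin> {c..d} \<Longrightarrow> f x = 0" "\<And>x. x \<notin> {c'..d'} \<Longrightarrow> g x = 0"
    using f g unfolding bump_def by blast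
  then have "p < min c c'" "max d d' < q" "\<forall>x. x \<notin> {min c c'..max d d'} \<longrightarrow> f x + g x = 0"
    by (auto simp: min_def max_def split: if_splits)
  with f g show ?thesis unfolding bump_def by (blast intro: smooth_add)
qed

lemma bump_cmult: "bump p q f \<Longrightarrow> bump p q (\<lambda>x. k * f x)"
  unfolding bump_def by (metis smooth_cmult mult_zero_right)

lemma bump_mono: "bump p q f \<Longrightarrow> p' \<le> p \<Longrightarrow> q \<le> q' \<Longrightarrow> bump p' q' f"
  unfolding bump_def by (meson order_le_less_trans order_less_le_trans)

lemma bump_deriv: assumes "bump p q f" shows "bump p q (deriv f)"
proof -
  obtain c d where cd: "p < c" "d < q" "\<And>x. x \<notin> {c..d} \<Longrightarrow> f x = 0" "smooth f"
    using assms unfolding bump_def by blast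
  have "deriv f x = 0" if "x \<notin> {c..d}" for x
  proof (rule DERIV_imp_deriv)
    have "((\<lambda>_. 0) has_real_derivative 0) (at x)" by simp
    then show "(f has_real_derivative 0) (at x)"
      by (rule has_field_derivative_transform_within_open[where S = "- {c..d}"]) (use that cd(3) in auto)
  qed
  with cd show ?thesis unfolding bump_def by (auto intro: smooth_deriv)
qed

definition hat :: "real \<Rightarrow> real \<Rightarrow> real \<Rightarrow> real" where
  "hat c d x = flat 1 (x - c) * flat 1 (d - x)"

lemma smooth_hat: "smooth (hat c d)"
  unfolding hat_def[abs_def]
  using smooth_mult[OF smooth_affine[OF smooth_flat, of 1 1 "-c"] smooth_affine[OF smooth_flat, of 1 "-1" d]]
  by (simp add: algebra_simps)

lemma hat_range: "x \<in> {c<..<d} \<Longrightarrow> 0 < hat c d x" "x \<notin> {c<..<d} \<Longrightarrow> hat c d x = 0" "0 \<le> hat c d x" "hat c d x \<le> 1"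
  by (auto simp: hat_def flat_def mult_le_one)

text \<open>
  As \<open>n\<close> grows these bumps tend boundedly to the indicator of the open interval,
  since \<open>hat\<close> lies in \<open>(0, 1]\<close> there.
\<close>
definition plateau :: "real \<Rightarrow> real \<Rightarrow> nat \<Rightarrow> real \<Rightarrow> real" where
  "plateau c d n x = 1 - (1 - hat c d x) ^ n"

lemma bump_plateau: "p < c \<Longrightarrow> d < q \<Longrightarrow> bump p q (plateau c d n)"
  unfolding bump_def plateau_def[abs_def]
  by (intro conjI smooth_diff smooth_const smooth_power smooth_hat exI[of _ c] exI[of _ d])
    (auto simp: hat_range)

lemma plateau_range: "\<bar>plateau c d n x\<bar> \<le> 1"
  using hat_range(3,4)[of c d x] by (simp add: plateau_def power_le_one)

lemma plateau_tendsto: "(\<lambda>n. plateau c d n x) \<longlonglongrightarrow> indicator {c<..<d} x"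
proof (cases "x \<in> {c<..<d}")
  case True
  have "(\<lambda>n. (1 - hat c d x) ^ n) \<longlonglongrightarrow> 0"
    using hat_range(1)[OF True] hat_range(4)[of c d x] by (intro LIMSEQ_realpow_zero) auto
  from tendsto_diff[OF tendsto_const[of 1] this] True show ?thesis by (simp add: plateau_def)
next
  case False
  then show ?thesis by (simp add: plateau_def hat_range)
qed

text \<open>
  An antiderivative is constant on either side of the support, and the vanishing integral makes
  the two constants equal.
\<close>
lemma bump_antiderivative:
  assumes a: "bump p q \<alpha>" and 0: "(\<integral>x. \<alpha> x \<partial>lborel) = 0"
  shows "\<exists>\<kappa>. bump p q \<kappa> \<and> deriv \<kappa> = \<alpha>"
proof -
  obtain c d where cd: "p < c" "d < q" "\<And>x. x \<notin> {c..d} \<Longrightarrow> \<alpha> x = 0"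
    using a unfolding bump_def by blast
  show ?thesis
  proof (cases "c \<le> d")
    case False
    then have "\<alpha> = (\<lambda>_. 0)" using cd(3) by auto
    then show ?thesis using a by (intro exI[of _ "\<lambda>_. 0"]) auto
  next
    case True
    have cont: "isCont \<alpha> x" for x by (rule smooth_isCont[OF bump_smooth[OF a]])
    obtain F where F: "\<And>x. (F has_vector_derivative \<alpha> x) (at x)"
      using einterval_antiderivative[of "-\<infinity>" \<infinity> \<alpha>] cont by auto
    then have F': "(F has_real_derivative \<alpha> x) (at x)" for x
      by (simp add: has_real_derivative_iff_has_vector_derivative)
    have left: "F x = F c" if "x \<le> c" for x
    proof (cases "x = c")
      case False
      then have "x < c" using that by simp
      moreover have "continuous_on {x..c} F" using F' by (meson DERIV_continuous_on has_field_derivative_at_within)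
      moreover have "(F has_real_derivative 0) (at y)" if "x < y" "y < c" for y
        using F'[of y] cd(3)[of y] that by simp
      ultimately show ?thesis using DERIV_isconst_end[of x c F] by simp
    qed simp
    have right: "F x = F d" if "d \<le> x" for x
    proof (cases "x = d")
      case False
      then have "d < x" using that by simp
      moreover have "continuous_on {d..x} F" using F' by (meson DERIV_continuous_on has_field_derivative_at_within)
      moreover have "(F has_real_derivative 0) (at y)" if "d < y" "y < x" for y
        using F'[of y] cd(3)[of y] that by simp
      ultimately show ?thesis using DERIV_isconst_end[of d x F] by simp
    qed simp
    have "F d - F c = (\<integral>x. indicator {c..d} x *\<^sub>R \<alpha> x \<partial>lborel)"
      by (rule integral_FTC_Icc[OF True, symmetric])
        (use F cont in \<open>auto intro: has_vector_derivative_at_within continuous_at_imp_continuous_on\<close>)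
    also have "\<dots> = (\<integral>x. \<alpha> x \<partial>lborel)"
      using cd(3) by (intro Bochner_Integration.integral_cong) (auto simp: indicator_def)
    finally have Fd: "F d = F c" using 0 by simp
    define \<kappa> where "\<kappa> x = F x - F c" for x
    have d\<kappa>: "(\<kappa> has_real_derivative \<alpha> x) (at x)" for x
      unfolding \<kappa>_def[abs_def] using F' by (auto intro!: derivative_eq_intros)
    have "smooth \<kappa>"
      by (rule smooth_coinduct[where P = "\<lambda>g. g = \<kappa> \<or> smooth g"])
        (use d\<kappa> bump_smooth[OF a] smooth_deriv smooth_has_derivative in blast)+
    moreover have "\<kappa> x = 0" if "x \<notin> {c..d}" for x
      using left[of x] right[of x] Fd that by (auto simp: \<kappa>_def)
    ultimately have "bump p q \<kappa>" using cd unfolding bump_def by blast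
    moreover have "deriv \<kappa> = \<alpha>" using d\<kappa> by (auto simp: DERIV_imp_deriv)
    ultimately show ?thesis by blast
  qed
qed

section \<open>Completeness of spaces of square integrable functions\<close>

text \<open>
  The pointwise structure, by which sets of functions become instances of the abstract spaces
  above.
\<close>
instantiation "fun" :: (type, real_vector) real_vector
begin
definition scaleR_fun :: "real \<Rightarrow> ('a \<Rightarrow> 'b) \<Rightarrow> 'a \<Rightarrow> 'b" where
  "scaleR_fun c f = (\<lambda>x. c *\<^sub>R f x)"
instance
  by standard (simp_all add: scaleR_fun_def fun_eq_iff plus_fun_def algebra_simps)
end

lemma fun_ops: "f + g = (\<lambda>x. f x + g x)" "f - g = (\<lambda>x. f x - g x)" "c *\<^sub>R f = (\<lambda>x. c *\<^sub>R f x)"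
  "(0 :: 'a \<Rightarrow> 'b :: real_vector) = (\<lambda>_. 0)"
  for f g :: "'a \<Rightarrow> 'b :: real_vector"
  by (auto simp: fun_eq_iff plus_fun_def fun_diff_def scaleR_fun_def zero_fun_def)

text \<open>
  The space \<open>L2_space\<close> for an arbitrary measure.
\<close>
definition L2 :: "'a measure \<Rightarrow> ('a \<Rightarrow> real) set" where
  "L2 M = {f \<in> borel_measurable M. integrable M (\<lambda>x. (f x)\<^sup>2)}"

definition ip2 :: "'a measure \<Rightarrow> ('a \<Rightarrow> real) \<Rightarrow> ('a \<Rightarrow> real) \<Rightarrow> real" where
  "ip2 M f g = (\<integral>x. f x * g x \<partial>M)"

lemma L2_measurable [measurable_dest]: "f \<in> L2 M \<Longrightarrow> f \<in> borel_measurable M" by (simp add: L2_def)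

lemma L2_square_integrable: "f \<in> L2 M \<Longrightarrow> integrable M (\<lambda>x. (f x)\<^sup>2)" by (simp add: L2_def)

lemma L2_mult_integrable:
  assumes "f \<in> L2 M" "g \<in> L2 M" shows "integrable M (\<lambda>x. f x * g x)"
proof (rule Bochner_Integration.integrable_bound)
  show "integrable M (\<lambda>x. (f x)\<^sup>2 + (g x)\<^sup>2)"
    using assms by (intro Bochner_Integration.integrable_add L2_square_integrable)
  have "\<bar>x * y\<bar> \<le> x\<^sup>2 + y\<^sup>2" for x y :: real
  proof -
    have "2 * (\<bar>x\<bar> * \<bar>y\<bar>) \<le> x\<^sup>2 + y\<^sup>2" "0 \<le> \<bar>x\<bar> * \<bar>y\<bar>"
      using zero_le_power2[of "\<bar>x\<bar> - \<bar>y\<bar>"] by (auto simp: power2_diff)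
    then show ?thesis unfolding abs_mult by linarith
  qed
  then show "AE x in M. norm (f x * g x) \<le> norm ((f x)\<^sup>2 + (g x)\<^sup>2)" by simp
qed (use assms in measurable)

lemma L2_add: "f \<in> L2 M \<Longrightarrow> g \<in> L2 M \<Longrightarrow> (\<lambda>x. f x + g x) \<in> L2 M"
proof -
  assume f: "f \<in> L2 M" and g: "g \<in> L2 M"
  have "integrable M (\<lambda>x. (f x)\<^sup>2 + (g x)\<^sup>2 + 2 * (f x * g x))"
    by (intro Bochner_Integration.integrable_add integrable_mult_right L2_square_integrable L2_mult_integrable f g)
  then have "integrable M (\<lambda>x. (f x + g x)\<^sup>2)" by (simp add: power2_sum mult.assoc)
  with f g show ?thesis by (simp add: L2_def borel_measurable_add)
qed

lemma L2_cmult: "f \<in> L2 M \<Longrightarrow> (\<lambda>x. c * f x) \<in> L2 M"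
  unfolding L2_def by (auto simp: power_mult_distrib)

lemma L2_diff: "f \<in> L2 M \<Longrightarrow> g \<in> L2 M \<Longrightarrow> (\<lambda>x. f x - g x) \<in> L2 M"
  using L2_add[of f M "\<lambda>x. (-1) * g x"] L2_cmult[of g M "-1"] by simp

lemma L2_zero: "(\<lambda>_. 0) \<in> L2 M" by (simp add: L2_def)

lemma L2_bounded:
  assumes "finite_measure M" "f \<in> borel_measurable M" "\<And>x. x \<in> space M \<Longrightarrow> \<bar>f x\<bar> \<le> B"
  shows "f \<in> L2 M"
proof -
  interpret finite_measure M by fact
  have "integrable M (\<lambda>x. (f x)\<^sup>2)"
  proof (rule integrable_const_bound[of _ "B\<^sup>2"])
    show "AE x in M. norm ((f x)\<^sup>2) \<le> B\<^sup>2"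
      using order_trans[OF assms(3) abs_ge_self] by (intro AE_I2) (simp add: abs_le_square_iff[symmetric])
  qed (use assms(2) in measurable)
  with assms(2) show ?thesis by (simp add: L2_def)
qed

lemma L2_integrable:
  assumes "finite_measure M" "f \<in> L2 M" shows "integrable M f"
  using L2_mult_integrable[OF assms(2) L2_bounded[of M "\<lambda>_. 1" 1]] assms(1) by simp

lemma L2_cong_AE:
  assumes "AE x in M. f x = g x" "g \<in> L2 M" "f \<in> borel_measurable M" shows "f \<in> L2 M"
proof -
  have "integrable M (\<lambda>x. (f x)\<^sup>2) \<longleftrightarrow> integrable M (\<lambda>x. (g x)\<^sup>2)"
    using assms by (intro integrable_cong_AE) auto
  with assms show ?thesis by (simp add: L2_def)
qed

interpretation L2: semi_inner "L2 M" "ip2 M" for M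
proof
  show "subspace (L2 M)"
    by (intro subspaceI) (auto simp: fun_ops L2_zero L2_add L2_cmult)
  fix u v w :: "'a \<Rightarrow> real" and c
  assume u: "u \<in> L2 M"
  { assume v: "v \<in> L2 M" and w: "w \<in> L2 M"
    show "ip2 M (u + v) w = ip2 M u w + ip2 M v w"
      unfolding ip2_def fun_ops distrib_right
      by (intro Bochner_Integration.integral_add L2_mult_integrable u v w) }
  { assume w: "w \<in> L2 M"
    show "ip2 M (c *\<^sub>R u) w = c * ip2 M u w" by (simp add: ip2_def fun_ops mult.assoc) }
  { assume v: "v \<in> L2 M"
    show "ip2 M u v = ip2 M v u" by (simp add: ip2_def mult.commute) }
  show "0 \<le> ip2 M u u" by (simp add: ip2_def)
qed

lemma ip2_self: "ip2 M f f = (\<integral>x. (f x)\<^sup>2 \<partial>M)" by (simp add: ip2_def power2_eq_square)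

lemma ip2_cong_AE:
  assumes "AE x in M. f x = f' x" "AE x in M. g x = g' x"
    "f \<in> borel_measurable M" "f' \<in> borel_measurable M" "g \<in> borel_measurable M" "g' \<in> borel_measurable M"
  shows "ip2 M f g = ip2 M f' g'"
  unfolding ip2_def using assms by (intro integral_cong_AE) auto

text \<open>
  The series of \<open>2 ^ k\<close> times the squared increments has a finite integral, so it
  converges almost everywhere. An increment is at most \<open>2 ^ k\<close> times its square
  plus \<open>(1 / 2) ^ k\<close>; thus the increments are summable on spaces of any total
  measure.
\<close>
lemma fast_subsequence_converges_AE:
  fixes f :: "nat \<Rightarrow> 'a \<Rightarrow> real"
  assumes f: "\<And>n. f n \<in> L2 M" and fast: "\<And>k. ip2 M (f (Suc k) - f k) (f (Suc k) - f k) \<le> (1 / 4) ^ k"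
  shows "AE x in M. convergent (\<lambda>n. f n x)"
proof -
  have [measurable]: "f n \<in> borel_measurable M" for n using f by (rule L2_measurable)
  let ?d = "\<lambda>k x. f (Suc k) x - f k x"
  have "(\<integral>\<^sup>+ x. (\<Sum>k. ennreal (2 ^ k * (?d k x)\<^sup>2)) \<partial>M) = (\<Sum>k. (\<integral>\<^sup>+ x. ennreal (2 ^ k * (?d k x)\<^sup>2) \<partial>M))"
    by (intro nn_integral_suminf) measurable
  also have "\<dots> \<le> (\<Sum>k. ennreal ((1 / 2) ^ k))"
  proof (intro suminf_le allI)
    fix k
    have "(\<integral>\<^sup>+ x. ennreal (2 ^ k * (?d k x)\<^sup>2) \<partial>M) = ennreal (\<integral>x. 2 ^ k * (?d k x)\<^sup>2 \<partial>M)"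
      using L2_square_integrable[OF L2_diff[OF f f]] by (intro nn_integral_eq_integral) auto
    also have "(\<integral>x. 2 ^ k * (?d k x)\<^sup>2 \<partial>M) \<le> (1 / 2) ^ k"
    proof -
      have "(\<integral>x. 2 ^ k * (?d k x)\<^sup>2 \<partial>M) = 2 ^ k * ip2 M (f (Suc k) - f k) (f (Suc k) - f k)"
        by (simp add: ip2_self fun_ops)
      also have "\<dots> \<le> 2 ^ k * (1 / 4) ^ k" using fast by (intro mult_left_mono) auto
      also have "\<dots> = (1 / 2) ^ k" by (simp add: power_mult_distrib[symmetric])
      finally show ?thesis .
    qed
    finally show "(\<integral>\<^sup>+ x. ennreal (2 ^ k * (?d k x)\<^sup>2) \<partial>M) \<le> ennreal ((1 / 2) ^ k)" by (simp add: ennreal_leI)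
  qed auto
  also have "\<dots> < top"
    by (subst suminf_ennreal2) (auto intro!: summable_geometric)
  finally have "AE x in M. (\<Sum>k. ennreal (2 ^ k * (?d k x)\<^sup>2)) \<noteq> \<infinity>"
    by (intro nn_integral_PInf_AE) auto
  then show ?thesis
  proof (eventually_elim)
    case (elim x)
    have s: "summable (\<lambda>k. 2 ^ k * (?d k x)\<^sup>2)"
      by (rule summable_suminf_not_top) (use elim in auto)
    have "summable (\<lambda>k. 2 ^ k * (?d k x)\<^sup>2 + (1 / 2) ^ k)"
      by (intro summable_add s) (auto intro!: summable_geometric)
    then have "summable (\<lambda>k. ?d k x)"
    proof (rule summable_comparison_test')
      fix k :: nat assume "0 \<le> k"
      have "2 * \<bar>?d k x\<bar> = 2 ^ k * (2 * \<bar>?d k x\<bar> * (1 / 2) ^ k)" by (simp add: power_divide)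
      also have "\<dots> \<le> 2 ^ k * ((?d k x)\<^sup>2 + ((1 / 2) ^ k)\<^sup>2)"
        using zero_le_power2[of "\<bar>?d k x\<bar> - (1 / 2) ^ k"] by (intro mult_left_mono) (auto simp: power2_diff)
      also have "\<dots> = 2 ^ k * (?d k x)\<^sup>2 + (1 / 2) ^ k"
        by (simp add: distrib_left power2_eq_square power_mult_distrib[symmetric] mult.assoc[symmetric])
      finally have le: "2 * \<bar>?d k x\<bar> \<le> 2 ^ k * (?d k x)\<^sup>2 + (1 / 2) ^ k" .
      have "norm (?d k x) \<le> 2 * \<bar>?d k x\<bar>" by simp
      with le show "norm (?d k x) \<le> 2 ^ k * (?d k x)\<^sup>2 + (1 / 2) ^ k" by (rule order_trans[rotated])
    qed
    then have "convergent (\<lambda>n. \<Sum>k<n. ?d k x)" by (simp add: summable_iff_convergent)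
    then have "convergent (\<lambda>n. f n x - f 0 x)" using sum_lessThan_telescope[of "\<lambda>k. f k x"] by simp
    from convergent_add[OF this convergent_const[of "f 0 x"]] show ?case by simp
  qed
qed

text \<open>
  Riesz--Fischer: the pointwise limit of a rapidly convergent subsequence is the limit of the
  whole sequence, by Fatou's lemma.
\<close>
theorem L2_complete:
  fixes f :: "nat \<Rightarrow> 'a \<Rightarrow> real"
  assumes f: "\<And>n. f n \<in> L2 M"
    and cauchy: "\<And>e. 0 < e \<Longrightarrow> \<exists>N. \<forall>m\<ge>N. \<forall>n\<ge>N. ip2 M (f m - f n) (f m - f n) < e"
  shows "\<exists>g\<in>L2 M. (\<lambda>n. ip2 M (f n - g) (f n - g)) \<longlonglongrightarrow> 0"
proof -
  have [measurable]: "f n \<in> borel_measurable M" for n using f by (rule L2_measurable)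
  have "\<exists>N. \<forall>m\<ge>N. \<forall>n\<ge>N. ip2 M (f m - f n) (f m - f n) < (1 / 4) ^ k" for k by (rule cauchy) simp
  then obtain N where N: "\<And>k m n. \<lbrakk>N k \<le> m; N k \<le> n\<rbrakk> \<Longrightarrow> ip2 M (f m - f n) (f m - f n) < (1 / 4) ^ k" by metis
  define r where "r k = (\<Sum>j\<le>k. N j) + k" for k
  have r: "N k \<le> r k" "N k \<le> r (Suc k)" "k \<le> r k" for k
    using member_le_sum[of k "{..k}" N] by (auto simp: r_def)
  have conv: "AE x in M. convergent (\<lambda>n. f (r n) x)"
    by (rule fast_subsequence_converges_AE) (use f N r in \<open>auto intro: less_imp_le\<close>)
  define g where "g x = lim (\<lambda>n. f (r n) x)" for x
  have g_meas [measurable]: "g \<in> borel_measurable M" unfolding g_def[abs_def] by measurable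
  have fatou: "(\<integral>\<^sup>+ x. ennreal ((f m x - g x)\<^sup>2) \<partial>M) \<le> ennreal e"
    if e: "0 < e" "\<And>n. N0 \<le> n \<Longrightarrow> ip2 M (f m - f n) (f m - f n) < e" for m e N0
  proof -
    have "(\<integral>\<^sup>+ x. ennreal ((f m x - g x)\<^sup>2) \<partial>M) = (\<integral>\<^sup>+ x. liminf (\<lambda>n. ennreal ((f m x - f (r n) x)\<^sup>2)) \<partial>M)"
    proof (rule nn_integral_cong_AE)
      show "AE x in M. ennreal ((f m x - g x)\<^sup>2) = liminf (\<lambda>n. ennreal ((f m x - f (r n) x)\<^sup>2))"
        using conv
      proof eventually_elim
        case (elim x)
        then have "(\<lambda>n. f (r n) x) \<longlonglongrightarrow> g x" by (simp add: g_def convergent_LIMSEQ_iff)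
        then have "(\<lambda>n. ennreal ((f m x - f (r n) x)\<^sup>2)) \<longlonglongrightarrow> ennreal ((f m x - g x)\<^sup>2)"
          by (intro tendsto_ennrealI tendsto_intros)
        then show ?case using lim_imp_Liminf[OF sequentially_bot] by metis
      qed
    qed
    also have "\<dots> \<le> liminf (\<lambda>n. \<integral>\<^sup>+ x. ennreal ((f m x - f (r n) x)\<^sup>2) \<partial>M)"
      by (rule nn_integral_liminf) measurable
    also have "\<dots> \<le> ennreal e"
    proof (rule Liminf_le)
      show "\<forall>\<^sub>F n in sequentially. (\<integral>\<^sup>+ x. ennreal ((f m x - f (r n) x)\<^sup>2) \<partial>M) \<le> ennreal e"
        using eventually_ge_at_top[of N0]
      proof eventually_elim
        case (elim n)
        have "(\<integral>\<^sup>+ x. ennreal ((f m x - f (r n) x)\<^sup>2) \<partial>M) = ennreal (ip2 M (f m - f (r n)) (f m - f (r n)))"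
          unfolding ip2_self fun_ops using L2_square_integrable[OF L2_diff[OF f f]]
          by (intro nn_integral_eq_integral) auto
        also have "\<dots> \<le> ennreal e" using e(2)[of "r n"] elim r(3)[of n] by (intro ennreal_leI) simp
        finally show ?case .
      qed
    qed simp
    finally show ?thesis .
  qed
  have close: "(\<lambda>x. f m x - g x) \<in> L2 M" "ip2 M (f m - g) (f m - g) \<le> e"
    if e: "0 < e" "\<And>n. N0 \<le> n \<Longrightarrow> ip2 M (f m - f n) (f m - f n) < e" for m e N0
  proof -
    have fat: "(\<integral>\<^sup>+ x. ennreal ((f m x - g x)\<^sup>2) \<partial>M) \<le> ennreal e" by (rule fatou[OF e(1)]) (rule e(2))
    have "integrable M (\<lambda>x. (f m x - g x)\<^sup>2)"
      by (rule integrableI_nonneg) (use fat in \<open>auto elim: le_less_trans\<close>)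
    then show "(\<lambda>x. f m x - g x) \<in> L2 M" by (simp add: L2_def)
    have "ennreal (\<integral>x. (f m x - g x)\<^sup>2 \<partial>M) \<le> ennreal e"
      using fat \<open>integrable M _\<close> by (simp add: nn_integral_eq_integral)
    then show "ip2 M (f m - g) (f m - g) \<le> e" using e(1) by (simp add: ip2_self fun_ops)
  qed
  obtain N1 where "\<And>m n. \<lbrakk>N1 \<le> m; N1 \<le> n\<rbrakk> \<Longrightarrow> ip2 M (f m - f n) (f m - f n) < 1"
    using cauchy[of 1] by auto
  then have "(\<lambda>x. f N1 x - g x) \<in> L2 M" by (intro close(1)[of 1 N1]) auto
  from L2_diff[OF f[of N1] this] have g: "g \<in> L2 M" by simp
  have "(\<lambda>n. ip2 M (f n - g) (f n - g)) \<longlonglongrightarrow> 0"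
  proof (rule LIMSEQ_I)
    fix e :: real assume e: "0 < e"
    obtain N2 where N2: "\<And>m n. \<lbrakk>N2 \<le> m; N2 \<le> n\<rbrakk> \<Longrightarrow> ip2 M (f m - f n) (f m - f n) < e / 2"
      using cauchy[of "e / 2"] e by auto
    have "norm (ip2 M (f m - g) (f m - g) - 0) < e" if "N2 \<le> m" for m
    proof -
      have "ip2 M (f m - g) (f m - g) \<le> e / 2" using e that N2 by (intro close(2)[of _ N2]) auto
      then show ?thesis using e by (simp add: ip2_self)
    qed
    then show "\<exists>no. \<forall>n\<ge>no. norm (ip2 M (f n - g) (f n - g) - 0) < e" by blast
  qed
  with g show ?thesis by blast
qed

section \<open>The fundamental lemma on a rectangle\<close>

text \<open>
  Lebesgue measure on an open interval, as a measure on the whole line: measurability then does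
  not depend on the end points.
\<close>
definition seg :: "real \<Rightarrow> real \<Rightarrow> real measure" where
  "seg p q = density lborel (\<lambda>x. ennreal (indicator {p<..<q} x))"

definition rect :: "real \<Rightarrow> real \<Rightarrow> real \<Rightarrow> real \<Rightarrow> (real \<times> real) measure" where
  "rect p q r s = seg p q \<Otimes>\<^sub>M seg r s"

lemma sets_seg [simp, measurable_cong]: "sets (seg p q) = sets borel" by (simp add: seg_def)
lemma space_seg [simp]: "space (seg p q) = UNIV" by (simp add: seg_def)

lemma emeasure_seg_UNIV: "emeasure (seg p q) UNIV = ennreal (max 0 (q - p))"
proof -
  have "emeasure (seg p q) UNIV = (\<integral>\<^sup>+x. ennreal (indicator {p<..<q} x) \<partial>lborel)"
    unfolding seg_def by (subst emeasure_density) auto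
  also have "\<dots> = emeasure lborel {p<..<q}" by (simp add: ennreal_indicator)
  also have "\<dots> = ennreal (max 0 (q - p))" by (cases "p \<le> q") (auto simp: max_def)
  finally show ?thesis .
qed

interpretation seg: finite_measure "seg p q" for p q
  by standard (simp add: emeasure_seg_UNIV)

interpretation rect: pair_sigma_finite "seg p q" "seg r s" for p q r s ..

lemma measure_seg [simp]: "p \<le> q \<Longrightarrow> measure (seg p q) UNIV = q - p"
  by (simp add: measure_def emeasure_seg_UNIV)

lemma AE_seg: "(AE x in seg p q. P x) \<longleftrightarrow> (AE x in lborel. x \<in> {p<..<q} \<longrightarrow> P x)"
  unfolding seg_def by (subst AE_density) (auto simp: indicator_def)

lemma AE_seg_in: "AE x in seg p q. p < x \<and> x < q"
  by (simp add: AE_seg)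

lemma integrable_seg: "f \<in> borel_measurable borel \<Longrightarrow> integrable (seg p q) f \<longleftrightarrow> integrable lborel (\<lambda>x. indicator {p<..<q} x * f x :: real)"
  unfolding seg_def by (subst integrable_density) auto

lemma integral_seg: "f \<in> borel_measurable borel \<Longrightarrow> integral\<^sup>L (seg p q) f = (\<integral>x. indicator {p<..<q} x * f x \<partial>lborel :: real)"
  unfolding seg_def by (subst integral_density) auto

lemma sets_rect [simp, measurable_cong]: "sets (rect p q r s) = sets borel"
  unfolding rect_def borel_prod[symmetric] by (intro sets_pair_measure_cong) auto
lemma space_rect [simp]: "space (rect p q r s) = UNIV" by (simp add: rect_def space_pair_measure)

interpretation rectf: finite_measure "rect p q r s" for p q r s
proof
  have "emeasure (rect p q r s) (UNIV \<times> UNIV) = emeasure (seg p q) UNIV * emeasure (seg r s) UNIV"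
    unfolding rect_def by (intro seg.emeasure_pair_measure_Times) auto
  then show "emeasure (rect p q r s) (space (rect p q r s)) \<noteq> \<infinity>"
    by (simp add: emeasure_seg_UNIV ennreal_mult_eq_top_iff)
qed

lemma rect_borel [measurable]: "{p<..<q} \<times> {r<..<s} \<in> sets (borel :: (real \<times> real) measure)"
  by (intro borel_open open_Times) auto

lemma rect_density: "rect p q r s = density lborel (\<lambda>z. ennreal (indicator ({p<..<q} \<times> {r<..<s}) z))"
proof -
  have "sigma_finite_measure (seg r s)" by unfold_locales
  then have "rect p q r s = density (lborel \<Otimes>\<^sub>M lborel) (\<lambda>(x, y). ennreal (indicator {p<..<q} x) * ennreal (indicator {r<..<s} y))"
    unfolding rect_def seg_def
    by (intro pair_measure_density) (auto intro: sigma_finite_lborel)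
  also have "(\<lambda>(x, y). ennreal (indicator {p<..<q} x) * ennreal (indicator {r<..<s} y))
      = (\<lambda>z. ennreal (indicator ({p<..<q} \<times> {r<..<s}) z))"
    by (auto simp: indicator_def fun_eq_iff)
  finally show ?thesis by (simp add: lborel_prod)
qed

lemma integrable_rect: "f \<in> borel_measurable borel \<Longrightarrow>
    integrable (rect p q r s) f \<longleftrightarrow> integrable lborel (\<lambda>x. indicator ({p<..<q} \<times> {r<..<s}) x * f x :: real)"
  unfolding rect_density by (subst integrable_density) auto

lemma integral_rect: "f \<in> borel_measurable borel \<Longrightarrow>
    integral\<^sup>L (rect p q r s) f = (\<integral>x. indicator ({p<..<q} \<times> {r<..<s}) x * f x \<partial>lborel :: real)"
  unfolding rect_density by (subst integral_density) auto

lemma AE_rect: "(AE z in rect p q r s. P z) \<longleftrightarrow> (AE z in lborel. z \<in> {p<..<q} \<times> {r<..<s} \<longrightarrow> P z)"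
  unfolding rect_density by (subst AE_density, measurable) (simp add: indicator_def)

lemma AE_rect_in: "AE z in rect p q r s. z \<in> {p<..<q} \<times> {r<..<s}"
  by (simp add: AE_rect)

lemma box_prod_real: "box (a, c) (b, d) = {a<..<b} \<times> {c<..<d :: real}" for a b :: real
  by (force simp: box_def Basis_prod_def)

text \<open>
  Products of plateaus tend boundedly to indicators of boxes, so the integral of
  \<open>f\<close> over every box is 0, and by Dynkin's theorem over every Borel set. Product
  test functions suffice, which is what permits the use of Fubini's theorem later.
\<close>
lemma fundamental_lemma:
  assumes f: "integrable (rect p q r s) f"
    and 0: "\<And>\<alpha> \<beta>. \<lbrakk>bump p q \<alpha>; bump r s \<beta>\<rbrakk> \<Longrightarrow> (\<integral>z. f z * (\<alpha> (fst z) * \<beta> (snd z)) \<partial>rect p q r s) = 0"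
  shows "AE z in rect p q r s. f z = (0 :: real)"
proof -
  let ?M = "rect p q r s"
  have [measurable]: "f \<in> borel_measurable borel" using borel_measurable_integrable[OF f] by simp
  have [measurable]: "fst \<in> borel_measurable (borel :: (real \<times> real) measure)" "snd \<in> borel_measurable (borel :: (real \<times> real) measure)"
    by (auto simp: borel_prod[symmetric])
  have dom: "(\<integral>z. f z * (g (fst z) * h (snd z)) \<partial>?M) = 0"
    if G: "\<And>n z. z \<in> {p<..<q} \<times> {r<..<s} \<Longrightarrow> \<bar>G n (fst z)\<bar> \<le> 1 \<and> \<bar>H n (snd z)\<bar> \<le> 1"
      and lim: "\<And>z. z \<in> {p<..<q} \<times> {r<..<s} \<Longrightarrow> (\<lambda>n. G n (fst z)) \<longlonglongrightarrow> g (fst z) \<and> (\<lambda>n. H n (snd z)) \<longlonglongrightarrow> h (snd z)"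
      and meas: "\<And>n. G n \<in> borel_measurable borel" "\<And>n. H n \<in> borel_measurable borel" "g \<in> borel_measurable borel" "h \<in> borel_measurable borel"
      and eq: "\<And>n. (\<integral>z. f z * (G n (fst z) * H n (snd z)) \<partial>?M) = 0"
    for G H :: "nat \<Rightarrow> real \<Rightarrow> real" and g h
  proof -
    note [measurable] = meas
    have "(\<lambda>n. \<integral>z. f z * (G n (fst z) * H n (snd z)) \<partial>?M) \<longlonglongrightarrow> (\<integral>z. f z * (g (fst z) * h (snd z)) \<partial>?M)"
    proof (rule integral_dominated_convergence[where w = "\<lambda>z. \<bar>f z\<bar>"])
      show "AE z in ?M. (\<lambda>n. f z * (G n (fst z) * H n (snd z))) \<longlonglongrightarrow> f z * (g (fst z) * h (snd z))"
        using AE_rect_in by eventually_elim (use lim in \<open>auto intro!: tendsto_intros\<close>)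
      show "AE z in ?M. norm (f z * (G n (fst z) * H n (snd z))) \<le> \<bar>f z\<bar>" for n
        using AE_rect_in
      proof eventually_elim
        case (elim z)
        have "\<bar>G n (fst z)\<bar> * \<bar>H n (snd z)\<bar> \<le> 1" using G[OF elim, of n] by (intro mult_le_one) auto
        then show ?case by (simp add: abs_mult mult_left_le)
      qed
    qed (use f in auto)
    with eq show ?thesis using LIMSEQ_unique[OF _ tendsto_const] by simp
  qed
  have inner: "(\<integral>z. f z * (indicator {c<..<d} (fst z) * indicator {e<..<g} (snd z)) \<partial>?M) = 0"
    if "p < c" "d < q" "r < e" "g < s" for c d e g
    by (rule dom[of "plateau c d" "plateau e g"])
      (use that plateau_range plateau_tendsto in \<open>auto intro!: 0 bump_plateau simp: bump_borel[OF bump_plateau]\<close>)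
  (* boxes compactly inside the rectangle exhaust the part of an arbitrary box that lies in it *)
  have ev: "(\<lambda>n. indicator {max c (p + 1 / Suc n)<..<min d (q - 1 / Suc n)} x :: real) \<longlonglongrightarrow> indicator {c<..<d} x"
    if "p < x" "x < q" for c d p q x :: real
  proof (cases "c < x \<and> x < d")
    case True
    have "(\<lambda>n. p + 1 / Suc n) \<longlonglongrightarrow> p + 0" "(\<lambda>n. q - 1 / Suc n) \<longlonglongrightarrow> q - 0"
      by (intro tendsto_intros LIMSEQ_Suc[OF lim_inverse_n'])+
    then have "\<forall>\<^sub>F n in sequentially. p + 1 / Suc n < x" "\<forall>\<^sub>F n in sequentially. x < q - 1 / Suc n"
      using that by (auto intro: order_tendstoD)
    then have "\<forall>\<^sub>F n in sequentially. indicator {max c (p + 1 / Suc n)<..<min d (q - 1 / Suc n)} x = (indicator {c<..<d} x :: real)"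
      by eventually_elim (use True in \<open>auto simp: indicator_def\<close>)
    then show ?thesis by (rule tendsto_eventually)
  next
    case False
    then have "indicator {max c (p + 1 / Suc n)<..<min d (q - 1 / Suc n)} x = (indicator {c<..<d} x :: real)" for n
      by (auto simp: indicator_def)
    then show ?thesis by simp
  qed
  have box: "(\<integral>z. f z * (indicator {c<..<d} (fst z) * indicator {e<..<g} (snd z)) \<partial>?M) = 0" for c d e g
  proof (rule dom[of "\<lambda>n. indicator {max c (p + 1 / Suc n)<..<min d (q - 1 / Suc n)}"
          "\<lambda>n. indicator {max e (r + 1 / Suc n)<..<min g (s - 1 / Suc n)}"])
    fix n
    show "(\<integral>z. f z * (indicator {max c (p + 1 / Suc n)<..<min d (q - 1 / Suc n)} (fst z) *
        indicator {max e (r + 1 / Suc n)<..<min g (s - 1 / Suc n)} (snd z)) \<partial>?M) = 0"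
      by (rule inner) (auto simp: less_max_iff_disj min_less_iff_disj)
  next
    fix z :: "real \<times> real" assume z: "z \<in> {p<..<q} \<times> {r<..<s}"
    show "(\<lambda>n. indicator {max c (p + 1 / Suc n)<..<min d (q - 1 / Suc n)} (fst z)) \<longlonglongrightarrow> (indicator {c<..<d} (fst z) :: real)
      \<and> (\<lambda>n. indicator {max e (r + 1 / Suc n)<..<min g (s - 1 / Suc n)} (snd z)) \<longlonglongrightarrow> (indicator {e<..<g} (snd z) :: real)"
      using z by (intro conjI ev) auto
  qed (auto simp: indicator_def)
  have sets: "(\<integral>z. indicator A z * f z \<partial>?M) = 0" if A: "A \<in> sets borel" for A
  proof -
    have borel: "sets (borel :: (real \<times> real) measure) = sigma_sets UNIV (range (\<lambda>(a, b). box a b))"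
      by (subst borel_eq_box) simp
    have whole: "(\<integral>z. f z \<partial>?M) = 0"
    proof -
      have "(\<integral>z. f z \<partial>?M) = (\<integral>z. f z * (indicator {p<..<q} (fst z) * indicator {r<..<s} (snd z)) \<partial>?M)"
      proof (intro integral_cong_AE)
        show "AE z in ?M. f z = f z * (indicator {p<..<q} (fst z) * indicator {r<..<s} (snd z))"
          using AE_rect_in[of p q r s] by eventually_elim (auto simp: indicator_def)
      qed measurable
      with box show ?thesis by simp
    qed
    have "Int_stable (range (\<lambda>(a, b). box a b :: (real \<times> real) set))"
      by (auto simp: Int_stable_def box_Int_box)
    moreover have "range (\<lambda>(a, b). box a b :: (real \<times> real) set) \<subseteq> Pow UNIV" by simp
    moreover have "A \<in> sigma_sets UNIV (range (\<lambda>(a, b). box a b))" using A borel by simp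
    ultimately show ?thesis
    proof (induction rule: sigma_sets_induct_disjoint)
      case (basic A)
      then obtain a c b d where "A = box (a, c) (b, d)" by auto
      then have "(\<integral>z. indicator A z * f z \<partial>?M) = (\<integral>z. f z * (indicator {a<..<b} (fst z) * indicator {c<..<d} (snd z)) \<partial>?M)"
        by (intro Bochner_Integration.integral_cong) (auto simp: box_prod_real indicator_def)
      with box show ?case by simp
    next
      case (compl A)
      then have [measurable]: "A \<in> sets borel" by (simp add: borel)
      have "(\<integral>z. indicator (UNIV - A) z * f z \<partial>?M) = (\<integral>z. f z - indicator A z * f z \<partial>?M)"
        by (intro Bochner_Integration.integral_cong) (auto simp: indicator_def)
      also have "\<dots> = (\<integral>z. f z \<partial>?M) - (\<integral>z. indicator A z * f z \<partial>?M)"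
        using integrable_mult_indicator[of A ?M f] f by (intro Bochner_Integration.integral_diff) auto
      finally show ?case using whole compl by simp
    next
      case (union A)
      then have [measurable]: "A i \<in> sets borel" for i by (auto simp: borel)
      have "(LINT z:(\<Union>i. A i)|?M. f z) = (\<Sum>i. (LINT z:(A i)|?M. f z))"
        using union f integrable_mult_indicator[of "\<Union>i. A i" ?M f]
        by (intro lebesgue_integral_countable_add) (auto simp: disjoint_family_on_def set_integrable_def)
      with union show ?case by (simp add: set_lebesgue_integral_def)
    qed simp
  qed
  show ?thesis
    by (rule rectf.density_zero[OF f]) (use sets in \<open>simp add: set_lebesgue_integral_def\<close>)
qed

section \<open>Primitives on an interval\<close>

text \<open>
  The primitive that vanishes at \<open>p\<close>. The upper limit enters through a conditional
  under the integral, so that measurability in \<open>x\<close> and in further parameters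
  follows from the measurability of parametric integrals.
\<close>
definition prim :: "real \<Rightarrow> real \<Rightarrow> (real \<Rightarrow> real) \<Rightarrow> real \<Rightarrow> real" where
  "prim p q g x = (\<integral>t. (if t < x then g t else 0) \<partial>seg p q)"

abbreviation plane :: "(real \<times> real) measure" where "plane \<equiv> borel \<Otimes>\<^sub>M borel"

declare sets_rect [measurable_cong del]

lemma sets_rect_plane [measurable_cong]: "sets (rect p q r s) = sets plane"
  unfolding borel_prod by (rule sets_rect)

lemma borel_plane: "f \<in> borel_measurable borel \<longleftrightarrow> f \<in> borel_measurable plane"
  unfolding borel_prod ..

lemma prim_integrable: "integrable (seg p q) g \<Longrightarrow> integrable (seg p q) (\<lambda>t. if t < x then g t else 0 :: real)"
  by (rule Bochner_Integration.integrable_bound[of _ g]) auto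

lemma prim_bound: "integrable (seg p q) g \<Longrightarrow> \<bar>prim p q g x\<bar> \<le> (\<integral>t. \<bar>g t\<bar> \<partial>seg p q)"
  unfolding prim_def
  by (rule order_trans[OF integral_abs_bound]) (rule integral_mono; use prim_integrable in auto)

lemma prim_borel [measurable]:
  assumes [measurable]: "g \<in> borel_measurable borel"
  shows "prim p q g \<in> borel_measurable borel"
  unfolding prim_def[abs_def] by measurable

lemma prim_section_borel [measurable]:
  assumes [measurable]: "g \<in> borel_measurable plane"
  shows "(\<lambda>z. prim p q (\<lambda>t. g (t, snd z)) (fst z)) \<in> borel_measurable plane"
  unfolding prim_def by measurable

lemma integral_section_borel [measurable]:
  assumes [measurable]: "g \<in> borel_measurable plane"
  shows "(\<lambda>y. \<integral>t. g (t, y) \<partial>seg p q :: real) \<in> borel_measurable borel"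
  by measurable

lemma prim_diff_bound:
  assumes g: "integrable (seg p q) g"
  shows "\<bar>prim p q g x - prim p q g x'\<bar> \<le> (\<integral>t. \<bar>g t\<bar> \<partial>seg p q)"
proof -
  have "prim p q g x - prim p q g x' = (\<integral>t. (if t < x then g t else 0) - (if t < x' then g t else 0) \<partial>seg p q)"
    unfolding prim_def by (intro Bochner_Integration.integral_diff[symmetric] prim_integrable g)
  also have "\<bar>\<dots>\<bar> \<le> (\<integral>t. \<bar>(if t < x then g t else 0) - (if t < x' then g t else 0)\<bar> \<partial>seg p q)" by (rule integral_abs_bound)
  also have "\<dots> \<le> (\<integral>t. \<bar>g t\<bar> \<partial>seg p q)"
    by (rule integral_mono) (use prim_integrable[OF g] g in auto)
  finally show ?thesis .
qed

lemma prim_integrable_outer: "integrable (seg p q) g \<Longrightarrow> integrable (seg p q) (prim p q g)"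
  by (rule seg.integrable_const_bound[of _ "\<integral>t. \<bar>g t\<bar> \<partial>seg p q"])
    (auto intro: prim_bound dest: borel_measurable_integrable)

text \<open>
  Any two values of a primitive of \<open>g\<close> differ by at most the integral of
  \<open>\<bar>g\<bar>\<close>; average over one of them.
\<close>
lemma oscillation_1d:
  assumes pq: "p < q" and f: "integrable (seg p q) f" and g: "integrable (seg p q) g"
    and acl: "AE x in seg p q. f x = c + prim p q g x"
  shows "AE x in seg p q. \<bar>f x - (\<integral>x. f x \<partial>seg p q) / (q - p)\<bar> \<le> (\<integral>t. \<bar>g t\<bar> \<partial>seg p q)"
  using acl
proof eventually_elim
  case (elim x)
  let ?A = "\<integral>t. \<bar>g t\<bar> \<partial>seg p q"
  note [measurable] = borel_measurable_integrable[OF f, simplified] borel_measurable_integrable[OF g, simplified]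
  have "(\<integral>x. f x \<partial>seg p q) = (\<integral>x. c + prim p q g x \<partial>seg p q)"
    using acl by (intro integral_cong_AE) auto
  also have "\<dots> = c * (q - p) + (\<integral>x. prim p q g x \<partial>seg p q)"
    using prim_integrable_outer[OF g] pq by simp
  finally have "f x - (\<integral>x. f x \<partial>seg p q) / (q - p) = prim p q g x - (\<integral>x. prim p q g x \<partial>seg p q) / (q - p)"
    using elim pq by (simp add: add_divide_distrib)
  also have "\<dots> = (\<integral>x'. prim p q g x - prim p q g x' \<partial>seg p q) / (q - p)"
    using prim_integrable_outer[OF g] pq by (simp add: diff_divide_distrib)
  also have "\<bar>\<dots>\<bar> \<le> ?A"
  proof -
    have "\<bar>\<integral>x'. prim p q g x - prim p q g x' \<partial>seg p q\<bar> \<le> (\<integral>x'. \<bar>prim p q g x - prim p q g x'\<bar> \<partial>seg p q)"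
      by (rule integral_abs_bound)
    also have "\<dots> \<le> (\<integral>x'. ?A \<partial>seg p q)"
      using prim_integrable_outer[OF g] prim_diff_bound[OF g] by (intro integral_mono) auto
    finally show ?thesis using pq by (simp add: divide_le_eq mult.commute)
  qed
  finally show ?case .
qed

lemma prim_tendsto:
  assumes g: "integrable (seg p q) g"
  shows "(X \<longlonglongrightarrow> p \<Longrightarrow> (\<lambda>n. prim p q g (X n)) \<longlonglongrightarrow> 0)"
    and "(X \<longlonglongrightarrow> q \<Longrightarrow> (\<lambda>n. prim p q g (X n)) \<longlonglongrightarrow> (\<integral>t. g t \<partial>seg p q))"
proof -
  note [measurable] = borel_measurable_integrable[OF g, simplified]
  have *: "(\<lambda>n. prim p q g (X n)) \<longlonglongrightarrow> (\<integral>t. h t \<partial>seg p q)"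
    if "AE t in seg p q. (\<lambda>n. if t < X n then g t else 0) \<longlonglongrightarrow> h t" "h \<in> borel_measurable borel" for h
    unfolding prim_def
    by (rule integral_dominated_convergence[where w = "\<lambda>t. \<bar>g t\<bar>"]) (use that g in auto)
  { assume X: "X \<longlonglongrightarrow> p"
    have "(\<lambda>n. prim p q g (X n)) \<longlonglongrightarrow> (\<integral>t. 0 \<partial>seg p q)"
    proof (rule *)
      show "AE t in seg p q. (\<lambda>n. if t < X n then g t else 0) \<longlonglongrightarrow> 0"
        using AE_seg_in[of p q]
      proof eventually_elim
        case (elim t)
        then have "\<forall>\<^sub>F n in sequentially. X n < t" using order_tendstoD(2)[OF X] by auto
        then show ?case by (rule tendsto_eventually[OF eventually_mono]) auto
      qed
    qed auto
    then show "(\<lambda>n. prim p q g (X n)) \<longlonglongrightarrow> 0" by simp }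
  { assume X: "X \<longlonglongrightarrow> q"
    show "(\<lambda>n. prim p q g (X n)) \<longlonglongrightarrow> (\<integral>t. g t \<partial>seg p q)"
    proof (rule *)
      show "AE t in seg p q. (\<lambda>n. if t < X n then g t else 0) \<longlonglongrightarrow> g t"
        using AE_seg_in[of p q]
      proof eventually_elim
        case (elim t)
        then have "\<forall>\<^sub>F n in sequentially. t < X n" using order_tendstoD(1)[OF X] by auto
        then show ?case by (rule tendsto_eventually[OF eventually_mono]) auto
      qed
    qed auto }
qed

lemma AE_seg_ex:
  assumes "AE x in seg p q. P x" "p \<le> c" "c < d" "d \<le> q"
  shows "\<exists>x. c < x \<and> x < d \<and> P x"
proof (rule ccontr)
  assume no: "\<not> ?thesis"
  have "AE x in lborel. x \<notin> {c<..<d}"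
    using assms(1)[unfolded AE_seg] by eventually_elim (use no assms in auto)
  then have "emeasure lborel {c<..<d} = 0"
    by (subst AE_iff_measurable[symmetric, where P = "\<lambda>x. x \<notin> {c<..<d}"]) auto
  with assms show False by simp
qed

lemma AE_seg_sequences:
  assumes P: "AE x in seg p q. P x" and pq: "p < q"
  obtains X Y where "X \<longlonglongrightarrow> p" "\<And>n :: nat. P (X n) \<and> p < X n \<and> X n < q" "Y \<longlonglongrightarrow> q" "\<And>n :: nat. P (Y n) \<and> p < Y n \<and> Y n < q"
proof -
  have le: "(q - p) / Suc n \<le> q - p" for n using pq divide_left_mono[of 1 "real (Suc n)" "q - p"] by simp
  have pos: "0 < (q - p) / Suc n" for n using pq by simp
  have "\<exists>x. p < x \<and> x < p + (q - p) / Suc n \<and> P x" for n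
    by (intro AE_seg_ex[OF P]) (use le[of n] pos[of n] in linarith)+
  then obtain X where X: "\<And>n. p < X n \<and> X n < p + (q - p) / Suc n \<and> P (X n)" by metis
  have "\<exists>x. q - (q - p) / Suc n < x \<and> x < q \<and> P x" for n
    by (intro AE_seg_ex[OF P]) (use le[of n] pos[of n] in linarith)+
  then obtain Y where Y: "\<And>n. q - (q - p) / Suc n < Y n \<and> Y n < q \<and> P (Y n)" by metis
  have z: "(\<lambda>n. (q - p) / Suc n) \<longlonglongrightarrow> 0" by (rule LIMSEQ_Suc[OF lim_const_over_n])
  have "X \<longlonglongrightarrow> p"
    by (rule tendsto_sandwich[OF _ _ tendsto_const tendsto_eq_rhs[OF tendsto_add[OF tendsto_const[of p] z]]])
      (use X in \<open>auto intro!: always_eventually less_imp_le\<close>)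
  moreover have "Y \<longlonglongrightarrow> q"
    by (rule tendsto_sandwich[OF _ _ tendsto_eq_rhs[OF tendsto_diff[OF tendsto_const[of q] z]] tendsto_const])
      (use Y in \<open>auto intro!: always_eventually less_imp_le\<close>)
  moreover have "P (X n) \<and> p < X n \<and> X n < q" for n using X[of n] le[of n] by auto
  moreover have "P (Y n) \<and> p < Y n \<and> Y n < q" for n using Y[of n] le[of n] by auto
  ultimately show ?thesis using that by blast
qed

text \<open>
  The identity for \<open>f\<close> holds only almost everywhere, but at points arbitrarily
  close to either end; along them both \<open>h\<close> and the primitive converge.
\<close>
lemma trace_zero_1d:
  assumes pq: "p < q" and g: "integrable (seg p q) g"
    and acl: "AE x in seg p q. f x = c + prim p q g x"
    and cont: "AE x in seg p q. f x = h x" "continuous_on {p..q} h" "h p = 0" "h q = 0"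
  shows "c = 0" "(\<integral>t. g t \<partial>seg p q) = 0"
proof -
  have "AE x in seg p q. h x = c + prim p q g x" using acl cont(1) by eventually_elim simp
  then obtain X Y where X: "X \<longlonglongrightarrow> p" "\<And>n :: nat. h (X n) = c + prim p q g (X n) \<and> p < X n \<and> X n < q"
    and Y: "Y \<longlonglongrightarrow> q" "\<And>n :: nat. h (Y n) = c + prim p q g (Y n) \<and> p < Y n \<and> Y n < q"
    using AE_seg_sequences[OF _ pq] by blast
  have "(\<lambda>n. h (X n)) \<longlonglongrightarrow> h p"
    using X pq by (intro continuous_on_tendsto_compose[OF cont(2)]) (auto intro!: always_eventually less_imp_le)
  moreover have "(\<lambda>n. h (X n)) \<longlonglongrightarrow> c + 0"
    using X(2) tendsto_add[OF tendsto_const[of c] prim_tendsto(1)[OF g X(1)]] by simp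
  ultimately show c: "c = 0" using cont(3) LIMSEQ_unique by fastforce
  have "(\<lambda>n. h (Y n)) \<longlonglongrightarrow> h q"
    using Y pq by (intro continuous_on_tendsto_compose[OF cont(2)]) (auto intro!: always_eventually less_imp_le)
  moreover have "(\<lambda>n. h (Y n)) \<longlonglongrightarrow> c + (\<integral>t. g t \<partial>seg p q)"
    using Y(2) tendsto_add[OF tendsto_const[of c] prim_tendsto(2)[OF g Y(1)]] by simp
  ultimately show "(\<integral>t. g t \<partial>seg p q) = 0" using cont(4) c LIMSEQ_unique by fastforce
qed

lemma seg_no_atoms: "AE y in seg p q. y \<noteq> (x::real)"
  unfolding AE_seg using AE_lborel_singleton[of x] by eventually_elim simp

text \<open>
  Fubini's theorem on the triangle \<open>t < x\<close>; this is integration by parts.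
\<close>
lemma prim_fubini:
  assumes f: "integrable (seg p q) f" and g: "integrable (seg p q) g"
  shows "(\<integral>x. prim p q f x * g x \<partial>seg p q) = (\<integral>t. f t * ((\<integral>x. g x \<partial>seg p q) - prim p q g t) \<partial>seg p q)"
proof -
  note [measurable] = borel_measurable_integrable[OF f, simplified] borel_measurable_integrable[OF g, simplified]
  have int: "integrable (seg p q \<Otimes>\<^sub>M seg p q) (\<lambda>(x, t). (if t < x then f t else 0) * g x)"
  proof (rule Bochner_Integration.integrable_bound)
    show "integrable (seg p q \<Otimes>\<^sub>M seg p q) (\<lambda>(x, t). g x * f t)"
      by (rule rect.Fubini_integrable) (use f g in \<open>auto simp: abs_mult\<close>)
  qed (auto simp: mult.commute)
  have "(\<integral>x. prim p q f x * g x \<partial>seg p q) = (\<integral>x. (\<integral>t. (if t < x then f t else 0) * g x \<partial>seg p q) \<partial>seg p q)"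
    unfolding prim_def by simp
  also have "\<dots> = (\<integral>t. (\<integral>x. (if t < x then f t else 0) * g x \<partial>seg p q) \<partial>seg p q)"
    using rect.Fubini_integral[OF int] by simp
  also have "\<dots> = (\<integral>t. f t * ((\<integral>x. g x \<partial>seg p q) - prim p q g t) \<partial>seg p q)"
  proof (rule Bochner_Integration.integral_cong[OF refl])
    fix t
    have "(\<integral>x. (if t < x then f t else 0) * g x \<partial>seg p q) = (\<integral>x. f t * (g x - (if x < t then g x else 0)) \<partial>seg p q)"
    proof (rule integral_cong_AE)
      show "AE x in seg p q. (if t < x then f t else 0) * g x = f t * (g x - (if x < t then g x else 0))"
        using seg_no_atoms[where x = t] by eventually_elim auto
    qed measurable
    also have "\<dots> = f t * ((\<integral>x. g x \<partial>seg p q) - prim p q g t)"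
      using prim_integrable[OF g] g unfolding prim_def by simp
    finally show "(\<integral>x. (if t < x then f t else 0) * g x \<partial>seg p q) = f t * ((\<integral>x. g x \<partial>seg p q) - prim p q g t)" .
  qed
  finally show ?thesis .
qed

lemma integral_bump_seg:
  assumes "bump p q \<alpha>" shows "(\<integral>x. \<alpha> x \<partial>seg p q) = (\<integral>x. \<alpha> x \<partial>lborel)"
proof -
  have "indicator {p<..<q} x * \<alpha> x = \<alpha> x" for x
    using bump_outside[OF assms, of x] by (cases "x \<in> {p<..<q}") auto
  then show ?thesis unfolding integral_seg[OF bump_borel[OF assms]] by (simp only:)
qed

lemma integrable_bump_seg:
  assumes "bump p q \<alpha>" shows "integrable (seg p q) \<alpha>"
proof -
  obtain B where "\<And>x. \<bar>\<alpha> x\<bar> \<le> B" using bump_bounded[OF assms] by blast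
  then show ?thesis using bump_borel[OF assms] by (intro seg.integrable_const_bound[of _ B]) auto
qed

lemma bump_eq_prim:
  assumes \<alpha>: "bump p q \<alpha>" and x: "p < x" "x < q"
  shows "\<alpha> x = prim p q (deriv \<alpha>) x"
proof -
  have [measurable]: "deriv \<alpha> \<in> borel_measurable borel" using bump_borel[OF bump_deriv[OF \<alpha>]] .
  have "prim p q (deriv \<alpha>) x = (\<integral>t. indicator {p..x} t *\<^sub>R deriv \<alpha> t \<partial>lborel)"
    unfolding prim_def
  proof (subst integral_seg)
    show "(\<integral>t. indicator {p<..<q} t * (if t < x then deriv \<alpha> t else 0) \<partial>lborel) = (\<integral>t. indicator {p..x} t *\<^sub>R deriv \<alpha> t \<partial>lborel)"
    proof (rule integral_cong_AE)
      show "AE t in lborel. indicator {p<..<q} t * (if t < x then deriv \<alpha> t else 0) = indicator {p..x} t *\<^sub>R deriv \<alpha> t"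
        using AE_lborel_singleton[of x] AE_lborel_singleton[of p]
        by eventually_elim (use x in \<open>auto simp: indicator_def\<close>)
    qed measurable
  qed measurable
  also have "\<dots> = \<alpha> x - \<alpha> p"
    using x smooth_has_derivative[OF bump_smooth[OF \<alpha>]] smooth_continuous_on[OF smooth_deriv[OF bump_smooth[OF \<alpha>]]]
    by (intro integral_FTC_Icc) (auto simp: has_real_derivative_iff_has_vector_derivative[symmetric] intro: has_field_derivative_at_within)
  finally show ?thesis using bump_outside[OF \<alpha>, of p] by simp
qed

lemma integral_bump_deriv: "bump p q \<alpha> \<Longrightarrow> (\<integral>x. deriv \<alpha> x \<partial>seg p q) = 0"
  if "p < q"
proof -
  assume \<alpha>: "bump p q \<alpha>"
  show ?thesis
  proof (rule trace_zero_1d(2)[OF that integrable_bump_seg[OF bump_deriv[OF \<alpha>]], where h = \<alpha> and c = 0])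
    show "AE x in seg p q. \<alpha> x = 0 + prim p q (deriv \<alpha>) x"
      using AE_seg_in[of p q] by eventually_elim (use bump_eq_prim[OF \<alpha>] in auto)
  qed (use \<alpha> bump_outside[OF \<alpha>] in \<open>auto intro: smooth_continuous_on bump_smooth\<close>)
qed

lemma prim_by_parts_bump:
  assumes pq: "p < q" and g: "integrable (seg p q) g" and \<alpha>: "bump p q \<alpha>"
  shows "(\<integral>x. prim p q g x * deriv \<alpha> x \<partial>seg p q) = - (\<integral>x. g x * \<alpha> x \<partial>seg p q)"
proof -
  have "(\<integral>x. prim p q g x * deriv \<alpha> x \<partial>seg p q) = (\<integral>t. g t * ((\<integral>x. deriv \<alpha> x \<partial>seg p q) - prim p q (deriv \<alpha>) t) \<partial>seg p q)"
    by (rule prim_fubini[OF g integrable_bump_seg[OF bump_deriv[OF \<alpha>]]])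
  also have "\<dots> = (\<integral>x. - (g x * \<alpha> x) \<partial>seg p q)"
  proof (rule integral_cong_AE)
    show "AE t in seg p q. g t * ((\<integral>x. deriv \<alpha> x \<partial>seg p q) - prim p q (deriv \<alpha>) t) = - (g t * \<alpha> t)"
      using AE_seg_in[of p q]
      by eventually_elim (use integral_bump_deriv[OF pq \<alpha>] bump_eq_prim[OF \<alpha>] in auto)
  qed (use bump_borel[OF \<alpha>] bump_borel[OF bump_deriv[OF \<alpha>]] borel_measurable_integrable[OF g] in auto)
  finally show ?thesis by simp
qed

section \<open>Absolute continuity on lines\<close>

lemma sets_seg_pair [simp]: "sets (seg p q \<Otimes>\<^sub>M seg r s) = sets plane"
  using sets_rect_plane by (simp add: rect_def)

lemma measurable_rect: "borel_measurable (rect p q r s) = borel_measurable plane"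
  by (rule measurable_cong_sets[OF sets_rect_plane refl])

lemma rect_measurable: "integrable (rect p q r s) f \<Longrightarrow> f \<in> borel_measurable plane"
  using borel_measurable_integrable[of "rect p q r s" f] by (simp only: measurable_rect)

lemma rect_fubini:
  fixes f :: "real \<times> real \<Rightarrow> real"
  assumes f: "integrable (rect p q r s) f"
  shows "AE y in seg r s. integrable (seg p q) (\<lambda>x. f (x, y))"
    and "integrable (seg r s) (\<lambda>y. \<integral>x. f (x, y) \<partial>seg p q)"
    and "(\<integral>z. f z \<partial>rect p q r s) = (\<integral>y. (\<integral>x. f (x, y) \<partial>seg p q) \<partial>seg r s)"
proof -
  have f': "integrable (seg p q \<Otimes>\<^sub>M seg r s) (case_prod (\<lambda>x y. f (x, y)))"
    using f by (simp add: rect_def)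
  show "AE y in seg r s. integrable (seg p q) (\<lambda>x. f (x, y))" by (rule rect.AE_integrable_snd[OF f'])
  show "integrable (seg r s) (\<lambda>y. \<integral>x. f (x, y) \<partial>seg p q)" by (rule rect.integrable_snd[OF f'])
  show "(\<integral>z. f z \<partial>rect p q r s) = (\<integral>y. (\<integral>x. f (x, y) \<partial>seg p q) \<partial>seg r s)"
    using rect.integral_snd[OF f'] by (simp add: rect_def)
qed

lemma AE_rect_sections:
  assumes "Measurable.pred plane P"
  shows "(AE z in rect p q r s. P z) \<longleftrightarrow> (AE y in seg r s. AE x in seg p q. P (x, y))"
proof -
  have m: "{x \<in> space (seg p q \<Otimes>\<^sub>M seg r s). P (fst x, snd x)} \<in> sets (seg p q \<Otimes>\<^sub>M seg r s)"
    using assms by (simp add: space_pair_measure pred_def)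
  show ?thesis
    unfolding rect_def using rect.AE_pair_iff[OF m] rect.AE_commute[OF m] by simp
qed

lemma AE_rect_swap:
  assumes "AE z in rect p q r s. P z"
  shows "AE z in rect r s p q. P (prod.swap z)"
proof -
  have "AE z in distr (rect r s p q) (rect p q r s) (\<lambda>(x, y). (y, x)). P z"
    using assms unfolding rect_def rect.distr_pair_swap[of p q r s, symmetric] .
  then have "AE z in rect r s p q. P ((\<lambda>(x, y). (y, x)) z)"
    by (rule AE_distrD[rotated]) (simp add: rect_def measurable_pair_swap')
  then show ?thesis by eventually_elim (auto simp: prod.swap_def split: prod.splits)
qed

lemma integral_rect_swap:
  fixes f :: "real \<times> real \<Rightarrow> real"
  assumes "f \<in> borel_measurable plane"
  shows "(\<integral>z. f (prod.swap z) \<partial>rect r s p q) = (\<integral>z. f z \<partial>rect p q r s)"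
proof -
  have "f \<in> borel_measurable (seg p q \<Otimes>\<^sub>M seg r s)" using assms by measurable
  from rect.integral_product_swap[OF this] show ?thesis
    unfolding rect_def prod.swap_def case_prod_beta by simp
qed

lemma swap_measurable:
  assumes [measurable]: "f \<in> borel_measurable plane" shows "(\<lambda>z. f (prod.swap z)) \<in> borel_measurable plane"
  unfolding prod.swap_def by measurable

lemma integrable_rect_swap:
  fixes f :: "real \<times> real \<Rightarrow> real"
  assumes "integrable (rect p q r s) f"
  shows "integrable (rect r s p q) (\<lambda>z. f (prod.swap z))"
  using rect.integrable_product_swap[OF assms[unfolded rect_def]]
  unfolding rect_def prod.swap_def case_prod_beta .

lemma integrable_mult_bounded:
  fixes f h :: "'a \<Rightarrow> real"
  assumes f: "integrable M f" and h: "h \<in> borel_measurable M" "\<And>x. \<bar>h x\<bar> \<le> B"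
  shows "integrable M (\<lambda>x. f x * h x)"
proof (rule Bochner_Integration.integrable_bound)
  show "integrable M (\<lambda>x. B * f x)" using f by simp
  have "\<bar>f x * h x\<bar> \<le> \<bar>B * f x\<bar>" for x
  proof -
    have "\<bar>h x\<bar> * \<bar>f x\<bar> \<le> \<bar>B\<bar> * \<bar>f x\<bar>" using h(2)[of x] by (intro mult_right_mono) auto
    then show ?thesis by (simp add: abs_mult mult.commute)
  qed
  then show "AE x in M. norm (f x * h x) \<le> norm (B * f x)" by simp
qed (use f h in \<open>auto dest: borel_measurable_integrable\<close>)

lemma integrable_snd_comp:
  fixes h :: "real \<Rightarrow> real"
  assumes h: "integrable (seg r s) h"
  shows "integrable (rect p q r s) (\<lambda>z. h (snd z))"
    and "p \<le> q \<Longrightarrow> (\<integral>z. h (snd z) \<partial>rect p q r s) = (q - p) * (\<integral>y. h y \<partial>seg r s)"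
proof -
  note [measurable] = borel_measurable_integrable[OF h, simplified]
  show i: "integrable (rect p q r s) (\<lambda>z. h (snd z))"
    unfolding rect_def by (rule rect.Fubini_integrable) (use h in auto)
  show "(\<integral>z. h (snd z) \<partial>rect p q r s) = (q - p) * (\<integral>y. h y \<partial>seg r s)" if "p \<le> q"
    using rect_fubini(3)[OF i] that by simp
qed

lemma bump_mult_integrable:
  assumes f: "integrable (rect p q r s) f" and \<alpha>: "bump p' q' \<alpha>" and \<beta>: "bump r' s' \<beta>"
  shows "integrable (rect p q r s) (\<lambda>z. f z * (\<alpha> (fst z) * \<beta> (snd z)))"
proof -
  obtain A B where AB: "\<And>x. \<bar>\<alpha> x\<bar> \<le> A" "\<And>y. \<bar>\<beta> y\<bar> \<le> B" using bump_bounded \<alpha> \<beta> by metis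
  note [measurable] = bump_borel[OF \<alpha>] bump_borel[OF \<beta>]
  show ?thesis
  proof (rule integrable_mult_bounded[OF f])
    show "\<bar>\<alpha> (fst z) * \<beta> (snd z)\<bar> \<le> A * B" for z
      unfolding abs_mult using AB order_trans[OF abs_ge_zero AB(1)] by (intro mult_mono) auto
  qed measurable
qed

lemma bump_fubini:
  assumes f: "integrable (rect p q r s) f" and \<alpha>: "bump p' q' \<alpha>" and \<beta>: "bump r' s' \<beta>"
  shows "(\<integral>z. f z * (\<alpha> (fst z) * \<beta> (snd z)) \<partial>rect p q r s) = (\<integral>y. (\<integral>x. f (x, y) * \<alpha> x \<partial>seg p q) * \<beta> y \<partial>seg r s)"
  using rect_fubini(3)[OF bump_mult_integrable[OF f \<alpha> \<beta>]] by (simp add: mult.assoc[symmetric])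

text \<open>
  Weak differentiability in \<open>x\<close>, tested with products of bumps only.
\<close>
definition weak_x :: "real \<Rightarrow> real \<Rightarrow> real \<Rightarrow> real \<Rightarrow> (real \<times> real \<Rightarrow> real) \<Rightarrow> (real \<times> real \<Rightarrow> real) \<Rightarrow> bool" where
  "weak_x p q r s v g \<longleftrightarrow> (\<forall>\<alpha> \<beta>. bump p q \<alpha> \<longrightarrow> bump r s \<beta> \<longrightarrow>
     (\<integral>z. v z * (deriv \<alpha> (fst z) * \<beta> (snd z)) \<partial>rect p q r s) = - (\<integral>z. g z * (\<alpha> (fst z) * \<beta> (snd z)) \<partial>rect p q r s))"

definition weak_y :: "real \<Rightarrow> real \<Rightarrow> real \<Rightarrow> real \<Rightarrow> (real \<times> real \<Rightarrow> real) \<Rightarrow> (real \<times> real \<Rightarrow> real) \<Rightarrow> bool" where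
  "weak_y p q r s v g \<longleftrightarrow> (\<forall>\<alpha> \<beta>. bump p q \<alpha> \<longrightarrow> bump r s \<beta> \<longrightarrow>
     (\<integral>z. v z * (\<alpha> (fst z) * deriv \<beta> (snd z)) \<partial>rect p q r s) = - (\<integral>z. g z * (\<alpha> (fst z) * \<beta> (snd z)) \<partial>rect p q r s))"

lemma weak_y_swap:
  assumes "weak_y p q r s v g" and [measurable]: "v \<in> borel_measurable plane" "g \<in> borel_measurable plane"
  shows "weak_x r s p q (\<lambda>z. v (prod.swap z)) (\<lambda>z. g (prod.swap z))"
  unfolding weak_x_def
proof (intro allI impI)
  fix \<alpha> \<beta> assume b: "bump r s \<alpha>" "bump p q \<beta>"
  note [measurable] = bump_borel[OF b(1)] bump_borel[OF b(2)] bump_borel[OF bump_deriv[OF b(1)]]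
  have "(\<integral>z. v (prod.swap z) * (deriv \<alpha> (fst z) * \<beta> (snd z)) \<partial>rect r s p q) = (\<integral>z. v z * (\<beta> (fst z) * deriv \<alpha> (snd z)) \<partial>rect p q r s)"
    using integral_rect_swap[of "\<lambda>z. v z * (\<beta> (fst z) * deriv \<alpha> (snd z))" r s p q] by (simp add: mult.commute)
  moreover have "(\<integral>z. g (prod.swap z) * (\<alpha> (fst z) * \<beta> (snd z)) \<partial>rect r s p q) = (\<integral>z. g z * (\<beta> (fst z) * \<alpha> (snd z)) \<partial>rect p q r s)"
    using integral_rect_swap[of "\<lambda>z. g z * (\<beta> (fst z) * \<alpha> (snd z))" r s p q] by (simp add: mult.commute)
  ultimately show "(\<integral>z. v (prod.swap z) * (deriv \<alpha> (fst z) * \<beta> (snd z)) \<partial>rect r s p q) =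
      - (\<integral>z. g (prod.swap z) * (\<alpha> (fst z) * \<beta> (snd z)) \<partial>rect r s p q)"
    using assms(1) b unfolding weak_y_def by simp
qed

lemma integral_subrect:
  fixes h :: "real \<times> real \<Rightarrow> real"
  assumes h: "h \<in> borel_measurable plane" and sub: "p \<le> p'" "q' \<le> q" "r \<le> r'" "s' \<le> s"
    and 0: "\<And>z. z \<notin> {p'<..<q'} \<times> {r'<..<s'} \<Longrightarrow> h z = 0"
  shows "(\<integral>z. h z \<partial>rect p q r s) = (\<integral>z. h z \<partial>rect p' q' r' s')"
proof -
  have "indicator ({p<..<q} \<times> {r<..<s}) z * h z = indicator ({p'<..<q'} \<times> {r'<..<s'}) z * h z" for z
    using 0[of z] sub by (cases "z \<in> {p'<..<q'} \<times> {r'<..<s'}") (auto simp: indicator_def)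
  then show ?thesis unfolding integral_rect[OF h[folded borel_plane]] by (simp only:)
qed

lemma weak_x_mono:
  assumes w: "weak_x p q r s v g" and sub: "p \<le> p'" "q' \<le> q" "r \<le> r'" "s' \<le> s"
    and [measurable]: "v \<in> borel_measurable plane" "g \<in> borel_measurable plane"
  shows "weak_x p' q' r' s' v g"
  unfolding weak_x_def
proof (intro allI impI)
  fix \<alpha> \<beta> assume b: "bump p' q' \<alpha>" "bump r' s' \<beta>"
  note [measurable] = bump_borel[OF b(1)] bump_borel[OF b(2)] bump_borel[OF bump_deriv[OF b(1)]]
  have z: "deriv \<alpha> (fst z) * \<beta> (snd z) = 0" "\<alpha> (fst z) * \<beta> (snd z) = 0" if "z \<notin> {p'<..<q'} \<times> {r'<..<s'}" for z
    using that bump_outside[OF b(1), of "fst z"] bump_outside[OF b(2), of "snd z"] bump_outside[OF bump_deriv[OF b(1)], of "fst z"]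
    by (cases z; auto)+
  have "bump p q \<alpha>" "bump r s \<beta>" using b sub by (auto intro: bump_mono)
  with w have "(\<integral>z. v z * (deriv \<alpha> (fst z) * \<beta> (snd z)) \<partial>rect p q r s) = - (\<integral>z. g z * (\<alpha> (fst z) * \<beta> (snd z)) \<partial>rect p q r s)"
    unfolding weak_x_def by blast
  moreover have "(\<integral>z. v z * (deriv \<alpha> (fst z) * \<beta> (snd z)) \<partial>rect p q r s) = (\<integral>z. v z * (deriv \<alpha> (fst z) * \<beta> (snd z)) \<partial>rect p' q' r' s')"
    by (rule integral_subrect[OF _ sub]) (use z in auto)
  moreover have "(\<integral>z. g z * (\<alpha> (fst z) * \<beta> (snd z)) \<partial>rect p q r s) = (\<integral>z. g z * (\<alpha> (fst z) * \<beta> (snd z)) \<partial>rect p' q' r' s')"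
    by (rule integral_subrect[OF _ sub]) (use z in auto)
  ultimately show "(\<integral>z. v z * (deriv \<alpha> (fst z) * \<beta> (snd z)) \<partial>rect p' q' r' s') =
      - (\<integral>z. g z * (\<alpha> (fst z) * \<beta> (snd z)) \<partial>rect p' q' r' s')" by simp
qed

lemma integrable_subrect:
  fixes h :: "real \<times> real \<Rightarrow> real"
  assumes h: "integrable (rect p q r s) h" and sub: "p \<le> p'" "q' \<le> q" "r \<le> r'" "s' \<le> s"
  shows "integrable (rect p' q' r' s') h"
proof -
  have m: "h \<in> borel_measurable borel" using borel_measurable_integrable[OF h] by (simp add: borel_plane cong: measurable_cong_sets)
  have "integrable lborel (\<lambda>z. indicator ({p'<..<q'} \<times> {r'<..<s'}) z *\<^sub>R (indicator ({p<..<q} \<times> {r<..<s}) z * h z))"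
    using h m by (intro integrable_mult_indicator) (auto simp: integrable_rect)
  also have "(\<lambda>z. indicator ({p'<..<q'} \<times> {r'<..<s'}) z *\<^sub>R (indicator ({p<..<q} \<times> {r<..<s}) z * h z)) = (\<lambda>z. indicator ({p'<..<q'} \<times> {r'<..<s'}) z * h z)"
    using sub by (auto simp: indicator_def fun_eq_iff)
  finally show ?thesis using m by (simp add: integrable_rect)
qed

lemma normalized_bump:
  assumes pq: "p < q"
  obtains \<alpha> where "bump p q \<alpha>" "(\<integral>x. \<alpha> x \<partial>seg p q) = 1"
proof -
  let ?a = "(2 * p + q) / 3" let ?b = "(p + 2 * q) / 3"
  let ?h = "plateau ?a ?b 1"
  have h: "bump p q ?h" using pq by (intro bump_plateau) auto
  have hp: "?h x = hat ?a ?b x" for x by (simp add: plateau_def)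
  have nz: "(\<integral>x. ?h x \<partial>seg p q) \<noteq> 0"
  proof
    assume 0: "(\<integral>x. ?h x \<partial>seg p q) = 0"
    have "AE x in seg p q. 0 \<le> ?h x" unfolding hp by (intro AE_I2 hat_range)
    from integral_nonneg_eq_0_iff_AE[OF integrable_bump_seg[OF h] this] 0
    have "AE x in seg p q. ?h x = 0" by blast
    from AE_seg_ex[OF this, of ?a ?b] pq obtain x where "?a < x" "x < ?b" "?h x = 0" by auto
    then show False using hat_range(1)[of x ?a ?b] unfolding hp by simp
  qed
  define k where "k = 1 / (\<integral>x. ?h x \<partial>seg p q)"
  show thesis
  proof (rule that[of "\<lambda>x. k * ?h x"])
    show "bump p q (\<lambda>x. k * ?h x)" by (rule bump_cmult[OF h])
    show "(\<integral>x. k * ?h x \<partial>seg p q) = 1" using nz by (simp add: k_def)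
  qed
qed

text \<open>
  Subtract from \<open>v\<close> the primitives of \<open>g\<close> along rows. The difference
  \<open>d\<close> is orthogonal to every \<open>deriv \<alpha> (x) * \<beta> (y)\<close>. A
  bump \<open>\<alpha>\<close> minus its integral times a fixed bump \<open>\<eta>\<close> of
  integral 1 is such a derivative, so against \<open>\<alpha>\<close> the function
  \<open>d\<close> acts like its average \<open>c (y)\<close> with weight \<open>\<eta>\<close>,
  and the fundamental lemma identifies the two.
\<close>
theorem absolutely_continuous_on_lines:
  assumes pq: "p < q" and v: "integrable (rect p q r s) v" and g: "integrable (rect p q r s) g"
    and w: "weak_x p q r s v g"
  shows "\<exists>c. c \<in> borel_measurable borel \<and> (AE z in rect p q r s. v z = c (snd z) + prim p q (\<lambda>t. g (t, snd z)) (fst z))"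
proof -
  have [measurable]: "v \<in> borel_measurable plane" "g \<in> borel_measurable plane"
    using rect_measurable v g by blast+
  let ?G = "\<lambda>z. prim p q (\<lambda>t. g (t, snd z)) (fst z)"
  have ga: "integrable (rect p q r s) (\<lambda>z. \<bar>g z\<bar>)" using g by simp
  define A where "A y = (\<integral>t. \<bar>g (t, y)\<bar> \<partial>seg p q)" for y
  have [measurable]: "A \<in> borel_measurable borel"
    unfolding A_def by (rule integral_section_borel[of "\<lambda>z. \<bar>g z\<bar>"]) measurable
  have A: "integrable (seg r s) A" using rect_fubini(2)[OF ga] unfolding A_def[abs_def] .
  have G: "integrable (rect p q r s) ?G"
  proof (rule Bochner_Integration.integrable_bound[OF integrable_snd_comp(1)[OF A]])
    have "Measurable.pred plane (\<lambda>z. norm (?G z) \<le> norm (A (snd z)))" by measurable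
    then show "AE z in rect p q r s. norm (?G z) \<le> norm (A (snd z))"
    proof (subst AE_rect_sections)
      show "AE y in seg r s. AE x in seg p q. norm (?G (x, y)) \<le> norm (A (snd (x, y)))"
        using rect_fubini(1)[OF g]
      proof eventually_elim
        case (elim y)
        have "\<bar>prim p q (\<lambda>t. g (t, y)) x\<bar> \<le> A y" for x using prim_bound[OF elim] by (simp add: A_def)
        then show ?case by (intro AE_I2) (auto intro: order_trans[OF _ abs_ge_self])
      qed
    qed
  qed measurable
  define d where "d z = v z - ?G z" for z
  have [measurable]: "d \<in> borel_measurable plane" unfolding d_def by measurable
  have d: "integrable (rect p q r s) d" unfolding d_def by (intro Bochner_Integration.integrable_diff v G)
  have ortho: "(\<integral>z. d z * (deriv \<alpha> (fst z) * \<beta> (snd z)) \<partial>rect p q r s) = 0" if b: "bump p q \<alpha>" "bump r s \<beta>" for \<alpha> \<beta>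
  proof -
    note [measurable] = bump_borel[OF b(1)] bump_borel[OF b(2)] bump_borel[OF bump_deriv[OF b(1)]]
    have "(\<integral>z. ?G z * (deriv \<alpha> (fst z) * \<beta> (snd z)) \<partial>rect p q r s)
        = (\<integral>y. (\<integral>x. prim p q (\<lambda>t. g (t, y)) x * deriv \<alpha> x \<partial>seg p q) * \<beta> y \<partial>seg r s)"
      using bump_fubini[OF G bump_deriv[OF b(1)] b(2)] by simp
    also have "\<dots> = (\<integral>y. - ((\<integral>x. g (x, y) * \<alpha> x \<partial>seg p q) * \<beta> y) \<partial>seg r s)"
    proof (rule integral_cong_AE)
      show "AE y in seg r s. (\<integral>x. prim p q (\<lambda>t. g (t, y)) x * deriv \<alpha> x \<partial>seg p q) * \<beta> y = - ((\<integral>x. g (x, y) * \<alpha> x \<partial>seg p q) * \<beta> y)"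
        using rect_fubini(1)[OF g] by eventually_elim (simp add: prim_by_parts_bump[OF pq _ b(1)])
      have [measurable]: "(\<lambda>z. prim p q (\<lambda>t. g (t, snd z)) (fst z) * deriv \<alpha> (fst z)) \<in> borel_measurable plane" by measurable
      have "(\<lambda>y. \<integral>x. (\<lambda>z. prim p q (\<lambda>t. g (t, snd z)) (fst z) * deriv \<alpha> (fst z)) (x, y) \<partial>seg p q) \<in> borel_measurable borel"
        by (rule integral_section_borel) measurable
      then have [measurable]: "(\<lambda>y. \<integral>x. prim p q (\<lambda>t. g (t, y)) x * deriv \<alpha> x \<partial>seg p q) \<in> borel_measurable borel" by simp
      show "(\<lambda>y. (\<integral>x. prim p q (\<lambda>t. g (t, y)) x * deriv \<alpha> x \<partial>seg p q) * \<beta> y) \<in> borel_measurable (seg r s)" by measurable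
    qed measurable
    also have "\<dots> = - (\<integral>z. g z * (\<alpha> (fst z) * \<beta> (snd z)) \<partial>rect p q r s)"
      using bump_fubini[OF g b] by simp
    also have "\<dots> = (\<integral>z. v z * (deriv \<alpha> (fst z) * \<beta> (snd z)) \<partial>rect p q r s)"
      using w b unfolding weak_x_def by simp
    finally show ?thesis
      unfolding d_def left_diff_distrib
      using bump_mult_integrable[OF v bump_deriv[OF b(1)] b(2)] bump_mult_integrable[OF G bump_deriv[OF b(1)] b(2)]
      by simp
  qed
  obtain \<eta> where \<eta>: "bump p q \<eta>" "(\<integral>x. \<eta> x \<partial>seg p q) = 1"
    using normalized_bump[OF pq] .
  define c where "c y = (\<integral>x. d (x, y) * \<eta> x \<partial>seg p q)" for y
  note [measurable] = bump_borel[OF \<eta>(1)]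
  have [measurable]: "(\<lambda>z. d z * \<eta> (fst z)) \<in> borel_measurable plane" by measurable
  have c_meas [measurable]: "c \<in> borel_measurable borel"
    using integral_section_borel[of "\<lambda>z. d z * \<eta> (fst z)" p q] unfolding c_def by simp
  obtain E where E: "\<And>x. \<bar>\<eta> x\<bar> \<le> E" using bump_bounded[OF \<eta>(1)] by blast
  have d\<eta>: "integrable (rect p q r s) (\<lambda>z. d z * \<eta> (fst z))"
    by (rule integrable_mult_bounded[OF d, of _ E]) (use E in \<open>auto intro: measurable_compose\<close>)
  have c_int: "integrable (seg r s) c"
    using rect_fubini(2)[OF d\<eta>] unfolding c_def by simp
  have cc: "integrable (rect p q r s) (\<lambda>z. c (snd z))" by (rule integrable_snd_comp(1)[OF c_int])
  have "AE z in rect p q r s. d z - c (snd z) = 0"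
  proof (rule fundamental_lemma)
    show "integrable (rect p q r s) (\<lambda>z. d z - c (snd z))" by (intro Bochner_Integration.integrable_diff d cc)
    fix \<alpha> \<beta> assume b: "bump p q \<alpha>" "bump r s \<beta>"
    (* the bump alpha - A * eta has integral 0 and is therefore the derivative of a bump kappa *)
    define A where "A = (\<integral>x. \<alpha> x \<partial>seg p q)"
    define \<gamma> where "\<gamma> x = \<alpha> x + (- A) * \<eta> x" for x
    have \<gamma>: "bump p q \<gamma>" unfolding \<gamma>_def[abs_def] by (intro bump_add bump_cmult b \<eta>)
    have "(\<integral>x. \<gamma> x \<partial>lborel) = (\<integral>x. \<gamma> x \<partial>seg p q)" by (rule integral_bump_seg[OF \<gamma>, symmetric])
    also have "\<dots> = 0"
      unfolding \<gamma>_def using integrable_bump_seg[OF b(1)] integrable_bump_seg[OF \<eta>(1)] \<eta>(2) by (simp add: A_def)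
    finally obtain \<kappa> where \<kappa>: "bump p q \<kappa>" "deriv \<kappa> = \<gamma>" using bump_antiderivative[OF \<gamma>] by blast
    have "0 = (\<integral>z. d z * (\<gamma> (fst z) * \<beta> (snd z)) \<partial>rect p q r s)" using ortho[OF \<kappa>(1) b(2)] \<kappa>(2) by simp
    also have "\<dots> = (\<integral>z. d z * (\<alpha> (fst z) * \<beta> (snd z)) + (- A) * (d z * (\<eta> (fst z) * \<beta> (snd z))) \<partial>rect p q r s)"
      by (intro Bochner_Integration.integral_cong) (simp_all add: \<gamma>_def algebra_simps)
    also have "\<dots> = (\<integral>z. d z * (\<alpha> (fst z) * \<beta> (snd z)) \<partial>rect p q r s) - A * (\<integral>z. d z * (\<eta> (fst z) * \<beta> (snd z)) \<partial>rect p q r s)"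
      using bump_mult_integrable[OF d b] bump_mult_integrable[OF d \<eta>(1) b(2)] by simp
    also have "(\<integral>z. d z * (\<eta> (fst z) * \<beta> (snd z)) \<partial>rect p q r s) = (\<integral>y. c y * \<beta> y \<partial>seg r s)"
      using bump_fubini[OF d \<eta>(1) b(2)] by (simp add: c_def)
    finally have 1: "(\<integral>z. d z * (\<alpha> (fst z) * \<beta> (snd z)) \<partial>rect p q r s) = A * (\<integral>y. c y * \<beta> y \<partial>seg r s)" by simp
    have 2: "(\<integral>z. c (snd z) * (\<alpha> (fst z) * \<beta> (snd z)) \<partial>rect p q r s) = A * (\<integral>y. c y * \<beta> y \<partial>seg r s)"
    proof -
      have "(\<integral>x. c (snd (x, y)) * \<alpha> x \<partial>seg p q) * \<beta> y = A * (c y * \<beta> y)" for y by (simp add: A_def)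
      then show ?thesis unfolding bump_fubini[OF cc b] by (simp only: integral_mult_right_zero)
    qed
    show "(\<integral>z. (d z - c (snd z)) * (\<alpha> (fst z) * \<beta> (snd z)) \<partial>rect p q r s) = 0"
      unfolding left_diff_distrib
      using bump_mult_integrable[OF d b] bump_mult_integrable[OF cc b] 1 2 by simp
  qed
  then have "AE z in rect p q r s. v z = c (snd z) + prim p q (\<lambda>t. g (t, snd z)) (fst z)"
    by eventually_elim (simp add: d_def)
  with c_meas show ?thesis by blast
qed

section \<open>Estimates by integrals over rows\<close>

lemma measure_rect [simp]: "p \<le> q \<Longrightarrow> r \<le> s \<Longrightarrow> measure (rect p q r s) UNIV = (q - p) * (s - r)"
proof -
  assume pq: "p \<le> q" and rs: "r \<le> s"
  have "measure (rect p q r s) UNIV = (\<integral>z. 1 \<partial>rect p q r s)" by simp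
  also have "\<dots> = (q - p) * (\<integral>y. 1 \<partial>seg r s)" by (rule integrable_snd_comp(2)[OF _ pq]) simp
  also have "\<dots> = (q - p) * (s - r)" using rs by simp
  finally show ?thesis .
qed

lemma L1_L2_bound:
  assumes "finite_measure M" "f \<in> L2 M"
  shows "(\<integral>x. \<bar>f x\<bar> \<partial>M)\<^sup>2 \<le> measure M (space M) * (\<integral>x. (f x)\<^sup>2 \<partial>M)"
proof -
  interpret finite_measure M by fact
  have a: "(\<lambda>x. \<bar>f x\<bar>) \<in> L2 M" using assms(2) by (auto simp: L2_def intro: borel_measurable_abs)
  have one: "(\<lambda>_. 1) \<in> L2 M" using assms(1) by (intro L2_bounded[of _ _ 1]) auto
  from L2.cauchy_schwarz_sq[OF a one] show ?thesis
    by (simp add: ip2_def power2_eq_square[symmetric] mult.commute)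
qed

lemma AE_rect_sectionsD:
  assumes "AE z in rect p q r s. P z" shows "AE y in seg r s. AE x in seg p q. P (x, y)"
  using rect.AE_pair[OF AE_rect_swap[OF assms, unfolded rect_def]] by simp

lemma acl_sections:
  assumes pq: "p < q" and v: "integrable (rect p q r s) v" and g: "integrable (rect p q r s) g"
    and w: "weak_x p q r s v g"
  shows "AE y in seg r s. integrable (seg p q) (\<lambda>x. v (x, y)) \<and> integrable (seg p q) (\<lambda>x. g (x, y)) \<and>
    (\<exists>c. AE x in seg p q. v (x, y) = c + prim p q (\<lambda>t. g (t, y)) x)"
proof -
  obtain c where "AE z in rect p q r s. v z = c (snd z) + prim p q (\<lambda>t. g (t, snd z)) (fst z)"
    using absolutely_continuous_on_lines[OF assms] by blast
  from AE_rect_sectionsD[OF this] rect_fubini(1)[OF v] rect_fubini(1)[OF g] show ?thesis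
    by eventually_elim auto
qed

definition row_int :: "real \<Rightarrow> real \<Rightarrow> (real \<times> real \<Rightarrow> real) \<Rightarrow> real \<Rightarrow> real" where
  "row_int p q g y = (\<integral>x. g (x, y) \<partial>seg p q)"

definition row_abs :: "real \<Rightarrow> real \<Rightarrow> (real \<times> real \<Rightarrow> real) \<Rightarrow> real \<Rightarrow> real" where
  "row_abs p q g y = (\<integral>x. \<bar>g (x, y)\<bar> \<partial>seg p q)"

lemma row_borel [measurable]:
  assumes "g \<in> borel_measurable plane"
  shows "row_int p q g \<in> borel_measurable borel" "row_abs p q g \<in> borel_measurable borel"
proof -
  show "row_int p q g \<in> borel_measurable borel"
    using integral_section_borel[OF assms] unfolding row_int_def[abs_def] .
  have "(\<lambda>z. \<bar>g z\<bar>) \<in> borel_measurable plane" using assms by (rule borel_measurable_abs)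
  from integral_section_borel[OF this] show "row_abs p q g \<in> borel_measurable borel"
    unfolding row_abs_def[abs_def] .
qed

lemma oscillation_x:
  assumes pq: "p < q" and v: "integrable (rect p q r s) v" and g: "integrable (rect p q r s) g"
    and w: "weak_x p q r s v g"
  shows "AE z in rect p q r s. \<bar>v z - row_int p q v (snd z) / (q - p)\<bar> \<le> row_abs p q g (snd z)"
proof -
  note [measurable] = rect_measurable[OF v] rect_measurable[OF v]
    rect_measurable[OF g]
  have "Measurable.pred plane (\<lambda>z. \<bar>v z - row_int p q v (snd z) / (q - p)\<bar> \<le> row_abs p q g (snd z))"
    by measurable
  then show ?thesis
  proof (subst AE_rect_sections)
    show "AE y in seg r s. AE x in seg p q. \<bar>v (x, y) - row_int p q v (snd (x, y)) / (q - p)\<bar>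
      \<le> row_abs p q g (snd (x, y))"
      using acl_sections[OF assms]
    proof eventually_elim
      case (elim y)
      then obtain c where "AE x in seg p q. v (x, y) = c + prim p q (\<lambda>t. g (t, y)) x" by blast
      from oscillation_1d[OF pq _ _ this] elim show ?case by (simp add: row_int_def row_abs_def)
    qed
  qed
qed

lemma L2_rect_measurable: "f \<in> L2 (rect p q r s) \<Longrightarrow> f \<in> borel_measurable plane"
  by (simp add: L2_def measurable_rect)

text \<open>
  Cauchy--Schwarz on each row, then Fubini's theorem.
\<close>
lemma row_integral_L2:
  assumes pq: "p \<le> q" and g: "g \<in> L2 (rect p q r s)"
  defines "A \<equiv> \<lambda>z. row_abs p q g (snd z)"
  shows "A \<in> L2 (rect p q r s)" "(\<integral>z. (A z)\<^sup>2 \<partial>rect p q r s) \<le> (q - p)\<^sup>2 * (\<integral>z. (g z)\<^sup>2 \<partial>rect p q r s)"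
proof -
  note [measurable] = L2_rect_measurable[OF g]
  have A_meas: "A \<in> borel_measurable plane"
    unfolding A_def by measurable
  have g2: "integrable (rect p q r s) (\<lambda>z. (g z)\<^sup>2)" by (rule L2_square_integrable[OF g])
  define h where "h y = (q - p) * (\<integral>t. (g (t, y))\<^sup>2 \<partial>seg p q)" for y
  have h: "integrable (seg r s) h" unfolding h_def[abs_def] using rect_fubini(2)[OF g2] by simp
  note [measurable] = A_meas
  have "Measurable.pred plane (\<lambda>z. (A z)\<^sup>2 \<le> h (snd z))"
  proof -
    have [measurable]: "h \<in> borel_measurable borel"
      using integral_section_borel[of "\<lambda>z. (g z)\<^sup>2" p q] unfolding h_def[abs_def] by simp
    show ?thesis by measurable
  qed
  then have le: "AE z in rect p q r s. (A z)\<^sup>2 \<le> h (snd z)"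
  proof (subst AE_rect_sections)
    show "AE y in seg r s. AE x in seg p q. (A (x, y))\<^sup>2 \<le> h (snd (x, y))"
      using rect_fubini(1)[OF g2]
    proof eventually_elim
      case (elim y)
      then have "(\<lambda>t. g (t, y)) \<in> L2 (seg p q)" by (simp add: L2_def)
      from L1_L2_bound[OF seg.finite_measure_axioms this] pq show ?case by (simp add: A_def h_def row_abs_def)
    qed
  qed
  have i: "integrable (rect p q r s) (\<lambda>z. (A z)\<^sup>2)"
    by (rule Bochner_Integration.integrable_bound[OF integrable_snd_comp(1)[OF h]])
      (use le in \<open>auto elim!: eventually_mono\<close>)
  then show "A \<in> L2 (rect p q r s)" by (simp add: L2_def measurable_rect)
  have "(\<integral>z. (A z)\<^sup>2 \<partial>rect p q r s) \<le> (\<integral>z. h (snd z) \<partial>rect p q r s)"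
    by (rule integral_mono_AE[OF i integrable_snd_comp(1)[OF h] le])
  also have "\<dots> = (q - p) * (\<integral>y. h y \<partial>seg r s)" by (rule integrable_snd_comp(2)[OF h pq])
  also have "(\<integral>y. h y \<partial>seg r s) = (q - p) * (\<integral>z. (g z)\<^sup>2 \<partial>rect p q r s)"
    unfolding h_def using rect_fubini(3)[OF g2] by simp
  finally show "(\<integral>z. (A z)\<^sup>2 \<partial>rect p q r s) \<le> (q - p)\<^sup>2 * (\<integral>z. (g z)\<^sup>2 \<partial>rect p q r s)"
    by (simp add: power2_eq_square mult.assoc)
qed

lemma L2_bound_by_rows:
  assumes pq: "p \<le> q" and v: "v \<in> L2 (rect p q r s)" and g: "g \<in> L2 (rect p q r s)"
    and le: "AE z in rect p q r s. \<bar>v z\<bar> \<le> row_abs p q g (snd z)"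
  shows "(\<integral>z. (v z)\<^sup>2 \<partial>rect p q r s) \<le> (q - p)\<^sup>2 * (\<integral>z. (g z)\<^sup>2 \<partial>rect p q r s)"
proof -
  have "(\<integral>z. (v z)\<^sup>2 \<partial>rect p q r s) \<le> (\<integral>z. (row_abs p q g (snd z))\<^sup>2 \<partial>rect p q r s)"
  proof (rule integral_mono_AE[OF L2_square_integrable[OF v] L2_square_integrable[OF row_integral_L2(1)[OF pq g]]])
    show "AE z in rect p q r s. (v z)\<^sup>2 \<le> (row_abs p q g (snd z))\<^sup>2"
      using le by eventually_elim (simp add: abs_le_square_iff[symmetric])
  qed
  also note row_integral_L2(2)[OF pq g]
  finally show ?thesis .
qed

lemma rect_L2_integrable: "f \<in> L2 (rect p q r s) \<Longrightarrow> integrable (rect p q r s) f"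
  by (rule L2_integrable[OF rectf.finite_measure_axioms])

text \<open>
  Boundary values are given by a continuous representative; on almost every row they become
  statements about the primitive.
\<close>
lemma trace_zero_sections:
  assumes pq: "p < q" and v: "integrable (rect p q r s) v" and g: "integrable (rect p q r s) g"
    and w: "weak_x p q r s v g"
    and h: "continuous_on ({p..q} \<times> {r..s}) h" "AE z in rect p q r s. v z = h z" "\<And>y. y \<in> {r..s} \<Longrightarrow> h (p, y) = 0 \<and> h (q, y) = 0"
  shows "AE y in seg r s. (AE x in seg p q. v (x, y) = prim p q (\<lambda>t. g (t, y)) x) \<and> (\<integral>t. g (t, y) \<partial>seg p q) = 0"
  using acl_sections[OF pq v g w] AE_rect_sectionsD[OF h(2)] AE_seg_in[of r s]
proof eventually_elim
  case (elim y)
  then obtain c where c: "AE x in seg p q. v (x, y) = c + prim p q (\<lambda>t. g (t, y)) x" by blast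
  have cont: "continuous_on {p..q} (\<lambda>x. h (x, y))"
    by (rule continuous_on_compose2[OF h(1)]) (use elim in \<open>auto intro!: continuous_intros\<close>)
  have "c = 0" "(\<integral>t. g (t, y) \<partial>seg p q) = 0"
    using trace_zero_1d[OF pq _ c _ cont] elim h(3)[of y] by auto
  with c show ?case by simp
qed

lemma trace_zero_bound:
  assumes pq: "p < q" and v: "integrable (rect p q r s) v" and g: "integrable (rect p q r s) g"
    and z: "AE y in seg r s. (AE x in seg p q. v (x, y) = prim p q (\<lambda>t. g (t, y)) x) \<and> (\<integral>t. g (t, y) \<partial>seg p q) = 0"
  shows "AE z in rect p q r s. \<bar>v z\<bar> \<le> row_abs p q g (snd z)"
proof -
  note [measurable] = rect_measurable[OF v] rect_measurable[OF g]
  have "Measurable.pred plane (\<lambda>z. \<bar>v z\<bar> \<le> row_abs p q g (snd z))" by measurable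
  then show ?thesis
  proof (subst AE_rect_sections)
    show "AE y in seg r s. AE x in seg p q. \<bar>v (x, y)\<bar> \<le> row_abs p q g (snd (x, y))"
      using z rect_fubini(1)[OF g]
    proof eventually_elim
      case (elim y)
      then have "AE x in seg p q. v (x, y) = prim p q (\<lambda>t. g (t, y)) x" by blast
      then show ?case by eventually_elim (use prim_bound[of p q "\<lambda>t. g (t, y)"] elim in \<open>auto simp: row_abs_def\<close>)
    qed
  qed
qed

lemma mean_zero_bound:
  assumes pq: "p < q" and f: "integrable (rect p q r s) f" and g: "integrable (rect p q r s) g"
    and w: "weak_x p q r s f g" and z: "AE y in seg r s. (\<integral>t. f (t, y) \<partial>seg p q) = 0"
  shows "AE z in rect p q r s. \<bar>f z\<bar> \<le> row_abs p q g (snd z)"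
proof -
  note [measurable] = rect_measurable[OF f]
  have "Measurable.pred plane (\<lambda>z. row_int p q f (snd z) = 0)" by measurable
  then have "AE z in rect p q r s. row_int p q f (snd z) = 0"
    by (subst AE_rect_sections) (use z in \<open>auto simp: row_int_def elim!: eventually_mono\<close>)
  with oscillation_x[OF pq f g w] show ?thesis by eventually_elim simp
qed

text \<open>
  On a row \<open>f\<close> is a constant plus the primitive of \<open>f'\<close>. The constant
  disappears because \<open>v'\<close> has integral 0, and \<open>prim_fubini\<close> moves the
  primitive from \<open>f'\<close> to \<open>v'\<close>.
\<close>
lemma integration_by_parts_rect:
  assumes pq: "p < q"
    and L: "f \<in> L2 (rect p q r s)" "f' \<in> L2 (rect p q r s)" "v \<in> L2 (rect p q r s)" "v' \<in> L2 (rect p q r s)"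
    and w: "weak_x p q r s f f'"
    and z: "AE y in seg r s. (AE x in seg p q. v (x, y) = prim p q (\<lambda>t. v' (t, y)) x) \<and> (\<integral>t. v' (t, y) \<partial>seg p q) = 0"
  shows "(\<integral>z. f z * v' z \<partial>rect p q r s) = - (\<integral>z. f' z * v z \<partial>rect p q r s)"
proof -
  note [measurable] = L2_rect_measurable[OF L(1)] L2_rect_measurable[OF L(2)] L2_rect_measurable[OF L(3)] L2_rect_measurable[OF L(4)]
  note i1 = rect_fubini[OF L2_mult_integrable[OF L(1) L(4)]] and i2 = rect_fubini[OF L2_mult_integrable[OF L(2) L(3)]]
  have "(\<integral>y. (\<integral>x. f (x, y) * v' (x, y) \<partial>seg p q) \<partial>seg r s) = (\<integral>y. - (\<integral>x. f' (x, y) * v (x, y) \<partial>seg p q) \<partial>seg r s)"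
  proof (rule integral_cong_AE)
    show "AE y in seg r s. (\<integral>x. f (x, y) * v' (x, y) \<partial>seg p q) = - (\<integral>x. f' (x, y) * v (x, y) \<partial>seg p q)"
      using acl_sections[OF pq rect_L2_integrable[OF L(1)] rect_L2_integrable[OF L(2)] w] z
        rect_fubini(1)[OF rect_L2_integrable[OF L(4)]]
    proof eventually_elim
      case (elim y)
      let ?f' = "\<lambda>t. f' (t, y)" and ?v' = "\<lambda>t. v' (t, y)"
      obtain c where c: "AE x in seg p q. f (x, y) = c + prim p q ?f' x" using elim by blast
      have i: "integrable (seg p q) ?f'" "integrable (seg p q) ?v'" and zv: "(\<integral>t. v' (t, y) \<partial>seg p q) = 0" using elim by auto
      note m [measurable] = borel_measurable_integrable[OF i(1), simplified] borel_measurable_integrable[OF i(2), simplified]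
      have sect [measurable]: "(\<lambda>x. f (x, y)) \<in> borel_measurable borel" "(\<lambda>x. v (x, y)) \<in> borel_measurable borel" by measurable
      have pv: "integrable (seg p q) (\<lambda>x. prim p q ?f' x * v' (x, y))"
        using integrable_mult_bounded[OF i(2), of "prim p q ?f'" "\<integral>t. \<bar>f' (t, y)\<bar> \<partial>seg p q"] prim_bound[OF i(1)]
        by (simp add: mult.commute)
      have "(\<integral>x. f (x, y) * v' (x, y) \<partial>seg p q) = (\<integral>x. c * v' (x, y) + prim p q ?f' x * v' (x, y) \<partial>seg p q)"
        by (rule integral_cong_AE) (use c in \<open>auto elim!: eventually_mono simp: distrib_right\<close>)
      also have "\<dots> = (\<integral>x. prim p q ?f' x * v' (x, y) \<partial>seg p q)" using i pv zv by simp
      also have "\<dots> = (\<integral>t. f' (t, y) * (0 - prim p q ?v' t) \<partial>seg p q)"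
        using prim_fubini[OF i] zv by simp
      also have "\<dots> = (\<integral>t. - (f' (t, y) * v (t, y)) \<partial>seg p q)"
      proof (rule integral_cong_AE)
        have "AE x in seg p q. v (x, y) = prim p q ?v' x" using elim by blast
        then show "AE t in seg p q. f' (t, y) * (0 - prim p q ?v' t) = - (f' (t, y) * v (t, y))"
          by eventually_elim simp
      qed measurable
      finally show ?case by simp
    qed
  qed (use i1(2) i2(2) in \<open>auto dest: borel_measurable_integrable\<close>)
  then show ?thesis using i1(3) i2(3) by simp
qed

text \<open>
  All values of \<open>f1\<close> are within the integral of \<open>\<bar>f2\<bar>\<close> of
  its mean. The mean in turn is found, up to the same error, by integrating \<open>f1\<close>
  against the bump \<open>\<alpha>\<close> of integral 1, and this integral passes to
  \<open>f\<close> by parts.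
\<close>
lemma first_derivative_1d:
  assumes pq: "p < q" and i: "integrable (seg p q) f" "integrable (seg p q) f1" "integrable (seg p q) f2"
    and f: "AE x in seg p q. f x = d + prim p q f1 x" and f1: "AE x in seg p q. f1 x = e + prim p q f2 x"
    and \<alpha>: "bump p q \<alpha>" "(\<integral>x. \<alpha> x \<partial>seg p q) = 1" "\<And>x. \<bar>\<alpha> x\<bar> \<le> B" "\<And>x. \<bar>deriv \<alpha> x\<bar> \<le> B"
  shows "AE x in seg p q. \<bar>f1 x\<bar> \<le> B * (\<integral>t. \<bar>f t\<bar> \<partial>seg p q) + (1 + B * (q - p)) * (\<integral>t. \<bar>f2 t\<bar> \<partial>seg p q)"
proof -
  note [measurable] = borel_measurable_integrable[OF i(1), simplified] borel_measurable_integrable[OF i(2), simplified]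
    bump_borel[OF \<alpha>(1)] bump_borel[OF bump_deriv[OF \<alpha>(1)]]
  define m where "m = (\<integral>x. f1 x \<partial>seg p q) / (q - p)"
  define F where "F = (\<integral>t. \<bar>f2 t\<bar> \<partial>seg p q)"
  have F0: "0 \<le> F" by (simp add: F_def)
  have B0: "0 \<le> B" using order_trans[OF abs_ge_zero \<alpha>(3)] .
  have osc: "AE x in seg p q. \<bar>f1 x - m\<bar> \<le> F" unfolding m_def F_def by (rule oscillation_1d[OF pq i(2,3) f1])
  have fa: "integrable (seg p q) (\<lambda>x. f x * deriv \<alpha> x)" "integrable (seg p q) (\<lambda>x. f1 x * \<alpha> x)"
    by (rule integrable_mult_bounded[OF i(1) _ \<alpha>(4)], simp) (rule integrable_mult_bounded[OF i(2) _ \<alpha>(3)], simp)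
  have ia: "integrable (seg p q) \<alpha>" "integrable (seg p q) (deriv \<alpha>)"
    using \<alpha>(1) by (auto intro: integrable_bump_seg bump_deriv)
  have "(\<integral>x. f x * deriv \<alpha> x \<partial>seg p q) = (\<integral>x. d * deriv \<alpha> x + prim p q f1 x * deriv \<alpha> x \<partial>seg p q)"
    by (rule integral_cong_AE) (use f in \<open>auto elim!: eventually_mono simp: distrib_right\<close>)
  also have "\<dots> = - (\<integral>x. f1 x * \<alpha> x \<partial>seg p q)"
  proof (subst Bochner_Integration.integral_add)
    show "integrable (seg p q) (\<lambda>x. prim p q f1 x * deriv \<alpha> x)"
      by (rule integrable_mult_bounded[OF prim_integrable_outer[OF i(2)] _ \<alpha>(4)]) simp
    show "(\<integral>x. d * deriv \<alpha> x \<partial>seg p q) + (\<integral>x. prim p q f1 x * deriv \<alpha> x \<partial>seg p q) = - (\<integral>x. f1 x * \<alpha> x \<partial>seg p q)"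
      using prim_by_parts_bump[OF pq i(2) \<alpha>(1)] integral_bump_deriv[OF pq \<alpha>(1)] by simp
  qed (use ia in simp)
  finally have parts: "(\<integral>x. f1 x * \<alpha> x \<partial>seg p q) = - (\<integral>x. f x * deriv \<alpha> x \<partial>seg p q)" by simp
  (* alpha has integral 1, so the constant m is its own average *)
  have "m = (\<integral>x. m * \<alpha> x \<partial>seg p q)" using \<alpha>(2) by simp
  also have "\<dots> = (\<integral>x. f1 x * \<alpha> x - (f1 x - m) * \<alpha> x \<partial>seg p q)" by (simp add: algebra_simps)
  also have "\<dots> = (\<integral>x. f1 x * \<alpha> x \<partial>seg p q) - (\<integral>x. (f1 x - m) * \<alpha> x \<partial>seg p q)"
    by (intro Bochner_Integration.integral_diff fa integrable_mult_bounded[OF _ _ \<alpha>(3)]) (use i in auto)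
  finally have m: "m = - (\<integral>x. f x * deriv \<alpha> x \<partial>seg p q) - (\<integral>x. (f1 x - m) * \<alpha> x \<partial>seg p q)" using parts by simp
  have 1: "\<bar>\<integral>x. f x * deriv \<alpha> x \<partial>seg p q\<bar> \<le> B * (\<integral>t. \<bar>f t\<bar> \<partial>seg p q)"
  proof -
    have "\<bar>\<integral>x. f x * deriv \<alpha> x \<partial>seg p q\<bar> \<le> (\<integral>x. \<bar>f x * deriv \<alpha> x\<bar> \<partial>seg p q)" by (rule integral_abs_bound)
    also have "\<dots> \<le> (\<integral>x. B * \<bar>f x\<bar> \<partial>seg p q)"
    proof (rule integral_mono)
      show "\<bar>f x * deriv \<alpha> x\<bar> \<le> B * \<bar>f x\<bar>" for x
        using mult_right_mono[OF \<alpha>(4)[of x], of "\<bar>f x\<bar>"] by (simp add: abs_mult mult.commute)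
    qed (use fa(1) i(1) in auto)
    finally show ?thesis by simp
  qed
  have 2: "\<bar>\<integral>x. (f1 x - m) * \<alpha> x \<partial>seg p q\<bar> \<le> B * (q - p) * F"
  proof -
    have "\<bar>\<integral>x. (f1 x - m) * \<alpha> x \<partial>seg p q\<bar> \<le> (\<integral>x. \<bar>(f1 x - m) * \<alpha> x\<bar> \<partial>seg p q)" by (rule integral_abs_bound)
    also have "\<dots> \<le> (\<integral>x. F * B \<partial>seg p q)"
    proof (rule integral_mono_AE)
      show "integrable (seg p q) (\<lambda>x. \<bar>(f1 x - m) * \<alpha> x\<bar>)"
        using integrable_mult_bounded[of "seg p q" "\<lambda>x. f1 x - m" \<alpha> B] i \<alpha>(3) by simp
      show "AE x in seg p q. \<bar>(f1 x - m) * \<alpha> x\<bar> \<le> F * B"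
        using osc by eventually_elim (use \<alpha>(3) F0 in \<open>auto simp: abs_mult intro!: mult_mono\<close>)
    qed simp
    also have "\<dots> = B * (q - p) * F" using pq by simp
    finally show ?thesis .
  qed
  have mb: "\<bar>m\<bar> \<le> B * (\<integral>t. \<bar>f t\<bar> \<partial>seg p q) + B * (q - p) * F" using m 1 2 by linarith
  show ?thesis using osc
  proof eventually_elim
    case (elim x)
    have "(1 + B * (q - p)) * F = F + B * (q - p) * F" by (simp add: algebra_simps)
    then show ?case using elim mb unfolding F_def[symmetric] by linarith
  qed
qed

lemma first_derivative_bound:
  assumes pq: "p < q"
  shows "\<exists>C\<ge>0. \<forall>r s f f1 f2. f \<in> L2 (rect p q r s) \<longrightarrow> f1 \<in> L2 (rect p q r s) \<longrightarrow> f2 \<in> L2 (rect p q r s) \<longrightarrow>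
    weak_x p q r s f f1 \<longrightarrow> weak_x p q r s f1 f2 \<longrightarrow>
    (\<integral>z. (f1 z)\<^sup>2 \<partial>rect p q r s) \<le> C * ((\<integral>z. (f z)\<^sup>2 \<partial>rect p q r s) + (\<integral>z. (f2 z)\<^sup>2 \<partial>rect p q r s))"
proof -
  obtain \<alpha> where \<alpha>: "bump p q \<alpha>" "(\<integral>x. \<alpha> x \<partial>seg p q) = 1" using normalized_bump[OF pq] .
  obtain B1 B2 where "\<And>x. \<bar>\<alpha> x\<bar> \<le> B1" "\<And>x. \<bar>deriv \<alpha> x\<bar> \<le> B2"
    using bump_bounded[OF \<alpha>(1)] bump_bounded[OF bump_deriv[OF \<alpha>(1)]] by metis
  then obtain B where B: "\<And>x. \<bar>\<alpha> x\<bar> \<le> B" "\<And>x. \<bar>deriv \<alpha> x\<bar> \<le> B"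
    by (metis max.cobounded1 max.cobounded2 order_trans)
  have B0: "0 \<le> B" using order_trans[OF abs_ge_zero B(1)] .
  define k where "k = B + (1 + B * (q - p))"
  have k0: "0 \<le> k" "B \<le> k" "1 + B * (q - p) \<le> k" using B0 pq by (auto simp: k_def)
  have main: "(\<integral>z. (f1 z)\<^sup>2 \<partial>rect p q r s) \<le> (2 * k\<^sup>2 * (q - p)\<^sup>2) * ((\<integral>z. (f z)\<^sup>2 \<partial>rect p q r s) + (\<integral>z. (f2 z)\<^sup>2 \<partial>rect p q r s))"
    if L: "f \<in> L2 (rect p q r s)" "f1 \<in> L2 (rect p q r s)" "f2 \<in> L2 (rect p q r s)"
      and w: "weak_x p q r s f f1" "weak_x p q r s f1 f2" for r s f f1 f2
  proof -
    note [measurable] = L2_rect_measurable[OF L(2)] L2_rect_measurable[OF L(1)]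
      L2_rect_measurable[OF L(3)]
    let ?A = "\<lambda>z. row_abs p q f (snd z)" let ?A2 = "\<lambda>z. row_abs p q f2 (snd z)"
    have "Measurable.pred plane (\<lambda>z. \<bar>f1 z\<bar> \<le> B * ?A z + (1 + B * (q - p)) * ?A2 z)" by measurable
    then have le: "AE z in rect p q r s. \<bar>f1 z\<bar> \<le> B * ?A z + (1 + B * (q - p)) * ?A2 z"
    proof (subst AE_rect_sections)
      show "AE y in seg r s. AE x in seg p q. \<bar>f1 (x, y)\<bar> \<le> B * ?A (x, y) + (1 + B * (q - p)) * ?A2 (x, y)"
        using acl_sections[OF pq rect_L2_integrable[OF L(1)] rect_L2_integrable[OF L(2)] w(1)]
          acl_sections[OF pq rect_L2_integrable[OF L(2)] rect_L2_integrable[OF L(3)] w(2)]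
      proof eventually_elim
        case (elim y)
        then obtain d e where "AE x in seg p q. f (x, y) = d + prim p q (\<lambda>t. f1 (t, y)) x"
          "AE x in seg p q. f1 (x, y) = e + prim p q (\<lambda>t. f2 (t, y)) x" by blast
        from first_derivative_1d[OF pq _ _ _ this \<alpha> B] elim show ?case by (simp add: row_abs_def)
      qed
    qed
    have sq: "AE z in rect p q r s. (f1 z)\<^sup>2 \<le> 2 * k\<^sup>2 * ((?A z)\<^sup>2 + (?A2 z)\<^sup>2)"
      using le
    proof eventually_elim
      case (elim z)
      have "B * ?A z + (1 + B * (q - p)) * ?A2 z \<le> k * ?A z + k * ?A2 z"
        using k0 by (intro add_mono mult_right_mono) (auto simp: row_abs_def)
      with elim have "\<bar>f1 z\<bar> \<le> k * (?A z + ?A2 z)" by (simp add: algebra_simps)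
      then have "(f1 z)\<^sup>2 \<le> (k * (?A z + ?A2 z))\<^sup>2" using abs_le_square_iff[of "f1 z" "k * (?A z + ?A2 z)"] by linarith
      also have "\<dots> = k\<^sup>2 * (?A z + ?A2 z)\<^sup>2" by (simp add: power_mult_distrib)
      also have "\<dots> \<le> k\<^sup>2 * (2 * ((?A z)\<^sup>2 + (?A2 z)\<^sup>2))"
        using zero_le_power2[of "?A z - ?A2 z"] by (intro mult_left_mono) (auto simp: power2_sum power2_diff)
      finally show ?case by (simp add: algebra_simps)
    qed
    note A = row_integral_L2[OF less_imp_le[OF pq] L(1)] and A2 = row_integral_L2[OF less_imp_le[OF pq] L(3)]
    have "(\<integral>z. (f1 z)\<^sup>2 \<partial>rect p q r s) \<le> (\<integral>z. 2 * k\<^sup>2 * ((?A z)\<^sup>2 + (?A2 z)\<^sup>2) \<partial>rect p q r s)"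
      by (rule integral_mono_AE[OF L2_square_integrable[OF L(2)] _ sq])
        (use L2_square_integrable[OF A(1)] L2_square_integrable[OF A2(1)] in simp)
    also have "\<dots> = 2 * k\<^sup>2 * ((\<integral>z. (?A z)\<^sup>2 \<partial>rect p q r s) + (\<integral>z. (?A2 z)\<^sup>2 \<partial>rect p q r s))"
      using L2_square_integrable[OF A(1)] L2_square_integrable[OF A2(1)] by simp
    also have "\<dots> \<le> 2 * k\<^sup>2 * ((q - p)\<^sup>2 * (\<integral>z. (f z)\<^sup>2 \<partial>rect p q r s) + (q - p)\<^sup>2 * (\<integral>z. (f2 z)\<^sup>2 \<partial>rect p q r s))"
      by (intro mult_left_mono add_mono A(2) A2(2)) auto
    finally show ?thesis by (simp add: algebra_simps)
  qed
  show ?thesis by (rule exI[of _ "2 * k\<^sup>2 * (q - p)\<^sup>2"]) (use main in auto)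
qed

section \<open>Sup bound, Poincare inequality and dyadic means\<close>

lemma L2_swap:
  assumes "f \<in> L2 (rect p q r s)" shows "(\<lambda>z. f (prod.swap z)) \<in> L2 (rect r s p q)"
  using swap_measurable[OF L2_rect_measurable[OF assms]] integrable_rect_swap[OF L2_square_integrable[OF assms]]
  by (simp add: L2_def measurable_rect)

lemma row_abs_integrable:
  assumes "integrable (rect p q r s) g"
  shows "integrable (seg r s) (row_abs p q g)" "(\<integral>y. row_abs p q g y \<partial>seg r s) = (\<integral>z. \<bar>g z\<bar> \<partial>rect p q r s)"
  using rect_fubini(2,3)[OF integrable_abs[OF assms]] by (simp_all add: row_abs_def[abs_def])

lemma row_int_integrable:
  assumes "integrable (rect p q r s) g"
  shows "integrable (seg r s) (row_int p q g)" "(\<integral>y. row_int p q g y \<partial>seg r s) = (\<integral>z. g z \<partial>rect p q r s)"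
  using rect_fubini(2,3)[OF assms] by (simp_all add: row_int_def[abs_def])

text \<open>
  The transposed form of \<open>oscillation_x\<close>, with \<open>m\<close> the means over
  columns and \<open>a\<close> the integrals of \<open>\<bar>g\<bar>\<close> over columns.
\<close>
lemma oscillation_y:
  assumes rs: "r < s" and L: "v \<in> L2 (rect p q r s)" "g \<in> L2 (rect p q r s)" and w: "weak_y p q r s v g"
  obtains m a where "m \<in> borel_measurable borel" "a \<in> borel_measurable borel"
    "integrable (seg p q) m" "(\<integral>x. m x \<partial>seg p q) = (\<integral>z. v z \<partial>rect p q r s) / (s - r)"
    "integrable (seg p q) a" "(\<integral>x. a x \<partial>seg p q) = (\<integral>z. \<bar>g z\<bar> \<partial>rect p q r s)"
    "\<And>x. \<bar>m x\<bar> \<le> row_abs r s (\<lambda>z. v (prod.swap z)) x / (s - r)"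
    "AE z in rect p q r s. \<bar>v z - m (fst z)\<bar> \<le> a (fst z)"
proof -
  let ?v = "\<lambda>z. v (prod.swap z)" and ?g = "\<lambda>z. g (prod.swap z)"
  note [measurable] = L2_rect_measurable[OF L2_swap[OF L(1)]] L2_rect_measurable[OF L2_swap[OF L(2)]]
  note i = rect_L2_integrable[OF L2_swap[OF L(1)]] rect_L2_integrable[OF L2_swap[OF L(2)]]
  have osc: "AE z in rect r s p q. \<bar>?v z - row_int r s ?v (snd z) / (s - r)\<bar> \<le> row_abs r s ?g (snd z)"
    by (rule oscillation_x[OF rs i weak_y_swap[OF w L2_rect_measurable[OF L(1)] L2_rect_measurable[OF L(2)]]])
  show thesis
  proof (rule that[of "\<lambda>x. row_int r s ?v x / (s - r)" "row_abs r s ?g"])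
    show "integrable (seg p q) (\<lambda>x. row_int r s ?v x / (s - r))" using row_int_integrable(1)[OF i(1)] by simp
    show "(\<integral>x. row_int r s ?v x / (s - r) \<partial>seg p q) = (\<integral>z. v z \<partial>rect p q r s) / (s - r)"
      using row_int_integrable(2)[OF i(1)] integral_rect_swap[OF L2_rect_measurable[OF L(1)], of r s p q] by simp
    show "integrable (seg p q) (row_abs r s ?g)" by (rule row_abs_integrable(1)[OF i(2)])
    have "(\<lambda>z. \<bar>g z\<bar>) \<in> borel_measurable plane" using L2_rect_measurable[OF L(2)] by (rule borel_measurable_abs)
    from integral_rect_swap[OF this, of r s p q]
    show "(\<integral>x. row_abs r s ?g x \<partial>seg p q) = (\<integral>z. \<bar>g z\<bar> \<partial>rect p q r s)" using row_abs_integrable(2)[OF i(2)] by simp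
    show "\<bar>row_int r s ?v x / (s - r)\<bar> \<le> row_abs r s ?v x / (s - r)" for x
      using rs integral_abs_bound[of "seg r s" "\<lambda>y. ?v (y, x)"]
      by (auto simp: row_int_def row_abs_def abs_divide intro!: divide_right_mono)
    show "AE z in rect p q r s. \<bar>v z - row_int r s ?v (fst z) / (s - r)\<bar> \<le> row_abs r s ?g (fst z)"
      using AE_rect_swap[OF osc] by simp
  qed measurable
qed

text \<open>
  The zero boundary values bound \<open>\<bar>u (x, y)\<bar>\<close> by the integral of
  \<open>\<bar>ux\<bar>\<close> over the row at height \<open>y\<close>. On each column
  \<open>ux\<close> is within the column integral of \<open>\<bar>uxy\<bar>\<close> of its mean,
  which bounds the row integral uniformly in \<open>y\<close>. This takes the place of the
  Sobolev embedding in two dimensions.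
\<close>
lemma sup_bound:
  assumes pq: "p < q" and rs: "r < s"
    and L: "u \<in> L2 (rect p q r s)" "ux \<in> L2 (rect p q r s)" "uxy \<in> L2 (rect p q r s)"
    and z: "AE y in seg r s. (AE x in seg p q. u (x, y) = prim p q (\<lambda>t. ux (t, y)) x) \<and> (\<integral>t. ux (t, y) \<partial>seg p q) = 0"
    and w: "weak_y p q r s ux uxy"
  shows "AE z in rect p q r s. \<bar>u z\<bar> \<le> (\<integral>z. \<bar>ux z\<bar> \<partial>rect p q r s) / (s - r) + (\<integral>z. \<bar>uxy z\<bar> \<partial>rect p q r s)"
proof -
  note [measurable] = L2_rect_measurable[OF L(1)] L2_rect_measurable[OF L(2)]
  let ?ux = "\<lambda>z. ux (prod.swap z)"
  obtain m a where ma: "m \<in> borel_measurable borel" "a \<in> borel_measurable borel"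
    "integrable (seg p q) a" "(\<integral>x. a x \<partial>seg p q) = (\<integral>z. \<bar>uxy z\<bar> \<partial>rect p q r s)"
    "\<And>x. \<bar>m x\<bar> \<le> row_abs r s ?ux x / (s - r)"
    "AE z in rect p q r s. \<bar>ux z - m (fst z)\<bar> \<le> a (fst z)"
    using oscillation_y[OF rs L(2,3) w] by blast
  define H where "H x = row_abs r s ?ux x / (s - r) + a x" for x
  note i = row_abs_integrable[OF rect_L2_integrable[OF L2_swap[OF L(2)]]]
  have Hi: "integrable (seg p q) H" unfolding H_def[abs_def] using i(1) ma(3) by simp
  have "(\<lambda>z. \<bar>ux z\<bar>) \<in> borel_measurable plane" by measurable
  from integral_rect_swap[OF this, of r s p q] have "(\<integral>x. row_abs r s ?ux x \<partial>seg p q) = (\<integral>z. \<bar>ux z\<bar> \<partial>rect p q r s)" using i(2) by simp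
  then have H: "(\<integral>x. H x \<partial>seg p q) = (\<integral>z. \<bar>ux z\<bar> \<partial>rect p q r s) / (s - r) + (\<integral>z. \<bar>uxy z\<bar> \<partial>rect p q r s)"
    unfolding H_def using i(1) ma(3,4) by simp
  have "AE z in rect p q r s. \<bar>ux z\<bar> \<le> H (fst z)"
    using ma(6)
  proof eventually_elim
    case (elim z)
    then show ?case using ma(5)[of "fst z"] unfolding H_def by linarith
  qed
  from AE_rect_sectionsD[OF this]
  have r: "AE y in seg r s. row_abs p q ux y \<le> (\<integral>x. H x \<partial>seg p q)"
    using rect_fubini(1)[OF rect_L2_integrable[OF L(2)]]
  proof eventually_elim
    case (elim y)
    then show ?case unfolding row_abs_def by (intro integral_mono_AE Hi) auto
  qed
  have "Measurable.pred plane (\<lambda>z. row_abs p q ux (snd z) \<le> (\<integral>x. H x \<partial>seg p q))" by measurable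
  then have "AE z in rect p q r s. row_abs p q ux (snd z) \<le> (\<integral>x. H x \<partial>seg p q)"
    by (subst AE_rect_sections) (use r in \<open>auto elim!: eventually_mono\<close>)
  with trace_zero_bound[OF pq rect_L2_integrable[OF L(1)] rect_L2_integrable[OF L(2)] z] show ?thesis
    unfolding H by eventually_elim linarith
qed

lemma first_derivative_bound_y:
  assumes rs: "r < s"
  shows "\<exists>C\<ge>0. \<forall>p q f f1 f2. f \<in> L2 (rect p q r s) \<longrightarrow> f1 \<in> L2 (rect p q r s) \<longrightarrow> f2 \<in> L2 (rect p q r s) \<longrightarrow>
    weak_y p q r s f f1 \<longrightarrow> weak_y p q r s f1 f2 \<longrightarrow>
    (\<integral>z. (f1 z)\<^sup>2 \<partial>rect p q r s) \<le> C * ((\<integral>z. (f z)\<^sup>2 \<partial>rect p q r s) + (\<integral>z. (f2 z)\<^sup>2 \<partial>rect p q r s))"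
proof -
  obtain C where C: "C \<ge> 0" "\<And>p q f f1 f2. \<lbrakk>f \<in> L2 (rect r s p q); f1 \<in> L2 (rect r s p q); f2 \<in> L2 (rect r s p q);
    weak_x r s p q f f1; weak_x r s p q f1 f2\<rbrakk> \<Longrightarrow>
    (\<integral>z. (f1 z)\<^sup>2 \<partial>rect r s p q) \<le> C * ((\<integral>z. (f z)\<^sup>2 \<partial>rect r s p q) + (\<integral>z. (f2 z)\<^sup>2 \<partial>rect r s p q))"
    using first_derivative_bound[OF rs] by blast
  have sw: "(\<integral>z. (f (prod.swap z))\<^sup>2 \<partial>rect r s p q) = (\<integral>z. (f z)\<^sup>2 \<partial>rect p q r s)" if f: "f \<in> L2 (rect p q r s)" for p q and f :: "real \<times> real \<Rightarrow> real"
  proof -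
    have "(\<lambda>z. (f z)\<^sup>2) \<in> borel_measurable plane" using L2_rect_measurable[OF f] by (rule borel_measurable_power)
    from integral_rect_swap[OF this, of r s p q] show ?thesis .
  qed
  show ?thesis
  proof (intro exI[of _ C] conjI allI impI C(1))
    fix p q and f f1 f2 :: "real \<times> real \<Rightarrow> real"
    assume L: "f \<in> L2 (rect p q r s)" "f1 \<in> L2 (rect p q r s)" "f2 \<in> L2 (rect p q r s)"
      and w: "weak_y p q r s f f1" "weak_y p q r s f1 f2"
    note m = L2_rect_measurable[OF L(1)] L2_rect_measurable[OF L(2)] L2_rect_measurable[OF L(3)]
    from C(2)[OF L2_swap[OF L(1)] L2_swap[OF L(2)] L2_swap[OF L(3)] weak_y_swap[OF w(1) m(1,2)] weak_y_swap[OF w(2) m(2,3)]]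
    show "(\<integral>z. (f1 z)\<^sup>2 \<partial>rect p q r s) \<le> C * ((\<integral>z. (f z)\<^sup>2 \<partial>rect p q r s) + (\<integral>z. (f2 z)\<^sup>2 \<partial>rect p q r s))"
      unfolding sw[OF L(1)] sw[OF L(2)] sw[OF L(3)] .
  qed
qed

text \<open>
  The deviation of \<open>v\<close> from its mean is the deviation from the row mean, controlled
  by \<open>gx\<close>, plus the deviation of row means from the total mean, controlled by
  \<open>gy\<close>.
\<close>
lemma poincare_rect:
  assumes pq: "p < q" and rs: "r < s"
    and L: "v \<in> L2 (rect p q r s)" "gx \<in> L2 (rect p q r s)" "gy \<in> L2 (rect p q r s)"
    and w: "weak_x p q r s v gx" "weak_y p q r s v gy"
  shows "(\<integral>z. (v z)\<^sup>2 \<partial>rect p q r s) \<le> (\<integral>z. v z \<partial>rect p q r s)\<^sup>2 / ((q - p) * (s - r))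
    + 2 * (q - p)\<^sup>2 * (\<integral>z. (gx z)\<^sup>2 \<partial>rect p q r s) + 2 * (s - r)\<^sup>2 * (\<integral>z. (gy z)\<^sup>2 \<partial>rect p q r s)"
proof -
  let ?R = "rect p q r s"
  note i = rect_L2_integrable[OF L(1)] rect_L2_integrable[OF L(2)] rect_L2_integrable[OF L(3)]
  note [measurable] = L2_rect_measurable[OF L(1)] L2_rect_measurable[OF L(2)]
  define V where "V = (\<integral>z. v z \<partial>?R)"
  define mQ where "mQ = V / ((q - p) * (s - r))"
  obtain n a where na: "n \<in> borel_measurable borel" "a \<in> borel_measurable borel"
    "integrable (seg p q) n" "(\<integral>x. n x \<partial>seg p q) = V / (s - r)"
    "integrable (seg p q) a" "(\<integral>x. a x \<partial>seg p q) = (\<integral>z. \<bar>gy z\<bar> \<partial>?R)"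
    "AE z in ?R. \<bar>v z - n (fst z)\<bar> \<le> a (fst z)"
    using oscillation_y[OF rs L(1,3) w(2)] unfolding V_def by blast
  define b where "b = (\<integral>z. \<bar>gy z\<bar> \<partial>?R) / (q - p)"
  have "AE y in seg r s. \<bar>row_int p q v y / (q - p) - mQ\<bar> \<le> b"
    using AE_rect_sectionsD[OF na(7)] rect_fubini(1)[OF i(1)]
  proof eventually_elim
    case (elim y)
    have "row_int p q v y - V / (s - r) = (\<integral>x. v (x, y) - n x \<partial>seg p q)"
      using elim na(3,4) by (simp add: row_int_def)
    also have "\<bar>\<dots>\<bar> \<le> (\<integral>x. \<bar>v (x, y) - n x\<bar> \<partial>seg p q)" by (rule integral_abs_bound)
    also have "\<dots> \<le> (\<integral>x. a x \<partial>seg p q)"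
      using elim na(3,5) by (intro integral_mono_AE) auto
    finally have le: "\<bar>row_int p q v y - V / (s - r)\<bar> \<le> (\<integral>z. \<bar>gy z\<bar> \<partial>?R)" unfolding na(6) .
    have "row_int p q v y / (q - p) - mQ = (row_int p q v y - V / (s - r)) / (q - p)"
      by (simp add: mQ_def diff_divide_distrib mult.commute)
    with le pq show ?case by (simp add: b_def abs_divide divide_right_mono)
  qed
  moreover have "Measurable.pred plane (\<lambda>z. \<bar>row_int p q v (snd z) / (q - p) - mQ\<bar> \<le> b)" by measurable
  ultimately have "AE z in ?R. \<bar>row_int p q v (snd z) / (q - p) - mQ\<bar> \<le> b"
    by (subst AE_rect_sections) (auto elim!: eventually_mono)
  with oscillation_x[OF pq i(1,2) w(1)] have le: "AE z in ?R. \<bar>v z - mQ\<bar> \<le> row_abs p q gx (snd z) + b"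
    by eventually_elim linarith
  note A = row_integral_L2[OF less_imp_le[OF pq] L(2)]
  have cL: "(\<lambda>_. k) \<in> L2 ?R" for k :: real
    by (rule L2_bounded[OF rectf.finite_measure_axioms, where B = "\<bar>k\<bar>"]) auto
  have v2: "integrable ?R (\<lambda>z. (v z)\<^sup>2)" by (rule L2_square_integrable[OF L(1)])
  have QV: "measure ?R UNIV = (q - p) * (s - r)" using pq rs by simp
  have Q0: "0 < (q - p) * (s - r)" using pq rs by simp
  have "(\<integral>z. (v z - mQ)\<^sup>2 \<partial>?R) = (\<integral>z. (v z)\<^sup>2 - 2 * mQ * v z + mQ\<^sup>2 \<partial>?R)"
    by (simp add: power2_diff algebra_simps)
  also have "\<dots> = (\<integral>z. (v z)\<^sup>2 \<partial>?R) - 2 * mQ * V + mQ\<^sup>2 * ((q - p) * (s - r))"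
    using v2 i(1) QV by (simp add: V_def)
  also have "\<dots> = (\<integral>z. (v z)\<^sup>2 \<partial>?R) - V\<^sup>2 / ((q - p) * (s - r))"
  proof -
    have "mQ * ((q - p) * (s - r)) = V" using pq rs by (simp add: mQ_def)
    then have "mQ\<^sup>2 * ((q - p) * (s - r)) = mQ * V" by (simp add: power2_eq_square mult.assoc)
    moreover have "mQ * V = V\<^sup>2 / ((q - p) * (s - r))" by (simp add: mQ_def power2_eq_square)
    ultimately show ?thesis by simp
  qed
  finally have var: "(\<integral>z. (v z)\<^sup>2 \<partial>?R) = V\<^sup>2 / ((q - p) * (s - r)) + (\<integral>z. (v z - mQ)\<^sup>2 \<partial>?R)" by simp
  have "(\<integral>z. (v z - mQ)\<^sup>2 \<partial>?R) \<le> (\<integral>z. 2 * (row_abs p q gx (snd z))\<^sup>2 + 2 * b\<^sup>2 \<partial>?R)"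
  proof (rule integral_mono_AE)
    show "integrable ?R (\<lambda>z. (v z - mQ)\<^sup>2)" by (rule L2_square_integrable[OF L2_diff[OF L(1) cL]])
    show "integrable ?R (\<lambda>z. 2 * (row_abs p q gx (snd z))\<^sup>2 + 2 * b\<^sup>2)" using L2_square_integrable[OF A(1)] by simp
    show "AE z in ?R. (v z - mQ)\<^sup>2 \<le> 2 * (row_abs p q gx (snd z))\<^sup>2 + 2 * b\<^sup>2"
      using le
    proof eventually_elim
      case (elim z)
      let ?x = "row_abs p q gx (snd z)"
      have "(v z - mQ)\<^sup>2 \<le> (?x + b)\<^sup>2" using elim abs_le_square_iff[of "v z - mQ" "?x + b"] by linarith
      also have "\<dots> \<le> 2 * ?x\<^sup>2 + 2 * b\<^sup>2" using zero_le_power2[of "?x - b"] by (simp add: power2_sum power2_diff)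
      finally show ?case .
    qed
  qed
  also have "\<dots> = 2 * (\<integral>z. (row_abs p q gx (snd z))\<^sup>2 \<partial>?R) + 2 * b\<^sup>2 * ((q - p) * (s - r))"
    using L2_square_integrable[OF A(1)] QV by simp
  also have "\<dots> \<le> 2 * ((q - p)\<^sup>2 * (\<integral>z. (gx z)\<^sup>2 \<partial>?R)) + 2 * ((s - r)\<^sup>2 * (\<integral>z. (gy z)\<^sup>2 \<partial>?R))"
  proof -
    have "(\<integral>z. \<bar>gy z\<bar> \<partial>?R)\<^sup>2 \<le> ((q - p) * (s - r)) * (\<integral>z. (gy z)\<^sup>2 \<partial>?R)"
      using L1_L2_bound[OF rectf.finite_measure_axioms L(3)] pq rs by simp
    from mult_right_mono[OF this, of "(s - r) / (q - p)"] have "b\<^sup>2 * ((q - p) * (s - r)) \<le> (s - r)\<^sup>2 * (\<integral>z. (gy z)\<^sup>2 \<partial>?R)"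
      using pq rs by (simp add: b_def power_divide power2_eq_square ac_simps)
    with A(2) show ?thesis by linarith
  qed
  finally show ?thesis unfolding var V_def[symmetric] by simp
qed

lemma seg_split:
  fixes f :: "real \<Rightarrow> real"
  assumes f: "integrable (seg p q) f" and m: "p \<le> m" "m \<le> q"
  shows "integrable (seg p m) f" "integrable (seg m q) f"
    "(\<integral>x. f x \<partial>seg p q) = (\<integral>x. f x \<partial>seg p m) + (\<integral>x. f x \<partial>seg m q)"
proof -
  have meas [measurable]: "f \<in> borel_measurable borel" using borel_measurable_integrable[OF f] by simp
  have f': "integrable lborel (\<lambda>x. indicator {p<..<q} x * f x)" using f integrable_seg[OF meas] by blast
  have i: "integrable lborel (\<lambda>x. indicator {a<..<b} x * f x)" if "p \<le> a" "b \<le> q" for a b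
  proof (rule Bochner_Integration.integrable_bound[OF f'])
    show "AE x in lborel. norm (indicator {a<..<b} x * f x) \<le> norm (indicator {p<..<q} x * f x)"
      using that by (auto simp: indicator_def)
  qed measurable
  show "integrable (seg p m) f" "integrable (seg m q) f" using i m integrable_seg[OF meas] by auto
  have "(\<integral>x. indicator {p<..<q} x * f x \<partial>lborel) = (\<integral>x. indicator {p<..<m} x * f x + indicator {m<..<q} x * f x \<partial>lborel)"
  proof (rule integral_cong_AE)
    show "AE x in lborel. indicator {p<..<q} x * f x = indicator {p<..<m} x * f x + indicator {m<..<q} x * f x"
      using AE_lborel_singleton[of m] by eventually_elim (use m in \<open>auto simp: indicator_def\<close>)
  qed measurable
  also have "\<dots> = (\<integral>x. indicator {p<..<m} x * f x \<partial>lborel) + (\<integral>x. indicator {m<..<q} x * f x \<partial>lborel)"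
    using i m by (intro Bochner_Integration.integral_add) auto
  finally show "(\<integral>x. f x \<partial>seg p q) = (\<integral>x. f x \<partial>seg p m) + (\<integral>x. f x \<partial>seg m q)"
    unfolding integral_seg[OF meas] .
qed

lemma rect_split_y:
  fixes f :: "real \<times> real \<Rightarrow> real"
  assumes f: "integrable (rect p q r s) f" and m: "r \<le> m" "m \<le> s"
  shows "(\<integral>z. f z \<partial>rect p q r s) = (\<integral>z. f z \<partial>rect p q r m) + (\<integral>z. f z \<partial>rect p q m s)"
  using seg_split(3)[OF rect_fubini(2)[OF f] m] rect_fubini(3)[OF f]
    rect_fubini(3)[OF integrable_subrect[OF f, of p q r m]] rect_fubini(3)[OF integrable_subrect[OF f, of p q m s]] m by simp

lemma rect_split_x:
  fixes f :: "real \<times> real \<Rightarrow> real"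
  assumes f: "integrable (rect p q r s) f" and m: "p \<le> m" "m \<le> q"
  shows "(\<integral>z. f z \<partial>rect p q r s) = (\<integral>z. f z \<partial>rect p m r s) + (\<integral>z. f z \<partial>rect m q r s)"
proof -
  have sw: "(\<integral>z. f z \<partial>rect a b r s) = (\<integral>z. f (prod.swap z) \<partial>rect r s a b)" for a b
    using integral_rect_swap[OF rect_measurable[OF f], of r s a b] by simp
  show ?thesis unfolding sw by (rule rect_split_y[OF integrable_rect_swap[OF f] m])
qed

lemma weak_y_mono:
  assumes w: "weak_y p q r s v g" and sub: "p \<le> p'" "q' \<le> q" "r \<le> r'" "s' \<le> s"
    and m: "v \<in> borel_measurable plane" "g \<in> borel_measurable plane"
  shows "weak_y p' q' r' s' v g"
  unfolding weak_y_def
proof (intro allI impI)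
  fix \<alpha> \<beta> assume b: "bump p' q' \<alpha>" "bump r' s' \<beta>"
  note [measurable] = m bump_borel[OF b(1)] bump_borel[OF b(2)] bump_borel[OF bump_deriv[OF b(2)]]
  have z: "\<alpha> (fst z) * deriv \<beta> (snd z) = 0" "\<alpha> (fst z) * \<beta> (snd z) = 0" if "z \<notin> {p'<..<q'} \<times> {r'<..<s'}" for z
    using that bump_outside[OF b(1), of "fst z"] bump_outside[OF b(2), of "snd z"] bump_outside[OF bump_deriv[OF b(2)], of "snd z"]
    by (cases z; auto)+
  have "bump p q \<alpha>" "bump r s \<beta>" using b sub by (auto intro: bump_mono)
  with w have "(\<integral>z. v z * (\<alpha> (fst z) * deriv \<beta> (snd z)) \<partial>rect p q r s) = - (\<integral>z. g z * (\<alpha> (fst z) * \<beta> (snd z)) \<partial>rect p q r s)"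
    unfolding weak_y_def by blast
  moreover have "(\<integral>z. v z * (\<alpha> (fst z) * deriv \<beta> (snd z)) \<partial>rect p q r s) = (\<integral>z. v z * (\<alpha> (fst z) * deriv \<beta> (snd z)) \<partial>rect p' q' r' s')"
    by (rule integral_subrect[OF _ sub]) (use z in auto)
  moreover have "(\<integral>z. g z * (\<alpha> (fst z) * \<beta> (snd z)) \<partial>rect p q r s) = (\<integral>z. g z * (\<alpha> (fst z) * \<beta> (snd z)) \<partial>rect p' q' r' s')"
    by (rule integral_subrect[OF _ sub]) (use z in auto)
  ultimately show "(\<integral>z. v z * (\<alpha> (fst z) * deriv \<beta> (snd z)) \<partial>rect p' q' r' s') =
      - (\<integral>z. g z * (\<alpha> (fst z) * \<beta> (snd z)) \<partial>rect p' q' r' s')" by simp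
qed

lemma L2_subrect:
  assumes "f \<in> L2 (rect p q r s)" "p \<le> p'" "q' \<le> q" "r \<le> r'" "s' \<le> s" shows "f \<in> L2 (rect p' q' r' s')"
  using integrable_subrect[OF L2_square_integrable[OF assms(1)] assms(2-)] L2_rect_measurable[OF assms(1)]
  by (simp add: L2_def measurable_rect)

text \<open>
  The squared mean over a cell times its area, the cell being given by its four sides.
\<close>
definition mean_sq :: "(real \<times> real \<Rightarrow> real) \<Rightarrow> real \<times> real \<times> real \<times> real \<Rightarrow> real" where
  "mean_sq v = (\<lambda>(p, q, r, s). (\<integral>z. v z \<partial>rect p q r s)\<^sup>2 / ((q - p) * (s - r)))"

definition subcells :: "real \<Rightarrow> real \<Rightarrow> real \<Rightarrow> real \<Rightarrow> (real \<times> real \<times> real \<times> real) list \<Rightarrow> bool" where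
  "subcells p q r s cs \<longleftrightarrow> (\<forall>(a, b, c, d) \<in> set cs. p \<le> a \<and> a < b \<and> b \<le> q \<and> r \<le> c \<and> c < d \<and> d \<le> s)"

lemma subcells_mono:
  "subcells p' q' r' s' cs \<Longrightarrow> p \<le> p' \<Longrightarrow> q' \<le> q \<Longrightarrow> r \<le> r' \<Longrightarrow> s' \<le> s \<Longrightarrow> subcells p q r s cs"
  unfolding subcells_def by fastforce

text \<open>
  The Poincare inequality on each cell of the \<open>n\<close>-th dyadic subdivision: the
  gradient terms scale with the square of the side lengths, and only finitely many cell means
  are left. This is the compactness of the embedding of $H^1$ in $L^2$ in quantitative form.
\<close>
theorem finitely_many_means:
  assumes "p < q" "r < s"
  shows "\<exists>cs. subcells p q r s cs \<and> (\<forall>v gx gy. v \<in> L2 (rect p q r s) \<longrightarrow> gx \<in> L2 (rect p q r s) \<longrightarrow> gy \<in> L2 (rect p q r s) \<longrightarrow>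
    weak_x p q r s v gx \<longrightarrow> weak_y p q r s v gy \<longrightarrow>
    (\<integral>z. (v z)\<^sup>2 \<partial>rect p q r s) \<le> sum_list (map (mean_sq v) cs)
      + 2 * ((q - p) / 2 ^ n)\<^sup>2 * (\<integral>z. (gx z)\<^sup>2 \<partial>rect p q r s) + 2 * ((s - r) / 2 ^ n)\<^sup>2 * (\<integral>z. (gy z)\<^sup>2 \<partial>rect p q r s))"
  using assms
proof (induction n arbitrary: p q r s)
  case 0
  show ?case
    by (rule exI[of _ "[(p, q, r, s)]"]) (use 0 poincare_rect in \<open>auto simp: subcells_def mean_sq_def\<close>)
next
  case (Suc n)
  let ?m = "(p + q) / 2" and ?k = "(r + s) / 2"
  have mk: "p < ?m" "?m < q" "r < ?k" "?k < s" using Suc.prems by auto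
  define I where "I = 2 * ((q - p) / 2 ^ Suc n)\<^sup>2"
  define J where "J = 2 * ((s - r) / 2 ^ Suc n)\<^sup>2"
  have half: "?m - p = (q - p) / 2" "q - ?m = (q - p) / 2" "?k - r = (s - r) / 2" "s - ?k = (s - r) / 2"
    by (simp_all add: field_simps)
  have cells: "\<exists>cs. subcells a b c d cs \<and> (\<forall>v gx gy. v \<in> L2 (rect a b c d) \<longrightarrow> gx \<in> L2 (rect a b c d) \<longrightarrow> gy \<in> L2 (rect a b c d) \<longrightarrow>
    weak_x a b c d v gx \<longrightarrow> weak_y a b c d v gy \<longrightarrow>
    (\<integral>z. (v z)\<^sup>2 \<partial>rect a b c d) \<le> sum_list (map (mean_sq v) cs)
      + I * (\<integral>z. (gx z)\<^sup>2 \<partial>rect a b c d) + J * (\<integral>z. (gy z)\<^sup>2 \<partial>rect a b c d))"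
    if "a < b" "c < d" "b - a = (q - p) / 2" "d - c = (s - r) / 2" for a b c d
    using Suc.IH[OF that(1,2)] unfolding that(3,4) I_def J_def by simp
  obtain c1 where c1: "subcells p ?m r ?k c1" "\<And>v gx gy. \<lbrakk>v \<in> L2 (rect p ?m r ?k); gx \<in> L2 (rect p ?m r ?k); gy \<in> L2 (rect p ?m r ?k);
      weak_x p ?m r ?k v gx; weak_y p ?m r ?k v gy\<rbrakk> \<Longrightarrow> (\<integral>z. (v z)\<^sup>2 \<partial>rect p ?m r ?k) \<le> sum_list (map (mean_sq v) c1)
      + I * (\<integral>z. (gx z)\<^sup>2 \<partial>rect p ?m r ?k) + J * (\<integral>z. (gy z)\<^sup>2 \<partial>rect p ?m r ?k)"
    using cells[OF mk(1,3) half(1,3)] by blast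
  obtain c2 where c2: "subcells p ?m ?k s c2" "\<And>v gx gy. \<lbrakk>v \<in> L2 (rect p ?m ?k s); gx \<in> L2 (rect p ?m ?k s); gy \<in> L2 (rect p ?m ?k s);
      weak_x p ?m ?k s v gx; weak_y p ?m ?k s v gy\<rbrakk> \<Longrightarrow> (\<integral>z. (v z)\<^sup>2 \<partial>rect p ?m ?k s) \<le> sum_list (map (mean_sq v) c2)
      + I * (\<integral>z. (gx z)\<^sup>2 \<partial>rect p ?m ?k s) + J * (\<integral>z. (gy z)\<^sup>2 \<partial>rect p ?m ?k s)"
    using cells[OF mk(1,4) half(1,4)] by blast
  obtain c3 where c3: "subcells ?m q r ?k c3" "\<And>v gx gy. \<lbrakk>v \<in> L2 (rect ?m q r ?k); gx \<in> L2 (rect ?m q r ?k); gy \<in> L2 (rect ?m q r ?k);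
      weak_x ?m q r ?k v gx; weak_y ?m q r ?k v gy\<rbrakk> \<Longrightarrow> (\<integral>z. (v z)\<^sup>2 \<partial>rect ?m q r ?k) \<le> sum_list (map (mean_sq v) c3)
      + I * (\<integral>z. (gx z)\<^sup>2 \<partial>rect ?m q r ?k) + J * (\<integral>z. (gy z)\<^sup>2 \<partial>rect ?m q r ?k)"
    using cells[OF mk(2,3) half(2,3)] by blast
  obtain c4 where c4: "subcells ?m q ?k s c4" "\<And>v gx gy. \<lbrakk>v \<in> L2 (rect ?m q ?k s); gx \<in> L2 (rect ?m q ?k s); gy \<in> L2 (rect ?m q ?k s);
      weak_x ?m q ?k s v gx; weak_y ?m q ?k s v gy\<rbrakk> \<Longrightarrow> (\<integral>z. (v z)\<^sup>2 \<partial>rect ?m q ?k s) \<le> sum_list (map (mean_sq v) c4)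
      + I * (\<integral>z. (gx z)\<^sup>2 \<partial>rect ?m q ?k s) + J * (\<integral>z. (gy z)\<^sup>2 \<partial>rect ?m q ?k s)"
    using cells[OF mk(2,4) half(2,4)] by blast
  have split: "(\<integral>z. f z \<partial>rect p q r s) = (\<integral>z. f z \<partial>rect p ?m r ?k) + (\<integral>z. f z \<partial>rect p ?m ?k s)
      + (\<integral>z. f z \<partial>rect ?m q r ?k) + (\<integral>z. f z \<partial>rect ?m q ?k s)" if "integrable (rect p q r s) f" for f :: "real \<times> real \<Rightarrow> real"
    using rect_split_x[OF that, of ?m] rect_split_y[OF integrable_subrect[OF that, of p ?m r s], of ?k]
      rect_split_y[OF integrable_subrect[OF that, of ?m q r s], of ?k] mk by simp
  show ?case unfolding I_def[symmetric] J_def[symmetric]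
  proof (intro exI[of _ "c1 @ c2 @ c3 @ c4"] conjI allI impI)
    have "subcells p q r s c1" "subcells p q r s c2" "subcells p q r s c3" "subcells p q r s c4"
      using mk by (auto intro: subcells_mono[OF c1(1)] subcells_mono[OF c2(1)] subcells_mono[OF c3(1)] subcells_mono[OF c4(1)])
    then show "subcells p q r s (c1 @ c2 @ c3 @ c4)" unfolding subcells_def by auto
    fix v gx gy
    assume L: "v \<in> L2 (rect p q r s)" "gx \<in> L2 (rect p q r s)" "gy \<in> L2 (rect p q r s)"
      and w: "weak_x p q r s v gx" "weak_y p q r s v gy"
    note m = L2_rect_measurable[OF L(1)] L2_rect_measurable[OF L(2)] L2_rect_measurable[OF L(3)]
    have sub: "v \<in> L2 (rect a b c d)" "gx \<in> L2 (rect a b c d)" "gy \<in> L2 (rect a b c d)"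
      "weak_x a b c d v gx" "weak_y a b c d v gy" if "p \<le> a" "b \<le> q" "r \<le> c" "d \<le> s" for a b c d
      using L2_subrect[OF L(1) that] L2_subrect[OF L(2) that] L2_subrect[OF L(3) that]
        weak_x_mono[OF w(1) that m(1,2)] weak_y_mono[OF w(2) that m(1,3)] by auto
    have mk': "p \<le> p" "?m \<le> q" "r \<le> r" "?k \<le> s" "q \<le> q" "s \<le> s" "p \<le> ?m" "r \<le> ?k" using mk by auto
    note b1 = c1(2)[OF sub[OF mk'(1,2,3,4)]] and b2 = c2(2)[OF sub[OF mk'(1,2,8,6)]]
      and b3 = c3(2)[OF sub[OF mk'(7,5,3,4)]] and b4 = c4(2)[OF sub[OF mk'(7,5,8,6)]]
    show "(\<integral>z. (v z)\<^sup>2 \<partial>rect p q r s) \<le> sum_list (map (mean_sq v) (c1 @ c2 @ c3 @ c4))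
      + I * (\<integral>z. (gx z)\<^sup>2 \<partial>rect p q r s) + J * (\<integral>z. (gy z)\<^sup>2 \<partial>rect p q r s)"
      unfolding split[OF L2_square_integrable[OF L(1)]] split[OF L2_square_integrable[OF L(2)]] split[OF L2_square_integrable[OF L(3)]]
        map_append sum_list_append distrib_left
      using b1 b2 b3 b4 by linarith
  qed
qed

section \<open>Weak derivatives on the plate\<close>

abbreviation plateM :: "real \<Rightarrow> (real \<times> real) measure" where "plateM l \<equiv> lebesgue_on (plate l)"
abbreviation plateR :: "real \<Rightarrow> (real \<times> real) measure" where "plateR l \<equiv> rect 0 pi (- l) l"

lemma plate_borel [measurable]: "plate l \<in> sets borel" unfolding plate_def by measurable

lemma plate_lebesgue: "plate l \<inter> space lebesgue \<in> sets lebesgue" by simp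

lemma AE_plate: "(AE z in plateM l. P z) \<longleftrightarrow> (AE z in plateR l. P z)"
  unfolding AE_restrict_space_iff[OF plate_lebesgue] AE_completion_iff AE_rect by (simp add: plate_def)

lemma borel_plateM: "f \<in> borel_measurable plane \<Longrightarrow> f \<in> borel_measurable (plateM l)"
  unfolding borel_prod by (auto intro!: measurable_restrict_space1 measurable_completion)

lemma integral_plate:
  assumes f: "f \<in> borel_measurable plane"
  shows "(\<integral>z. f z \<partial>plateM l) = (\<integral>z. f z \<partial>plateR l :: real)" "integrable (plateM l) f \<longleftrightarrow> integrable (plateR l) f"
proof -
  have m: "f \<in> borel_measurable borel" using f by (simp only: borel_prod)
  have m': "(\<lambda>z. indicator (plate l) z *\<^sub>R f z) \<in> borel_measurable lborel" using m by simp
  show "(\<integral>z. f z \<partial>plateM l) = (\<integral>z. f z \<partial>plateR l)"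
    unfolding integral_restrict_space[OF plate_lebesgue] integral_completion[OF m'] integral_rect[OF m]
    by (simp add: plate_def)
  show "integrable (plateM l) f \<longleftrightarrow> integrable (plateR l) f"
    unfolding integrable_restrict_space[OF plate_lebesgue] integrable_completion[OF m'] integrable_rect[OF m]
    by (simp add: plate_def)
qed

lemma plateM_finite: "finite_measure (plateM l)"
proof
  have "emeasure (plateM l) (space (plateM l)) = emeasure lborel (plate l)"
    by (simp add: emeasure_restrict_space)
  also have "\<dots> = emeasure (plateR l) UNIV"
    unfolding rect_density by (subst emeasure_density) (auto simp: plate_def ennreal_indicator nn_integral_indicator)
  finally show "emeasure (plateM l) (space (plateM l)) \<noteq> \<infinity>"
    using rectf.emeasure_finite[of 0 pi "-l" l UNIV] by simp
qed

lemma L2_space_eq: "L2_space (plate l) = L2 (plateM l)" by (simp add: L2_space_def L2_def)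

lemma inner0_eq: "inner0 l = ip2 (plateM l)" by (simp add: inner0_def ip2_def fun_eq_iff)

text \<open>
  Elements of \<open>L2 (plateM l)\<close> are only Lebesgue measurable. Borel representatives
  are measurable for the product \<open>\<sigma>\<close>-algebra, as Fubini's theorem requires.
\<close>
definition rep :: "real \<Rightarrow> (real \<times> real \<Rightarrow> real) \<Rightarrow> real \<times> real \<Rightarrow> real" where
  "rep l f = (SOME f'. f' \<in> borel_measurable plane \<and> (AE z in plateM l. f z = f' z))"

lemma rep:
  assumes "f \<in> borel_measurable (plateM l)"
  shows "rep l f \<in> borel_measurable plane" "AE z in plateM l. f z = rep l f z"
proof -
  have "(\<lambda>z. indicator (plate l) z *\<^sub>R f z) \<in> borel_measurable lebesgue"
    using assms by (simp add: borel_measurable_restrict_space_iff)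
  from completion_ex_borel_measurable_real[OF this] obtain g
    where g: "g \<in> borel_measurable lborel" "AE z in lborel. indicator (plate l) z *\<^sub>R f z = g z" by blast
  have "AE z in plateM l. f z = g z"
    unfolding AE_restrict_space_iff[OF plate_lebesgue] AE_completion_iff using g(2)
    by eventually_elim auto
  moreover have "g \<in> borel_measurable plane" using g(1) unfolding borel_prod by simp
  ultimately have "\<exists>f'. f' \<in> borel_measurable plane \<and> (AE z in plateM l. f z = f' z)" by blast
  from someI_ex[OF this] show "rep l f \<in> borel_measurable plane" "AE z in plateM l. f z = rep l f z"
    unfolding rep_def by auto
qed

lemma rep_L2:
  assumes "f \<in> L2 (plateM l)"
  shows "rep l f \<in> L2 (plateR l)" "AE z in plateM l. f z = rep l f z" "rep l f \<in> L2 (plateM l)"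
proof -
  note r = rep[OF L2_measurable[OF assms]]
  show "AE z in plateM l. f z = rep l f z" by (rule r(2))
  have "AE z in plateM l. rep l f z = f z" using r(2) by eventually_elim simp
  then show L: "rep l f \<in> L2 (plateM l)" by (rule L2_cong_AE[OF _ assms borel_plateM[OF r(1)]])
  have "(\<lambda>z. (rep l f z)\<^sup>2) \<in> borel_measurable plane" using r(1) by (rule borel_measurable_power)
  from integral_plate(2)[OF this] L2_square_integrable[OF L] r(1)
  show "rep l f \<in> L2 (plateR l)" by (simp add: L2_def measurable_rect)
qed

lemma ip2_rep:
  assumes "f \<in> L2 (plateM l)" "g \<in> L2 (plateM l)"
  shows "ip2 (plateM l) f g = ip2 (plateR l) (rep l f) (rep l g)"
proof -
  note f = rep_L2[OF assms(1)] and g = rep_L2[OF assms(2)]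
  have "ip2 (plateM l) f g = ip2 (plateM l) (rep l f) (rep l g)"
    by (rule ip2_cong_AE[OF f(2) g(2)]) (use assms f(3) g(3) in \<open>auto dest: L2_measurable\<close>)
  also have "\<dots> = ip2 (plateR l) (rep l f) (rep l g)"
    unfolding ip2_def
    by (rule integral_plate(1)) (intro borel_measurable_times L2_rect_measurable[OF f(1)] L2_rect_measurable[OF g(1)])
  finally show ?thesis .
qed

lemma ip2_rep_borel:
  assumes "f \<in> L2 (plateM l)" and h: "h \<in> borel_measurable plane"
  shows "ip2 (plateM l) f h = (\<integral>z. rep l f z * h z \<partial>plateR l)"
proof -
  note f = rep_L2[OF assms(1)]
  have "ip2 (plateM l) f h = ip2 (plateM l) (rep l f) h"
    by (rule ip2_cong_AE[OF f(2)]) (use assms f(3) borel_plateM[OF h] in \<open>auto dest: L2_measurable\<close>)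
  also have "\<dots> = (\<integral>z. rep l f z * h z \<partial>plateR l)"
    unfolding ip2_def by (rule integral_plate(1)) (intro borel_measurable_times L2_rect_measurable[OF f(1)] h)
  finally show ?thesis .
qed

lemma smooth_deriv_funpow: "smooth f \<Longrightarrow> smooth ((deriv ^^ n) f)"
  by (induction n) (auto intro: smooth_deriv)

lemma bump_deriv_funpow: "bump p q f \<Longrightarrow> bump p q ((deriv ^^ n) f)"
  by (induction n) (auto intro: bump_deriv)

lemma pdx_product: "smooth a \<Longrightarrow> pdx (\<lambda>z. a (fst z) * b (snd z)) = (\<lambda>z. deriv a (fst z) * b (snd z))"
  unfolding pdx_def by (auto simp: fun_eq_iff intro!: DERIV_imp_deriv DERIV_cmult_right smooth_has_derivative)

lemma pdy_product: "smooth b \<Longrightarrow> pdy (\<lambda>z. a (fst z) * b (snd z)) = (\<lambda>z. a (fst z) * deriv b (snd z))"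
  unfolding pdy_def by (auto simp: fun_eq_iff intro!: DERIV_imp_deriv DERIV_cmult smooth_has_derivative)

lemma pderivs_product:
  assumes "smooth a" "smooth b"
  shows "pderivs i j (\<lambda>z. a (fst z) * b (snd z)) = (\<lambda>z. (deriv ^^ i) a (fst z) * (deriv ^^ j) b (snd z))"
proof -
  have y: "(pdy ^^ j) (\<lambda>z. a (fst z) * b (snd z)) = (\<lambda>z. a (fst z) * (deriv ^^ j) b (snd z))" for j
    by (induction j) (simp_all add: pdy_product smooth_deriv_funpow[OF assms(2)])
  have x: "(pdx ^^ i) (\<lambda>z. a (fst z) * c (snd z)) = (\<lambda>z. (deriv ^^ i) a (fst z) * c (snd z))" for i c
    by (induction i) (simp_all add: pdx_product smooth_deriv_funpow[OF assms(1)])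
  show ?thesis unfolding pderivs_def y x ..
qed

lemma smooth_product_differentiable:
  assumes "smooth a" "smooth b"
  shows "(\<lambda>z. a (fst z) * b (snd z)) differentiable_on (UNIV :: (real \<times> real) set)"
proof -
  have d: "f differentiable (at x)" if "smooth f" for f :: "real \<Rightarrow> real" and x
    using smooth_has_derivative[OF that, of x] by (auto simp: real_differentiable_def)
  show ?thesis
    unfolding differentiable_on_def
    by (intro ballI differentiable_mult differentiable_compose[OF d[OF assms(1)]] differentiable_compose[OF d[OF assms(2)]])
      (auto intro: bounded_linear_imp_differentiable bounded_linear_fst bounded_linear_snd)
qed

lemma bump_product_test_function:
  assumes a: "bump 0 pi a" and b: "bump (- l) l b"
  shows "(\<lambda>z. a (fst z) * b (snd z)) \<in> test_functions (plate l)"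
proof -
  obtain c d c' d' where cd: "0 < c" "d < pi" "- l < c'" "d' < l" "\<And>x. x \<notin> {c..d} \<Longrightarrow> a x = 0" "\<And>x. x \<notin> {c'..d'} \<Longrightarrow> b x = 0"
    using a b unfolding bump_def by blast
  let ?S = "closure {z. a (fst z) * b (snd z) \<noteq> 0}"
  have sub: "{z. a (fst z) * b (snd z) \<noteq> 0} \<subseteq> {c..d} \<times> {c'..d'}"
  proof clarsimp
    fix x y assume "a x \<noteq> 0" "b y \<noteq> 0"
    with cd(5)[of x] cd(6)[of y] show "c \<le> x \<and> x \<le> d \<and> c' \<le> y \<and> y \<le> d'" by auto
  qed
  then have cl: "?S \<subseteq> {c..d} \<times> {c'..d'}" by (intro closure_minimal closed_Times) auto
  have "compact ({c..d} \<times> {c'..d'})" by (intro compact_Times) auto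
  then have "compact (({c..d} \<times> {c'..d'}) \<inter> ?S)" by (rule compact_Int_closed) simp
  moreover have "({c..d} \<times> {c'..d'}) \<inter> ?S = ?S" using cl by blast
  ultimately have "compact ?S" by simp
  moreover have "?S \<subseteq> plate l" using cl cd by (fastforce simp: plate_def)
  ultimately show ?thesis
    unfolding test_functions_def
    using pderivs_product[OF bump_smooth[OF a] bump_smooth[OF b]]
      smooth_product_differentiable[OF smooth_deriv_funpow[OF bump_smooth[OF a]] smooth_deriv_funpow[OF bump_smooth[OF b]]]
    by auto
qed

lemma test_function_L2:
  assumes "\<psi> \<in> test_functions (plate l)"
  shows "pderivs i j \<psi> \<in> L2 (plateM l)"
proof -
  have cont: "continuous_on UNIV (pderivs i j \<psi>)"
    using assms by (intro differentiable_imp_continuous_on) (auto simp: test_functions_def)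
  have "bounded (pderivs i j \<psi> ` (cbox (0, - l) (pi, l)))"
    by (intro compact_imp_bounded compact_continuous_image continuous_on_subset[OF cont]) auto
  then obtain B where B: "\<And>z. z \<in> cbox (0, - l) (pi, l) \<Longrightarrow> \<bar>pderivs i j \<psi> z\<bar> \<le> B" unfolding bounded_iff by fastforce
  have meas: "pderivs i j \<psi> \<in> borel_measurable plane"
    unfolding borel_prod by (rule borel_measurable_continuous_onI[OF cont])
  show ?thesis
  proof (rule L2_bounded[OF plateM_finite borel_plateM[OF meas]])
    fix z assume "z \<in> space (plateM l)"
    then show "\<bar>pderivs i j \<psi> z\<bar> \<le> B" by (intro B) (auto simp: plate_def)
  qed
qed

lemma has_weak_deriv_iff:
  "has_weak_deriv (plate l) i j f g \<longleftrightarrow>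
    (\<forall>\<psi>\<in>test_functions (plate l). ip2 (plateM l) f (pderivs i j \<psi>) = (-1) ^ (i + j) * ip2 (plateM l) g (pderivs 0 0 \<psi>))"
  by (simp add: has_weak_deriv_def ip2_def pderivs_def)

lemma has_weak_deriv_bumps:
  assumes w: "has_weak_deriv (plate l) i j f g" and L: "f \<in> L2 (plateM l)" "g \<in> L2 (plateM l)"
    and b: "bump 0 pi \<alpha>" "bump (- l) l \<beta>"
  shows "(\<integral>z. rep l f z * ((deriv ^^ i) \<alpha> (fst z) * (deriv ^^ j) \<beta> (snd z)) \<partial>plateR l)
    = (-1) ^ (i + j) * (\<integral>z. rep l g z * (\<alpha> (fst z) * \<beta> (snd z)) \<partial>plateR l)"
proof -
  let ?\<psi> = "\<lambda>z. \<alpha> (fst z) * \<beta> (snd z)"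
  note P = pderivs_product[OF bump_smooth[OF b(1)] bump_smooth[OF b(2)]]
  note [measurable] = bump_borel[OF bump_deriv_funpow[OF b(1)]] bump_borel[OF bump_deriv_funpow[OF b(2)]]
  have m: "pderivs i j ?\<psi> \<in> borel_measurable plane" for i j unfolding P by measurable
  have "ip2 (plateM l) f (pderivs i j ?\<psi>) = (-1) ^ (i + j) * ip2 (plateM l) g (pderivs 0 0 ?\<psi>)"
    using w bump_product_test_function[OF b] unfolding has_weak_deriv_iff by blast
  then show ?thesis unfolding ip2_rep_borel[OF L(1) m] ip2_rep_borel[OF L(2) m] unfolding P by simp
qed

lemma weak_deriv_unique:
  assumes "has_weak_deriv (plate l) i j f g1" "has_weak_deriv (plate l) i j f g2"
    and L: "f \<in> L2 (plateM l)" "g1 \<in> L2 (plateM l)" "g2 \<in> L2 (plateM l)"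
  shows "AE z in plateM l. g1 z = g2 z"
proof -
  note r1 = rep_L2[OF L(2)] and r2 = rep_L2[OF L(3)]
  have "AE z in plateR l. rep l g1 z - rep l g2 z = 0"
  proof (rule fundamental_lemma)
    note i = rect_L2_integrable[OF r1(1)] rect_L2_integrable[OF r2(1)]
    show "integrable (plateR l) (\<lambda>z. rep l g1 z - rep l g2 z)" using i by simp
    fix \<alpha> \<beta> assume b: "bump 0 pi \<alpha>" "bump (- l) l \<beta>"
    have "(-1) ^ (i + j) * (\<integral>z. rep l g1 z * (\<alpha> (fst z) * \<beta> (snd z)) \<partial>plateR l)
        = (-1) ^ (i + j) * (\<integral>z. rep l g2 z * (\<alpha> (fst z) * \<beta> (snd z)) \<partial>plateR l)"
      using has_weak_deriv_bumps[OF assms(1) L(1,2) b] has_weak_deriv_bumps[OF assms(2) L(1,3) b] by simp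
    then show "(\<integral>z. (rep l g1 z - rep l g2 z) * (\<alpha> (fst z) * \<beta> (snd z)) \<partial>plateR l) = 0"
      unfolding left_diff_distrib using bump_mult_integrable[OF i(1) b] bump_mult_integrable[OF i(2) b] by simp
  qed
  with r1(2) r2(2) show ?thesis unfolding AE_plate by eventually_elim simp
qed

lemma has_weak_deriv_add:
  assumes "has_weak_deriv (plate l) i j f f'" "has_weak_deriv (plate l) i j g g'"
    and L: "f \<in> L2 (plateM l)" "f' \<in> L2 (plateM l)" "g \<in> L2 (plateM l)" "g' \<in> L2 (plateM l)"
  shows "has_weak_deriv (plate l) i j (f + g) (f' + g')"
  using assms(1,2) L test_function_L2 unfolding has_weak_deriv_iff
  by (simp add: L2.add_left distrib_left)

lemma has_weak_deriv_scale:
  assumes "has_weak_deriv (plate l) i j f f'" and L: "f \<in> L2 (plateM l)" "f' \<in> L2 (plateM l)"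
  shows "has_weak_deriv (plate l) i j (c *\<^sub>R f) (c *\<^sub>R f')"
  using assms(1) L test_function_L2 unfolding has_weak_deriv_iff
  by (simp add: L2.scale_left)

text \<open>
  Both sides of the defining identity are continuous in the mean square for a fixed test
  function.
\<close>
lemma has_weak_deriv_limit:
  assumes w: "\<And>n :: nat. has_weak_deriv (plate l) i j (f n) (g n)"
    and L: "\<And>n. f n \<in> L2 (plateM l)" "\<And>n. g n \<in> L2 (plateM l)" "f' \<in> L2 (plateM l)" "g' \<in> L2 (plateM l)"
    and lim: "(\<lambda>n. ip2 (plateM l) (f n - f') (f n - f')) \<longlonglongrightarrow> 0" "(\<lambda>n. ip2 (plateM l) (g n - g') (g n - g')) \<longlonglongrightarrow> 0"
  shows "has_weak_deriv (plate l) i j f' g'"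
  unfolding has_weak_deriv_iff
proof
  fix \<psi> assume \<psi>: "\<psi> \<in> test_functions (plate l)"
  note t = test_function_L2[OF \<psi>]
  have N: "(\<lambda>n. L2.N (plateM l) (f n - f')) \<longlonglongrightarrow> 0" "(\<lambda>n. L2.N (plateM l) (g n - g')) \<longlonglongrightarrow> 0"
    using tendsto_real_sqrt[OF lim(1)] tendsto_real_sqrt[OF lim(2)] by (simp_all add: L2.N_def)
  have "(\<lambda>n. ip2 (plateM l) (f n) (pderivs i j \<psi>)) \<longlonglongrightarrow> ip2 (plateM l) f' (pderivs i j \<psi>)"
    by (rule L2.tendsto_ip_const[OF N(1)]) (use L t in auto)
  moreover have "(\<lambda>n. (-1) ^ (i + j) * ip2 (plateM l) (g n) (pderivs 0 0 \<psi>)) \<longlonglongrightarrow> (-1) ^ (i + j) * ip2 (plateM l) g' (pderivs 0 0 \<psi>)"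
    by (intro tendsto_mult tendsto_const L2.tendsto_ip_const[OF N(2)]) (use L t in auto)
  moreover have "ip2 (plateM l) (f n) (pderivs i j \<psi>) = (-1) ^ (i + j) * ip2 (plateM l) (g n) (pderivs 0 0 \<psi>)" for n
    using w[of n] \<psi> unfolding has_weak_deriv_iff by blast
  ultimately show "ip2 (plateM l) f' (pderivs i j \<psi>) = (-1) ^ (i + j) * ip2 (plateM l) g' (pderivs 0 0 \<psi>)"
    by (simp only:) (rule LIMSEQ_unique)
qed

section \<open>The energy space of the plate\<close>

lemma H2_spaceD:
  assumes "u \<in> H2_space (plate l)" "i + j \<le> 2"
  shows "weak_deriv (plate l) i j u \<in> L2 (plateM l)" "has_weak_deriv (plate l) i j u (weak_deriv (plate l) i j u)"
proof -
  have "\<exists>g. g \<in> L2_space (plate l) \<and> has_weak_deriv (plate l) i j u g"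
    using assms unfolding H2_space_def by blast
  from someI_ex[OF this] show "weak_deriv (plate l) i j u \<in> L2 (plateM l)"
    "has_weak_deriv (plate l) i j u (weak_deriv (plate l) i j u)"
    unfolding weak_deriv_def L2_space_eq by auto
qed

lemma H2_wd_L2:
  assumes "u \<in> H2_space (plate l)"
  shows "wdx l u \<in> L2 (plateM l)" "wdxx l u \<in> L2 (plateM l)" "wdxy l u \<in> L2 (plateM l)" "wdyy l u \<in> L2 (plateM l)"
    "weak_deriv (plate l) 0 1 u \<in> L2 (plateM l)"
  using assms by (auto intro!: H2_spaceD)

lemma ip2_cong_L2:
  assumes "AE z in M. f z = g z" "f \<in> L2 M" "g \<in> L2 M" "h \<in> L2 M"
  shows "ip2 M f h = ip2 M g h"
  by (rule ip2_cong_AE[OF assms(1) _ L2_measurable[OF assms(2)] L2_measurable[OF assms(3)]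
    L2_measurable[OF assms(4)] L2_measurable[OF assms(4)]]) simp

lemma H2_space_L2: "u \<in> H2_space (plate l) \<Longrightarrow> u \<in> L2 (plateM l)"
  by (simp add: H2_space_def L2_space_eq)

lemma H2starD: "u \<in> H2star l \<Longrightarrow> u \<in> H2_space (plate l)" by (simp add: H2star_def)

lemmas H2star_L2 = H2_space_L2[OF H2starD]
lemmas H2star_weak = H2_spaceD[OF H2starD]

lemma H2_spaceI:
  assumes "u \<in> L2 (plateM l)" "\<And>i j. i + j \<le> 2 \<Longrightarrow> \<exists>g\<in>L2 (plateM l). has_weak_deriv (plate l) i j u g"
  shows "u \<in> H2_space (plate l)"
  using assms by (simp add: H2_space_def L2_space_eq)

lemma subspace_H2star: "subspace (H2star l)"
proof (rule subspaceI)
  have "(0 :: real \<times> real \<Rightarrow> real) \<in> H2_space (plate l)"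
    by (intro H2_spaceI L2.mem bexI[of _ 0]) (auto simp: has_weak_deriv_iff ip2_def fun_ops)
  then show "0 \<in> H2star l" unfolding H2star_def by (auto simp: fun_ops intro!: exI[of _ "\<lambda>_. 0"])
next
  fix u v assume u: "u \<in> H2star l" and v: "v \<in> H2star l"
  have H: "u + v \<in> H2_space (plate l)"
  proof (rule H2_spaceI)
    fix i j :: nat assume ij: "i + j \<le> 2"
    show "\<exists>g\<in>L2 (plateM l). has_weak_deriv (plate l) i j (u + v) g"
      using has_weak_deriv_add[OF H2star_weak(2)[OF u ij] H2star_weak(2)[OF v ij]]
        H2star_L2[OF u] H2star_L2[OF v] H2star_weak(1)[OF u ij] H2star_weak(1)[OF v ij] by (blast intro: L2.mem)
  qed (use u v H2star_L2 in auto)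
  obtain g h where "continuous_on ({0..pi} \<times> {-l..l}) g" "AE p in plateM l. u p = g p" "\<forall>p \<in> {0, pi} \<times> {-l..l}. g p = 0"
    "continuous_on ({0..pi} \<times> {-l..l}) h" "AE p in plateM l. v p = h p" "\<forall>p \<in> {0, pi} \<times> {-l..l}. h p = 0"
    using u v unfolding H2star_def by blast
  then have "continuous_on ({0..pi} \<times> {-l..l}) (\<lambda>p. g p + h p)" "AE p in plateM l. (u + v) p = g p + h p"
    "\<forall>p \<in> {0, pi} \<times> {-l..l}. g p + h p = 0"
    by (auto intro: continuous_on_add simp: fun_ops elim!: eventually_elim2)
  with H show "u + v \<in> H2star l" unfolding H2star_def by blast
next
  fix c and u assume u: "u \<in> H2star l"
  have H: "c *\<^sub>R u \<in> H2_space (plate l)"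
  proof (rule H2_spaceI)
    fix i j :: nat assume ij: "i + j \<le> 2"
    show "\<exists>g\<in>L2 (plateM l). has_weak_deriv (plate l) i j (c *\<^sub>R u) g"
      using has_weak_deriv_scale[OF H2star_weak(2)[OF u ij]] H2star_L2[OF u] H2star_weak(1)[OF u ij] by (blast intro: L2.mem)
  qed (use u H2star_L2 in auto)
  obtain g where "continuous_on ({0..pi} \<times> {-l..l}) g" "AE p in plateM l. u p = g p" "\<forall>p \<in> {0, pi} \<times> {-l..l}. g p = 0"
    using u unfolding H2star_def by blast
  then have "continuous_on ({0..pi} \<times> {-l..l}) (\<lambda>p. c * g p)" "AE p in plateM l. (c *\<^sub>R u) p = c * g p"
    "\<forall>p \<in> {0, pi} \<times> {-l..l}. c * g p = 0"
    by (auto intro: continuous_on_mult_left simp: fun_ops elim!: eventually_mono)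
  with H show "c *\<^sub>R u \<in> H2star l" unfolding H2star_def by blast
qed

lemma H2star_closed: "u \<in> H2star l \<Longrightarrow> v \<in> H2star l \<Longrightarrow> u + v \<in> H2star l" "u \<in> H2star l \<Longrightarrow> c *\<^sub>R u \<in> H2star l"
  "u \<in> H2star l \<Longrightarrow> v \<in> H2star l \<Longrightarrow> u - v \<in> H2star l"
  using subspace_H2star[of l] by (auto intro: subspace_add subspace_scale subspace_diff)

lemma weak_deriv_AE_eq:
  assumes u: "u \<in> H2_space (plate l)" and ij: "i + j \<le> 2" and g: "has_weak_deriv (plate l) i j u g" "g \<in> L2 (plateM l)"
  shows "AE z in plateM l. weak_deriv (plate l) i j u z = g z"
  by (rule weak_deriv_unique[OF H2_spaceD(2)[OF u ij] g(1) H2_space_L2[OF u] H2_spaceD(1)[OF u ij] g(2)])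

text \<open>
  \<open>weak_deriv\<close> is a choice of representative and as such linear only almost
  everywhere.
\<close>
lemma ip2_weak_deriv_linear:
  assumes u: "u \<in> H2star l" and v: "v \<in> H2star l" and ij: "i + j \<le> 2" and f: "f \<in> L2 (plateM l)"
  shows "ip2 (plateM l) (weak_deriv (plate l) i j (u + v)) f = ip2 (plateM l) (weak_deriv (plate l) i j u) f + ip2 (plateM l) (weak_deriv (plate l) i j v) f"
    and "ip2 (plateM l) (weak_deriv (plate l) i j (c *\<^sub>R u)) f = c * ip2 (plateM l) (weak_deriv (plate l) i j u) f"
proof -
  let ?w = "weak_deriv (plate l) i j"
  note L = H2star_L2[OF u] H2star_L2[OF v] H2star_weak(1)[OF u ij] H2star_weak(1)[OF v ij]
  have "AE z in plateM l. ?w (u + v) z = (?w u + ?w v) z"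
    by (rule weak_deriv_AE_eq[OF H2starD[OF H2star_closed(1)[OF u v]] ij
        has_weak_deriv_add[OF H2star_weak(2)[OF u ij] H2star_weak(2)[OF v ij] L(1,3,2,4)]]) (use L in simp)
  then have "ip2 (plateM l) (?w (u + v)) f = ip2 (plateM l) (?w u + ?w v) f"
    by (rule ip2_cong_L2[OF _ H2star_weak(1)[OF H2star_closed(1)[OF u v] ij] L2.mem(1)[OF L(3,4)] f])
  then show "ip2 (plateM l) (?w (u + v)) f = ip2 (plateM l) (?w u) f + ip2 (plateM l) (?w v) f"
    using L f by (simp add: L2.add_left)
  have "AE z in plateM l. ?w (c *\<^sub>R u) z = (c *\<^sub>R ?w u) z"
    by (rule weak_deriv_AE_eq[OF H2starD[OF H2star_closed(2)[OF u]] ij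
        has_weak_deriv_scale[OF H2star_weak(2)[OF u ij] L(1,3)]]) (use L in simp)
  then have "ip2 (plateM l) (?w (c *\<^sub>R u)) f = ip2 (plateM l) (c *\<^sub>R ?w u) f"
    by (rule ip2_cong_L2[OF _ H2star_weak(1)[OF H2star_closed(2)[OF u] ij] L2.mem(2)[OF L(3)] f])
  then show "ip2 (plateM l) (?w (c *\<^sub>R u)) f = c * ip2 (plateM l) (?w u) f"
    using L f by (simp add: L2.scale_left)
qed

lemma inner2_eq:
  assumes u: "u \<in> H2star l" and v: "v \<in> H2star l"
  shows "inner2 \<sigma> l u v = ip2 (plateM l) (wdxx l u) (wdxx l v) + ip2 (plateM l) (wdyy l u) (wdyy l v)
    + \<sigma> * (ip2 (plateM l) (wdxx l u) (wdyy l v) + ip2 (plateM l) (wdyy l u) (wdxx l v))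
    + 2 * (1 - \<sigma>) * ip2 (plateM l) (wdxy l u) (wdxy l v)"
proof -
  note L = H2_wd_L2(2)[OF H2starD[OF u]] H2_wd_L2(4)[OF H2starD[OF u]] H2_wd_L2(3)[OF H2starD[OF u]]
    and L' = H2_wd_L2(2)[OF H2starD[OF v]] H2_wd_L2(4)[OF H2starD[OF v]] H2_wd_L2(3)[OF H2starD[OF v]]
  have "inner2 \<sigma> l u v = (\<integral>z. wdxx l u z * wdxx l v z + wdyy l u z * wdyy l v z
    + \<sigma> * (wdxx l u z * wdyy l v z + wdyy l u z * wdxx l v z) + 2 * (1 - \<sigma>) * (wdxy l u z * wdxy l v z) \<partial>plateM l)"
    unfolding inner2_def laplacian_def by (intro Bochner_Integration.integral_cong refl) (simp add: algebra_simps)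
  also have "\<dots> = ip2 (plateM l) (wdxx l u) (wdxx l v) + ip2 (plateM l) (wdyy l u) (wdyy l v)
    + \<sigma> * (ip2 (plateM l) (wdxx l u) (wdyy l v) + ip2 (plateM l) (wdyy l u) (wdxx l v))
    + 2 * (1 - \<sigma>) * ip2 (plateM l) (wdxy l u) (wdxy l v)"
    unfolding ip2_def using L L' by (simp add: L2_mult_integrable)
  finally show ?thesis .
qed

definition form1 :: "real \<Rightarrow> (real \<times> real \<Rightarrow> real) \<Rightarrow> (real \<times> real \<Rightarrow> real) \<Rightarrow> real" where
  "form1 l u v = inner0 l (wdx l u) (wdx l v)"

definition second_order_energy :: "real \<Rightarrow> (real \<times> real \<Rightarrow> real) \<Rightarrow> real" where
  "second_order_energy l u = ip2 (plateM l) (wdxx l u) (wdxx l u) + ip2 (plateM l) (wdyy l u) (wdyy l u) + ip2 (plateM l) (wdxy l u) (wdxy l u)"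

text \<open>
  The mixed term \<open>2 * \<sigma> * (u_xx, u_yy)\<close> is in absolute value at most
  \<open>\<sigma>\<close> times the sum of the squares, so the form lies between \<open>1 -
  \<sigma>\<close> and \<open>2\<close> times the second order energy.
\<close>
lemma inner2_bounds:
  assumes s: "0 < \<sigma>" "\<sigma> < 1 / 2" and u: "u \<in> H2star l"
  shows "second_order_energy l u / 2 \<le> inner2 \<sigma> l u u" "inner2 \<sigma> l u u \<le> 2 * second_order_energy l u"
proof -
  note L = H2_wd_L2(2)[OF H2starD[OF u]] H2_wd_L2(4)[OF H2starD[OF u]] H2_wd_L2(3)[OF H2starD[OF u]]
  define x y w c where "x = ip2 (plateM l) (wdxx l u) (wdxx l u)" and "y = ip2 (plateM l) (wdyy l u) (wdyy l u)"
    and "w = ip2 (plateM l) (wdxy l u) (wdxy l u)" and "c = ip2 (plateM l) (wdxx l u) (wdyy l u)"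
  have n: "0 \<le> x" "0 \<le> y" "0 \<le> w" using L L2.nonneg by (auto simp: x_def y_def w_def)
  have c': "ip2 (plateM l) (wdyy l u) (wdxx l u) = c" unfolding c_def by (rule L2.sym[OF L(2,1)])
  have "0 \<le> x + y + 2 * c" using L2.nonneg[OF L2.mem(1)[OF L(1,2)]] L c' by (simp add: L2.bilin x_def y_def c_def)
  then have lo: "- (x + y) \<le> 2 * c" by simp
  have "0 \<le> x + y - 2 * c" using L2.nonneg[OF L2.mem(3)[OF L(1,2)]] L c' by (simp add: L2.bilin x_def y_def c_def)
  then have hi: "2 * c \<le> x + y" by simp
  have a: "inner2 \<sigma> l u u = x + y + \<sigma> * (2 * c) + 2 * (1 - \<sigma>) * w"
    unfolding inner2_eq[OF u u] c' c_def[symmetric] x_def[symmetric] y_def[symmetric] w_def[symmetric] by simp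
  have E: "second_order_energy l u = x + y + w" by (simp add: second_order_energy_def x_def y_def w_def)
  have ar: "(x + y + w) / 2 \<le> x + y + A + W" if "- B \<le> A" "B \<le> 1 / 2 * (x + y)" "1 / 2 * w \<le> W" for A B W
    using that by (simp add: field_simps)
  have "- (\<sigma> * (x + y)) \<le> \<sigma> * (2 * c)"
    using mult_left_mono[OF lo, of \<sigma>] s by (simp only: mult_minus_right)
  moreover have "\<sigma> * (x + y) \<le> 1 / 2 * (x + y)" using s n by (intro mult_right_mono) auto
  moreover have "1 / 2 * w \<le> 2 * (1 - \<sigma>) * w" using s n by (intro mult_right_mono) auto
  ultimately show "second_order_energy l u / 2 \<le> inner2 \<sigma> l u u" unfolding a E by (rule ar)
  have ar': "x + y + A + W \<le> 2 * (x + y + w)" if "A \<le> B" "B \<le> 1 * (x + y)" "W \<le> 2 * w" for A B W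
    using that by (simp add: field_simps)
  have "\<sigma> * (2 * c) \<le> \<sigma> * (x + y)" using hi s by (intro mult_left_mono) auto
  moreover have "\<sigma> * (x + y) \<le> 1 * (x + y)" using s n by (intro mult_right_mono) auto
  moreover have "2 * (1 - \<sigma>) * w \<le> 2 * w" using s n by (intro mult_right_mono) auto
  ultimately show "inner2 \<sigma> l u u \<le> 2 * second_order_energy l u" unfolding a E by (rule ar')
qed

lemma second_order_parts:
  assumes u: "u \<in> H2star l"
  shows "ip2 (plateM l) (wdxx l u) (wdxx l u) \<le> second_order_energy l u"
    "ip2 (plateM l) (wdyy l u) (wdyy l u) \<le> second_order_energy l u"
    "ip2 (plateM l) (wdxy l u) (wdxy l u) \<le> second_order_energy l u" "0 \<le> second_order_energy l u"
  using L2.nonneg[OF H2_wd_L2(2)[OF H2starD[OF u]]] L2.nonneg[OF H2_wd_L2(4)[OF H2starD[OF u]]]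
    L2.nonneg[OF H2_wd_L2(3)[OF H2starD[OF u]]] by (auto simp: second_order_energy_def)

lemma semi_inner_H2star:
  assumes s: "0 < \<sigma>" "\<sigma> < 1 / 2"
  shows "semi_inner (H2star l) (inner2 \<sigma> l)"
proof
  fix u v w :: "real \<times> real \<Rightarrow> real" and c
  assume u: "u \<in> H2star l"
  have L: "wdxx l f \<in> L2 (plateM l)" "wdyy l f \<in> L2 (plateM l)" "wdxy l f \<in> L2 (plateM l)" if "f \<in> H2star l" for f
    using H2star_weak(1)[OF that, of 2 0] H2star_weak(1)[OF that, of 0 2] H2star_weak(1)[OF that, of 1 1] by auto
  { assume v: "v \<in> H2star l" and w: "w \<in> H2star l"
    show "inner2 \<sigma> l (u + v) w = inner2 \<sigma> l u w + inner2 \<sigma> l v w"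
      unfolding inner2_eq[OF H2star_closed(1)[OF u v] w] inner2_eq[OF u w] inner2_eq[OF v w]
      using L[OF w] by (simp add: ip2_weak_deriv_linear[OF u v] algebra_simps) }
  { assume w: "w \<in> H2star l"
    show "inner2 \<sigma> l (c *\<^sub>R u) w = c * inner2 \<sigma> l u w"
      unfolding inner2_eq[OF H2star_closed(2)[OF u] w] inner2_eq[OF u w]
      using L[OF w] by (simp add: ip2_weak_deriv_linear[OF u u] algebra_simps) }
  { assume v: "v \<in> H2star l"
    show "inner2 \<sigma> l u v = inner2 \<sigma> l v u"
      unfolding inner2_eq[OF u v] inner2_eq[OF v u] ip2_def by (simp add: mult.commute algebra_simps) }
  show "0 \<le> inner2 \<sigma> l u u" using inner2_bounds(1)[OF s u] second_order_parts(4)[OF u] by simp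
qed (rule subspace_H2star)

lemma semi_inner_form1: "semi_inner (H2star l) (form1 l)"
proof
  fix u v w :: "real \<times> real \<Rightarrow> real" and c
  assume u: "u \<in> H2star l"
  have L: "wdx l f \<in> L2 (plateM l)" if "f \<in> H2star l" for f using H2star_weak(1)[OF that, of 1 0] by auto
  { assume v: "v \<in> H2star l" and w: "w \<in> H2star l"
    show "form1 l (u + v) w = form1 l u w + form1 l v w"
      unfolding form1_def inner0_eq using ip2_weak_deriv_linear(1)[OF u v _ L[OF w], of 1 0] by simp }
  { assume w: "w \<in> H2star l"
    show "form1 l (c *\<^sub>R u) w = c * form1 l u w"
      unfolding form1_def inner0_eq using ip2_weak_deriv_linear(2)[OF u u _ L[OF w], of 1 0] by simp }
  { assume v: "v \<in> H2star l"
    show "form1 l u v = form1 l v u" unfolding form1_def inner0_eq by (rule L2.sym[OF L[OF u] L[OF v]]) }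
  show "0 \<le> form1 l u u" unfolding form1_def inner0_eq by (rule L2.nonneg[OF L[OF u]])
qed (rule subspace_H2star)

text \<open>
  \<open>H2_space\<close> relates every derivative to \<open>u\<close> itself. Inserting the
  derivative of a bump for a bump shows that second derivatives are derivatives of first ones.
\<close>
lemma weak_chain:
  assumes u: "u \<in> H2_space (plate l)"
  shows "weak_x 0 pi (- l) l (rep l u) (rep l (wdx l u))"
    "weak_x 0 pi (- l) l (rep l (wdx l u)) (rep l (wdxx l u))"
    "weak_y 0 pi (- l) l (rep l (wdx l u)) (rep l (wdxy l u))"
    "weak_y 0 pi (- l) l (rep l u) (rep l (weak_deriv (plate l) 0 1 u))"
    "weak_y 0 pi (- l) l (rep l (weak_deriv (plate l) 0 1 u)) (rep l (wdyy l u))"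
proof -
  note B = has_weak_deriv_bumps[OF H2_spaceD(2)[OF u] H2_space_L2[OF u] H2_spaceD(1)[OF u]]
  show "weak_x 0 pi (- l) l (rep l u) (rep l (wdx l u))"
    unfolding weak_x_def using B[of 1 0] by simp
  show "weak_y 0 pi (- l) l (rep l u) (rep l (weak_deriv (plate l) 0 1 u))"
    unfolding weak_y_def using B[of 0 1] by simp
  show "weak_x 0 pi (- l) l (rep l (wdx l u)) (rep l (wdxx l u))"
    unfolding weak_x_def
  proof (intro allI impI)
    fix \<alpha> \<beta> assume b: "bump 0 pi \<alpha>" "bump (- l) l \<beta>"
    show "(\<integral>z. rep l (wdx l u) z * (deriv \<alpha> (fst z) * \<beta> (snd z)) \<partial>plateR l) = - (\<integral>z. rep l (wdxx l u) z * (\<alpha> (fst z) * \<beta> (snd z)) \<partial>plateR l)"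
      using B[of 1 0, OF _ _ bump_deriv[OF b(1)] b(2)] B[of 2 0, OF _ _ b] by (simp add: numeral_2_eq_2)
  qed
  show "weak_y 0 pi (- l) l (rep l (wdx l u)) (rep l (wdxy l u))"
    unfolding weak_y_def
  proof (intro allI impI)
    fix \<alpha> \<beta> assume b: "bump 0 pi \<alpha>" "bump (- l) l \<beta>"
    show "(\<integral>z. rep l (wdx l u) z * (\<alpha> (fst z) * deriv \<beta> (snd z)) \<partial>plateR l) = - (\<integral>z. rep l (wdxy l u) z * (\<alpha> (fst z) * \<beta> (snd z)) \<partial>plateR l)"
      using B[of 1 0, OF _ _ b(1) bump_deriv[OF b(2)]] B[of 1 1, OF _ _ b] by simp
  qed
  show "weak_y 0 pi (- l) l (rep l (weak_deriv (plate l) 0 1 u)) (rep l (wdyy l u))"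
    unfolding weak_y_def
  proof (intro allI impI)
    fix \<alpha> \<beta> assume b: "bump 0 pi \<alpha>" "bump (- l) l \<beta>"
    show "(\<integral>z. rep l (weak_deriv (plate l) 0 1 u) z * (\<alpha> (fst z) * deriv \<beta> (snd z)) \<partial>plateR l) = - (\<integral>z. rep l (wdyy l u) z * (\<alpha> (fst z) * \<beta> (snd z)) \<partial>plateR l)"
      using B[of 0 1, OF _ _ b(1) bump_deriv[OF b(2)]] B[of 0 2, OF _ _ b] by (simp add: numeral_2_eq_2)
  qed
qed

lemma ip2_rep_sq: "f \<in> L2 (plateM l) \<Longrightarrow> ip2 (plateM l) f f = (\<integral>z. (rep l f z)\<^sup>2 \<partial>plateR l)"
  using ip2_rep[of f l f] by (simp add: ip2_self)

lemma H2star_trace: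
  assumes u: "u \<in> H2star l"
  shows "AE y in seg (- l) l. (AE x in seg 0 pi. rep l u (x, y) = prim 0 pi (\<lambda>t. rep l (wdx l u) (t, y)) x)
    \<and> (\<integral>t. rep l (wdx l u) (t, y) \<partial>seg 0 pi) = 0"
proof -
  obtain g where g: "continuous_on ({0..pi} \<times> {-l..l}) g" "AE p in plateM l. u p = g p" "\<forall>p \<in> {0, pi} \<times> {-l..l}. g p = 0"
    using u unfolding H2star_def by blast
  have "AE z in plateR l. rep l u z = g z"
    using g(2) rep_L2(2)[OF H2star_L2[OF u]] unfolding AE_plate by eventually_elim simp
  then show ?thesis
    using g(1,3) rect_L2_integrable[OF rep_L2(1)[OF H2_space_L2[OF H2starD[OF u]]]] rect_L2_integrable[OF rep_L2(1)[OF H2_wd_L2(1)[OF H2starD[OF u]]]]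
    by (intro trace_zero_sections[where h = g] weak_chain(1)[OF H2starD[OF u]]) auto
qed

text \<open>
  On almost every row \<open>u\<close> vanishes at both ends and \<open>u_x\<close> has mean 0;
  either property bounds a function by the row integral of its derivative.
\<close>
lemma poincare_ux:
  assumes u: "u \<in> H2star l"
  shows "form1 l u u \<le> pi\<^sup>2 * ip2 (plateM l) (wdxx l u) (wdxx l u)" "ip2 (plateM l) u u \<le> pi\<^sup>2 * form1 l u u"
proof -
  note H = H2starD[OF u]
  note L = rep_L2(1)[OF H2_space_L2[OF H]] rep_L2(1)[OF H2_wd_L2(1)[OF H]] rep_L2(1)[OF H2_wd_L2(2)[OF H]]
  note i = L[THEN rect_L2_integrable]
  note W = H2_wd_L2(1)[OF H] H2_wd_L2(2)[OF H]
  have z: "AE y in seg (- l) l. (\<integral>t. rep l (wdx l u) (t, y) \<partial>seg 0 pi) = 0" using H2star_trace[OF u] by eventually_elim simp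
  have "AE z in plateR l. \<bar>rep l (wdx l u) z\<bar> \<le> row_abs 0 pi (rep l (wdxx l u)) (snd z)"
    by (rule mean_zero_bound[OF pi_gt_zero i(2,3) weak_chain(2)[OF H] z])
  from L2_bound_by_rows[OF less_imp_le[OF pi_gt_zero] L(2,3) this]
  show "form1 l u u \<le> pi\<^sup>2 * ip2 (plateM l) (wdxx l u) (wdxx l u)"
    unfolding form1_def inner0_eq ip2_rep_sq[OF W(1)] ip2_rep_sq[OF W(2)] by simp
  have "AE z in plateR l. \<bar>rep l u z\<bar> \<le> row_abs 0 pi (rep l (wdx l u)) (snd z)"
    by (rule trace_zero_bound[OF pi_gt_zero i(1,2) H2star_trace[OF u]])
  from L2_bound_by_rows[OF less_imp_le[OF pi_gt_zero] L(1,2) this]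
  show "ip2 (plateM l) u u \<le> pi\<^sup>2 * form1 l u u"
    unfolding form1_def inner0_eq ip2_rep_sq[OF W(1)] ip2_rep_sq[OF H2_space_L2[OF H]] by simp
qed

lemma form1_by_parts:
  assumes u: "u \<in> H2star l" and v: "v \<in> H2star l"
  shows "form1 l u v = - ip2 (plateM l) (wdxx l u) v"
proof -
  note H = H2starD[OF u] and H' = H2starD[OF v]
  note W = H2_wd_L2(1)[OF H] H2_wd_L2(2)[OF H] H2_wd_L2(1)[OF H']
  have "(\<integral>z. rep l (wdx l u) z * rep l (wdx l v) z \<partial>plateR l) = - (\<integral>z. rep l (wdxx l u) z * rep l v z \<partial>plateR l)"
    using rep_L2(1)[OF H2_wd_L2(1)[OF H]] rep_L2(1)[OF H2_wd_L2(2)[OF H]] rep_L2(1)[OF H2_space_L2[OF H']] rep_L2(1)[OF H2_wd_L2(1)[OF H']]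
    by (intro integration_by_parts_rect[OF pi_gt_zero _ _ _ _ weak_chain(2)[OF H] H2star_trace[OF v]]) auto
  then show ?thesis
    unfolding form1_def inner0_eq ip2_rep[OF W(1,3)] ip2_rep[OF W(2) H2_space_L2[OF H']] by (simp add: ip2_def)
qed

text \<open>
  There is no boundary condition on the long edges, so \<open>u_y\<close> is controlled by
  interpolation between \<open>u\<close> and \<open>u_yy\<close>.
\<close>
lemma uy_bound:
  assumes l: "0 < l"
  shows "\<exists>C\<ge>0. \<forall>u\<in>H2star l. ip2 (plateM l) (weak_deriv (plate l) 0 1 u) (weak_deriv (plate l) 0 1 u)
    \<le> C * (ip2 (plateM l) u u + ip2 (plateM l) (wdyy l u) (wdyy l u))"
proof -
  have "- l < l" using l by simp
  from first_derivative_bound_y[OF this] obtain C where C: "C \<ge> 0" "\<And>p q f f1 f2. \<lbrakk>f \<in> L2 (rect p q (- l) l); f1 \<in> L2 (rect p q (- l) l);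
    f2 \<in> L2 (rect p q (- l) l); weak_y p q (- l) l f f1; weak_y p q (- l) l f1 f2\<rbrakk> \<Longrightarrow>
    (\<integral>z. (f1 z)\<^sup>2 \<partial>rect p q (- l) l) \<le> C * ((\<integral>z. (f z)\<^sup>2 \<partial>rect p q (- l) l) + (\<integral>z. (f2 z)\<^sup>2 \<partial>rect p q (- l) l))"
    by blast
  have "ip2 (plateM l) (weak_deriv (plate l) 0 1 u) (weak_deriv (plate l) 0 1 u)
    \<le> C * (ip2 (plateM l) u u + ip2 (plateM l) (wdyy l u) (wdyy l u))" if u: "u \<in> H2star l" for u
  proof -
    note H = H2starD[OF u]
    note W = H2_wd_L2(5)[OF H] H2_wd_L2(4)[OF H]
    show ?thesis unfolding ip2_rep_sq[OF W(1)] ip2_rep_sq[OF W(2)] ip2_rep_sq[OF H2_space_L2[OF H]]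
      using rep_L2(1)[OF H2_space_L2[OF H]] rep_L2(1)[OF H2_wd_L2(5)[OF H]] rep_L2(1)[OF H2_wd_L2(4)[OF H]]
      by (intro C(2) weak_chain[OF H]) auto
  qed
  with C(1) show ?thesis by blast
qed

lemma H2star_sup_bound:
  assumes l: "0 < l"
  shows "\<exists>C\<ge>0. \<forall>u\<in>H2star l. AE z in plateM l. \<bar>u z\<bar> \<le> C * sqrt (second_order_energy l u)"
proof -
  let ?area = "pi * (2 * l)"
  have ll: "- l < l" using l by simp
  have L1: "(\<integral>z. \<bar>f z\<bar> \<partial>plateR l) \<le> sqrt ?area * sqrt (\<integral>z. (f z)\<^sup>2 \<partial>plateR l)" if "f \<in> L2 (plateR l)" for f
  proof -
    have "(\<integral>z. \<bar>f z\<bar> \<partial>plateR l)\<^sup>2 \<le> ?area * (\<integral>z. (f z)\<^sup>2 \<partial>plateR l)"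
      using L1_L2_bound[OF rectf.finite_measure_axioms that] l by simp
    from real_sqrt_le_mono[OF this] show ?thesis by (simp add: real_sqrt_mult)
  qed
  define C where "C = sqrt ?area * pi / (2 * l) + sqrt ?area"
  have "AE z in plateM l. \<bar>u z\<bar> \<le> C * sqrt (second_order_energy l u)" if u: "u \<in> H2star l" for u
  proof -
    note H = H2starD[OF u]
    note W = H2_wd_L2(1)[OF H] H2_wd_L2(3)[OF H]
    note L = rep_L2(1)[OF H2_space_L2[OF H]] rep_L2(1)[OF H2_wd_L2(1)[OF H]] rep_L2(1)[OF H2_wd_L2(3)[OF H]]
    let ?E = "second_order_energy l u"
    have "(\<integral>z. (rep l (wdx l u) z)\<^sup>2 \<partial>plateR l) = form1 l u u"
      unfolding form1_def inner0_eq ip2_rep_sq[OF W(1)] ..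
    also have "\<dots> \<le> pi\<^sup>2 * ?E"
      by (rule order_trans[OF poincare_ux(1)[OF u] mult_left_mono[OF second_order_parts(1)[OF u]]]) simp
    finally have "sqrt (\<integral>z. (rep l (wdx l u) z)\<^sup>2 \<partial>plateR l) \<le> pi * sqrt ?E"
      using real_sqrt_le_mono[of _ "pi\<^sup>2 * ?E"] by (simp add: real_sqrt_mult)
    then have 1: "(\<integral>z. \<bar>rep l (wdx l u) z\<bar> \<partial>plateR l) \<le> sqrt ?area * (pi * sqrt ?E)"
      using order_trans[OF L1[OF L(2)] mult_left_mono[of _ _ "sqrt ?area"]] l by simp
    have "(\<integral>z. (rep l (wdxy l u) z)\<^sup>2 \<partial>plateR l) \<le> ?E"
      using second_order_parts(3)[OF u] unfolding ip2_rep_sq[OF W(2)] .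
    then have 2: "(\<integral>z. \<bar>rep l (wdxy l u) z\<bar> \<partial>plateR l) \<le> sqrt ?area * sqrt ?E"
      using order_trans[OF L1[OF L(3)] mult_left_mono[of _ _ "sqrt ?area"]] l by simp
    have "(\<integral>z. \<bar>rep l (wdx l u) z\<bar> \<partial>plateR l) / (l - - l) + (\<integral>z. \<bar>rep l (wdxy l u) z\<bar> \<partial>plateR l)
        \<le> sqrt ?area * (pi * sqrt ?E) / (2 * l) + sqrt ?area * sqrt ?E"
      using 1 2 l by (intro add_mono) (auto intro: divide_right_mono)
    also have "\<dots> = C * sqrt ?E" by (simp add: C_def distrib_right)
    finally have le: "(\<integral>z. \<bar>rep l (wdx l u) z\<bar> \<partial>plateR l) / (l - - l) + (\<integral>z. \<bar>rep l (wdxy l u) z\<bar> \<partial>plateR l) \<le> C * sqrt ?E" .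
    have "AE z in plateR l. \<bar>rep l u z\<bar> \<le> (\<integral>z. \<bar>rep l (wdx l u) z\<bar> \<partial>plateR l) / (l - - l) + (\<integral>z. \<bar>rep l (wdxy l u) z\<bar> \<partial>plateR l)"
      by (rule sup_bound[OF pi_gt_zero ll L H2star_trace[OF u] weak_chain(3)[OF H]])
    with rep_L2(2)[OF H2_space_L2[OF H]] show ?thesis
      unfolding AE_plate by eventually_elim (use le in linarith)
  qed
  moreover have "0 \<le> C" using l by (simp add: C_def)
  ultimately show ?thesis by blast
qed

lemma cell_integral:
  assumes f: "f \<in> L2 (plateM l)" and sub: "0 \<le> a" "b \<le> pi" "- l \<le> c" "d \<le> l"
  shows "(\<integral>z. rep l f z \<partial>rect a b c d) = ip2 (plateM l) f (indicator ({a<..<b} \<times> {c<..<d}))"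
    "indicator ({a<..<b} \<times> {c<..<d}) \<in> L2 (plateM l)"
proof -
  let ?I = "indicator ({a<..<b} \<times> {c<..<d}) :: real \<times> real \<Rightarrow> real"
  have I: "?I \<in> borel_measurable plane" unfolding borel_prod by (rule borel_measurable_indicator) simp
  show "?I \<in> L2 (plateM l)" by (rule L2_bounded[OF plateM_finite borel_plateM[OF I], where B = 1]) (auto simp: indicator_def)
  have m: "(\<lambda>z. rep l f z * ?I z) \<in> borel_measurable plane"
    by (intro borel_measurable_times I L2_rect_measurable[OF rep_L2(1)[OF f]])
  have "ip2 (plateM l) f ?I = (\<integral>z. rep l f z * ?I z \<partial>rect a b c d)"
    unfolding ip2_rep_borel[OF f I] by (rule integral_subrect[OF m sub]) simp
  also have "\<dots> = (\<integral>z. rep l f z \<partial>rect a b c d)"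
  proof (rule integral_cong_AE)
    show "AE z in rect a b c d. rep l f z * ?I z = rep l f z" using AE_rect_in by eventually_elim simp
  qed (use m L2_rect_measurable[OF rep_L2(1)[OF f]] in \<open>simp_all only: measurable_rect\<close>)
  finally show "(\<integral>z. rep l f z \<partial>rect a b c d) = ip2 (plateM l) f ?I" by simp
qed

text \<open>
  \<open>finitely_many_means\<close> for \<open>u_x\<close>, whose derivatives are
  \<open>u_xx\<close> and \<open>u_xy\<close>; the functionals are the inner products with the
  normalised indicators of the cells.
\<close>
theorem form1_almost_finite_rank:
  assumes l: "0 < l" and e: "0 < e"
  shows "\<exists>(k :: nat) \<kappa>. (\<forall>i<k. \<kappa> i \<in> L2 (plateM l)) \<and>
    (\<forall>u\<in>H2star l. form1 l u u \<le> (\<Sum>i<k. (ip2 (plateM l) (wdx l u) (\<kappa> i))\<^sup>2) + e * second_order_energy l u)"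
proof -
  have ll: "- l < l" using l by simp
  define D where "D = max pi (2 * l)"
  have D: "0 < D" "pi \<le> D" "2 * l \<le> D" by (auto simp: D_def less_max_iff_disj)
  obtain n where n: "4 * D\<^sup>2 / e < 2 ^ n" using real_arch_pow[of 2 "4 * D\<^sup>2 / e"] by auto
  have small: "2 * (x / 2 ^ n)\<^sup>2 \<le> e" if "0 \<le> x" "x \<le> D" for x
  proof -
    have "(x / 2 ^ n)\<^sup>2 = x\<^sup>2 / (2 ^ n)\<^sup>2" by (simp add: power_divide)
    also have "\<dots> \<le> D\<^sup>2 / (2 ^ n)\<^sup>2" using that by (intro divide_right_mono power_mono) auto
    also have "\<dots> \<le> D\<^sup>2 / 2 ^ n" using D by (intro divide_left_mono) (auto simp: power2_eq_square)
    also have "\<dots> \<le> e / 4" using n e by (simp add: field_simps)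
    finally show ?thesis using e by simp
  qed
  obtain cs where cs: "subcells 0 pi (- l) l cs" "\<And>v gx gy. \<lbrakk>v \<in> L2 (plateR l); gx \<in> L2 (plateR l); gy \<in> L2 (plateR l);
    weak_x 0 pi (- l) l v gx; weak_y 0 pi (- l) l v gy\<rbrakk> \<Longrightarrow>
    (\<integral>z. (v z)\<^sup>2 \<partial>plateR l) \<le> sum_list (map (mean_sq v) cs)
      + 2 * ((pi - 0) / 2 ^ n)\<^sup>2 * (\<integral>z. (gx z)\<^sup>2 \<partial>plateR l) + 2 * ((l - - l) / 2 ^ n)\<^sup>2 * (\<integral>z. (gy z)\<^sup>2 \<partial>plateR l)"
    using finitely_many_means[OF pi_gt_zero ll, of n] by blast
  define K where "K = (\<lambda>(a, b, c, d). (1 / sqrt ((b - a) * (d - c))) *\<^sub>R (indicator ({a<..<b} \<times> {c<..<d}) :: real \<times> real \<Rightarrow> real))"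
  have K: "K x \<in> L2 (plateM l)" "f \<in> L2 (plateM l) \<Longrightarrow> mean_sq (rep l f) x = (ip2 (plateM l) f (K x))\<^sup>2"
    if x: "x \<in> set cs" for x f
  proof -
    obtain a b c d where abcd: "x = (a, b, c, d)" by (cases x)
    have s: "0 \<le> a" "a < b" "b \<le> pi" "- l \<le> c" "c < d" "d \<le> l" using cs(1) x unfolding subcells_def abcd by auto
    have I: "indicator ({a<..<b} \<times> {c<..<d}) \<in> L2 (plateM l)" using cell_integral(2)[OF L2.mem(4) s(1,3,4,6)] .
    then show "K x \<in> L2 (plateM l)" unfolding K_def abcd by simp
    assume f: "f \<in> L2 (plateM l)"
    show "mean_sq (rep l f) x = (ip2 (plateM l) f (K x))\<^sup>2"
      unfolding mean_sq_def K_def abcd using s f I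
      by (simp add: cell_integral(1)[OF f s(1,3,4,6)] L2.scale_right power_mult_distrib power_divide)
  qed
  show ?thesis
  proof (intro exI[of _ "length cs"] exI[of _ "\<lambda>i. K (cs ! i)"] conjI allI impI ballI)
    show "K (cs ! i) \<in> L2 (plateM l)" if "i < length cs" for i using K(1) that by simp
    fix u assume u: "u \<in> H2star l"
    note H = H2starD[OF u]
    note W = H2_wd_L2(1)[OF H] H2_wd_L2(2)[OF H] H2_wd_L2(3)[OF H]
    note L = rep_L2(1)[OF H2_wd_L2(1)[OF H]] rep_L2(1)[OF H2_wd_L2(2)[OF H]] rep_L2(1)[OF H2_wd_L2(3)[OF H]]
    have "sum_list (map (mean_sq (rep l (wdx l u))) cs) = sum_list (map (\<lambda>x. (ip2 (plateM l) (wdx l u) (K x))\<^sup>2) cs)"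
      using K(2)[OF _ W(1)] by (intro arg_cong[where f = sum_list] map_cong) auto
    also have "\<dots> = (\<Sum>i<length cs. (ip2 (plateM l) (wdx l u) (K (cs ! i)))\<^sup>2)"
      by (simp add: sum_list_sum_nth atLeast0LessThan)
    finally have S: "sum_list (map (mean_sq (rep l (wdx l u))) cs) = (\<Sum>i<length cs. (ip2 (plateM l) (wdx l u) (K (cs ! i)))\<^sup>2)" .
    have b: "form1 l u u \<le> (\<Sum>i<length cs. (ip2 (plateM l) (wdx l u) (K (cs ! i)))\<^sup>2)
      + 2 * ((pi - 0) / 2 ^ n)\<^sup>2 * ip2 (plateM l) (wdxx l u) (wdxx l u) + 2 * ((l - - l) / 2 ^ n)\<^sup>2 * ip2 (plateM l) (wdxy l u) (wdxy l u)"
      using cs(2)[OF L weak_chain(2)[OF H] weak_chain(3)[OF H]]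
      unfolding form1_def inner0_eq ip2_rep_sq[OF W(1)] ip2_rep_sq[OF W(2)] ip2_rep_sq[OF W(3)] S .
    have "2 * ((pi - 0) / 2 ^ n)\<^sup>2 * ip2 (plateM l) (wdxx l u) (wdxx l u) \<le> e * ip2 (plateM l) (wdxx l u) (wdxx l u)"
      using small[of "pi - 0"] D by (intro mult_right_mono L2.nonneg W) auto
    moreover have "2 * ((l - - l) / 2 ^ n)\<^sup>2 * ip2 (plateM l) (wdxy l u) (wdxy l u) \<le> e * ip2 (plateM l) (wdxy l u) (wdxy l u)"
      using small[of "l - - l"] D l by (intro mult_right_mono L2.nonneg W) auto
    moreover have "0 \<le> e * ip2 (plateM l) (wdyy l u) (wdyy l u)"
      using e L2.nonneg[OF H2_wd_L2(4)[OF H]] by simp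
    ultimately show "form1 l u u \<le> (\<Sum>i<length cs. (ip2 (plateM l) (wdx l u) (K (cs ! i)))\<^sup>2) + e * second_order_energy l u"
      using b unfolding second_order_energy_def distrib_left by linarith
  qed
qed

section \<open>Completeness of the energy space and the spectral gap\<close>

lemma has_weak_deriv_self: "u \<in> L2 (plateM l) \<Longrightarrow> has_weak_deriv (plate l) 0 0 u u"
  by (simp add: has_weak_deriv_iff)

lemma weak_deriv_diff_norm:
  assumes u: "u \<in> H2star l" and v: "v \<in> H2star l" and ij: "i + j \<le> 2"
  shows "ip2 (plateM l) (weak_deriv (plate l) i j u - weak_deriv (plate l) i j v) (weak_deriv (plate l) i j u - weak_deriv (plate l) i j v)
    = ip2 (plateM l) (weak_deriv (plate l) i j (u - v)) (weak_deriv (plate l) i j (u - v))"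
proof -
  let ?w = "weak_deriv (plate l) i j"
  note L = H2star_weak(1)[OF u ij] H2star_weak(1)[OF v ij] H2star_weak(1)[OF H2star_closed(3)[OF u v] ij]
  have lin: "ip2 (plateM l) (?w (u - v)) f = ip2 (plateM l) (?w u - ?w v) f" if f: "f \<in> L2 (plateM l)" for f
    using ip2_weak_deriv_linear(1)[OF H2star_closed(3)[OF u v] v ij f] L f by (simp add: L2.diff_left)
  have "ip2 (plateM l) (?w (u - v)) (?w (u - v)) = ip2 (plateM l) (?w u - ?w v) (?w (u - v))" by (rule lin[OF L(3)])
  also have "\<dots> = ip2 (plateM l) (?w (u - v)) (?w u - ?w v)" using L by (intro L2.sym) auto
  also have "\<dots> = ip2 (plateM l) (?w u - ?w v) (?w u - ?w v)" by (rule lin) (use L in simp)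
  finally show ?thesis by simp
qed

text \<open>
  The second derivatives bound \<open>u_x\<close> and \<open>u\<close> by
  \<open>poincare_ux\<close>, and then \<open>u_y\<close> by \<open>uy_bound\<close>.
\<close>
lemma weak_deriv_energy_bound:
  assumes l: "0 < l"
  shows "\<exists>C\<ge>0. \<forall>u\<in>H2star l. ip2 (plateM l) u u \<le> C * second_order_energy l u \<and>
    (\<forall>i j. i + j \<le> 2 \<longrightarrow> ip2 (plateM l) (weak_deriv (plate l) i j u) (weak_deriv (plate l) i j u) \<le> C * second_order_energy l u)"
proof -
  obtain D where D: "D \<ge> 0" "\<And>u. u \<in> H2star l \<Longrightarrow> ip2 (plateM l) (weak_deriv (plate l) 0 1 u) (weak_deriv (plate l) 0 1 u)
    \<le> D * (ip2 (plateM l) u u + ip2 (plateM l) (wdyy l u) (wdyy l u))" using uy_bound[OF l] by blast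
  (* the summands bound u, u_x, u_y and the second derivatives, in this order *)
  define C where "C = pi\<^sup>2 * pi\<^sup>2 + pi\<^sup>2 + D * (pi\<^sup>2 * pi\<^sup>2 + 1) + 1"
  have C: "0 \<le> C" "pi\<^sup>2 * pi\<^sup>2 \<le> C" "pi\<^sup>2 \<le> C" "D * (pi\<^sup>2 * pi\<^sup>2 + 1) \<le> C" "1 \<le> C"
    using D(1) mult_nonneg_nonneg[OF D(1), of "pi\<^sup>2 * pi\<^sup>2 + 1"] zero_le_power2[of pi]
      mult_nonneg_nonneg[OF zero_le_power2[of pi] zero_le_power2[of pi]] unfolding C_def by linarith+
  have "ip2 (plateM l) u u \<le> C * second_order_energy l u \<and>
    (\<forall>i j. i + j \<le> 2 \<longrightarrow> ip2 (plateM l) (weak_deriv (plate l) i j u) (weak_deriv (plate l) i j u) \<le> C * second_order_energy l u)"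
    if u: "u \<in> H2star l" for u
  proof -
    let ?E = "second_order_energy l u"
    note E = second_order_parts[OF u]
    have up: "x \<le> C * ?E" if "x \<le> k * ?E" "k \<le> C" for x k
      using that(1) mult_right_mono[OF that(2) E(4)] by (rule order_trans)
    have b: "form1 l u u \<le> pi\<^sup>2 * ?E"
      by (rule order_trans[OF poincare_ux(1)[OF u] mult_left_mono[OF E(1)]]) simp
    have z: "ip2 (plateM l) u u \<le> (pi\<^sup>2 * pi\<^sup>2) * ?E"
      using order_trans[OF poincare_ux(2)[OF u] mult_left_mono[OF b, of "pi\<^sup>2"]] by (simp add: mult.assoc)
    have "ip2 (plateM l) u u + ip2 (plateM l) (wdyy l u) (wdyy l u) \<le> (pi\<^sup>2 * pi\<^sup>2 + 1) * ?E"
      using z E(2) by (simp add: distrib_right)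
    from mult_left_mono[OF this D(1)] D(2)[OF u]
    have y: "ip2 (plateM l) (weak_deriv (plate l) 0 1 u) (weak_deriv (plate l) 0 1 u) \<le> (D * (pi\<^sup>2 * pi\<^sup>2 + 1)) * ?E"
      unfolding mult.assoc by (rule order_trans[rotated])
    have H: "u \<in> H2_space (plate l)" by (rule H2starD[OF u])
    note L = H2_space_L2[OF H]
    have "AE z in plateM l. weak_deriv (plate l) 0 0 u z = u z"
      by (rule weak_deriv_AE_eq[OF H _ has_weak_deriv_self[OF L] L]) simp
    note AE = this
    have L0: "weak_deriv (plate l) 0 0 u \<in> L2 (plateM l)" by (rule H2_spaceD(1)[OF H]) simp
    have "ip2 (plateM l) (weak_deriv (plate l) 0 0 u) (weak_deriv (plate l) 0 0 u) = ip2 (plateM l) u u"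
      by (rule ip2_cong_AE[OF AE AE L2_measurable[OF L0] L2_measurable[OF L] L2_measurable[OF L0] L2_measurable[OF L]])
    with z have z': "ip2 (plateM l) (weak_deriv (plate l) 0 0 u) (weak_deriv (plate l) 0 0 u) \<le> (pi\<^sup>2 * pi\<^sup>2) * ?E" by simp
    have "ip2 (plateM l) (weak_deriv (plate l) i j u) (weak_deriv (plate l) i j u) \<le> C * ?E" if ij: "i + j \<le> 2" for i j
    proof -
      consider "i = 0" "j = 0" | "i = 1" "j = 0" | "i = 0" "j = 1" | "i = 2" "j = 0" | "i = 1" "j = 1" | "i = 0" "j = 2"
        using ij by linarith
      then show ?thesis
      proof cases
        case 1 show ?thesis unfolding 1 by (rule up[OF z' C(2)])
      next
        case 2 show ?thesis unfolding 2 using up[OF b C(3)] unfolding form1_def inner0_eq .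
      next
        case 3 show ?thesis unfolding 3 by (rule up[OF y C(4)])
      next
        case 4 show ?thesis unfolding 4 by (rule up[OF _ C(5)]) (use E in simp)
      next
        case 5 show ?thesis unfolding 5 by (rule up[OF _ C(5)]) (use E in simp)
      next
        case 6 show ?thesis unfolding 6 by (rule up[OF _ C(5)]) (use E in simp)
      qed
    qed
    with up[OF z C(2)] show ?thesis by blast
  qed
  with C(1) show ?thesis by blast
qed

text \<open>
  A nonempty open set is not negligible, and the plate is dense in the closed rectangle.
\<close>
lemma AE_le_imp_le_on_closure:
  assumes l: "0 < l" and h: "continuous_on ({0..pi} \<times> {-l..l}) h" and le: "AE z in plateM l. h z \<le> (c :: real)"
    and z: "z \<in> {0..pi} \<times> {-l..l}"
  shows "h z \<le> c"
proof -
  have cl: "closure (plate l) = {0..pi} \<times> {-l..l}"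
    unfolding plate_def using l by (simp add: closure_Times)
  have op: "open (plate l)" unfolding plate_def by (intro open_Times) auto
  have sub: "plate l \<subseteq> {0..pi} \<times> {-l..l}" by (auto simp: plate_def)
  have "h x \<le> c" if x: "x \<in> plate l" for x
  proof (rule ccontr)
    assume "\<not> h x \<le> c"
    let ?V = "plate l \<inter> h -` {c<..}"
    have "open ?V" by (rule continuous_open_preimage[OF continuous_on_subset[OF h sub] op]) simp
    moreover have "?V \<noteq> {}" using x \<open>\<not> h x \<le> c\<close> by auto
    ultimately have nn: "\<not> negligible ?V" using open_not_negligible by blast
    have "AE x in lebesgue. x \<in> plate l \<longrightarrow> h x \<le> c" using le unfolding AE_restrict_space_iff[OF plate_lebesgue] .
    then have "AE x in lebesgue. x \<notin> ?V" by eventually_elim auto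
    moreover have "?V \<in> sets lebesgue" using \<open>open ?V\<close> by (simp add: borel_open)
    ultimately have "?V \<in> null_sets lebesgue" by (simp add: AE_iff_null_sets)
    with nn show False by (simp add: negligible_iff_null_sets)
  qed
  with continuous_le_on_closure[of "plate l" h z c] h z cl show ?thesis by auto
qed

text \<open>
  The functions and all their weak derivatives converge in the mean square, and limits of weak
  derivatives are weak derivatives of the limit. The boundary condition survives because the sup
  bound makes the continuous representatives converge uniformly on the closed rectangle.
\<close>
theorem H2star_complete:
  assumes s: "0 < \<sigma>" "\<sigma> < 1 / 2" and l: "0 < l"
    and u: "\<And>n. u n \<in> H2star l"
    and cauchy: "\<And>e. 0 < e \<Longrightarrow> \<exists>N. \<forall>m\<ge>N. \<forall>n\<ge>N. inner2 \<sigma> l (u m - u n) (u m - u n) < e"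
  shows "\<exists>v\<in>H2star l. (\<lambda>n. inner2 \<sigma> l (u n - v) (u n - v)) \<longlonglongrightarrow> 0"
proof -
  let ?E = "\<lambda>m n. second_order_energy l (u m - u n)" and ?M = "plateM l" and ?K = "{0..pi} \<times> {-l..l}"
  note H = H2starD[OF u] and d = H2star_closed(3)[OF u u]
  have E0: "0 \<le> ?E m n" for m n by (rule second_order_parts(4)[OF d])
  have Ecauchy: "\<exists>N. \<forall>m\<ge>N. \<forall>n\<ge>N. ?E m n < e" if e: "0 < e" for e
  proof -
    obtain N where N: "\<And>m n. \<lbrakk>m \<ge> N; n \<ge> N\<rbrakk> \<Longrightarrow> inner2 \<sigma> l (u m - u n) (u m - u n) < e / 2" using cauchy[of "e / 2"] e by auto
    have "?E m n < e" if "m \<ge> N" "n \<ge> N" for m n using N[OF that] inner2_bounds(1)[OF s d, of m n] by simp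
    then show ?thesis by blast
  qed
  obtain C where C: "C \<ge> 0" "\<And>u. u \<in> H2star l \<Longrightarrow> ip2 ?M u u \<le> C * second_order_energy l u"
    "\<And>u i j. u \<in> H2star l \<Longrightarrow> i + j \<le> 2 \<Longrightarrow> ip2 ?M (weak_deriv (plate l) i j u) (weak_deriv (plate l) i j u) \<le> C * second_order_energy l u"
    using weak_deriv_energy_bound[OF l] by blast
  have L2lim: "\<exists>g\<in>L2 ?M. (\<lambda>n. ip2 ?M (f n - g) (f n - g)) \<longlonglongrightarrow> 0"
    if f: "\<And>n. f n \<in> L2 ?M" and b: "\<And>m n. ip2 ?M (f m - f n) (f m - f n) \<le> C * ?E m n" for f
  proof (rule L2_complete[OF f])
    fix e :: real assume e: "0 < e"
    obtain N where N: "\<And>m n. \<lbrakk>m \<ge> N; n \<ge> N\<rbrakk> \<Longrightarrow> ?E m n < e / (C + 1)" using Ecauchy[of "e / (C + 1)"] e C(1) by auto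
    have "ip2 ?M (f m - f n) (f m - f n) < e" if mn: "m \<ge> N" "n \<ge> N" for m n
    proof -
      have "ip2 ?M (f m - f n) (f m - f n) \<le> (C + 1) * ?E m n" using b[of m n] E0[of m n] by (simp add: distrib_right)
      also have "\<dots> < e" using N[OF mn] C(1) by (simp add: field_simps)
      finally show ?thesis .
    qed
    then show "\<exists>N. \<forall>m\<ge>N. \<forall>n\<ge>N. ip2 ?M (f m - f n) (f m - f n) < e" by blast
  qed
  obtain v where v: "v \<in> L2 ?M" "(\<lambda>n. ip2 ?M (u n - v) (u n - v)) \<longlonglongrightarrow> 0"
    using L2lim[OF H2_space_L2[OF H] C(2)[OF d]] by blast
  have ex: "\<exists>g\<in>L2 ?M. (\<lambda>n. ip2 ?M (weak_deriv (plate l) i j (u n) - g) (weak_deriv (plate l) i j (u n) - g)) \<longlonglongrightarrow> 0" if ij: "i + j \<le> 2" for i j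
    by (rule L2lim[OF H2_spaceD(1)[OF H ij]]) (simp add: weak_deriv_diff_norm[OF u u ij] C(3)[OF d ij])
  define g where "g i j = (SOME g. g \<in> L2 ?M \<and>
    (\<lambda>n. ip2 ?M (weak_deriv (plate l) i j (u n) - g) (weak_deriv (plate l) i j (u n) - g)) \<longlonglongrightarrow> 0)" for i j
  have g: "g i j \<in> L2 ?M"
    "(\<lambda>n. ip2 ?M (weak_deriv (plate l) i j (u n) - g i j) (weak_deriv (plate l) i j (u n) - g i j)) \<longlonglongrightarrow> 0" if ij: "i + j \<le> 2" for i j
    using someI_ex[OF ex[OF ij, unfolded Bex_def]] unfolding g_def by blast+
  have wg: "has_weak_deriv (plate l) i j v (g i j)" if ij: "i + j \<le> 2" for i j
    by (rule has_weak_deriv_limit[OF H2_spaceD(2)[OF H ij] H2_space_L2[OF H] H2_spaceD(1)[OF H ij] v(1) g(1)[OF ij] v(2) g(2)[OF ij]])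
  have vH: "v \<in> H2_space (plate l)"
  proof (rule H2_spaceI[OF v(1)])
    fix i j :: nat assume ij: "i + j \<le> 2"
    from wg[OF ij] g(1)[OF ij] show "\<exists>g\<in>L2 (plateM l). has_weak_deriv (plate l) i j v g" by (rule bexI)
  qed
  have exh: "\<exists>h. continuous_on ?K h \<and> (AE p in ?M. u n p = h p) \<and> (\<forall>p \<in> {0, pi} \<times> {-l..l}. h p = 0)" for n
    using u[of n] unfolding H2star_def by blast
  from choice[OF allI[OF exh]] obtain h where "\<forall>n. continuous_on ?K (h n) \<and> (AE p in ?M. u n p = h n p) \<and> (\<forall>p \<in> {0, pi} \<times> {-l..l}. h n p = 0)" ..
  then have h: "\<And>n. continuous_on ?K (h n)" "\<And>n. AE p in ?M. u n p = h n p" "\<And>n p. p \<in> {0, pi} \<times> {-l..l} \<Longrightarrow> h n p = 0"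
    by blast+
  obtain B where B: "B \<ge> 0" "\<And>u. u \<in> H2star l \<Longrightarrow> AE z in ?M. \<bar>u z\<bar> \<le> B * sqrt (second_order_energy l u)"
    using H2star_sup_bound[OF l] by blast
  (* the sup bound holds almost everywhere and extends to all points by continuity *)
  have unif: "\<bar>h m z - h n z\<bar> \<le> B * sqrt (?E m n)" if "z \<in> ?K" for m n z
  proof (rule AE_le_imp_le_on_closure[OF l _ _ that])
    show "continuous_on ?K (\<lambda>z. \<bar>h m z - h n z\<bar>)" by (intro continuous_intros h)
    show "AE z in ?M. \<bar>h m z - h n z\<bar> \<le> B * sqrt (?E m n)"
      using h(2)[of m] h(2)[of n] B(2)[OF d, of m n] by eventually_elim (simp add: fun_ops)
  qed
  have "uniformly_Cauchy_on ?K h"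
    unfolding uniformly_Cauchy_on_def
  proof (intro allI impI)
    fix e :: real assume e: "0 < e"
    obtain N where N: "\<And>m n. \<lbrakk>m \<ge> N; n \<ge> N\<rbrakk> \<Longrightarrow> ?E m n < (e / (B + 1))\<^sup>2" using Ecauchy[of "(e / (B + 1))\<^sup>2"] e B(1) by auto
    have "dist (h m z) (h n z) < e" if z: "z \<in> ?K" and mn: "m \<ge> N" "n \<ge> N" for z m n
    proof -
      have "sqrt (?E m n) < e / (B + 1)" using N[OF mn] e B(1) real_sqrt_less_mono[of "?E m n" "(e / (B + 1))\<^sup>2"] by simp
      then have "(B + 1) * sqrt (?E m n) < e" using B(1) by (simp add: field_simps)
      moreover have "B * sqrt (?E m n) \<le> (B + 1) * sqrt (?E m n)" using E0 by (intro mult_right_mono) auto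
      ultimately show ?thesis using unif[OF z, of m n] by (simp add: dist_real_def)
    qed
    then show "\<exists>M. \<forall>x\<in>?K. \<forall>m\<ge>M. \<forall>n\<ge>M. dist (h m x) (h n x) < e" by blast
  qed
  then obtain k where k: "uniform_limit ?K h k sequentially"
    using Cauchy_uniformly_convergent unfolding uniformly_convergent_on_def by blast
  have kc: "continuous_on ?K k"
    by (rule uniform_limit_theorem[OF always_eventually k]) (auto simp: h(1))
  have k0: "k p = 0" if p: "p \<in> {0, pi} \<times> {-l..l}" for p
  proof -
    have "p \<in> ?K" using p by auto
    from tendsto_uniform_limitI[OF k this] have "(\<lambda>n. h n p) \<longlonglongrightarrow> k p" .
    with h(3)[OF p] show ?thesis using LIMSEQ_unique[OF tendsto_const[of 0]] by simp
  qed
  have subK: "plate l \<subseteq> ?K" by (auto simp: plate_def)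
  have km: "k \<in> borel_measurable ?M"
    by (rule continuous_imp_measurable_on_sets_lebesgue[OF continuous_on_subset[OF kc subK]]) simp
  have "compact (k ` ?K)" by (intro compact_continuous_image kc compact_Times) auto
  from compact_imp_bounded[OF this] obtain Bk where "\<forall>x\<in>k ` ?K. norm x \<le> Bk" unfolding bounded_iff ..
  then have Bk: "\<And>p. p \<in> ?K \<Longrightarrow> \<bar>k p\<bar> \<le> Bk" by auto
  have kL: "k \<in> L2 ?M" by (rule L2_bounded[OF plateM_finite km, where B = Bk]) (use Bk subK in auto)
  interpret M: finite_measure ?M by (rule plateM_finite)
  have uk: "(\<lambda>n. ip2 ?M (u n - k) (u n - k)) \<longlonglongrightarrow> 0"
  proof (rule LIMSEQ_I)
    fix e :: real assume e: "0 < e"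
    define \<eta> where "\<eta> = sqrt (e / (measure ?M (plate l) + 1))"
    have m0: "0 < measure ?M (plate l) + 1" using measure_nonneg[of ?M "plate l"] by linarith
    have \<eta>: "0 < \<eta>" "\<eta>\<^sup>2 = e / (measure ?M (plate l) + 1)" using e m0 by (auto simp: \<eta>_def)
    obtain N where N: "\<And>n z. \<lbrakk>n \<ge> N; z \<in> ?K\<rbrakk> \<Longrightarrow> \<bar>h n z - k z\<bar> < \<eta>"
      using uniform_limitD[OF k \<eta>(1)] unfolding eventually_sequentially dist_real_def by blast
    have "norm (ip2 ?M (u n - k) (u n - k) - 0) < e" if n: "n \<ge> N" for n
    proof -
      have "ip2 ?M (u n - k) (u n - k) \<le> (\<integral>z. \<eta>\<^sup>2 \<partial>?M)"
        unfolding ip2_self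
      proof (rule integral_mono_AE)
        show "integrable ?M (\<lambda>x. ((u n - k) x)\<^sup>2)" by (rule L2_square_integrable[OF L2.mem(3)[OF H2_space_L2[OF H] kL]])
        have "AE z in ?M. z \<in> plate l" by (rule AE_I2) simp
        then show "AE z in ?M. ((u n - k) z)\<^sup>2 \<le> \<eta>\<^sup>2"
          using h(2)[of n]
        proof eventually_elim
          case (elim z)
          then have "\<bar>(u n - k) z\<bar> < \<eta>" using N[OF n, of z] subK by (auto simp: fun_ops)
          then show ?case using \<eta>(1) by (simp add: abs_le_square_iff[symmetric])
        qed
      qed simp
      also have "\<dots> = measure ?M (plate l) * \<eta>\<^sup>2" by simp
      also have "\<dots> < e" unfolding \<eta>(2) using e m0 by (simp add: field_simps)
      finally show ?thesis using L2.nonneg[of "u n - k" ?M] H2_space_L2[OF H[of n]] kL by simp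
    qed
    then show "\<exists>no. \<forall>n\<ge>no. norm (ip2 ?M (u n - k) (u n - k) - 0) < e" by blast
  qed
  (* the mean square limit v and the uniform limit k are both limits of u n, hence equal almost everywhere *)
  have "L2.N ?M (v - k) \<le> 0"
  proof (rule tendsto_lowerbound)
    show "(\<lambda>n. L2.N ?M (u n - v) + L2.N ?M (u n - k)) \<longlonglongrightarrow> 0"
      using tendsto_add[OF tendsto_real_sqrt[OF v(2)] tendsto_real_sqrt[OF uk]] by (simp add: L2.N_def)
    show "\<forall>\<^sub>F n in sequentially. L2.N ?M (v - k) \<le> L2.N ?M (u n - v) + L2.N ?M (u n - k)"
    proof (rule always_eventually, rule allI)
      fix n
      have un: "u n \<in> L2 ?M" by (rule H2_space_L2[OF H])
      show "L2.N ?M (v - k) \<le> L2.N ?M (u n - v) + L2.N ?M (u n - k)"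
        using L2.N_diff_triangle[OF v(1) un kL] L2.N_minus_commute[OF v(1) un] by simp
    qed
  qed simp
  then have "ip2 ?M (v - k) (v - k) = 0" using L2.N_nonneg[of "v - k" ?M] v(1) kL by (simp add: L2.N_def)
  then have vk0: "(\<integral>z. ((v - k) z)\<^sup>2 \<partial>?M) = 0" unfolding ip2_self .
  have "AE z in ?M. ((v - k) z)\<^sup>2 = 0"
    by (rule iffD1[OF integral_nonneg_eq_0_iff_AE vk0, OF L2_square_integrable[OF L2.mem(3)[OF v(1) kL]]]) simp
  then have "AE z in ?M. v z = k z" by eventually_elim (simp add: fun_ops)
  with vH kc k0 have vS: "v \<in> H2star l" unfolding H2star_def by blast
  have wl: "(\<lambda>n. ip2 ?M (weak_deriv (plate l) i j (u n - v)) (weak_deriv (plate l) i j (u n - v))) \<longlonglongrightarrow> 0" if ij: "i + j \<le> 2" for i j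
  proof (rule Lim_transform_eventually[OF g(2)[OF ij]], rule always_eventually, rule allI)
    fix n
    let ?w = "weak_deriv (plate l) i j"
    note Ls = H2_spaceD(1)[OF H[of n] ij] H2_spaceD(1)[OF vH ij]
    have "AE z in ?M. ?w v z = g i j z" by (rule weak_deriv_AE_eq[OF vH ij wg[OF ij] g(1)[OF ij]])
    then have AE: "AE z in ?M. (?w (u n) - g i j) z = (?w (u n) - ?w v) z" by eventually_elim (simp add: fun_ops)
    have "ip2 ?M (?w (u n) - g i j) (?w (u n) - g i j) = ip2 ?M (?w (u n) - ?w v) (?w (u n) - ?w v)"
      by (rule ip2_cong_AE[OF AE AE]) (use Ls g(1)[OF ij] in \<open>auto intro!: L2_measurable simp del: fun_diff_def\<close>)
    also have "\<dots> = ip2 ?M (?w (u n - v)) (?w (u n - v))" by (rule weak_deriv_diff_norm[OF u vS ij])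
    finally show "ip2 ?M (?w (u n) - g i j) (?w (u n) - g i j) = ip2 ?M (?w (u n - v)) (?w (u n - v))" .
  qed
  have El: "(\<lambda>n. 2 * second_order_energy l (u n - v)) \<longlonglongrightarrow> 0"
    using tendsto_mult_right_zero[OF tendsto_add_zero[OF tendsto_add_zero[OF wl[of 2 0] wl[of 0 2]] wl[of 1 1]], of 2]
    unfolding second_order_energy_def by simp
  have nv: "u n - v \<in> H2star l" for n by (rule H2star_closed(3)[OF u vS])
  have "(\<lambda>n. inner2 \<sigma> l (u n - v) (u n - v)) \<longlonglongrightarrow> 0"
  proof (rule tendsto_sandwich[OF _ _ tendsto_const El])
    show "\<forall>\<^sub>F n in sequentially. 0 \<le> inner2 \<sigma> l (u n - v) (u n - v)"
      using semi_inner.nonneg[OF semi_inner_H2star[OF s] nv] by simp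
    show "\<forall>\<^sub>F n in sequentially. inner2 \<sigma> l (u n - v) (u n - v) \<le> 2 * second_order_energy l (u n - v)"
      using inner2_bounds(2)[OF s nv] by simp
  qed
  with vS show ?thesis by blast
qed

lemma form1_le_inner2:
  assumes s: "0 < \<sigma>" "\<sigma> < 1 / 2" and u: "u \<in> H2star l"
  shows "form1 l u u \<le> (2 * pi\<^sup>2) * inner2 \<sigma> l u u"
proof -
  have "form1 l u u \<le> pi\<^sup>2 * second_order_energy l u"
    by (rule order_trans[OF poincare_ux(1)[OF u] mult_left_mono[OF second_order_parts(1)[OF u]]]) simp
  also have "\<dots> \<le> pi\<^sup>2 * (2 * inner2 \<sigma> l u u)"
    using inner2_bounds(1)[OF s u] by (intro mult_left_mono) auto
  finally show ?thesis by simp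
qed

lemma compact_form_plate:
  assumes s: "0 < \<sigma>" "\<sigma> < 1 / 2" and l: "0 < l"
  shows "compact_form (H2star l) (inner2 \<sigma> l) (form1 l) (2 * pi\<^sup>2)"
proof -
  interpret A: semi_inner "H2star l" "inner2 \<sigma> l" by (rule semi_inner_H2star[OF s])
  interpret B: semi_inner "H2star l" "form1 l" by (rule semi_inner_form1)
  show ?thesis
  proof
    fix e :: real assume e: "0 < e"
    obtain k :: nat and \<kappa> where \<kappa>: "\<And>i. i < k \<Longrightarrow> \<kappa> i \<in> L2 (plateM l)"
      "\<And>u. u \<in> H2star l \<Longrightarrow> form1 l u u \<le> (\<Sum>i<k. (ip2 (plateM l) (wdx l u) (\<kappa> i))\<^sup>2) + (e / 2) * second_order_energy l u"
      using form1_almost_finite_rank[OF l, of "e / 2"] e by auto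
    define \<phi> where "\<phi> i u = ip2 (plateM l) (wdx l u) (\<kappa> i)" for i u
    show "\<exists>(k::nat) \<phi>. (\<forall>i<k. (\<forall>u\<in>H2star l. \<forall>v\<in>H2star l. \<phi> i (u - v) = \<phi> i u - \<phi> i v) \<and> (\<exists>M. \<forall>u\<in>H2star l. \<bar>\<phi> i u\<bar> \<le> M * A.N u)) \<and>
      (\<forall>u\<in>H2star l. form1 l u u \<le> e * inner2 \<sigma> l u u + (\<Sum>i<k. (\<phi> i u :: real)\<^sup>2))"
    proof (intro exI[of _ k] exI[of _ \<phi>] conjI allI impI ballI)
      fix i assume i: "i < k"
      fix u v assume u: "u \<in> H2star l" and v: "v \<in> H2star l"
      show "\<phi> i (u - v) = \<phi> i u - \<phi> i v"
        using ip2_weak_deriv_linear(1)[OF H2star_closed(3)[OF u v] v _ \<kappa>(1)[OF i], of 1 0] by (simp add: \<phi>_def)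
    next
      fix i assume i: "i < k"
      show "\<exists>M. \<forall>u\<in>H2star l. \<bar>\<phi> i u\<bar> \<le> M * A.N u"
      proof (intro exI[of _ "L2.N (plateM l) (\<kappa> i) * sqrt (2 * pi\<^sup>2)"] ballI)
        fix u assume u: "u \<in> H2star l"
        note W = H2_wd_L2(1)[OF H2starD[OF u]]
        have "L2.N (plateM l) (wdx l u) = sqrt (form1 l u u)" by (simp add: L2.N_def form1_def inner0_eq)
        also have "\<dots> \<le> sqrt (2 * pi\<^sup>2) * A.N u"
          using real_sqrt_le_mono[OF form1_le_inner2[OF s u]] by (simp add: A.N_def real_sqrt_mult)
        finally have "L2.N (plateM l) (\<kappa> i) * L2.N (plateM l) (wdx l u) \<le> L2.N (plateM l) (\<kappa> i) * (sqrt (2 * pi\<^sup>2) * A.N u)"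
          using \<kappa>(1)[OF i] by (intro mult_left_mono) auto
        moreover have "\<bar>\<phi> i u\<bar> \<le> L2.N (plateM l) (\<kappa> i) * L2.N (plateM l) (wdx l u)"
          using L2.cauchy_schwarz[OF W \<kappa>(1)[OF i]] unfolding \<phi>_def by (subst mult.commute)
        ultimately show "\<bar>\<phi> i u\<bar> \<le> L2.N (plateM l) (\<kappa> i) * sqrt (2 * pi\<^sup>2) * A.N u"
          unfolding mult.assoc by (rule order_trans[rotated])
      qed
    next
      fix u assume u: "u \<in> H2star l"
      have "(e / 2) * second_order_energy l u \<le> (e / 2) * (2 * inner2 \<sigma> l u u)"
        using inner2_bounds(1)[OF s u] e by (intro mult_left_mono) auto
      with \<kappa>(2)[OF u] show "form1 l u u \<le> e * inner2 \<sigma> l u u + (\<Sum>i<k. (\<phi> i u)\<^sup>2)"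
        by (simp add: \<phi>_def)
    qed
  qed (use form1_le_inner2[OF s] H2star_complete[OF s l] in blast)+
qed

lemma AE_zero_form1:
  assumes z: "z \<in> H2star l" and 0: "AE p in plateM l. z p = 0"
  shows "form1 l z z = 0"
proof -
  note L = H2_wd_L2(2)[OF H2starD[OF z]] H2star_L2[OF z]
  have "AE p in plateM l. wdxx l z p * z p = 0" using 0 by eventually_elim simp
  then have "ip2 (plateM l) (wdxx l z) z = 0" unfolding ip2_def by (rule integral_eq_zero_AE)
  then show ?thesis using form1_by_parts[OF z z] by simp
qed

text \<open>
  \<open>\<Lambda>\<^sub>2\<close> is given by counting eigenfunctions. If the Rayleigh quotient
  were below \<open>\<Lambda>\<^sub>2\<close> somewhere on the complement of \<open>w\<close>,
  \<open>eigenfunction_below\<close> would supply an eigenfunction orthogonal to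
  \<open>w\<close> with eigenvalue below \<open>\<Lambda>\<^sub>2\<close>, and together with
  \<open>w\<close> it would contradict the minimality of \<open>\<Lambda>\<^sub>2\<close>. A
  general \<open>u\<close> is split into its component along \<open>w\<close> and the rest.
\<close>
theorem spectral_gap:
  assumes s: "0 < \<sigma>" "\<sigma> < 1 / 2" and l: "0 < l"
    and w: "w \<in> H2star l" "form1 l w w = 1" "buckling_eigenpair \<sigma> l \<Lambda>\<^sub>1 w"
    and k2: "is_kth_buckling_eigenvalue \<sigma> l 2 \<Lambda>\<^sub>2" and less: "\<Lambda>\<^sub>1 < \<Lambda>\<^sub>2" and u: "u \<in> H2star l"
  shows "(\<Lambda>\<^sub>2 - \<Lambda>\<^sub>1) * (form1 l u u - (form1 l u w)\<^sup>2) \<le> inner2 \<sigma> l u u - \<Lambda>\<^sub>1 * form1 l u u"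
proof -
  interpret F: compact_form "H2star l" "inner2 \<sigma> l" "form1 l" "2 * pi\<^sup>2" by (rule compact_form_plate[OF s l])
  have aw: "inner2 \<sigma> l w v = \<Lambda>\<^sub>1 * form1 l w v" if "v \<in> H2star l" for v
    using w(3) that unfolding buckling_eigenpair_def form1_def by blast
  have orth: "\<Lambda>\<^sub>2 * form1 l z z \<le> inner2 \<sigma> l z z" if z: "z \<in> H2star l" "form1 l z w = 0" for z
  proof (rule ccontr)
    assume "\<not> ?thesis"
    then have "inner2 \<sigma> l z z < \<Lambda>\<^sub>2 * form1 l z z" by simp
    from F.eigenfunction_below[OF w(1,2) aw z this] obtain \<mu> y where y: "\<mu> < \<Lambda>\<^sub>2" "y \<in> H2star l" "form1 l y y = 1" "form1 l y w = 0"
      "\<And>v. v \<in> H2star l \<Longrightarrow> inner2 \<sigma> l y v = \<mu> * form1 l y v" by blast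
    have ey: "buckling_eigenpair \<sigma> l \<mu> y"
      unfolding buckling_eigenpair_def using y AE_zero_form1[OF y(2)] by (auto simp: form1_def)
    have yw: "inner2 \<sigma> l y w = 0" "inner2 \<sigma> l w y = 0"
      using y(5)[OF w(1)] y(4) F.A.sym[OF w(1) y(2)] by auto
    (* w and y are two orthogonal eigenfunctions with eigenvalues below Lambda_2 *)
    have "has_eigenfunctions_upto \<sigma> l 2 (max \<Lambda>\<^sub>1 \<mu>)"
      unfolding has_eigenfunctions_upto_def
      by (rule exI[of _ "\<lambda>i. if i = 0 then \<Lambda>\<^sub>1 else \<mu>"], rule exI[of _ "\<lambda>i. if i = 0 then w else y"])
        (use w(3) ey yw in \<open>auto simp: numeral_2_eq_2 less_Suc_eq\<close>)
    with k2 have "\<Lambda>\<^sub>2 \<le> max \<Lambda>\<^sub>1 \<mu>" unfolding is_kth_buckling_eigenvalue_def by blast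
    with less y(1) show False by simp
  qed
  define c z where "c = form1 l u w" and "z = u - c *\<^sub>R w"
  have zH: "z \<in> H2star l" using u w(1) by (simp add: z_def)
  have bwu: "form1 l w u = c" using F.B.sym[OF w(1) u] by (simp add: c_def)
  have auw: "inner2 \<sigma> l w u = \<Lambda>\<^sub>1 * c" "inner2 \<sigma> l u w = \<Lambda>\<^sub>1 * c" "inner2 \<sigma> l w w = \<Lambda>\<^sub>1"
    using aw[OF u] aw[OF w(1)] F.A.sym[OF u w(1)] w(2) bwu by auto
  have "form1 l z w = 0" using u w(1,2) by (simp add: z_def F.B.bilin c_def)
  from orth[OF zH this] have "\<Lambda>\<^sub>2 * form1 l z z \<le> inner2 \<sigma> l z z" .
  moreover have "form1 l z z = form1 l u u - c\<^sup>2"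
    using u w(1,2) bwu by (simp add: z_def F.B.bilin c_def[symmetric] power2_eq_square algebra_simps)
  moreover have "inner2 \<sigma> l z z = inner2 \<sigma> l u u - \<Lambda>\<^sub>1 * c\<^sup>2"
    using u w(1) auw by (simp add: z_def F.A.bilin power2_eq_square algebra_simps)
  ultimately show ?thesis unfolding c_def[symmetric] by (simp add: algebra_simps)
qed

section \<open>The first eigenfunction\<close>

lemma smooth_sin_cos: "smooth (\<lambda>x. h * sin x + k * cos x)"
proof (rule smooth_coinduct)
  fix g :: "real \<Rightarrow> real" assume "\<exists>h k. g = (\<lambda>x. h * sin x + k * cos x)"
  then obtain h k where g: "g = (\<lambda>x. h * sin x + k * cos x)" by blast
  have "(g has_real_derivative (- k) * sin x + h * cos x) (at x)" for x
    unfolding g by (auto intro!: derivative_eq_intros)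
  then show "\<exists>g'. (\<exists>h k. g' = (\<lambda>x. h * sin x + k * cos x)) \<and> (\<forall>x. (g has_real_derivative g' x) (at x))"
    by (intro exI[of _ "\<lambda>x. (- k) * sin x + h * cos x"]) blast
qed blast

lemma bump_smooth_mult: "smooth f \<Longrightarrow> bump p q g \<Longrightarrow> bump p q (\<lambda>x. f x * g x)"
  unfolding bump_def by (metis smooth_mult mult_zero_right)

text \<open>
  The integrand is the derivative of the bump \<open>sin x * deriv \<alpha> x - cos x * \<alpha>
  x\<close>.
\<close>
lemma sine_orthogonal:
  assumes \<alpha>: "bump 0 pi \<alpha>"
  shows "(\<integral>x. sin x * (deriv (deriv \<alpha>) x + \<alpha> x) \<partial>seg 0 pi) = 0"
proof -
  let ?\<kappa> = "\<lambda>x. sin x * deriv \<alpha> x + - cos x * \<alpha> x"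
  note \<alpha>' = bump_deriv[OF \<alpha>]
  have "bump 0 pi ?\<kappa>"
    using bump_add[OF bump_smooth_mult[OF smooth_sin_cos[of 1 0] \<alpha>'] bump_smooth_mult[OF smooth_sin_cos[of 0 "- 1"] \<alpha>]] by simp
  moreover have "deriv ?\<kappa> = (\<lambda>x. sin x * (deriv (deriv \<alpha>) x + \<alpha> x))"
  proof (rule ext, rule DERIV_imp_deriv)
    fix x
    show "(?\<kappa> has_real_derivative sin x * (deriv (deriv \<alpha>) x + \<alpha> x)) (at x)"
      by (rule DERIV_cong[OF DERIV_add[OF DERIV_mult[OF DERIV_sin smooth_has_derivative[OF bump_smooth[OF \<alpha>']]]
          DERIV_mult[OF DERIV_minus[OF DERIV_cos] smooth_has_derivative[OF bump_smooth[OF \<alpha>]]]]])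
        (simp add: algebra_simps)
  qed
  ultimately show ?thesis using integral_bump_deriv[OF pi_gt_zero, of ?\<kappa>] by simp
qed

text \<open>
  On almost every row \<open>w\<close> is a multiple of the sine, hence orthogonal to
  \<open>\<alpha>'' + \<alpha>\<close> for every bump \<open>\<alpha>\<close>.
\<close>
lemma wdxx_sine:
  assumes H: "w \<in> H2_space (plate l)" and w: "AE p in plateM l. w p = \<phi> (snd p) * sin (fst p)"
  shows "AE p in plateM l. wdxx l w p = - w p"
proof -
  note L = H2_space_L2[OF H] H2_wd_L2(2)[OF H]
  note r = rep_L2[OF L(1)] and r2 = rep_L2[OF L(2)]
  note i = rect_L2_integrable[OF r(1)] and i2 = rect_L2_integrable[OF r2(1)]
  have "AE z in plateR l. rep l w z = \<phi> (snd z) * sin (fst z)"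
    using w r(2) unfolding AE_plate by eventually_elim simp
  from AE_rect_sectionsD[OF this] have sec: "AE y in seg (- l) l. AE x in seg 0 pi. rep l w (x, y) = \<phi> y * sin x" by simp
  have "AE z in plateR l. rep l (wdxx l w) z + rep l w z = 0"
  proof (rule fundamental_lemma)
    show "integrable (plateR l) (\<lambda>z. rep l (wdxx l w) z + rep l w z)" using i i2 by simp
    fix \<alpha> \<beta> assume b: "bump 0 pi \<alpha>" "bump (- l) l \<beta>"
    let ?\<gamma> = "\<lambda>x. deriv (deriv \<alpha>) x + \<alpha> x"
    have \<alpha>2: "bump 0 pi (deriv (deriv \<alpha>))" by (intro bump_deriv b)
    have \<gamma>: "bump 0 pi ?\<gamma>" by (rule bump_add[OF \<alpha>2 b(1)])
    note [measurable] = bump_borel[OF \<gamma>]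
    have 2: "(\<integral>z. rep l w z * (deriv (deriv \<alpha>) (fst z) * \<beta> (snd z)) \<partial>plateR l)
        = (\<integral>z. rep l (wdxx l w) z * (\<alpha> (fst z) * \<beta> (snd z)) \<partial>plateR l)"
      using has_weak_deriv_bumps[OF H2_spaceD(2)[OF H, of 2 0] L b] by (simp add: numeral_2_eq_2)
    have "AE y in seg (- l) l. (\<integral>x. rep l w (x, y) * ?\<gamma> x \<partial>seg 0 pi) * \<beta> y = 0"
      using sec rect_fubini(1)[OF i]
    proof eventually_elim
      case (elim y)
      note [measurable] = borel_measurable_integrable[OF elim(2), simplified]
      have "(\<integral>x. rep l w (x, y) * ?\<gamma> x \<partial>seg 0 pi) = (\<integral>x. \<phi> y * (sin x * ?\<gamma> x) \<partial>seg 0 pi)"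
      proof (rule integral_cong_AE)
        show "AE x in seg 0 pi. rep l w (x, y) * ?\<gamma> x = \<phi> y * (sin x * ?\<gamma> x)" using elim(1) by eventually_elim simp
      qed measurable
      also have "\<dots> = 0" using sine_orthogonal[OF b(1)] by simp
      finally show ?case by simp
    qed
    then have "(\<integral>z. rep l w z * (?\<gamma> (fst z) * \<beta> (snd z)) \<partial>plateR l) = 0"
      unfolding bump_fubini[OF i \<gamma> b(2)] by (rule integral_eq_zero_AE)
    then have "(\<integral>z. rep l w z * (deriv (deriv \<alpha>) (fst z) * \<beta> (snd z)) \<partial>plateR l)
        + (\<integral>z. rep l w z * (\<alpha> (fst z) * \<beta> (snd z)) \<partial>plateR l) = 0"
      using bump_mult_integrable[OF i \<alpha>2 b(2)] bump_mult_integrable[OF i b]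
      by (simp add: distrib_left distrib_right)
    with 2 show "(\<integral>z. (rep l (wdxx l w) z + rep l w z) * (\<alpha> (fst z) * \<beta> (snd z)) \<partial>plateR l) = 0"
      using bump_mult_integrable[OF i b] bump_mult_integrable[OF i2 b] unfolding distrib_right by simp
  qed
  with r(2) r2(2) show ?thesis unfolding AE_plate by eventually_elim simp
qed

text \<open>
  This converts the normalisation of the eigenfunction in $L^2$ into the one that the abstract
  argument uses.
\<close>
lemma form1_sine:
  assumes H: "w \<in> H2star l" and w: "AE p in plateM l. w p = \<phi> (snd p) * sin (fst p)"
  shows "form1 l w w = inner0 l w w"
proof -
  note L = H2star_L2[OF H] and D = H2_wd_L2(2)[OF H2starD[OF H]]
  have "AE p in plateM l. wdxx l w p = ((- 1) *\<^sub>R w) p"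
    using wdxx_sine[OF H2starD[OF H] w] by eventually_elim (simp add: fun_ops)
  from ip2_cong_L2[OF this D L2.mem(2)[OF L] L] have "ip2 (plateM l) (wdxx l w) w = - ip2 (plateM l) w w"
    by (simp only: L2.scale_left[OF L L])
  with form1_by_parts[OF H H] show ?thesis by (simp add: inner0_eq)
qed

section \<open>Weak solutions as damped evolutions\<close>

lemma norm2_eq: "0 < \<sigma> \<Longrightarrow> \<sigma> < 1 / 2 \<Longrightarrow> semi_inner.N (inner2 \<sigma> l) = norm2 \<sigma> l"
  by (rule ext) (simp add: semi_inner.N_def[OF semi_inner_H2star[of \<sigma> l]] norm2_def)

lemma norm0_eq: "L2.N (plateM l) = norm0 l"
  by (rule ext) (simp add: L2.N_def norm0_def inner0_eq)

lemma at_within_initial: "0 \<le> t \<Longrightarrow> at t within {0..t + 1} = at (t :: real) within {0..}"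
  by (rule at_within_nhd[of _ "{..<t + 1}"]) auto

lemma C0_inD:
  assumes "C0_in X N (t + 1) u" "0 \<le> t"
  shows "u t \<in> X" "((\<lambda>s. N (u s - u t)) \<longlongrightarrow> 0) (at t within {0..})"
  using assms unfolding C0_in_def fun_diff_def at_within_initial[OF assms(2), symmetric] by auto

lemma C1_inD:
  assumes "C1_in X N (t + 1) u u'" "0 \<le> t"
  shows "((\<lambda>s. N ((u s - u t) /\<^sub>R (s - t) - u' t)) \<longlongrightarrow> 0) (at t within {0..})"
proof -
  have "(u s - u t) /\<^sub>R (s - t) - u' t = (\<lambda>p. (u s p - u t p) / (s - t) - u' t p)" for s
    by (rule ext) (simp add: fun_ops divide_inverse_commute)
  then show ?thesis using assms unfolding C1_in_def at_within_initial[OF assms(2), symmetric] by auto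
qed

text \<open>
  The norm of \<open>v\<close> may vanish without \<open>v\<close> being 0 in \<open>H2star
  l\<close>, so \<open>v\<close> is scaled by \<open>1 / (norm2 \<sigma> l v + 1)\<close>.
\<close>
lemma dual_norm_bound:
  assumes s: "0 < \<sigma>" "\<sigma> < 1 / 2" and f: "f \<in> H2star_dual \<sigma> l" and v: "v \<in> H2star l"
  shows "\<bar>f v\<bar> \<le> (norm2 \<sigma> l v + 1) * dual_norm \<sigma> l f"
proof -
  interpret A: semi_inner "H2star l" "inner2 \<sigma> l" by (rule semi_inner_H2star[OF s])
  note N = norm2_eq[OF s, of l]
  define k where "k = 1 / (norm2 \<sigma> l v + 1)"
  have n: "0 < norm2 \<sigma> l v + 1" using A.N_nonneg[OF v] unfolding N by linarith
  have k: "0 < k" using n by (simp add: k_def)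
  obtain C where C: "\<And>V. V \<in> H2star l \<Longrightarrow> \<bar>f V\<bar> \<le> C * norm2 \<sigma> l V" using f unfolding H2star_dual_def by blast
  have "bdd_above ((\<lambda>V. \<bar>f V\<bar>) ` {V \<in> H2star l. norm2 \<sigma> l V \<le> 1})"
  proof (rule bdd_aboveI2)
    fix V assume "V \<in> {V \<in> H2star l. norm2 \<sigma> l V \<le> 1}"
    then have V: "V \<in> H2star l" "norm2 \<sigma> l V \<le> 1" by auto
    have "C * norm2 \<sigma> l V \<le> \<bar>C\<bar> * 1"
      using V(2) A.N_nonneg[OF V(1)] unfolding N by (intro mult_mono) auto
    with C[OF V(1)] show "\<bar>f V\<bar> \<le> \<bar>C\<bar>" by simp
  qed
  moreover have "k *\<^sub>R v \<in> {V \<in> H2star l. norm2 \<sigma> l V \<le> 1}"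
  proof -
    have "norm2 \<sigma> l (k *\<^sub>R v) = k * norm2 \<sigma> l v" using A.N_scale[OF v, of k] k unfolding N by simp
    also have "\<dots> \<le> 1" using n by (simp add: k_def)
    finally show ?thesis using v by simp
  qed
  ultimately have "\<bar>f (k *\<^sub>R v)\<bar> \<le> dual_norm \<sigma> l f" unfolding dual_norm_def by (rule cSUP_upper[rotated])
  moreover have "f (k *\<^sub>R v) = k * f v"
  proof -
    have "k *\<^sub>R v = (\<lambda>p. k * v p)" by (simp add: fun_ops fun_eq_iff)
    then show ?thesis using f v unfolding H2star_dual_def by simp
  qed
  ultimately have "k * \<bar>f v\<bar> \<le> dual_norm \<sigma> l f" using k by (simp add: abs_mult)
  from mult_left_mono[OF this, of "norm2 \<sigma> l v + 1"] n show ?thesis by (simp add: k_def)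
qed

lemma H2star_dual_bounded: "f \<in> H2star_dual \<sigma> l \<Longrightarrow> \<exists>C. \<forall>V\<in>H2star l. \<bar>f V\<bar> \<le> C * norm2 \<sigma> l V"
  by (simp add: H2star_dual_def)

lemma dual_quotient:
  assumes "f \<in> H2star_dual \<sigma> l" "g \<in> H2star_dual \<sigma> l" "h \<in> H2star_dual \<sigma> l"
  shows "(\<lambda>V. (f V - g V) / k - h V) \<in> H2star_dual \<sigma> l"
proof -
  obtain A B C where b: "\<And>V. V \<in> H2star l \<Longrightarrow> \<bar>f V\<bar> \<le> A * norm2 \<sigma> l V"
    "\<And>V. V \<in> H2star l \<Longrightarrow> \<bar>g V\<bar> \<le> B * norm2 \<sigma> l V" "\<And>V. V \<in> H2star l \<Longrightarrow> \<bar>h V\<bar> \<le> C * norm2 \<sigma> l V"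
    using assms[THEN H2star_dual_bounded] by blast
  have "\<bar>(f V - g V) / k - h V\<bar> \<le> ((A + B) / \<bar>k\<bar> + C) * norm2 \<sigma> l V" if V: "V \<in> H2star l" for V
  proof -
    have "\<bar>f V - g V\<bar> \<le> (A + B) * norm2 \<sigma> l V" using b(1,2)[OF V] by (simp add: distrib_right)
    from divide_right_mono[OF this, of "\<bar>k\<bar>"] have "\<bar>(f V - g V) / k\<bar> \<le> (A + B) / \<bar>k\<bar> * norm2 \<sigma> l V" by simp
    from order_trans[OF abs_triangle_ineq4 add_mono[OF this b(3)[OF V]]] show ?thesis
      unfolding distrib_right .
  qed
  moreover have "\<forall>U\<in>H2star l. \<forall>V\<in>H2star l. (f (\<lambda>p. U p + V p) - g (\<lambda>p. U p + V p)) / k - h (\<lambda>p. U p + V p)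
    = (f U - g U) / k - h U + ((f V - g V) / k - h V)"
    using assms unfolding H2star_dual_def by (simp add: add_divide_distrib diff_divide_distrib)
  moreover have "\<forall>c. \<forall>V\<in>H2star l. (f (\<lambda>p. c * V p) - g (\<lambda>p. c * V p)) / k - h (\<lambda>p. c * V p) = c * ((f V - g V) / k - h V)"
    using assms unfolding H2star_dual_def by (simp add: right_diff_distrib diff_divide_distrib)
  ultimately show ?thesis unfolding H2star_dual_def by blast
qed

text \<open>
  Difference quotients that converge in the dual norm converge at every fixed \<open>v\<close>.
\<close>
lemma C1_dual_derivative:
  assumes s: "0 < \<sigma>" "\<sigma> < 1 / 2" and C: "C1_in (H2star_dual \<sigma> l) (dual_norm \<sigma> l) (t + 1) f f'" and t: "0 \<le> t" and v: "v \<in> H2star l"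
  shows "((\<lambda>s. f s v) has_real_derivative f' t v) (at t within {0..})"
  unfolding has_field_derivative_iff
proof (rule LIM_zero_cancel, rule Lim_null_comparison)
  let ?q = "\<lambda>s V. (f s V - f t V) / (s - t) - f' t V"
  have "((\<lambda>s. dual_norm \<sigma> l (?q s)) \<longlongrightarrow> 0) (at t within {0..})"
    using C t unfolding C1_in_def at_within_initial[OF t, symmetric] by auto
  from tendsto_mult_right_zero[OF this] show "((\<lambda>s. (norm2 \<sigma> l v + 1) * dual_norm \<sigma> l (?q s)) \<longlongrightarrow> 0) (at t within {0..})" .
  have "f s \<in> H2star_dual \<sigma> l" "f' s \<in> H2star_dual \<sigma> l" if "s \<in> {0..t + 1}" for s
    using C that unfolding C1_in_def C0_in_def by blast+
  then have "?q s \<in> H2star_dual \<sigma> l" if "s \<in> {0..t + 1}" for s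
    using that t by (intro dual_quotient) auto
  note q = this
  have "\<forall>\<^sub>F s in at t within {0..t + 1}. s \<in> {0..t + 1}" by (simp add: eventually_at_filter)
  then show "\<forall>\<^sub>F s in at t within {0..}. norm ((f s v - f t v) / (s - t) - f' t v) \<le> (norm2 \<sigma> l v + 1) * dual_norm \<sigma> l (?q s)"
    unfolding at_within_initial[OF t]
  proof eventually_elim
    case (elim s)
    from dual_norm_bound[OF s q[OF elim] v] show ?case by simp
  qed
qed

lemma form1_sq: "form1 l u u = (\<integral>p. (wdx l u p)\<^sup>2 \<partial>plateM l)"
  by (simp add: form1_def inner0_def power2_eq_square)

text \<open>
  The solution on \<open>{0..t + 1}\<close> determines everything that is required at time
  \<open>t\<close>. The positivity of \<open>\<Lambda>\<^sub>1\<close> comes from the Poincare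
  inequality for \<open>u_x\<close>.
\<close>
lemma damped_evolution_weak_solution:
  assumes s: "0 < \<sigma>" "\<sigma> < 1 / 2" and l: "0 < l" and "0 < \<delta>" "0 < S" and P: "\<Lambda>\<^sub>1 < P" "P \<le> \<Lambda>\<^sub>2"
    and w: "w \<in> H2star l" "form1 l w w = 1" "buckling_eigenpair \<sigma> l \<Lambda>\<^sub>1 w" and k2: "is_kth_buckling_eigenvalue \<sigma> l 2 \<Lambda>\<^sub>2"
    and sol: "weak_solution \<sigma> l \<delta> P S (\<lambda>t p. 0) U\<^sub>0 V\<^sub>0 U U'"
  shows "damped_evolution (L2 (plateM l)) (H2star l) (ip2 (plateM l)) (inner2 \<sigma> l) (form1 l) (wdxx l) U U' \<delta> P S \<Lambda>\<^sub>1 \<Lambda>\<^sub>2 (pi\<^sup>2 + 2) w"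
proof -
  interpret A: semi_inner "H2star l" "inner2 \<sigma> l" by (rule semi_inner_H2star[OF s])
  interpret B: semi_inner "H2star l" "form1 l" by (rule semi_inner_form1)
  have eig: "inner2 \<sigma> l w u = \<Lambda>\<^sub>1 * form1 l w u" if "u \<in> H2star l" for u
    using w(3) that unfolding buckling_eigenpair_def form1_def by blast
  have "0 < \<Lambda>\<^sub>1"
  proof (rule ccontr)
    assume "\<not> ?thesis"
    then have "(2 * pi\<^sup>2) * \<Lambda>\<^sub>1 \<le> 0" by (intro mult_nonneg_nonpos) auto
    with form1_le_inner2[OF s w(1)] eig[OF w(1)] w(2) show False by simp
  qed
  have on: "weak_solution_on \<sigma> l \<delta> P S (\<lambda>t p. 0) U\<^sub>0 V\<^sub>0 (t + 1) U U'" if "0 \<le> t" for t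
    using sol that unfolding weak_solution_def by simp
  have CU: "C0_in (H2star l) (norm2 \<sigma> l) (t + 1) U" and C1: "C1_in (L2 (plateM l)) (norm0 l) (t + 1) U U'"
    and C0': "C0_in (L2 (plateM l)) (norm0 l) (t + 1) U'" if "0 \<le> t" for t
    using on[OF that] unfolding weak_solution_on_def C1_in_def L2_space_eq by blast+
  show ?thesis
  proof (unfold_locales, goal_cases)
    case 1 show ?case by (auto intro: H2star_L2)
  next
    case (2 u) then show ?case by (intro H2_wd_L2(2) H2starD)
  next
    case (3 u v) then show ?case by (rule form1_by_parts)
  next
    case (4 u v)
    note d = H2star_closed(3)[OF 4]
    have "ip2 (plateM l) (wdxx l u - wdxx l v) (wdxx l u - wdxx l v) = ip2 (plateM l) (wdxx l (u - v)) (wdxx l (u - v))"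
      by (rule weak_deriv_diff_norm[OF 4]) simp
    also have "\<dots> \<le> 2 * inner2 \<sigma> l (u - v) (u - v)"
      using second_order_parts(1)[OF d] inner2_bounds(1)[OF s d] by simp
    also have "\<dots> \<le> (pi\<^sup>2 + 2) * inner2 \<sigma> l (u - v) (u - v)" by (intro mult_right_mono A.nonneg d) simp
    finally show ?case .
  next
    case (5 u)
    have "pi\<^sup>2 * form1 l u u \<le> (pi\<^sup>2 + 2) * form1 l u u" by (intro mult_right_mono B.nonneg 5) simp
    with poincare_ux(2)[OF 5] show ?case by simp
  next
    case 6 show ?case by (rule w(1))
  next
    case 7 show ?case by (rule w(2))
  next
    case (8 u) then show ?case by (rule eig)
  next
    case (9 u) then show ?case by (rule spectral_gap[OF s l w k2, rotated]) (use P in simp)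
  next
    case 10 show ?case by (rule assms)
  next
    case 11 show ?case by (rule assms)
  next
    case 12 show ?case by fact
  next
    case 13 show ?case by (rule P)
  next
    case 14 show ?case by (rule P)
  next
    case 15 show ?case using zero_le_power2[of pi] by linarith
  next
    case (16 t) show ?case by (rule C0_inD(1)[OF CU[OF 16] 16])
  next
    case (17 t) show ?case by (rule C0_inD(1)[OF C0'[OF 17] 17])
  next
    case (18 t) show ?case unfolding norm2_eq[OF s] by (rule C0_inD(2)[OF CU[OF 18] 18])
  next
    case (19 t) show ?case unfolding norm0_eq by (rule C0_inD(2)[OF C0'[OF 19] 19])
  next
    case (20 t) show ?case unfolding norm0_eq by (rule C1_inD[OF C1[OF 20] 20])
  next
    case (21 t v)
    then obtain U'' where "C1_in (H2star_dual \<sigma> l) (dual_norm \<sigma> l) (t + 1) (\<lambda>t. inner0 l (U' t)) U''"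
      and eq: "\<And>r V. \<lbrakk>r \<in> {0..t + 1}; V \<in> H2star l\<rbrakk> \<Longrightarrow> U'' r V + \<delta> * inner0 l (U' r) V + inner2 \<sigma> l (U r) V
             + nonlocal_coeff l P S (U r) * inner0 l (wdx l (U r)) (wdx l V) = inner0 l (\<lambda>p. 0) V"
      using on[OF 21(1)] unfolding weak_solution_on_def by blast
    from C1_dual_derivative[OF s this(1) 21]
    have "((\<lambda>s. ip2 (plateM l) (U' s) v) has_real_derivative U'' t v) (at t within {0..})" unfolding inner0_eq .
    moreover have "U'' t v = - (\<delta> * ip2 (plateM l) (U' t) v + inner2 \<sigma> l (U t) v + (S * form1 l (U t) (U t) - P) * form1 l (U t) v)"
    proof -
      have "inner0 l (\<lambda>p. 0) v = 0" by (simp add: inner0_def)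
      moreover have "nonlocal_coeff l P S (U t) = S * form1 l (U t) (U t) - P" by (simp add: nonlocal_coeff_def form1_sq)
      ultimately have "U'' t v + \<delta> * ip2 (plateM l) (U' t) v + inner2 \<sigma> l (U t) v
        + (S * form1 l (U t) (U t) - P) * form1 l (U t) v = 0"
        using eq[of t v] 21 unfolding inner0_eq[symmetric] form1_def[of l "U t" v] by simp
      then show ?thesis by linarith
    qed
    ultimately show ?case by simp
  qed
qed

lemma fourth_power_sqrt: "0 \<le> x \<Longrightarrow> sqrt x ^ 4 = x\<^sup>2"
  by (metis numeral_Bit0 power_add power2_eq_square real_sqrt_pow2)

theorem theorem5:
  fixes \<sigma> l \<delta> S P \<Lambda>\<^sub>1 \<Lambda>\<^sub>2 :: real
    and U\<^sub>0 V\<^sub>0 w\<^sub>1 :: "real \<times> real \<Rightarrow> real"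
    and U U' :: "real \<Rightarrow> real \<times> real \<Rightarrow> real"
  assumes "0 < \<sigma>" "\<sigma> < 1/2" "0 < l"
    and "0 < \<delta>" "0 < S"
    and "U\<^sub>0 \<in> H2star l" "V\<^sub>0 \<in> L2_space (plate l)"
    and "is_kth_buckling_eigenvalue \<sigma> l 1 \<Lambda>\<^sub>1"
    and "is_kth_buckling_eigenvalue \<sigma> l 2 \<Lambda>\<^sub>2"
    and "buckling_eigenpair \<sigma> l \<Lambda>\<^sub>1 w\<^sub>1"
    and "\<exists>\<phi>. AE p in lebesgue_on (plate l). w\<^sub>1 p = \<phi> (snd p) * sin (fst p)"
    and "norm0 l w\<^sub>1 = 1"
    and "\<Lambda>\<^sub>1 < P" "P \<le> \<Lambda>\<^sub>2"
    and "weak_solution \<sigma> l \<delta> P S (\<lambda>t p. 0) U\<^sub>0 V\<^sub>0 U U'"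
    and "mech_energy \<sigma> l P S U U' 0 < 0"
  shows "let lam_plus = sqrt ((P - \<Lambda>\<^sub>1) / S);
             U_bar = (if inner2 \<sigma> l U\<^sub>0 w\<^sub>1 > 0 then (\<lambda>p. lam_plus * w\<^sub>1 p) else (\<lambda>p. - lam_plus * w\<^sub>1 p))
         in inner2 \<sigma> l U\<^sub>0 w\<^sub>1 \<noteq> 0 \<and>
            ((\<lambda>t. norm2 \<sigma> l (\<lambda>p. U t p - U_bar p)) \<longlongrightarrow> 0) at_top \<and>
            ((\<lambda>t. norm0 l (U' t)) \<longlongrightarrow> 0) at_top"
proof -
  note s = assms(1,2)
  have w: "w\<^sub>1 \<in> H2star l" using assms(10) by (simp add: buckling_eigenpair_def)
  obtain \<phi> where \<phi>: "AE p in plateM l. w\<^sub>1 p = \<phi> (snd p) * sin (fst p)" using assms(11) by blast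
  have unit: "form1 l w\<^sub>1 w\<^sub>1 = 1"
    using form1_sine[OF w \<phi>] assms(12) by (simp add: norm0_def)
  interpret damped_evolution "L2 (plateM l)" "H2star l" "ip2 (plateM l)" "inner2 \<sigma> l" "form1 l" "wdxx l" U U' \<delta> P S \<Lambda>\<^sub>1 \<Lambda>\<^sub>2 "pi\<^sup>2 + 2" w\<^sub>1
    by (rule damped_evolution_weak_solution[OF s assms(3-5) assms(13,14) w unit assms(10,9,15)])
  have sq: "(norm0 l (U' 0))\<^sup>2 = ip2 (plateM l) (U' 0) (U' 0)" "(norm2 \<sigma> l (U 0))\<^sup>2 = inner2 \<sigma> l (U 0) (U 0)"
    "(norm0 l (wdx l (U 0)))\<^sup>2 = \<beta> 0" "norm0 l (wdx l (U 0)) ^ 4 = (\<beta> 0)\<^sup>2"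
    using L2.nonneg[OF U'_in[of 0]] A.nonneg[of "U 0"] B.nonneg[of "U 0"]
    by (simp_all add: norm0_def norm2_def inner0_eq \<beta>_def form1_def fourth_power_sqrt)
  have "mech_energy \<sigma> l P S U U' 0 = En 0"
    unfolding mech_energy_def sq by (simp add: En_def G_def add_divide_distrib)
  then interpret damped_evolution_well "L2 (plateM l)" "H2star l" "ip2 (plateM l)" "inner2 \<sigma> l" "form1 l" "wdxx l" U U' \<delta> P S \<Lambda>\<^sub>1 \<Lambda>\<^sub>2 "pi\<^sup>2 + 2" w\<^sub>1
    by unfold_locales (use assms(16) in simp)
  have init: "AE p in plateM l. U 0 p = U\<^sub>0 p"
    using assms(15) unfolding weak_solution_def weak_solution_on_def by (meson zero_less_one)
  have U0: "U 0 \<in> H2star l" by simp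
  (* the initial value is attained only almost everywhere; by parts no derivative of it remains *)
  have "form1 l w\<^sub>1 U\<^sub>0 = form1 l w\<^sub>1 (U 0)"
  proof -
    have "ip2 (plateM l) (wdxx l w\<^sub>1) U\<^sub>0 = ip2 (plateM l) (wdxx l w\<^sub>1) (U 0)"
      by (rule ip2_cong_AE[OF AE_I2 AE_symmetric[OF init]])
        (use H2_wd_L2(2)[OF H2starD[OF w]] H2star_L2[OF assms(6)] H2star_L2[OF U0] in \<open>auto intro: L2_measurable\<close>)
    then show ?thesis by (simp add: form1_by_parts[OF w assms(6)] form1_by_parts[OF w U0])
  qed
  then have pos: "inner2 \<sigma> l U\<^sub>0 w\<^sub>1 = \<Lambda>\<^sub>1 * c 0"
    using A.sym[OF assms(6) w] w_eigen[OF assms(6)] B.sym[OF U0 w] by (simp add: c_def)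
  have \<Lambda>: "0 < \<Lambda>\<^sub>1" by (rule params(3))
  have c0: "c 0 \<noteq> 0" by (rule c_nonzero) simp
  let ?l = "sqrt ((P - \<Lambda>\<^sub>1) / S)"
  have bar: "(\<lambda>p. U t p - (if inner2 \<sigma> l U\<^sub>0 w\<^sub>1 > 0 then (\<lambda>p. ?l * w\<^sub>1 p) else (\<lambda>p. - ?l * w\<^sub>1 p)) p)
    = U t - (sgn (c 0) * sqrt lam2) *\<^sub>R w\<^sub>1" for t
  proof (cases "0 < c 0")
    case True
    with pos \<Lambda> show ?thesis by (simp add: fun_eq_iff fun_ops lam2_def)
  next
    case False
    with c0 have "c 0 < 0" by simp
    with pos \<Lambda> show ?thesis by (simp add: fun_eq_iff fun_ops lam2_def zero_less_mult_iff)
  qed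
  show ?thesis
    unfolding Let_def bar
    using convergence pos \<Lambda> c0 unfolding norm2_eq[OF s] norm0_eq by simp
qed

end
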